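(* Let $(\pi,\mathcal H)$ be an irreducible unitary representation of $G=\mathrm{SL}(2,\mathbb R)$, let $v\in\mathcal H_K$ be a non-zero $K$-finite vector and $f_v:G\to\mathcal H$, $g\mapsto\pi(g)v$, its orbit map. Then the domain of holomorphy of $f_v$ is: (i) $G_{\mathbb C}=\mathrm{SL}(2,\mathbb C)$, if $\pi$ is trivial; (ii) $\tilde S^+$, if $\pi$ is a non-trivial highest weight representation; (iii) $\tilde S^-$, if $\pi$ is a non-trivial lowest weight representation; (iv) $\tilde\Xi$, if $\pi$ is neither trivial, nor a highest weight representation, nor a lowest weight representation, i.e. a unitarizable principal series.
   Context: $K=\mathrm{SO}(2,\mathbb R)$, $K_{\mathbb C}=\mathrm{SO}(2,\mathbb C)$. $\mathrm{SL}(2,\mathbb C)$ acts on $\mathbb P^1(\mathbb C)$ by fractional linear transformations and diagonally on $\mathbb P^1(\mathbb C)\times\mathbb P^1(\mathbb C)$; $X_{\mathbb C}=G_{\mathbb C}/K_{\mathbb C}$ is identified with $(\mathbb P^1(\mathbb C)\times\mathbb P^1(\mathbb C))\setminus\mathrm{diag}$ via the base point $x_0=(i,-i)$. Let $X$ be the upper and $\overline X$ the lower half plane. Put $\Xi=X\times\overline X$ (the crown domain), $S^+=(\mathbb P^1(\mathbb C)\times\overline X)\cap X_{\mathbb C}$, $S^-=(X\times\mathbb P^1(\mathbb C))\cap X_{\mathbb C}$, and let $\tilde\Xi,\tilde S^+,\tilde S^-\subset G_{\mathbb C}$ be the preimages of these sets under $g\mapsto g.x_0$. With $\mathfrak p^{\pm}=\mathbb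 C\begin{pmatrix}1&\pm i\\ \pm i&-1\end{pmatrix}$ and $P^\pm=\exp\mathfrak p^\pm$ one has $\tilde S^\pm=GK_{\mathbb C}P^\pm$. $\mathcal H_K$ is the Harish-Chandra module of $K$-finite vectors. $\pi$ is a highest (resp. lowest) weight representation if $\mathcal H_K$ contains a non-zero vector annihilated by $\mathfrak p^+$ (resp. $\mathfrak p^-$). The domain of holomorphy of $f_v$ is the largest $G\times K_{\mathbb C}$-invariant (left $G$, right $K_{\mathbb C}$) domain in $G_{\mathbb C}$ containing $G$ to which $f_v$ extends as a holomorphic $\mathcal H$-valued map. *)

theory Defs
  imports "HOL-Analysis.Analysis"
begin

text \<open>
  Complex Hilbert spaces. Non-negativity and definiteness of the inner product (linear in the
  first argument) follow from \<open>cinner_norm\<close>; completeness comes from \<^class>\<open>banach\<close>.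
\<close>

class complex_hilbert = banach +
  fixes scaleC :: "complex \<Rightarrow> 'a \<Rightarrow> 'a"  (infixr \<open>*\<^sub>C\<close> 75)
    and cinner :: "'a \<Rightarrow> 'a \<Rightarrow> complex"
  assumes scaleC_add_right: "c *\<^sub>C (x + y) = c *\<^sub>C x + c *\<^sub>C y"
    and scaleC_add_left: "(c + d) *\<^sub>C x = c *\<^sub>C x + d *\<^sub>C x"
    and scaleC_scaleC: "c *\<^sub>C d *\<^sub>C x = (c * d) *\<^sub>C x"
    and scaleC_of_real: "complex_of_real r *\<^sub>C x = r *\<^sub>R x"
    and cinner_add_left: "cinner (x + y) z = cinner x z + cinner y z"
    and cinner_scaleC_left: "cinner (c *\<^sub>C x) y = c * cinner x y"
    and cinner_commute: "cinner x y = cnj (cinner y x)"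
    and cinner_norm: "cinner x x = complex_of_real ((norm x)\<^sup>2)"

global_interpretation complex_vector:
  vector_space "scaleC :: complex \<Rightarrow> 'a \<Rightarrow> 'a::complex_hilbert"
proof
  show "1 *\<^sub>C x = x" for x :: 'a
    using scaleC_of_real[of 1 x] by simp
qed (simp_all add: scaleC_add_right scaleC_add_left scaleC_scaleC)


definition SL2R :: "(real^2^2) set" where
  "SL2R = {g. det g = 1}"

definition SO2R :: "(real^2^2) set" where
  "SO2R = {k. rotation_matrix k}"

definition SL2C :: "(complex^2^2) set" where
  "SL2C = {g. det g = 1}"

text \<open>\<^const>\<open>orthogonal_matrix\<close> uses the transpose without conjugation.\<close>

definition SO2C :: "(complex^2^2) set" where
  "SO2C = {k. rotation_matrix k}"

abbreviation complexify :: "real^2^2 \<Rightarrow> complex^2^2" where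
  "complexify \<equiv> map_matrix complex_of_real"

definition smult_matrix :: "complex \<Rightarrow> complex^2^2 \<Rightarrow> complex^2^2" where
  "smult_matrix c A = map_matrix (\<lambda>z. c * z) A"


definition unitary_rep :: "(real^2^2 \<Rightarrow> 'h \<Rightarrow> 'h::complex_hilbert) \<Rightarrow> bool" where
  "unitary_rep \<pi> \<longleftrightarrow>
     (\<forall>g\<in>SL2R. Vector_Spaces.linear scaleC scaleC (\<pi> g) \<and> bij (\<pi> g) \<and>
        (\<forall>v w. cinner (\<pi> g v) (\<pi> g w) = cinner v w)) \<and>
     \<pi> (mat 1) = id \<and>
     (\<forall>g\<in>SL2R. \<forall>h\<in>SL2R. \<pi> (g ** h) = \<pi> g \<circ> \<pi> h) \<and>
     (\<forall>v. continuous_on SL2R (\<lambda>g. \<pi> g v))"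

definition irreducible_unitary_rep :: "(real^2^2 \<Rightarrow> 'h \<Rightarrow> 'h::complex_hilbert) \<Rightarrow> bool" where
  "irreducible_unitary_rep \<pi> \<longleftrightarrow>
     unitary_rep \<pi> \<and> (\<exists>v::'h. v \<noteq> 0) \<and>
     (\<forall>W. complex_vector.subspace W \<and> closed W \<and> (\<forall>g\<in>SL2R. \<pi> g ` W \<subseteq> W)
        \<longrightarrow> W = {0} \<or> W = UNIV)"

definition trivial_rep :: "(real^2^2 \<Rightarrow> 'h \<Rightarrow> 'h) \<Rightarrow> bool" where
  "trivial_rep \<pi> \<longleftrightarrow> (\<forall>g\<in>SL2R. \<forall>v. \<pi> g v = v)"

definition K_finite :: "(real^2^2 \<Rightarrow> 'h \<Rightarrow> 'h::complex_hilbert) \<Rightarrow> 'h set" where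
  "K_finite \<pi> = {v. \<exists>B. finite B \<and> (\<lambda>k. \<pi> k v) ` SO2R \<subseteq> complex_vector.span B}"

definition orbit_map :: "(real^2^2 \<Rightarrow> 'h \<Rightarrow> 'h) \<Rightarrow> 'h \<Rightarrow> real^2^2 \<Rightarrow> 'h" where
  "orbit_map \<pi> v g = \<pi> g v"


definition matrix_exp :: "real^2^2 \<Rightarrow> real^2^2" where
  "matrix_exp A = (\<Sum>n. (1 / fact n) *\<^sub>R (((**) A) ^^ n) (mat 1))"

text \<open>
  The derived representation of the Lie algebra \<open>sl(2,R)\<close> and its complex-linear extension to
  \<open>sl(2,C)\<close>. They are only applied to \<open>K\<close>-finite vectors of irreducible unitary
  representations; these are smooth vectors, so the derivatives exist.
\<close>

definition deriv_rep ::
    "(real^2^2 \<Rightarrow> 'h \<Rightarrow> 'h::complex_hilbert) \<Rightarrow> real^2^2 \<Rightarrow> 'h \<Rightarrow> 'h" where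
  "deriv_rep \<pi> X v = vector_derivative (\<lambda>t. \<pi> (matrix_exp (t *\<^sub>R X)) v) (at 0)"

definition deriv_rep_C ::
    "(real^2^2 \<Rightarrow> 'h \<Rightarrow> 'h::complex_hilbert) \<Rightarrow> complex^2^2 \<Rightarrow> 'h \<Rightarrow> 'h" where
  "deriv_rep_C \<pi> Z v = deriv_rep \<pi> (map_matrix Re Z) v + \<i> *\<^sub>C deriv_rep \<pi> (map_matrix Im Z) v"

definition p_plus :: "(complex^2^2) set" where
  "p_plus = range (\<lambda>c. smult_matrix c (vector [vector [1, \<i>], vector [\<i>, -1]]))"

definition p_minus :: "(complex^2^2) set" where
  "p_minus = range (\<lambda>c. smult_matrix c (vector [vector [1, -\<i>], vector [-\<i>, -1]]))"

definition highest_weight_rep :: "(real^2^2 \<Rightarrow> 'h \<Rightarrow> 'h::complex_hilbert) \<Rightarrow> bool" where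
  "highest_weight_rep \<pi> \<longleftrightarrow>
     (\<exists>w\<in>K_finite \<pi>. w \<noteq> 0 \<and> (\<forall>Z\<in>p_plus. deriv_rep_C \<pi> Z w = 0))"

definition lowest_weight_rep :: "(real^2^2 \<Rightarrow> 'h \<Rightarrow> 'h::complex_hilbert) \<Rightarrow> bool" where
  "lowest_weight_rep \<pi> \<longleftrightarrow>
     (\<exists>w\<in>K_finite \<pi>. w \<noteq> 0 \<and> (\<forall>Z\<in>p_minus. deriv_rep_C \<pi> Z w = 0))"


datatype P1C = Fin complex | Infinity

fun moebius_P1C :: "complex^2^2 \<Rightarrow> P1C \<Rightarrow> P1C" where
  "moebius_P1C g (Fin z) =
     (if g$2$1 * z + g$2$2 = 0 then Infinity
      else Fin ((g$1$1 * z + g$1$2) / (g$2$1 * z + g$2$2)))"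
| "moebius_P1C g Infinity =
     (if g$2$1 = 0 then Infinity else Fin (g$1$1 / g$2$1))"

definition act_P1C2 :: "complex^2^2 \<Rightarrow> P1C \<times> P1C \<Rightarrow> P1C \<times> P1C" where
  "act_P1C2 g = map_prod (moebius_P1C g) (moebius_P1C g)"

definition X_C :: "(P1C \<times> P1C) set" where
  "X_C = {(z, w). z \<noteq> w}"

definition base_point :: "P1C \<times> P1C" where
  "base_point = (Fin \<i>, Fin (-\<i>))"

definition upper_half_plane :: "P1C set" where
  "upper_half_plane = Fin ` {z. Im z > 0}"

definition lower_half_plane :: "P1C set" where
  "lower_half_plane = Fin ` {z. Im z < 0}"

definition crown :: "(P1C \<times> P1C) set" where
  "crown = upper_half_plane \<times> lower_half_plane"

definition S_plus :: "(P1C \<times> P1C) set" where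
  "S_plus = (UNIV \<times> lower_half_plane) \<inter> X_C"

definition S_minus :: "(P1C \<times> P1C) set" where
  "S_minus = (upper_half_plane \<times> UNIV) \<inter> X_C"

definition preimage_SL2C :: "(P1C \<times> P1C) set \<Rightarrow> (complex^2^2) set" where
  "preimage_SL2C A = {g\<in>SL2C. act_P1C2 g base_point \<in> A}"


text \<open>
  Holomorphy of a Hilbert-space-valued map on a subset \<open>D\<close> that is open in the complex
  submanifold \<open>SL(2,C)\<close> of the space of all complex matrices: locally, the map is the restriction
  of a map which is complex (Frechet) differentiable on an open set of matrices.
\<close>

definition complex_differentiable_at :: "(complex^2^2 \<Rightarrow> 'h::complex_hilbert) \<Rightarrow> complex^2^2 \<Rightarrow> bool"
  where "complex_differentiable_at F x \<longleftrightarrow>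
     (\<exists>L. (F has_derivative L) (at x) \<and> (\<forall>c Y. L (smult_matrix c Y) = c *\<^sub>C L Y))"

definition holomorphic_on_SL2C ::
    "(complex^2^2 \<Rightarrow> 'h::complex_hilbert) \<Rightarrow> (complex^2^2) set \<Rightarrow> bool" where
  "holomorphic_on_SL2C F D \<longleftrightarrow>
     (\<forall>g\<in>D. \<exists>U H. open U \<and> g \<in> U \<and> (\<forall>x\<in>U. complex_differentiable_at H x) \<and>
        (\<forall>x\<in>U \<inter> D. H x = F x))"

definition invariant_domain :: "(complex^2^2) set \<Rightarrow> bool" where
  "invariant_domain D \<longleftrightarrow>
     openin (top_of_set SL2C) D \<and> connected D \<and>
     (\<forall>g\<in>SL2R. \<forall>x\<in>D. \<forall>k\<in>SO2C. complexify g ** x ** k \<in> D) \<and>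
     complexify ` SL2R \<subseteq> D"

definition extends_holomorphically ::
    "(real^2^2 \<Rightarrow> 'h::complex_hilbert) \<Rightarrow> (complex^2^2) set \<Rightarrow> bool" where
  "extends_holomorphically f D \<longleftrightarrow>
     (\<exists>F. holomorphic_on_SL2C F D \<and> (\<forall>g\<in>SL2R. F (complexify g) = f g))"

text \<open>\<open>D\<close> is the largest invariant domain of extension, in the sense of inclusion.\<close>

definition is_domain_of_holomorphy ::
    "(real^2^2 \<Rightarrow> 'h::complex_hilbert) \<Rightarrow> (complex^2^2) set \<Rightarrow> bool" where
  "is_domain_of_holomorphy f D \<longleftrightarrow>
     invariant_domain D \<and> extends_holomorphically f D \<and>
     (\<forall>D'. invariant_domain D' \<and> extends_holomorphically f D' \<longrightarrow> D' \<subseteq> D)"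

end

theory Submission
  imports "HOL-Complex_Analysis.Complex_Analysis" "HOL-Real_Asymp.Real_Asymp" Defs
begin

text \<open>
  A vector \<open>v\<close> of weight \<open>n\<close> generates, under the raising and lowering operators, a chain of weight
  vectors whose norms are governed by one parameter \<open>\<nu>\<close> (the Casimir eigenvalue). After a Cayley transform
  of \<open>SL(2,C)\<close> the orbit map is a double binomial series in this chain: along the diagonal subgroup both
  sides solve the same linear ODE, and \<open>K\<close>-equivariance gives the rest. The series converges exactly on the
  crown; if the chain stops above (below), one of the two binomial series is a polynomial and the formula
  extends to \<open>S\<^sup>+\<close> (\<open>S\<^sup>-\<close>).

  For maximality one restricts an extension to the line \<open>c \<mapsto> exp (c Z)\<close> with \<open>Z\<close> spanning \<open>p\<^sup>+\<close>, where
  the identity theorem turns it into the power series with coefficients \<open>(Q gchoose k) w\<^sub>k\<close>. Beyond the crown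
  this contradicts the radius of convergence, unless the chain stops. Beyond \<open>S\<^sup>+\<close>, \<open>K\<^sub>C\<close>-equivariance makes
  the norm of the extension blow up at the boundary, since all weights are negative.
\<close>

text \<open>Smoothness of weight vectors and one-dimensionality of the weight spaces must both come
  out of unitarity and irreducibility, and the order matters. Multiplicity one comes first:
  compressed operators commute, and a square root turns this into a dichotomy that forces scalars.
  Since the compression of \<open>rp (dia s)\<close> to a weight is then a number, that number
  satisfies a mean value equation that can be smoothed; so it is twice differentiable, which in turn
  forces the orbit curve itself to be differentiable. The only derivative taken is
  \<open>Hop\<close>, along the diagonal group; rotating it gives the whole noncompact part of the
  Lie algebra. The chain is rescaled asymmetrically, as in a non-unitary model of a principal
  series, so that both raising and lowering have coefficients affine in the weight. This is what
  makes the sums binomial, and choosing the root \<open>nu\<close> with \<open>Re nu >= 0\<close>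
  keeps the rescaled chain bounded. The ODE system is infinite with coefficients growing in the
  index, so uniqueness rests on exponential growth bounds. Conjugation by diag(1,-1) exchanges
  highest and lowest weights, hence only one side is done by hand.\<close>

notation scaleC (infixr \<open>*%\<close> 75)

section \<open>Complex Hilbert spaces: sesquilinearity, Cauchy-Schwarz, continuity\<close>

lemma mult_cnj_norm: "z * cnj z = (complex_of_real (norm z))\<^sup>2"
	using complex_norm_square[of z] by simp

lemma scaleC_zero_left [simp]: "0 *% (x::'a::complex_hilbert) = 0"
	by (rule complex_vector.scale_zero_left)

lemma scaleC_one [simp]: "1 *% (x::'a::complex_hilbert) = x"
	by (rule complex_vector.scale_one)

lemma scaleC_zero_right [simp]: "c *% (0::'a::complex_hilbert) = 0"
	by (rule complex_vector.scale_zero_right)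

lemma scaleC_minus_left [simp]: "(- c) *% (x::'a::complex_hilbert) = - (c *% x)"
	by (rule complex_vector.scale_minus_left)

lemma scaleC_diff_right: "c *% (x - y::'a::complex_hilbert) = c *% x - c *% y"
	by (rule complex_vector.scale_right_diff_distrib)

lemma scaleC_scaleR: "c *% (r *\<^sub>R (x::'a::complex_hilbert)) = r *\<^sub>R (c *% x)"
	by (metis scaleC_of_real scaleC_scaleC mult.commute)

lemma scaleR_scaleC: "(r *\<^sub>R c) *% (x::'a::complex_hilbert) = r *\<^sub>R (c *% x)"
	by (metis scaleC_of_real scaleC_scaleC scaleR_conv_of_real)

lemma cinner_scaleC_right: "cinner x (c *% (y::'a::complex_hilbert)) = cnj c * cinner x y"
	by (metis cinner_commute cinner_scaleC_left complex_cnj_mult)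

lemma cinner_add_right: "cinner x (y + z::'a::complex_hilbert) = cinner x y + cinner x z"
	by (metis cinner_commute cinner_add_left complex_cnj_add)

lemma cinner_scaleR_left: "cinner (r *\<^sub>R x) (y::'a::complex_hilbert) = r *\<^sub>R cinner x y"
	by (metis cinner_scaleC_left scaleC_of_real scaleR_conv_of_real)

lemma cinner_scaleR_right: "cinner x (r *\<^sub>R y::'a::complex_hilbert) = r *\<^sub>R cinner x y"
	by (metis cinner_scaleC_right scaleC_of_real scaleR_conv_of_real complex_cnj_complex_of_real)

lemma cinner_zero_left [simp]: "cinner 0 (y::'a::complex_hilbert) = 0"
	using cinner_scaleR_left[of 0 0 y] by simp

lemma cinner_zero_right [simp]: "cinner (y::'a::complex_hilbert) 0 = 0"
	using cinner_scaleR_right[of y 0 0] by simp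

lemma cinner_minus_left [simp]: "cinner (- x) (y::'a::complex_hilbert) = - cinner x y"
	using cinner_scaleR_left[of "-1" x y] by simp

lemma cinner_minus_right [simp]: "cinner x (- y::'a::complex_hilbert) = - cinner x y"
	using cinner_scaleR_right[of x "-1" y] by simp

lemma cinner_diff_left: "cinner (x - y) (z::'a::complex_hilbert) = cinner x z - cinner y z"
	using cinner_add_left[of x "-y" z] by simp

lemma cinner_diff_right: "cinner x (y - z::'a::complex_hilbert) = cinner x y - cinner x z"
	using cinner_add_right[of x y "-z"] by simp

lemma norm_scaleC [simp]: "norm (c *% (x::'a::complex_hilbert)) = norm c * norm x"
proof -
	have "complex_of_real ((norm (c *% x))\<^sup>2) = of_real ((norm c * norm x)\<^sup>2)"
		unfolding power_mult_distrib of_real_mult complex_norm_square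
		by (simp add: cinner_norm[symmetric] cinner_scaleC_left cinner_scaleC_right del: of_real_power)
	then show ?thesis
		by (smt (verit) of_real_eq_iff norm_ge_zero mult_nonneg_nonneg power2_eq_iff_nonneg)
qed

lemma cinner_Cauchy_Schwarz: "norm (cinner x (y::'a::complex_hilbert)) <= norm x * norm y"
proof (cases "norm (cinner x y) = 0")
	case True
	then show ?thesis by simp
next
	case False
	then have y: "norm y > 0" by auto
	define c where "c = cinner x y / of_real ((norm y)\<^sup>2)"
	define N where "N = complex_of_real ((norm y)\<^sup>2)"
	have N: "N ~= 0" "cnj N = N" using y by (simp_all add: N_def)
	have cN: "cnj c = cnj (cinner x y) / N" "c = cinner x y / N"
		by (simp_all add: c_def N_def)
	have e1: "cinner y x = cnj (cinner x y)" by (rule cinner_commute)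
	have "cinner (x - c *% y) (x - c *% y)
			= cinner x x - cnj c * cinner x y - c * (cinner y x - cnj c * cinner y y)"
		by (simp add: cinner_diff_left cinner_diff_right cinner_scaleC_left cinner_scaleC_right
				right_diff_distrib)
	also have "... = of_real ((norm x)\<^sup>2) - cnj (cinner x y) / N * cinner x y
			- cinner x y / N * (cnj (cinner x y) - cnj (cinner x y) / N * N)"
		unfolding cN(2) e1 cinner_norm N_def[symmetric] by (simp only: complex_cnj_divide N(2))
	also have "... = of_real ((norm x)\<^sup>2) - cinner x y * cnj (cinner x y) / N"
		using N(1) by simp
	also have "... = of_real ((norm x)\<^sup>2 - (norm (cinner x y))\<^sup>2 / (norm y)\<^sup>2)"
		unfolding mult_cnj_norm N_def by simp
	finally have "of_real ((norm (x - c *% y))\<^sup>2)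
			= complex_of_real ((norm x)\<^sup>2 - (norm (cinner x y))\<^sup>2 / (norm y)\<^sup>2)"
		by (simp add: cinner_norm)
	then have "(norm (x - c *% y))\<^sup>2 = (norm x)\<^sup>2 - (norm (cinner x y))\<^sup>2 / (norm y)\<^sup>2"
		by (simp only: of_real_eq_iff)
	moreover have "0 <= (norm (x - c *% y))\<^sup>2" by simp
	ultimately have "(norm (cinner x y))\<^sup>2 / (norm y)\<^sup>2 <= (norm x)\<^sup>2"
		by linarith
	then have "(norm (cinner x y))\<^sup>2 <= (norm x * norm y)\<^sup>2"
		using y by (simp add: field_simps power_mult_distrib)
	then show ?thesis
		by (rule power2_le_imp_le) simp
qed

lemma bounded_bilinear_cinner:
	"bounded_bilinear (cinner :: 'a::complex_hilbert => 'a => complex)"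
	by (rule bounded_bilinear.intro)
		(auto intro!: exI[of _ 1] simp: cinner_add_left cinner_add_right cinner_scaleR_left
			cinner_scaleR_right cinner_Cauchy_Schwarz)

lemma bounded_bilinear_scaleC:
	"bounded_bilinear (scaleC :: complex => 'a => 'a::complex_hilbert)"
	by (rule bounded_bilinear.intro)
		(auto intro!: exI[of _ 1] simp: scaleC_add_left scaleC_add_right scaleC_scaleR scaleR_scaleC)

lemmas tendsto_cinner [tendsto_intros] = bounded_bilinear.tendsto[OF bounded_bilinear_cinner]
lemmas tendsto_scaleC [tendsto_intros] = bounded_bilinear.tendsto[OF bounded_bilinear_scaleC]
lemmas continuous_on_cinner [continuous_intros] =
	bounded_bilinear.continuous_on[OF bounded_bilinear_cinner]
lemmas continuous_on_scaleC [continuous_intros] =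
	bounded_bilinear.continuous_on[OF bounded_bilinear_scaleC]
lemmas bounded_linear_cinner_left [simp] =
	bounded_bilinear.bounded_linear_left[OF bounded_bilinear_cinner]
lemmas bounded_linear_cinner_right [simp] =
	bounded_bilinear.bounded_linear_right[OF bounded_bilinear_cinner]
lemmas bounded_linear_scaleC_left [simp] =
	bounded_bilinear.bounded_linear_left[OF bounded_bilinear_scaleC]
lemmas bounded_linear_scaleC_right [simp] =
	bounded_bilinear.bounded_linear_right[OF bounded_bilinear_scaleC]

lemma cinner_sum_left: "cinner (sum f S) (y::'a::complex_hilbert) = (\<Sum>i\<in>S. cinner (f i) y)"
	by (rule linear_sum[OF bounded_linear.linear[OF bounded_linear_cinner_left]])

lemma cinner_eq_zeroI: "(!!y. cinner x y = 0) ==> x = (0::'a::complex_hilbert)"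
	by (metis cinner_norm of_real_eq_0_iff power_eq_0_iff norm_eq_zero)

lemma cinner_eqI: "(!!z. cinner x z = cinner y z) ==> x = (y::'a::complex_hilbert)"
	using cinner_eq_zeroI[of "x - y"] by (auto simp: cinner_diff_left)

section \<open>Matrices of size two and the subgroups KAN of SL(2,R)\<close>

definition m22 :: "'a => 'a => 'a => 'a::zero => 'a^2^2" where
	"m22 a b c d = vector [vector [a, b], vector [c, d]]"

lemma m22_nth [simp]:
	"m22 a b c d $ 1 $ 1 = a" "m22 a b c d $ 1 $ 2 = b"
	"m22 a b c d $ 2 $ 1 = c" "m22 a b c d $ 2 $ 2 = d"
	by (simp_all add: m22_def vector_2)

lemma m22_surj: "z = m22 (z$1$1) (z$1$2) (z$2$1) (z$2$2)"
	by (simp add: vec_eq_iff forall_2)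

lemma m22_eq_iff [simp]:
	"m22 a b c d = m22 a' b' c' d' \<longleftrightarrow> a = a' & b = b' & c = c' & d = d'"
	by (auto simp add: vec_eq_iff forall_2)

lemma m22_cases: obtains a b c d where "z = m22 a b c d"
	using m22_surj by blast

lemma m22_mult [simp]:
	"m22 a b c d ** m22 a' b' c' d'
		= m22 (a*a' + b*c') (a*b' + b*d') (c*a' + d*c') (c*b' + d*(d'::'a::semiring_1))"
	by (simp add: vec_eq_iff forall_2 matrix_matrix_mult_def sum_2)

lemma det_m22 [simp]: "det (m22 a b c d) = a*d - b*(c::'a::comm_ring_1)"
	by (simp add: det_2)

lemma mat_1_m22: "mat 1 = m22 1 0 0 (1::'a::semiring_1)"
	by (simp add: vec_eq_iff forall_2 mat_def)

lemma map_matrix_m22 [simp]: "map_matrix f (m22 a b c d) = m22 (f a) (f b) (f c) (f d)"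
	by (simp add: vec_eq_iff forall_2 map_matrix_def)

lemma scaleR_m22: "r *\<^sub>R m22 a b c d = m22 (r *\<^sub>R a) (r *\<^sub>R b) (r *\<^sub>R c) (r *\<^sub>R d::'a::real_vector)"
	by (simp add: vec_eq_iff forall_2)

lemma smult_m22: "smult_matrix r (m22 a b c d) = m22 (r * a) (r * b) (r * c) (r * d)"
	by (simp add: smult_matrix_def)

lemma add_m22: "m22 a b c d + m22 a' b' c' d' = m22 (a+a') (b+b') (c+c') (d+d'::'a::monoid_add)"
	by (simp add: vec_eq_iff forall_2)

lemma continuous_on_m22 [continuous_intros]:
	fixes a b c d :: "'x::topological_space => 'a::real_normed_vector"
	assumes "continuous_on S a" "continuous_on S b" "continuous_on S c" "continuous_on S d"
	shows "continuous_on S (%x. m22 (a x) (b x) (c x) (d x))"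
proof -
	have "(%x. m22 (a x) (b x) (c x) (d x)) = (%x. \<chi> i j. if i = 1 then if j = 1 then a x else b x
			else if j = 1 then c x else d x)"
		by (auto simp: vec_eq_iff forall_2)
	moreover have "continuous_on S (%x. \<chi> i j. if i = 1 then if j = 1 then a x else b x
			else if j = 1 then c x else d x)"

		apply (intro continuous_on_vec_lambda) subgoal for i j using assms by (cases "i = 1"; cases "j = 1"; simp) done
	ultimately show ?thesis by (simp only:)
qed

lemma m22_in_SL2R [simp]: "m22 a b c d \<in> SL2R \<longleftrightarrow> a*d - b*c = 1"
	by (simp add: SL2R_def)

lemma m22_in_SL2C [simp]: "m22 a b c d \<in> SL2C \<longleftrightarrow> a*d - b*c = 1"
	by (simp add: SL2C_def)

lemma SL2R_mult [intro]: "g \<in> SL2R ==> h \<in> SL2R ==> g ** h \<in> SL2R"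
	by (simp add: SL2R_def det_mul)

lemma SL2C_mult [intro]: "g \<in> SL2C ==> h \<in> SL2C ==> g ** h \<in> SL2C"
	by (simp add: SL2C_def det_mul)

definition adj22 :: "'a^2^2 => 'a::comm_ring_1^2^2" where
	"adj22 g = m22 (g$2$2) (- (g$1$2)) (- (g$2$1)) (g$1$1)"

lemma adj22_m22 [simp]: "adj22 (m22 a b c d) = m22 d (-b) (-c) a"
	by (simp add: adj22_def)

lemma adj22_SL2R: "g \<in> SL2R ==> adj22 g \<in> SL2R & adj22 g ** g = mat 1 & g ** adj22 g = mat 1"
	by (cases g rule: m22_cases) (simp add: mat_1_m22 algebra_simps)

lemma complexify_mult: "complexify (g ** h) = complexify g ** complexify h"
	by (cases g rule: m22_cases, cases h rule: m22_cases) simp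

lemma complexify_SL2R: "g \<in> SL2R ==> complexify g \<in> SL2C"
	by (cases g rule: m22_cases) (simp flip: of_real_mult of_real_diff)

definition rot :: "real => real^2^2" where
	"rot th = m22 (cos th) (- sin th) (sin th) (cos th)"

definition dia :: "real => real^2^2" where
	"dia t = m22 (exp t) 0 0 (exp (- t))"

definition upp :: "real => real^2^2" where
	"upp p = m22 1 p 0 1"

lemma rot_SL2R [simp]: "rot th \<in> SL2R"
	by (simp add: rot_def flip: power2_eq_square)

lemma dia_SL2R [simp]: "dia t \<in> SL2R"
	by (simp add: dia_def flip: exp_add)

lemma upp_SL2R [simp]: "upp t \<in> SL2R"
	by (simp add: upp_def)

lemma mat_1_SL2R [simp]: "mat 1 \<in> SL2R"
	by (simp add: mat_1_m22)

lemma rot_mult: "rot al ** rot bt = rot (al + bt)"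
	by (simp add: rot_def cos_add sin_add algebra_simps)

lemma dia_mult: "dia s ** dia t = dia (s + t)"
	by (simp add: dia_def mult_exp_exp)

lemma upp_mult: "upp s ** upp t = upp (s + t)"
	by (simp add: upp_def)

lemma rot_0: "rot 0 = mat 1" and dia_0: "dia 0 = mat 1" and upp_0: "upp 0 = mat 1"
	by (simp_all add: rot_def dia_def upp_def mat_1_m22)

lemma rot_2pi: "rot (th + 2 * pi) = rot th"
	by (simp add: rot_def)

lemma SO2R_eq: "SO2R = range rot"
proof (intro set_eqI iffI)
	fix k assume k: "k \<in> SO2R"
	obtain a b c d where abcd: "k = m22 a b c d" by (rule m22_cases)
	have "transpose k = m22 a c b d"
		by (simp add: abcd transpose_def vec_eq_iff forall_2)
	then have "a*a + c*c = 1" "a*b + c*d = 0" "b*b + d*d = 1" "a*d - b*c = 1"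
		using k by (auto simp: SO2R_def rotation_matrix_def orthogonal_matrix abcd mat_1_m22)
	\<comment> \<open>Ring identities in a, b, c, d: once the four relations are inserted, the
	  right-hand sides collapse to a and to -c.\<close>
	moreover have "d = a*(a*d - b*c) + c*(a*b+c*d) + d*(1-(a*a + c*c))"
		by algebra
	moreover have "b = -c*(a*d - b*c) + a*(a*b+c*d) + b*(1-(a*a + c*c))"
		by algebra
	ultimately have "a\<^sup>2 + c\<^sup>2 = 1" "d = a" "b = -c"
		by (simp_all add: power2_eq_square)
	then show "k \<in> range rot"
		using sincos_total_2pi[of a c] by (metis abcd rangeI rot_def)
next
	fix k assume "k \<in> range rot"
	then obtain th where k: "k = rot th" by auto
	have "transpose k = m22 (cos th) (sin th) (- sin th) (cos th)"
		by (simp add: k rot_def transpose_def vec_eq_iff forall_2)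
	then show "k \<in> SO2R"
		using sin_cos_squared_add3[of th]
		by (simp add: SO2R_def rotation_matrix_def orthogonal_matrix k rot_def mat_1_m22 algebra_simps)
qed

text \<open>
	The entries of the inverse of \<open>z\<close>, for \<open>z\<close> of determinant 1, in the basis \<open>(1, \<plusminus>i)\<close> of
	eigenvectors of the rotations: \<open>SL(2,R)\<close> becomes \<open>SU(1,1)\<close>.
\<close>

definition cayA :: "complex^2^2 => complex" where
	"cayA z = ((z$1$1 + z$2$2) + \<i> * (z$1$2 - z$2$1)) / 2"
definition cayB :: "complex^2^2 => complex" where
	"cayB z = ((z$2$2 - z$1$1) - \<i> * (z$1$2 + z$2$1)) / 2"
definition cayC :: "complex^2^2 => complex" where
	"cayC z = ((z$2$2 - z$1$1) + \<i> * (z$1$2 + z$2$1)) / 2"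
definition cayD :: "complex^2^2 => complex" where
	"cayD z = ((z$1$1 + z$2$2) - \<i> * (z$1$2 - z$2$1)) / 2"

lemmas cay_defs = cayA_def cayB_def cayC_def cayD_def

section \<open>Cayley coordinates and the Cartan decomposition\<close>

text \<open>The coordinates belong to the inverse matrix, so the factors appear in reversed
  order.\<close>

lemma cay_mult:
	"cayA (z ** z') = cayA z' * cayA z + cayB z' * cayC z"
	"cayB (z ** z') = cayA z' * cayB z + cayB z' * cayD z"
	"cayC (z ** z') = cayC z' * cayA z + cayD z' * cayC z"
	"cayD (z ** z') = cayC z' * cayB z + cayD z' * cayD z"
	by (cases z rule: m22_cases; cases z' rule: m22_cases; simp add: cay_defs;
			simp add: field_simps power2_eq_square[symmetric]; simp add: algebra_simps i_squared)+

lemma cay_det: "cayA z * cayD z - cayB z * cayC z = det z"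
	by (cases z rule: m22_cases) (simp add: cay_defs field_simps)

lemma cay_inj:
	assumes "cayA z = cayA z'" "cayB z = cayB z'" "cayC z = cayC z'" "cayD z = cayD z'"
	shows "z = z'"
proof -
	have *: "y$1$1 = (cayA y + cayD y - cayB y - cayC y) / 2"
		"y$2$2 = (cayA y + cayD y + cayB y + cayC y) / 2"
		"y$1$2 = (cayA y - cayD y - cayB y + cayC y) / (2 * \<i>)"
		"y$2$1 = - (cayA y - cayD y + cayB y - cayC y) / (2 * \<i>)" for y :: "complex^2^2"
		by (simp_all add: cay_defs field_simps)
	show ?thesis
		by (simp add: vec_eq_iff forall_2 * assms)
qed

lemma cay_complexify:
	"cayD (complexify g) = cnj (cayA (complexify g))" "cayC (complexify g) = cnj (cayB (complexify g))"
	by (cases g rule: m22_cases; simp add: cay_defs)+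

lemma cay_rot:
	"cayA (complexify (rot th)) = cis (-th)" "cayB (complexify (rot th)) = 0"
	"cayC (complexify (rot th)) = 0" "cayD (complexify (rot th)) = cis th"
	by (simp_all add: cay_defs rot_def complex_eq_iff)

lemma cay_dia:
	"cayA (complexify (dia t)) = of_real (cosh t)" "cayB (complexify (dia t)) = - of_real (sinh t)"
	"cayC (complexify (dia t)) = - of_real (sinh t)" "cayD (complexify (dia t)) = of_real (cosh t)"
	by (simp_all add: cay_defs dia_def complex_eq_iff cosh_def sinh_def field_simps)

lemma cay_rot_dia_rot:
	"cayA (complexify (rot al ** dia t ** rot bt)) = cis (-(al + bt)) * of_real (cosh t)"
	"cayB (complexify (rot al ** dia t ** rot bt)) = - cis (al - bt) * of_real (sinh t)"
	by (simp_all add: complexify_mult cay_mult cay_rot cay_dia cis_mult algebra_simps)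

text \<open>In Cayley coordinates a real matrix is a pair (a, b) with |a|^2 - |b|^2 = 1. The modulus
  of b gives t, and the phases of a and -b give the two angles; no diagonalisation is
  involved.\<close>

lemma KAK:
	assumes "g \<in> SL2R"
	obtains al t bt where "g = rot al ** dia t ** rot bt" "t >= 0"
proof -
	define a b where "a = cayA (complexify g)" and "b = cayB (complexify g)"
	have "a * cnj a - b * cnj b = 1"
		using cay_det[of "complexify g"] assms complexify_SL2R[OF assms]
		by (simp add: a_def b_def cay_complexify SL2C_def)
	then have "complex_of_real ((norm a)\<^sup>2 - (norm b)\<^sup>2) = of_real 1"
		by (simp add: mult_cnj_norm)
	then have ab: "(norm a)\<^sup>2 = (norm b)\<^sup>2 + 1"
		unfolding of_real_eq_iff by simp
	define t where "t = arsinh (norm b)"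
	have sh: "sinh t = norm b" by (simp add: t_def sinh_arsinh_real)
	have "(cosh t)\<^sup>2 = (norm a)\<^sup>2"
		using cosh_square_eq[of t] ab unfolding sh by linarith
	then have ch: "cosh t = norm a"
		using power2_eq_imp_eq[OF _ cosh_real_nonneg norm_ge_zero] by blast
	obtain \<phi> where \<phi>: "a = norm a * cis \<phi>"
		by (metis rcis_def rcis_cmod_Arg)
	obtain \<psi> where \<psi>: "- b = norm b * cis \<psi>"
		by (metis norm_minus_cancel rcis_def rcis_cmod_Arg)
	\<comment> \<open>Solves \<open>-(al + bt) = \<phi>\<close> and \<open>al - bt = \<psi>\<close>,
	  the phases in \<open>cay_rot_dia_rot\<close>.\<close>
	define al bt where "al = (\<psi> - \<phi>) / 2" and "bt = - (\<psi> + \<phi>) / 2"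
	have e: "-(al + bt) = \<phi>" "al - bt = \<psi>" by (simp_all add: al_def bt_def field_simps)
	let ?h = "rot al ** dia t ** rot bt"
	have 1: "cayA (complexify g) = cayA (complexify ?h)"
		unfolding cay_rot_dia_rot e a_def[symmetric] unfolding ch using \<phi> by (simp only: mult.commute)
	have 2: "cayB (complexify g) = cayB (complexify ?h)"
		unfolding cay_rot_dia_rot e b_def[symmetric] sh using \<psi>
		by (metis minus_equation_iff mult.commute mult_minus_left)
	have "complexify g = complexify ?h"
		by (rule cay_inj) (simp_all add: cay_complexify 1 2)
	then have "g = ?h"
		by (cases g rule: m22_cases, cases ?h rule: m22_cases) (simp only: map_matrix_m22 m22_eq_iff of_real_eq_iff)
	moreover have "t >= 0" using sinh_real_nonneg_iff[of t] unfolding sh by simp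
	ultimately show ?thesis using that by blast
qed

lemma integral_period_shift:
	fixes f :: "real => 'a::banach"
	assumes c: "continuous_on UNIV f" and p: "!!x. f (x + 2 * pi) = f x"
	shows "integral {0..2*pi} (%x. f (x + a)) = integral {0..2*pi} f"
proof -
	define G where "G x = integral {0..2*pi} (%y. f (y + x))" for x
	have int: "f integrable_on {x..y}" for x y
		by (rule integrable_continuous_interval) (rule continuous_on_subset[OF c], simp)
	have G: "G x = integral {x..x+2*pi} f" for x
		using integral_shift_Icc_real[of 0 "2*pi" f x] by (simp add: G_def o_def add.commute)
	have sp: "integral {x..x+2*pi} f = integral {y..y+2*pi} f" if "x <= y" "y <= x + 2*pi" for x y
	proof -
		have "integral {x..x+2*pi} f = integral {x..y} f + integral {y..x+2*pi} f"
			using Henstock_Kurzweil_Integration.integral_combine[OF that(1,2) int] by simp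
		moreover have "integral {y..y+2*pi} f = integral {y..x+2*pi} f + integral {x+2*pi..y+2*pi} f"
			using Henstock_Kurzweil_Integration.integral_combine[of y "x+2*pi" "y+2*pi" f] that int by simp
		moreover have "integral {x+2*pi..y+2*pi} f = integral {x..y} f"
			using integral_shift_Icc_real[of x y f "2*pi"] p by (simp add: o_def add.commute)
		ultimately show ?thesis by simp
	qed
	have per: "G (x + 2*pi) = G x" for x
		using p by (simp add: G_def add.assoc[symmetric])
	have per_nat: "G (x + 2*pi*real n) = G x" for x n
	proof (induct n)
		case (Suc n)
		have "G (x + 2*pi*real (Suc n)) = G ((x + 2*pi*real n) + 2*pi)" by (simp add: algebra_simps)
		then show ?case using per Suc by simp
	qed simp
	have small: "G y = G 0" if "0 <= y" "y <= 2*pi" for y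
		using sp[of 0 y] that G by simp
	define k where "k = \<lfloor>a / (2*pi)\<rfloor>"
	define y where "y = a - 2*pi * of_int k"
	have "of_int k <= a / (2*pi)" "a / (2*pi) < of_int k + 1"
		unfolding k_def by linarith+
	then have "2*pi * of_int k <= a" "a <= 2*pi * of_int k + 2*pi"
		by (simp_all add: field_simps)
	then have y: "0 <= y" "y <= 2*pi" by (simp_all add: y_def)
	have "G a = G y"
	proof (cases "k >= 0")
		case True
		then have "y + 2 * pi * real (nat k) = a" by (simp add: y_def)
		then show ?thesis using per_nat[of y "nat k"] by (simp only:)
	next
		case False
		then have "a + 2 * pi * real (nat (- k)) = y" by (simp add: y_def)
		then show ?thesis using per_nat[of a "nat (-k)"] by (simp only:)
	qed
	then show ?thesis using small[OF y] by (simp add: G_def)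
qed

section \<open>Weight spaces of the rotation group in a unitary representation\<close>

locale unirep =
	fixes rp :: "real^2^2 => 'h => 'h::complex_hilbert"
	assumes unitary: "unitary_rep rp"
begin

lemma rep_add: "g \<in> SL2R ==> rp g (x + y) = rp g x + rp g y"
	and rep_scaleC: "g \<in> SL2R ==> rp g (c *% x) = c *% rp g x"
	and rep_cinner: "g \<in> SL2R ==> cinner (rp g x) (rp g y) = cinner x y"
	using unitary by (auto simp: unitary_rep_def Vector_Spaces.linear_iff)

lemma rep_mult: "g \<in> SL2R ==> h \<in> SL2R ==> rp (g ** h) x = rp g (rp h x)"
	using unitary by (simp add: unitary_rep_def)

lemma rep_1 [simp]: "rp (mat 1) x = x"
	using unitary by (simp add: unitary_rep_def)

lemma rep_norm [simp]: "g \<in> SL2R ==> norm (rp g x) = norm x"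
proof -
	assume "g \<in> SL2R"
	then have "complex_of_real ((norm (rp g x))\<^sup>2) = of_real ((norm x)\<^sup>2)"
		using rep_cinner[of g x x] by (simp only: cinner_norm)
	then have "(norm (rp g x))\<^sup>2 = (norm x)\<^sup>2" by (simp only: of_real_eq_iff)
	then show ?thesis by (rule power2_eq_imp_eq) simp_all
qed

lemma rep_bounded_linear: "g \<in> SL2R ==> bounded_linear (rp g)"
proof (rule bounded_linear_intro[where K = 1])
	fix r x assume "g \<in> SL2R"
	then show "rp g (r *\<^sub>R x) = r *\<^sub>R rp g x"
		using rep_scaleC[of g "of_real r" x] by (simp add: scaleC_of_real)
qed (auto simp: rep_add)

lemma rep_zero [simp]: "g \<in> SL2R ==> rp g 0 = 0"
	using rep_scaleC[of g 0 0] by simp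

lemma rep_diff: "g \<in> SL2R ==> rp g (x - y) = rp g x - rp g y"
	using linear_diff[OF bounded_linear.linear[OF rep_bounded_linear]] by blast

lemma rep_adjoint: "g \<in> SL2R ==> cinner (rp g x) y = cinner x (rp (adj22 g) y)"
	using rep_cinner[of g x "rp (adj22 g) y"] rep_mult[of g "adj22 g" y] adj22_SL2R[of g] by simp

lemma rep_continuous_on: "continuous_on SL2R (%g. rp g v)"
	using unitary by (simp add: unitary_rep_def)

lemma rep_continuous [continuous_intros]:
	assumes "continuous_on S f" "f ` S \<subseteq> SL2R"
	shows "continuous_on S (%x. rp (f x) v)"
	using continuous_on_compose2[OF rep_continuous_on assms] .

lemma continuous_rot [continuous_intros]: "continuous_on S (%x. rp (rot x) v)"
	by (rule rep_continuous) (auto simp: rot_def intro!: continuous_intros)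

lemma continuous_dia: "continuous_on S (%x. rp (dia x) v)"
	by (rule rep_continuous) (auto simp: dia_def simp flip: exp_add intro!: continuous_intros)

text \<open>The minus sign is chosen so that the action of p^+ raises n by 2, as
  \<open>deriv_rep_C_plus\<close> confirms. A highest weight is then a largest n.\<close>

definition wt :: "int => 'h set" where
	"wt n = {x. \<forall>th. rp (rot th) x = cis (- of_int n * th) *% x}"

text \<open>The n-th Fourier coefficient of the circle orbit of x; it turns out to be the orthogonal
  projection onto \<open>wt n\<close>.\<close>

definition proj :: "int => 'h => 'h" where
	"proj n x = (1 / (2*pi)) *\<^sub>R integral {0..2*pi} (%th. cis (of_int n * th) *% rp (rot th) x)"

lemma wtD: "x \<in> wt n ==> rp (rot th) x = cis (- of_int n * th) *% x"
	by (simp add: wt_def)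

lemma wt_zero [simp]: "0 \<in> wt n"
	by (simp add: wt_def)

lemma wt_add: "x \<in> wt n ==> y \<in> wt n ==> x + y \<in> wt n"
	by (simp add: wt_def rep_add scaleC_add_right)

lemma wt_scaleC: "x \<in> wt n ==> c *% x \<in> wt n"
	by (simp add: wt_def rep_scaleC scaleC_scaleC mult.commute)

lemma wt_diff: "x \<in> wt n ==> y \<in> wt n ==> x - y \<in> wt n"
	by (simp add: wt_def rep_diff scaleC_diff_right)

lemma continuous_proj_integrand: "continuous_on S (%th. cis (of_int n * th) *% rp (rot th) x)"
	by (intro continuous_intros)

lemma proj_in_wt: "proj n x \<in> wt n"
proof -
	have "rp (rot al) (proj n x) = cis (- of_int n * al) *% proj n x" for al
	proof -
		let ?f = "%th. cis (of_int n * th) *% rp (rot th) x"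
		have int: "?f integrable_on {0..2*pi}"
			by (intro integrable_continuous_interval continuous_proj_integrand)
		have per: "?f (th + 2 * pi) = ?f th" for th
		proof -
			have "cis (of_int n * (th + 2*pi)) = cis (of_int n * th) * cis (2 * pi * of_int n)"
				by (simp add: cis_mult algebra_simps)
			also have "cis (2 * pi * of_int n) = 1" by (rule cis_multiple_2pi) simp
			finally show ?thesis by (simp add: rot_2pi)
		qed
		have "rp (rot al) (integral {0..2*pi} ?f) = integral {0..2*pi} (%th. rp (rot al) (?f th))"
			using integral_linear[OF int rep_bounded_linear[of "rot al"]] by (simp add: o_def)
		also have "(%th. rp (rot al) (?f th)) = (%th. cis (- of_int n * al) *% ?f (th + al))"
		proof
			fix th
			have "rp (rot al) (rp (rot th) x) = rp (rot (th + al)) x"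
				using rep_mult[of "rot al" "rot th" x] by (simp add: rot_mult add.commute)
			moreover have "cis (of_int n * th) = cis (- of_int n * al) * cis (of_int n * (th + al))"
				by (simp add: cis_mult algebra_simps)
			ultimately show "rp (rot al) (?f th) = cis (- of_int n * al) *% ?f (th + al)"
				by (simp add: rep_scaleC scaleC_scaleC)
		qed
		also have "integral {0..2*pi} ... = cis (- of_int n * al) *% integral {0..2*pi} (%th. ?f (th + al))"
		proof -
			have "(%th. ?f (th + al)) integrable_on {0..2*pi}"
				by (intro integrable_continuous_interval continuous_intros rep_continuous)
					(auto simp: rot_def intro!: continuous_intros)
			from integral_linear[OF this bounded_linear_scaleC_right, of "cis (- of_int n * al)"]
			show ?thesis by (simp add: o_def)
		qed
		also have "integral {0..2*pi} (%th. ?f (th + al)) = integral {0..2*pi} ?f"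
			by (rule integral_period_shift[OF continuous_proj_integrand per])
		finally show ?thesis
			using linear_scale[OF bounded_linear.linear[OF rep_bounded_linear[of "rot al"]]]
			by (simp add: proj_def scaleC_scaleR)
	qed
	then show ?thesis by (simp add: wt_def)
qed

lemma cinner_proj_integral:
	"cinner (proj n x) y
		= (1 / (2*pi)) *\<^sub>R integral {0..2*pi} (%th. cis (of_int n * th) * cinner (rp (rot th) x) y)"
proof -
	have int: "(%th. cis (of_int n * th) *% rp (rot th) x) integrable_on {0..2*pi}"
		by (intro integrable_continuous_interval continuous_proj_integrand)
	show ?thesis
		using integral_linear[OF int bounded_linear_cinner_left[of y]]
		by (simp add: proj_def cinner_scaleR_left o_def cinner_scaleC_left)
qed

lemma rot_adj: "adj22 (rot th) = rot (- th)"
	by (simp add: rot_def)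

lemma dia_adj: "adj22 (dia th) = dia (- th)"
	by (simp add: dia_def)

lemma cinner_proj: "y \<in> wt n ==> cinner (proj n x) y = cinner x y"
proof -
	assume y: "y \<in> wt n"
	have "cis (of_int n * th) * cinner (rp (rot th) x) y = cinner x y" for th
		using wtD[OF y, of "-th"]
		by (simp add: rep_adjoint rot_adj cinner_scaleC_right cis_cnj cis_mult flip: mult.assoc)
	then show ?thesis by (simp add: cinner_proj_integral scaleR_conv_of_real)
qed

lemma proj_wt: "x \<in> wt n ==> proj n x = x"
proof -
	assume x: "x \<in> wt n"
	then have "cinner (proj n x - x) (proj n x - x) = 0"
		using cinner_proj[of "proj n x - x" n x] proj_in_wt wt_diff by (simp add: cinner_diff_left)
	then show ?thesis by (simp add: cinner_norm)
qed

lemma cinner_proj_proj: "cinner (proj n x) y = cinner x (proj n y)"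
	by (metis cinner_proj proj_in_wt cinner_commute)

lemma norm_proj_le: "norm (proj n x) <= norm x"
proof -
	have "complex_of_real ((norm (proj n x))\<^sup>2) = cinner x (proj n x)"
		by (metis cinner_norm cinner_proj proj_in_wt)
	then have "(norm (proj n x))\<^sup>2 = norm (cinner x (proj n x))"
		by (metis norm_of_real abs_power2)
	also have "... <= norm x * norm (proj n x)" by (rule cinner_Cauchy_Schwarz)
	finally show ?thesis
		by (smt (verit) norm_ge_zero power2_eq_square mult_right_le_imp_le)
qed

lemma proj_add: "proj n (x + y) = proj n x + proj n y"
	by (rule cinner_eqI) (simp add: cinner_proj_proj cinner_add_left)

lemma proj_scaleC: "proj n (c *% x) = c *% proj n x"
	by (rule cinner_eqI) (simp add: cinner_proj_proj cinner_scaleC_left)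

lemma proj_diff: "proj n (x - y) = proj n x - proj n y"
	by (rule cinner_eqI) (simp add: cinner_proj_proj cinner_diff_left)

lemma proj_zero [simp]: "proj n 0 = 0"
	using proj_scaleC[of n 0 0] by simp

lemma bounded_linear_proj: "bounded_linear (proj n)"
proof (rule bounded_linear_intro[where K = 1])
	show "proj n (r *\<^sub>R x) = r *\<^sub>R proj n x" for r x
		using proj_scaleC[of n "of_real r" x] by (simp add: scaleC_of_real)
qed (auto simp: proj_add norm_proj_le)

lemma wt_orthogonal: "x \<in> wt n ==> y \<in> wt m ==> n ~= m ==> cinner x y = 0"
proof -
	assume x: "x \<in> wt n" and y: "y \<in> wt m" and nm: "n ~= m"
	define th where "th = pi / of_int (n - m)"
	have "cinner x y = cinner (rp (rot th) x) (rp (rot th) y)" by (simp add: rep_cinner)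
	also have "... = cis (- of_int n * th) * cis (of_int m * th) * cinner x y"
		by (simp add: wtD[OF x] wtD[OF y] cinner_scaleC_left cinner_scaleC_right cis_cnj)
	also have "cis (- of_int n * th) * cis (of_int m * th) = cis (- (of_int (n - m) * th))"
		by (simp add: cis_mult algebra_simps)
	also have "of_int (n - m) * th = pi" using nm by (simp add: th_def)
	finally show ?thesis by (simp add: cis.ctr complex_eq_iff)
qed

lemma proj_wt_other: "x \<in> wt m ==> n ~= m ==> proj n x = 0"
	by (metis cinner_eq_zeroI cinner_proj_proj proj_in_wt wt_orthogonal)

text \<open>Completeness of the characters of the circle, applied to the coefficient
  \<open>\<xi>\<close> of x with itself. All its Fourier coefficients vanish, so by
  Stone-Weierstrass it is orthogonal to every continuous function, in particular to itself; at angle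
  0 it equals the squared norm of x.\<close>

lemma eq_zero_if_proj_zero:
	assumes "!!n. proj n x = 0"
	shows "x = 0"
proof -
	define \<xi> where "\<xi> z = cinner (rp (m22 (Re z) (- Im z) (Im z) (Re z)) x) x" for z :: complex
	have on_circle: "Re z * Re z + Im z * Im z = 1" if "z \<in> sphere 0 1" for z
		using that by (simp add: cmod_def power2_eq_square)
	have cont: "continuous_on (sphere 0 1) \<xi>"
		unfolding \<xi>_def by (intro continuous_intros rep_continuous) (auto simp: on_circle)
	have \<xi>_cis: "\<xi> (cis th) = cinner (rp (rot th) x) x" for th
		by (simp add: \<xi>_def rot_def)
	have coeff: "integral {0..2*pi} (%th. cis (of_int n * th) * \<xi> (cis th)) = 0" for n
		using assms[of n] cinner_proj_integral[of n x x] by (simp add: \<xi>_cis)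
	\<comment> \<open>Continuous functions on the circle without Fourier coefficients. The class is
	  stable under multiplication by z and \<open>cnj z\<close>, hence by real polynomial functions,
	  since a real linear form on the plane is a combination of these two.\<close>
	define V where "V f \<longleftrightarrow> continuous_on (sphere 0 1) f &
		(\<forall>n. integral {0..2*pi} (%th. cis (of_int n * th) * f (cis th)) = (0::complex))" for f
	have int: "(%th. cis (of_int n * th) * f (cis th)) integrable_on {0..2*pi}"
		if "continuous_on (sphere 0 1) f" for n and f :: "complex => complex"
		by (intro integrable_continuous_interval continuous_intros continuous_on_compose2[OF that]) auto
	have V_add: "V (%z. f z + g z)" if "V f" "V g" for f g
		using that int by (simp add: V_def continuous_on_add distrib_left Henstock_Kurzweil_Integration.integral_add)
	have V_cmult: "V (%z. c * f z)" if "V f" for f c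
	proof -
		have "integral {0..2*pi} (%th. cis (of_int n * th) * (c * f (cis th))) = 0" for n
			using that integral_mult_right[of "{0..2*pi}" c "%th. cis (of_int n * th) * f (cis th)"]
			by (simp add: V_def mult.left_commute)
		then show ?thesis using that by (auto simp: V_def intro!: continuous_intros)
	qed
	have V_z: "V (%z. z * f z)" "V (%z. cnj z * f z)" if "V f" for f
	proof -
		have "cis (of_int n * th) * (cis th * f (cis th)) = cis (of_int (n+1) * th) * f (cis th)"
			"cis (of_int n * th) * (cis (-th) * f (cis th)) = cis (of_int (n-1) * th) * f (cis th)" for n th
			by (simp_all add: cis_mult distrib_right left_diff_distrib flip: mult.assoc)
		then have "integral {0..2*pi} (%th. cis (of_int n * th) * (cis th * f (cis th))) = 0"
			"integral {0..2*pi} (%th. cis (of_int n * th) * (cis (-th) * f (cis th))) = 0" for n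
			using that unfolding V_def by presburger+
		then show "V (%z. z * f z)" "V (%z. cnj z * f z)"
			using that by (auto simp: V_def cis_cnj intro!: continuous_intros)
	qed
	have V_poly: "V (%z. of_real (p z) * f z)" if "real_polynomial_function p" "V f" for p f
		using that
	proof (induction arbitrary: f rule: real_polynomial_function.induct)
		case (linear l)
		define u v where "u = complex_of_real (l 1)" and "v = complex_of_real (l \<i>)"
		have "of_real (l z) = ((u - \<i> * v) / 2) * z + ((u + \<i> * v) / 2) * cnj z" for z
		proof -
			have "z = Re z *\<^sub>R 1 + Im z *\<^sub>R \<i>" by (simp add: complex_eq_iff)
			then have "l z = l (Re z *\<^sub>R 1 + Im z *\<^sub>R \<i>)" by (rule arg_cong)
			also have "... = Re z * l 1 + Im z * l \<i>"
				using bounded_linear.linear[OF linear(1)] by (simp add: linear_add linear_scale del: scaleR_one)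
			finally have lz: "l z = Re z * l 1 + Im z * l \<i>" .
			show ?thesis unfolding lz u_def v_def complex_eq_iff by (simp add: algebra_simps) argo
		qed
		then have "(%z. of_real (l z) * f z)
				= (%z. ((u - \<i> * v) / 2) * (z * f z) + ((u + \<i> * v) / 2) * (cnj z * f z))"
			by (auto simp: algebra_simps)
		then show ?case
			using V_add[OF V_cmult[OF V_z(1)[OF linear(2)], of "(u - \<i> * v) / 2"]
					V_cmult[OF V_z(2)[OF linear(2)], of "(u + \<i> * v) / 2"]] by (simp only:)
	next
		case (const c)
		then show ?case using V_cmult by blast
	next
		case (add p q)
		then show ?case using V_add[OF add.IH] by (simp add: distrib_right)
	next
		case (mult p q)
		then show ?case using mult.IH(1)[OF mult.IH(2)] by (simp add: mult.assoc)
	qed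
	have "V \<xi>" using coeff cont by (simp add: V_def)
	have compact: "compact (sphere (0::complex) 1)" by simp
	have real_part: "integral {0..2*pi} (%th. of_real (h (cis th)) * \<xi> (cis th)) = 0"
		if h: "continuous_on (sphere 0 1) h" for h :: "complex => real"
	proof (rule ccontr)
		let ?I = "integral {0..2*pi} (%th. of_real (h (cis th)) * \<xi> (cis th))"
		assume "?I ~= 0"
		define M where "M = (norm x)\<^sup>2 + 1"
		have M: "norm (\<xi> (cis th)) <= M" for th
			using cinner_Cauchy_Schwarz[of "rp (rot th) x" x] by (simp add: \<xi>_cis M_def power2_eq_square)
		have "M > 0" by (simp add: M_def add_nonneg_pos)
		\<comment> \<open>With this tolerance the error of the polynomial approximation is at most
		  \<open>2 * pi * e * M\<close>, half of the norm of \<open>?I\<close>.\<close>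
		define e where "e = norm ?I / (4 * pi * M)"
		have "e > 0" using \<open>?I ~= 0\<close> \<open>M > 0\<close> by (simp add: e_def)
		then obtain p where p: "real_polynomial_function p" "!!z. z \<in> sphere 0 1 ==> \<bar>h z - p z\<bar> < e"
			using Stone_Weierstrass_real_polynomial_function[OF compact h] by blast
		have pc: "continuous_on (sphere 0 1) p"
			using p(1) continuous_on_polymonial_function real_polynomial_function_eq by blast
		have 0: "integral {0..2*pi} (%th. of_real (p (cis th)) * \<xi> (cis th)) = 0"
			using V_poly[OF p(1) \<open>V \<xi>\<close>] unfolding V_def by (metis (no_types, lifting) cis_zero mult_1 mult_zero_left of_int_0 Henstock_Kurzweil_Integration.integral_cong)
		have i1: "(%th. of_real (q (cis th)) * \<xi> (cis th)) integrable_on {0..2*pi}"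
			if "continuous_on (sphere 0 1) q" for q :: "complex => real"
			by (intro integrable_continuous_interval continuous_intros continuous_on_compose2[OF that]
					continuous_on_compose2[OF cont]) auto
		have "?I = integral {0..2*pi} (%th. of_real (h (cis th)) * \<xi> (cis th) - of_real (p (cis th)) * \<xi> (cis th))"
			using Henstock_Kurzweil_Integration.integral_diff[OF i1[OF h] i1[OF pc]] 0 by simp
		also have "norm ... <= (e * M) * (2*pi - 0)"
		proof (rule integral_bound)
			show "continuous_on {0..2*pi} (%th. of_real (h (cis th)) * \<xi> (cis th) - of_real (p (cis th)) * \<xi> (cis th))"
				by (intro continuous_intros continuous_on_compose2[OF h] continuous_on_compose2[OF pc]
					continuous_on_compose2[OF cont]) auto
			fix th :: real
			have "norm (of_real (h (cis th)) * \<xi> (cis th) - of_real (p (cis th)) * \<xi> (cis th))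
					= \<bar>h (cis th) - p (cis th)\<bar> * norm (\<xi> (cis th))"
				by (metis left_diff_distrib norm_mult norm_of_real of_real_diff)
			also have "... <= e * M"
				using p(2)[of "cis th"] M[of th] \<open>e > 0\<close> by (intro mult_mono) auto
			finally show "norm (of_real (h (cis th)) * \<xi> (cis th) - of_real (p (cis th)) * \<xi> (cis th)) <= e * M" .
		qed simp
		also have "(e * M) * (2*pi - 0) = norm ?I / 2"
			using \<open>M > 0\<close> by (simp add: e_def)
		finally show False using \<open>?I ~= 0\<close> by simp
	qed
	have "integral {0..2*pi} (%th. cnj (\<xi> (cis th)) * \<xi> (cis th)) = 0"
	proof -
		have i2: "(%th. of_real (q (cis th)) * \<xi> (cis th)) integrable_on {0..2*pi}"
			if "continuous_on (sphere 0 1) q" for q :: "complex => real"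
			by (intro integrable_continuous_interval continuous_intros continuous_on_compose2[OF that]
					continuous_on_compose2[OF cont]) auto
		have cR: "continuous_on (sphere 0 1) (%z. Re (\<xi> z))" "continuous_on (sphere 0 1) (%z. Im (\<xi> z))"
			using cont by (auto intro!: continuous_intros)
		have e: "(%th. cnj (\<xi> (cis th)) * \<xi> (cis th)) = (%th. of_real (Re (\<xi> (cis th))) * \<xi> (cis th)
				- \<i> * (of_real (Im (\<xi> (cis th))) * \<xi> (cis th)))"
			by (rule ext) (simp add: complex_eq_iff)
		show ?thesis
			unfolding e using real_part[OF cR(1)] real_part[OF cR(2)] i2[OF cR(1)] integrable_on_mult_right[OF i2[OF cR(2)], of \<i>]
			by (simp add: Henstock_Kurzweil_Integration.integral_diff)
	qed
	moreover have "(%th. cnj (\<xi> (cis th)) * \<xi> (cis th)) = (%th. of_real ((norm (\<xi> (cis th)))\<^sup>2))"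
		by (rule ext) (simp add: mult_cnj_norm mult.commute)
	ultimately have "integral {0..2*pi} (%th. complex_of_real ((norm (\<xi> (cis th)))\<^sup>2)) = 0" by simp
	moreover have c2: "continuous_on {0..2*pi} (%th. (norm (\<xi> (cis th)))\<^sup>2)"
		by (intro continuous_intros continuous_on_compose2[OF cont]) auto
	moreover have lin_of_real: "bounded_linear (of_real :: real => complex)"
		by (rule bounded_linear_of_real)
	ultimately have "integral {0..2*pi} (%th. (norm (\<xi> (cis th)))\<^sup>2) = 0"
		using integral_linear[OF integrable_continuous_interval[OF c2] lin_of_real]
		by (simp add: o_def)
	then have "(norm (\<xi> (cis 0)))\<^sup>2 = 0"
		using integral_eq_0_iff[OF c2] by (auto dest: bspec[where x = 0])
	then show ?thesis
		unfolding \<xi>_cis rot_0 by (simp add: cinner_norm)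
qed

end

text \<open>S is the absolute value of B, the positive square root of B^2. The commutation clause is
  what the Schur-type argument for weight spaces consumes: S inherits every symmetry of B.\<close>

lemma selfadjoint_contraction_abs:
	fixes B :: "'h => 'h::complex_hilbert"
	assumes lin: "bounded_linear B" and contr: "!!x. norm (B x) <= norm x"
		and sa: "!!x y. cinner (B x) y = cinner x (B y)"
	obtains S where "bounded_linear S" "!!x. S (S x) = B (B x)" "!!x. 0 <= Re (cinner (S x) x)"
		"!!C x. bounded_linear C ==> (!!x. C (B x) = B (C x)) ==> C (S x) = S (C x)"
proof -
	define A where "A x = x - B (B x)" for x
	have linA: "bounded_linear A"
		unfolding A_def by (intro bounded_linear_sub bounded_linear_ident bounded_linear_compose[OF lin lin])
	have normA: "norm (A x) <= norm x" for x
	proof -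
		have "cinner (A x) (A x) = cinner x x - 2 * cinner (B x) (B x) + cinner (B (B x)) (B (B x))"
			unfolding A_def by (simp add: cinner_diff_left cinner_diff_right sa)
		then have "complex_of_real ((norm (A x))\<^sup>2)
				= of_real ((norm x)\<^sup>2 - 2 * (norm (B x))\<^sup>2 + (norm (B (B x)))\<^sup>2)"
			by (simp add: cinner_norm)
		then have "(norm (A x))\<^sup>2 = (norm x)\<^sup>2 - 2 * (norm (B x))\<^sup>2 + (norm (B (B x)))\<^sup>2"
			by (simp only: of_real_eq_iff)
		moreover have "(norm (B (B x)))\<^sup>2 <= (norm (B x))\<^sup>2"
			using contr by (intro power_mono) auto
		ultimately have "(norm (A x))\<^sup>2 <= (norm x)\<^sup>2"
			using zero_le_power2[of "norm (B x)"] by linarith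
		then show ?thesis by (rule power2_le_imp_le) simp
	qed
	\<comment> \<open>\<open>1 - sqrt (1 - A)\<close> is the limit of the iteration \<open>Y \<mapsto> (A + Y\<^sup>2) / 2\<close>; the scalar iteration
		with \<open>A = 1\<close> majorises it.\<close>
	define Y where "Y k = rec_nat (%_::'h. 0) (%_ Z x. (1/2) *\<^sub>R (A x + Z (Z x))) k" for k
	define y where "y k = rec_nat (0::real) (%_ z. (1 + z\<^sup>2) / 2) k" for k
	have Y0: "Y 0 x = 0" and YS: "Y (Suc k) x = (1/2) *\<^sub>R (A x + Y k (Y k x))" for k x
		by (simp_all add: Y_def)
	have y0: "y 0 = 0" and yS: "y (Suc k) = (1 + (y k)\<^sup>2) / 2" for k
		by (simp_all add: y_def)
	have y_bd: "0 <= y k & y k <= 1" for k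
	proof (induct k)
		case (Suc k)
		then have "(y k)\<^sup>2 <= 1" by (simp add: power_le_one)
		then show ?case by (simp add: yS)
	qed (simp add: y0)
	have Ylin: "bounded_linear (Y k)" for k
	proof (induct k)
		case 0
		have "Y 0 = (%_. 0)" by (rule ext) (simp add: Y0)
		then show ?case by simp
	next
		case (Suc k)
		have "Y (Suc k) = (%x. (1/2) *\<^sub>R (A x + Y k (Y k x)))" by (rule ext) (rule YS)
		then show ?case
			using linA bounded_linear_compose[OF Suc Suc]
			by (auto intro!: bounded_linear_add bounded_linear_compose[OF bounded_linear_scaleR_right])
	qed
	have Yadd: "Y k (u + v) = Y k u + Y k v" and Ydiff: "Y k (u - v) = Y k u - Y k v"
		and Yscale: "Y k (r *\<^sub>R u) = r *\<^sub>R Y k u" for k u v r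
		using bounded_linear.linear[OF Ylin[of k]] by (simp_all add: linear_add linear_diff linear_scale)
	have Ynorm: "norm (Y k x) <= y k * norm x" for k x
	proof (induct k arbitrary: x)
		case (Suc k)
		have "norm (Y (Suc k) x) <= (1/2) * (norm (A x) + norm (Y k (Y k x)))"
			using norm_triangle_ineq[of "A x" "Y k (Y k x)"] by (simp add: YS)
		also have "norm (Y k (Y k x)) <= y k * (y k * norm x)"
			using Suc[of "Y k x"] mult_left_mono[OF Suc[of x], of "y k"] y_bd[of k] by linarith
		finally show ?case
			using normA[of x] by (simp add: yS power2_eq_square algebra_simps)
	qed (simp add: Y0 y0)
	\<comment> \<open>The operator increments are dominated by the increments of the scalar sequence,
	  and those telescope to a convergent series.\<close>
	have Ystep: "norm (Y (Suc k) x - Y k x) <= (y (Suc k) - y k) * norm x" for k x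
	proof (induct k arbitrary: x)
		case 0
		show ?case using normA[of x] by (simp add: YS Y0 yS y0)
	next
		case (Suc k)
		let ?d = "y (Suc k) - y k"
		have d0: "?d >= 0" using Suc[of x] norm_ge_zero[of "Y (Suc k) x - Y k x"]
		proof (cases "x = 0")
			case True
			show ?thesis by (induct k) (simp_all add: yS y0 power_mono y_bd)
		next
			case False
			then show ?thesis using order_trans[OF norm_ge_zero Suc[of x]] by (simp add: zero_le_mult_iff)
		qed
		\<comment> \<open>The difference of two squares of operators, split as U(U - V) + (U - V)V; this
		  form is valid without U and V commuting.\<close>
		have "Y (Suc (Suc k)) x - Y (Suc k) x
				= (1/2) *\<^sub>R (Y (Suc k) (Y (Suc k) x - Y k x) + (Y (Suc k) (Y k x) - Y k (Y k x)))"
			unfolding YS[of "Suc k"] YS[of k x] Ydiff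
			by (simp add: YS[of k x, symmetric] scaleR_diff_right[symmetric])
				(simp add: YS[of k x] scaleR_diff_right scaleR_add_right)
		also have "norm ... <= (1/2) * (y (Suc k) * (?d * norm x) + ?d * (y k * norm x))"
		proof -
			have 1: "norm (Y (Suc k) (Y (Suc k) x - Y k x)) <= y (Suc k) * (?d * norm x)"
				using Ynorm[of "Suc k" "Y (Suc k) x - Y k x"]
					mult_left_mono[OF Suc[of x], of "y (Suc k)"] y_bd[of "Suc k"] by linarith
			have 2: "norm (Y (Suc k) (Y k x) - Y k (Y k x)) <= ?d * (y k * norm x)"
				using Suc[of "Y k x"] mult_left_mono[OF Ynorm[of k x] d0] by linarith
			show ?thesis
				using norm_triangle_ineq[of "Y (Suc k) (Y (Suc k) x - Y k x)" "Y (Suc k) (Y k x) - Y k (Y k x)"] 1 2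
				by simp
		qed
		also have "... = (y (Suc (Suc k)) - y (Suc k)) * norm x"
			unfolding yS[of "Suc k"] by (subst (3) yS) (simp add: power2_eq_square field_simps)
		finally show ?case .
	qed
	have mono_y: "incseq y"
	proof (rule incseq_SucI)
		fix k show "y k <= y (Suc k)"
			by (induct k) (simp_all add: yS y0 power_mono y_bd)
	qed
	have "Bseq y"
		using y_bd by (intro BseqI'[where K = 1]) auto
	then have "convergent y" using mono_y Bseq_monoseq_convergent incseq_imp_monoseq by blast
	then have sum_y: "summable (%k. y (Suc k) - y k)"
		by (metis convergent_LIMSEQ_iff sums_summable telescope_sums)
	define Z where "Z x = lim (%k. Y k x)" for x
	have lim: "(%k. Y k x) \<longlonglongrightarrow> Z x" for x
	proof -
		have "summable (%k. Y (Suc k) x - Y k x)"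
			by (rule summable_comparison_test'[OF summable_mult2[OF sum_y, of "norm x"] Ystep])
		then have "(%n. \<Sum>k<n. Y (Suc k) x - Y k x) \<longlonglongrightarrow> (\<Sum>k. Y (Suc k) x - Y k x)"
			by (rule summable_LIMSEQ)
		then have "(%n. Y n x) \<longlonglongrightarrow> (\<Sum>k. Y (Suc k) x - Y k x)"
			by (simp add: sum_lessThan_telescope[of "%k. Y k x"] Y0)
		then show ?thesis unfolding Z_def by (simp add: limI)
	qed
	have Ynorm1: "norm (Y k x) <= norm x" for k x
		using Ynorm[of k x] mult_right_mono[of "y k" 1 "norm x"] y_bd[of k] by auto
	have Znorm: "norm (Z x) <= norm x" for x
		by (rule LIMSEQ_le_const2[OF tendsto_norm[OF lim]]) (use Ynorm1 in auto)
	have Zadd: "Z (u + v) = Z u + Z v" for u v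
		by (rule LIMSEQ_unique[OF lim]) (simp add: Yadd tendsto_add[OF lim lim])
	have Zscale: "Z (r *\<^sub>R u) = r *\<^sub>R Z u" for r u
		by (rule LIMSEQ_unique[OF lim]) (simp add: Yscale tendsto_scaleR[OF tendsto_const lim])
	have Zlin: "bounded_linear Z"
		by (rule bounded_linear_intro[where K = 1]) (auto simp: Zadd Zscale Znorm)
	have Zdiff: "Z (u - v) = Z u - Z v" for u v
		using bounded_linear.linear[OF Zlin] by (simp add: linear_diff)
	have ZZ: "(%k. Y k (Y k x)) \<longlonglongrightarrow> Z (Z x)" for x
	proof -
		have "(%k. Y k (Y k x - Z x)) \<longlonglongrightarrow> 0"
		proof (rule Lim_null_comparison)
			show "\<forall>\<^sub>F k in sequentially. norm (Y k (Y k x - Z x)) <= norm (Y k x - Z x)"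
				using Ynorm1 by auto
			show "(%k. norm (Y k x - Z x)) \<longlonglongrightarrow> 0"
				using lim[of x] by (simp add: LIM_zero tendsto_norm_zero)
		qed
		from tendsto_add[OF this lim[of "Z x"]] show ?thesis by (simp add: Ydiff)
	qed
	have Zeq: "Z x = (1/2) *\<^sub>R (A x + Z (Z x))" for x
	proof (rule LIMSEQ_unique)
		show "(%k. Y (Suc k) x) \<longlonglongrightarrow> Z x" by (rule LIMSEQ_Suc[OF lim])
		show "(%k. Y (Suc k) x) \<longlonglongrightarrow> (1/2) *\<^sub>R (A x + Z (Z x))"
			unfolding YS by (intro tendsto_intros ZZ)
	qed
	define S where "S x = x - Z x" for x
	show ?thesis
	proof
		show "bounded_linear S"
			unfolding S_def by (intro bounded_linear_sub bounded_linear_ident Zlin)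
		show "S (S x) = B (B x)" for x
		proof -
			have "Z x + Z x = A x + Z (Z x)"
				by (subst (1 2) Zeq) (metis scaleR_half_double scaleR_add_right)
			then show ?thesis by (simp add: S_def Zdiff A_def algebra_simps)
		qed
		show "0 <= Re (cinner (S x) x)" for x
		proof -
			have "Re (cinner (Z x) x) <= norm (Z x) * norm x"
				using complex_Re_le_cmod cinner_Cauchy_Schwarz order_trans by blast
			also have "... <= (norm x)\<^sup>2" using Znorm by (simp add: power2_eq_square mult_right_mono)
			finally show ?thesis by (simp add: S_def cinner_diff_left cinner_norm)
		qed
		show "C (S x) = S (C x)" if C: "bounded_linear C" and comm: "!!x. C (B x) = B (C x)" for C x
		proof -
			have Cadd: "C (u + v) = C u + C v" and Cdiff: "C (u - v) = C u - C v"
				and Csc: "C (r *\<^sub>R u) = r *\<^sub>R C u" for u v r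
				using bounded_linear.linear[OF C] by (simp_all add: linear_add linear_diff linear_scale)
			have C0: "C 0 = 0" using Csc[of 0 0] by simp
			have "C (Y k x) = Y k (C x)" for k x
				by (induct k arbitrary: x) (simp_all add: Y0 YS C0 Csc Cadd A_def Cdiff comm)
			then have "C (Z x) = Z (C x)"
				using LIMSEQ_unique[OF bounded_linear.tendsto[OF C lim[of x]]] lim[of "C x"] by simp
			then show ?thesis by (simp add: S_def Cdiff)
		qed
	qed
qed

section \<open>Multiplicity one through the Hecke algebra\<close>

locale irrep =
	fixes rp :: "real^2^2 => 'h => 'h::complex_hilbert"
	assumes irreducible: "irreducible_unitary_rep rp"

sublocale irrep \<subseteq> unirep
	using irreducible by unfold_locales (simp add: irreducible_unitary_rep_def)

text \<open>Transposition followed by conjugation with diag(1,-1). Transposition alone would invert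
  rotations; the conjugation restores them, so that K and A are both fixed pointwise.\<close>

definition flip22 :: "real^2^2 => real^2^2" where
	"flip22 g = m22 (g$1$1) (- (g$2$1)) (- (g$1$2)) (g$2$2)"

lemma flip22_mult: "flip22 (g ** h) = flip22 h ** flip22 g"
	by (cases g rule: m22_cases, cases h rule: m22_cases) (simp add: flip22_def algebra_simps)

lemma flip22_SL2R: "g \<in> SL2R ==> flip22 g \<in> SL2R"
	by (cases g rule: m22_cases) (simp add: flip22_def algebra_simps)

lemma flip22_rot [simp]: "flip22 (rot th) = rot th" and flip22_dia [simp]: "flip22 (dia t) = dia t"
	by (simp_all add: flip22_def rot_def dia_def)

context irrep
begin

lemma invariant_subspace:
	assumes "complex_vector.subspace W" "closed W" "!!g x. g \<in> SL2R ==> x \<in> W ==> rp g x \<in> W"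
		and "x \<in> W" "x ~= 0"
	shows "y \<in> W"
proof -
	have "W = {0} \<or> W = UNIV"
		using irreducible assms(1-3) by (auto simp: irreducible_unitary_rep_def image_subset_iff)
	then show ?thesis using assms(4,5) by auto
qed

lemma closed_wt: "closed (wt n)"
proof -
	have "wt n = {x. proj n x = x}" using proj_wt proj_in_wt by auto metis
	then show ?thesis
		by (simp add: closed_Collect_eq linear_continuous_on[OF bounded_linear_proj] continuous_on_id)
qed

lemma coeff_rot_dia_rot:
	assumes "x \<in> wt n" "y \<in> wt n"
	shows "cinner (rp (rot al ** dia t ** rot bt) x) y
		= cis (- of_int n * (al + bt)) * cinner (rp (dia t) x) y"
proof -
	have "rp (rot al ** dia t ** rot bt) x = cis (- of_int n * bt) *% rp (rot al) (rp (dia t) x)"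
		using assms(1) by (simp add: rep_mult SL2R_mult wtD rep_scaleC)
	moreover have "cinner (rp (rot al) (rp (dia t) x)) y = cis (- of_int n * al) * cinner (rp (dia t) x) y"
		using assms(2) by (simp add: rep_adjoint[of "rot al"] rot_adj wtD cinner_scaleC_right cis_cnj)
	ultimately show ?thesis by (simp add: cinner_scaleC_left cis_mult ring_distribs add.commute flip: mult.assoc)
qed

text \<open>Between two vectors of the same weight the coefficient sees only t and the sum of the
  two angles, and reversing \<open>rot al ** dia t ** rot bt\<close> preserves both.\<close>

lemma coeff_flip22:
	assumes "x \<in> wt n" "y \<in> wt n" "g \<in> SL2R"
	shows "cinner (rp (flip22 g) x) y = cinner (rp g x) y"
proof -
	obtain al t bt where g: "g = rot al ** dia t ** rot bt" using KAK[OF assms(3)] by metis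
	then have "flip22 g = rot bt ** dia t ** rot al" by (simp add: flip22_mult matrix_mul_assoc)
	then show ?thesis using assms by (simp add: g coeff_rot_dia_rot add.commute)
qed

text \<open>Writes a product of two compressed operators as an average of coefficients of single
  group elements, to which \<open>coeff_flip22\<close> applies.\<close>

lemma coeff_proj_integral:
	assumes "g \<in> SL2R" "h \<in> SL2R"
	shows "cinner (rp g (proj n (rp h x))) y = (1 / (2*pi)) *\<^sub>R
		integral {0..2*pi} (%th. cis (of_int n * th) * cinner (rp (g ** rot th ** h) x) y)"
	using assms by (simp add: rep_adjoint[of g] cinner_proj_integral rep_mult SL2R_mult)

lemma proj_rep_flip22:
	assumes "x \<in> wt n" "g \<in> SL2R"
	shows "proj n (rp (flip22 g) x) = proj n (rp g x)"
proof (rule cinner_eqI)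
	fix z
	show "cinner (proj n (rp (flip22 g) x)) z = cinner (proj n (rp g x)) z"
		using coeff_flip22[OF assms(1) proj_in_wt assms(2)] by (simp add: cinner_proj_proj)
qed

text \<open>
	The Hecke algebra of a \<open>K\<close>-type is commutative, since the anti-automorphism \<open>flip22\<close> fixes
	every double coset of \<open>SO(2)\<close>.
\<close>

lemma hecke_commute:
	assumes x: "x \<in> wt n" and "g \<in> SL2R" "h \<in> SL2R"
	shows "proj n (rp g (proj n (rp h x))) = proj n (rp h (proj n (rp g x)))"
proof (rule cinner_eqI)
	fix z
	let ?y = "proj n z"
	have y: "?y \<in> wt n" by (rule proj_in_wt)
	have "cinner (rp g (proj n (rp h x))) ?y
			= cinner (rp (flip22 h) (proj n (rp (flip22 g) x))) ?y"
	proof -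
		have "cinner (rp (g ** rot th ** h) x) ?y = cinner (rp (flip22 h ** rot th ** flip22 g) x) ?y" for th
			using coeff_flip22[OF x y, of "g ** rot th ** h"] assms
			by (simp add: SL2R_mult flip22_mult matrix_mul_assoc)
		then show ?thesis
			using assms by (simp add: coeff_proj_integral flip22_SL2R)
	qed
	also have "... = cinner (rp h (proj n (rp g x))) ?y"
		using assms by (simp add: proj_rep_flip22 coeff_flip22[OF proj_in_wt proj_in_wt])
	finally show "cinner (proj n (rp g (proj n (rp h x)))) z = cinner (proj n (rp h (proj n (rp g x)))) z"
		by (simp add: cinner_proj_proj)
qed

text \<open>The Weyl element \<open>rot (pi/2)\<close> conjugates \<open>dia t\<close> to its
  inverse, and the two phases that it produces cancel because both vectors have the same
  weight.\<close>

lemma hecke_dia_selfadjoint: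
	assumes "x \<in> wt n" "y \<in> wt n"
	shows "cinner (rp (dia t) x) y = cinner x (rp (dia t) y)"
proof -
	have "rot (pi/2) ** dia t ** rot (- pi/2) = dia (- t)"
		by (simp add: rot_def dia_def)
	then have "cinner (rp (dia (- t)) y) x = cinner (rp (dia t) y) x"
		using coeff_rot_dia_rot[OF assms(2,1), of "pi/2" t "- pi/2"] by simp
	then show ?thesis
		by (metis cinner_commute dia_SL2R dia_adj rep_adjoint)
qed

text \<open>Irreducibility descends to \<open>wt n\<close> with the compressed operators: the
  vectors whose whole orbit projects into W form a closed subspace invariant under the group, so
  that one nonzero vector already makes it everything.\<close>

lemma wt_invariant_subspace:
	assumes sub: "complex_vector.subspace W" and cl: "closed W"
		and inv: "!!g x. g \<in> SL2R ==> x \<in> W ==> proj n (rp g x) \<in> W"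
		and x: "x \<in> W" "x ~= 0" and y: "y \<in> wt n"
	shows "y \<in> W"
proof -
	define Z where "Z = {x. \<forall>g\<in>SL2R. proj n (rp g x) \<in> W}"
	have Z: "Z = (\<Inter>g\<in>SL2R. (%x. proj n (rp g x)) -` W)" by (auto simp: Z_def)
	have "y \<in> Z"
	proof (rule invariant_subspace[of Z x])
		show "complex_vector.subspace Z"
			using sub by (auto simp: Z_def complex_vector.subspace_def rep_add rep_scaleC proj_add proj_scaleC)
		show "closed Z"
			unfolding Z
		proof (intro closed_INT ballI continuous_closed_vimage cl)
			fix g z assume "g \<in> SL2R"
			then have "bounded_linear (%x. proj n (rp g x))"
				by (intro bounded_linear_compose[OF bounded_linear_proj] rep_bounded_linear)
			then show "isCont (%x. proj n (rp g x)) z"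
				using linear_continuous_at by blast
		qed
		show "rp g z \<in> Z" if "g \<in> SL2R" "z \<in> Z" for g z
			using that by (auto simp: Z_def SL2R_mult simp flip: rep_mult)
		show "x \<in> Z" using inv x by (simp add: Z_def)
	qed (use x in auto)
	then have "\<forall>g\<in>SL2R. proj n (rp g y) \<in> W" by (simp add: Z_def)
	then have "proj n (rp (mat 1) y) \<in> W" using mat_1_SL2R by (rule bspec)
	then show ?thesis using y by (simp add: proj_wt)
qed

text \<open>The compression of \<open>dia t\<close> minus any real number is either nonnegative or
  nonpositive on \<open>wt n\<close>. A self-adjoint operator commuting with an irreducible family
  has no room for two spectral parts of opposite sign.\<close>

lemma hecke_dia_semibounded:
	fixes c :: real
	shows "(\<forall>x\<in>wt n. c * (norm x)\<^sup>2 <= Re (cinner (rp (dia t) x) x))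
			 \<or> (\<forall>x\<in>wt n. Re (cinner (rp (dia t) x) x) <= c * (norm x)\<^sup>2)"
proof -
	\<comment> \<open>Bounds the norm of the compression minus c, so that B becomes a
	  contraction.\<close>
	define M where "M = 1 + \<bar>c\<bar>"
	have M: "M > 0" by (simp add: M_def add_pos_nonneg)
	define T where "T x = proj n (rp (dia t) (proj n x))" for x
	define B where "B x = (1/M) *\<^sub>R (T x - c *\<^sub>R proj n x)" for x
	have linT: "bounded_linear T"
		unfolding T_def by (intro bounded_linear_compose[OF bounded_linear_proj]
				bounded_linear_compose[OF rep_bounded_linear] bounded_linear_proj) simp
	have linB: "bounded_linear B"
		unfolding B_def
		by (intro bounded_linear_compose[OF bounded_linear_scaleR_right] bounded_linear_sub linT bounded_linear_proj)
	have "norm (T x - c *\<^sub>R proj n x) <= M * norm x" for x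
	proof -
		have "norm (T x) <= norm (proj n x)"
			unfolding T_def using norm_proj_le[of n "rp (dia t) (proj n x)"] by simp
		then have "norm (T x) <= norm x" using norm_proj_le[of n x] by linarith
		moreover have "norm (c *\<^sub>R proj n x) <= \<bar>c\<bar> * norm x"
			using norm_proj_le[of n x] by (simp add: mult_left_mono)
		ultimately show ?thesis
			using norm_triangle_ineq4[of "T x" "c *\<^sub>R proj n x"] by (simp add: M_def algebra_simps)
	qed
	then have normB: "norm (B x) <= norm x" for x
		using M by (simp add: B_def divide_le_eq mult.commute del: scaleR_diff_right)
	have saB: "cinner (B x) y = cinner x (B y)" for x y
	proof -
		have "cinner (T x) y = cinner x (T y)"
			unfolding T_def
			by (simp add: cinner_proj_proj hecke_dia_selfadjoint[OF proj_in_wt proj_in_wt] flip: cinner_proj_proj)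
				(simp add: cinner_proj_proj hecke_dia_selfadjoint[OF proj_in_wt proj_in_wt])
		then show ?thesis
			by (simp add: B_def cinner_scaleR_left cinner_scaleR_right cinner_diff_left cinner_diff_right cinner_proj_proj)
	qed
	obtain S where S: "bounded_linear S" "!!x. S (S x) = B (B x)" "!!x. 0 <= Re (cinner (S x) x)"
		and comm: "!!C x. bounded_linear C ==> (!!x. C (B x) = B (C x)) ==> C (S x) = S (C x)"
		apply (rule selfadjoint_contraction_abs[OF linB normB saB])
		subgoal premises prems for S
			by (rule prems(1)[of S], rule prems(2), rule prems(3), rule prems(4), rule prems(5)) simp_all
		done
	have Bscale: "B (r *\<^sub>R x) = r *\<^sub>R B x" and Badd: "B (x + y) = B x + B y"
		and Bdiff: "B (x - y) = B x - B y" for r x y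
		using bounded_linear.linear[OF linB] by (simp_all add: linear_scale linear_add linear_diff)
	have Sadd: "S (x + y) = S x + S y" and Sdiff: "S (x - y) = S x - S y" for x y
		using bounded_linear.linear[OF S(1)] by (simp_all add: linear_add linear_diff)
	have pp: "proj n (proj n x) = proj n x" for x by (simp add: proj_wt proj_in_wt)
	have prB: "proj n (B x) = B x" "B (proj n x) = B x" for x
		using bounded_linear.linear[OF bounded_linear_proj[of n]]
		by (simp_all add: B_def T_def pp linear_scale linear_diff)
	have SP: "proj n (S x) = S (proj n x)" for x
		by (rule comm[OF bounded_linear_proj]) (simp add: prB)
	have SB: "B (S x) = S (B x)" for x
		by (rule comm[OF linB]) simp
	have SC: "c *% S x = S (c *% x)" for c x
		by (rule comm[OF bounded_linear_scaleC_right])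
			(simp add: B_def T_def proj_scaleC rep_scaleC scaleC_diff_right scaleC_scaleR)
	have BC: "B (c *% x) = c *% B x" for c x
		by (simp add: B_def T_def proj_scaleC rep_scaleC scaleC_diff_right scaleC_scaleR)
	have BT: "proj n (rp g (proj n (B x))) = B (proj n (rp g (proj n x)))" if g: "g \<in> SL2R" for g x
	proof -
		have lin: "bounded_linear (%x. proj n (rp g (proj n x)))"
			using g by (intro bounded_linear_compose[OF bounded_linear_proj]
				bounded_linear_compose[OF rep_bounded_linear] bounded_linear_proj)
		have "proj n (rp g (proj n (T x))) = T (proj n (rp g (proj n x)))"
			using hecke_commute[OF proj_in_wt, of g "dia t" n x] g by (simp add: T_def pp)
		then show ?thesis
			using linear_scale[OF bounded_linear.linear[OF lin]] linear_diff[OF bounded_linear.linear[OF lin]]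
			by (simp add: B_def pp)
	qed
	have ST: "proj n (rp g (proj n (S x))) = S (proj n (rp g (proj n x)))" if g: "g \<in> SL2R" for g x
		by (rule comm, intro bounded_linear_compose[OF bounded_linear_proj]
				bounded_linear_compose[OF rep_bounded_linear] bounded_linear_proj g) (rule BT[OF g])
	\<comment> \<open>The kernel of S + B in \<open>wt n\<close> is stable under the compressed
	  operators, hence zero or all of \<open>wt n\<close>. Since (S + B)(S - B) = 0, a zero kernel
	  gives S = B, and a full one gives S = -B.\<close>
	have key: "(\<forall>x\<in>wt n. S x = B x) \<or> (\<forall>x\<in>wt n. S x = - B x)"
	proof (cases "\<exists>x\<in>wt n. S x + B x = 0 & x ~= 0")
		case True
		then obtain x0 where x0: "x0 \<in> wt n" "S x0 + B x0 = 0" "x0 ~= 0" by auto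
		define W where "W = wt n \<inter> {x. S x + B x = 0}"
		have "y \<in> W" if "y \<in> wt n" for y
		proof (rule wt_invariant_subspace[of W n x0 y])
			show "complex_vector.subspace W"
				unfolding complex_vector.subspace_def
			proof (intro conjI ballI allI)
				show "0 \<in> W" using linear_0[OF bounded_linear.linear[OF S(1)]] linear_0[OF bounded_linear.linear[OF linB]]
					by (simp add: W_def)
				fix x y assume "x \<in> W" "y \<in> W"
				then have "(S x + B x) + (S y + B y) = 0" "x \<in> wt n" "y \<in> wt n" by (auto simp: W_def)
				then show "x + y \<in> W"
					by (simp add: W_def wt_add Sadd Badd algebra_simps)
			next
				fix c x assume "x \<in> W"
				then show "c *% x \<in> W"
					by (simp add: W_def wt_scaleC SC[symmetric] BC flip: scaleC_add_right)
			qed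
			show "closed W"
				unfolding W_def using linear_continuous_on[OF bounded_linear_add[OF S(1) linB], of UNIV]
				by (intro closed_Int closed_wt closed_Collect_eq continuous_on_const)
			show "proj n (rp g x) \<in> W" if "g \<in> SL2R" "x \<in> W" for g x
			proof -
				have x: "x \<in> wt n" "S x + B x = 0" using that by (auto simp: W_def)
				have "S (proj n (rp g x)) + B (proj n (rp g x)) = proj n (rp g (proj n (S x + B x)))"
					using ST[OF that(1), of x] BT[OF that(1), of x] x(1) that(1)
					by (simp add: proj_wt proj_add rep_add)
				then show ?thesis using x that(1) by (simp add: W_def proj_in_wt)
			qed
		qed (use x0 that in \<open>auto simp: W_def\<close>)
		then show ?thesis by (auto simp: W_def eq_neg_iff_add_eq_0)
	next
		case False
		have "S x = B x" if "x \<in> wt n" for x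
		proof -
			have "S x - B x \<in> wt n"
				using SP[of x] prB(1)[of x] proj_in_wt that by (metis proj_wt wt_diff)
			moreover have "S (S x - B x) + B (S x - B x) = 0"
				by (simp add: Sdiff Bdiff S(2) SB)
			ultimately show ?thesis using False by auto
		qed
		then show ?thesis by blast
	qed
	have B_form: "Re (cinner (B x) x) = (Re (cinner (rp (dia t) x) x) - c * (norm x)\<^sup>2) / M" if "x \<in> wt n" for x
		using that by (simp add: B_def T_def proj_wt cinner_scaleR_left cinner_diff_left cinner_proj cinner_norm)
	from key show ?thesis
	proof
		assume "\<forall>x\<in>wt n. S x = B x"
		then have "\<forall>x\<in>wt n. 0 <= Re (cinner (B x) x)" using S(3) by metis
		then show ?thesis using M B_form by (simp add: zero_le_divide_iff)
	next
		assume "\<forall>x\<in>wt n. S x = - B x"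
		then have "\<forall>x\<in>wt n. 0 <= - Re (cinner (B x) x)" using S(3) by (metis cinner_minus_left uminus_complex.sel(1))
		then show ?thesis using M B_form by (simp add: divide_le_0_iff)
	qed
qed

text \<open>Let c be the quotient of the quadratic form at one vector. Semiboundedness at every
  level below and above c squeezes the form to c times the squared norm on all of
  \<open>wt n\<close>.\<close>

lemma hecke_dia_scalar: "\<exists>c::real. \<forall>x\<in>wt n. proj n (rp (dia t) x) = c *\<^sub>R x"
proof (cases "\<exists>e\<in>wt n. e ~= 0")
	case False
	then have "proj n (rp (dia t) x) = 0 *\<^sub>R x" if "x \<in> wt n" for x
		using that by force
	then show ?thesis by blast
next
	case True
	then obtain e where e: "e \<in> wt n" "e ~= 0" by auto
	define q where "q x = Re (cinner (rp (dia t) x) x)" for x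
	define c where "c = q e / (norm e)\<^sup>2"
	have ne: "(norm e)\<^sup>2 > 0" using e by simp
	have ce: "c * (norm e)\<^sup>2 = q e" using e by (simp add: c_def)
	have lower: "d * (norm x)\<^sup>2 <= q x" if "x \<in> wt n" "d < c" for x d
	proof -
		have "d * (norm e)\<^sup>2 < q e" using that ne ce mult_strict_right_mono[of d c "(norm e)\<^sup>2"] by simp
		then show ?thesis using hecke_dia_semibounded[of n d t] that(1) e(1) by (force simp: q_def)
	qed
	have upper: "q x <= d * (norm x)\<^sup>2" if "x \<in> wt n" "c < d" for x d
	proof -
		have "q e < d * (norm e)\<^sup>2" using that ne ce mult_strict_right_mono[of c d "(norm e)\<^sup>2"] by simp
		then show ?thesis using hecke_dia_semibounded[of n d t] that(1) e(1) by (force simp: q_def)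
	qed
	have q: "q x = c * (norm x)\<^sup>2" if x: "x \<in> wt n" for x
	proof (rule antisym)
		show "q x <= c * (norm x)\<^sup>2"
		proof (rule field_le_epsilon)
			fix ep :: real assume "ep > 0"
			define d where "d = c + ep / (1 + (norm x)\<^sup>2)"
			have p: "1 + (norm x)\<^sup>2 > 0" by (simp add: add_pos_nonneg)
			have "c < d" using \<open>ep > 0\<close> p by (simp add: d_def)
			from upper[OF x this] have "q x <= c * (norm x)\<^sup>2 + ep / (1 + (norm x)\<^sup>2) * (norm x)\<^sup>2"
				by (simp add: d_def distrib_right)
			also have "ep / (1 + (norm x)\<^sup>2) * (norm x)\<^sup>2 <= ep"
				using \<open>ep > 0\<close> p by (simp add: field_simps)
			finally show "q x <= c * (norm x)\<^sup>2 + ep" by simp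
		qed
		show "c * (norm x)\<^sup>2 <= q x"
		proof (rule field_le_epsilon)
			fix ep :: real assume "ep > 0"
			define d where "d = c - ep / (1 + (norm x)\<^sup>2)"
			have p: "1 + (norm x)\<^sup>2 > 0" by (simp add: add_pos_nonneg)
			have "d < c" using \<open>ep > 0\<close> p by (simp add: d_def)
			from lower[OF x this] have "c * (norm x)\<^sup>2 - ep / (1 + (norm x)\<^sup>2) * (norm x)\<^sup>2 <= q x"
				by (simp add: d_def left_diff_distrib)
			moreover have "ep / (1 + (norm x)\<^sup>2) * (norm x)\<^sup>2 <= ep"
				using \<open>ep > 0\<close> p by (simp add: field_simps)
			ultimately show "c * (norm x)\<^sup>2 <= q x + ep" by simp
		qed
	qed
	have "proj n (rp (dia t) x) = c *\<^sub>R x" if x: "x \<in> wt n" for x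
	proof -
		define R where "R x = proj n (rp (dia t) x) - c *\<^sub>R x" for x
		have Rwt: "R x \<in> wt n" using x wt_scaleC[OF x, of "of_real c"]
			by (simp add: R_def wt_diff proj_in_wt scaleC_of_real)
		have R0: "Re (cinner (R z) z) = 0" if "z \<in> wt n" for z
			using q[OF that] that by (simp add: R_def q_def cinner_diff_left cinner_proj cinner_scaleR_left cinner_norm)
		have Radd: "R (u + v) = R u + R v" for u v
			by (simp add: R_def rep_add proj_add scaleR_add_right)
		have Rsa: "cinner (R (R x)) x = cinner (R x) (R x)"
		proof -
			have "cinner (R z) w = cinner z (R w)" if "z \<in> wt n" "w \<in> wt n" for z w
				using hecke_dia_selfadjoint[OF that] that cinner_proj[OF that(1), of "rp (dia t) w"]
				by (simp add: R_def cinner_diff_left cinner_diff_right cinner_proj cinner_scaleR_left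
						cinner_scaleR_right)
					(metis cinner_proj_proj proj_wt)
			from this[OF Rwt x] show ?thesis .
		qed
		\<comment> \<open>A self-adjoint R with vanishing quadratic form is zero: the test vector x + R x
		  brings out the squared norm of R x.\<close>
		have "Re (cinner (R (x + R x)) (x + R x)) = 0" by (rule R0) (intro wt_add x Rwt)
		then have "Re (cinner (R x) (R x)) = 0"
			using R0[OF x] R0[OF Rwt] Rsa by (simp add: Radd cinner_add_left cinner_add_right)
		then have "R x = 0" by (simp add: cinner_norm)
		then show ?thesis by (simp add: R_def)
	qed
	then show ?thesis by blast
qed

text \<open>By the Cartan decomposition every compressed operator acts on \<open>wt n\<close> by a
  scalar, so the line through e is already invariant and must be the whole space. The explicit
  coefficient is the one of the orthogonal projection.\<close>

lemma wt_one_dim: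
	assumes e: "e \<in> wt n" "e ~= 0" and x: "x \<in> wt n"
	shows "x = (cinner x e / of_real ((norm e)\<^sup>2)) *% e"
proof -
	let ?N = "complex_of_real ((norm e)\<^sup>2)"
	have N: "?N ~= 0" using e by simp
	define W where "W = wt n \<inter> {x. ?N *% x = cinner x e *% e}"
	have "x \<in> W"
	proof (rule wt_invariant_subspace[of W n e])
		show "complex_vector.subspace W"
			unfolding complex_vector.subspace_def
		proof (intro conjI ballI allI)
			show "0 \<in> W" by (simp add: W_def)
			show "x + y \<in> W" if "x \<in> W" "y \<in> W" for x y
				using that by (simp add: W_def wt_add scaleC_add_right scaleC_add_left cinner_add_left)
			show "c *% x \<in> W" if "x \<in> W" for c x
			proof -
				have "?N *% (c *% x) = c *% (?N *% x)" by (simp only: scaleC_scaleC mult.commute)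
				also have "?N *% x = cinner x e *% e" using that by (simp add: W_def)
				finally show ?thesis using that by (simp add: W_def wt_scaleC cinner_scaleC_left scaleC_scaleC)
			qed
		qed
		show "closed W"
			unfolding W_def by (intro closed_Int closed_wt closed_Collect_eq continuous_intros)
		show "proj n (rp g z) \<in> W" if g: "g \<in> SL2R" and z: "z \<in> W" for g z
		proof -
			have z': "z \<in> wt n" using z by (simp add: W_def)
			obtain al t bt where gd: "g = rot al ** dia t ** rot bt" using KAK[OF g] by metis
			obtain c where c: "!!x. x \<in> wt n ==> proj n (rp (dia t) x) = c *\<^sub>R x"
				using hecke_dia_scalar by blast
			have "proj n (rp g z) = (cis (- of_int n * (al + bt)) * of_real c) *% z"
			proof (rule cinner_eqI)
				fix w
				have "cinner (proj n (rp g z)) w = cinner (rp g z) (proj n w)" by (rule cinner_proj_proj)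
				also have "... = cis (- of_int n * (al + bt)) * cinner (rp (dia t) z) (proj n w)"
					unfolding gd by (rule coeff_rot_dia_rot[OF z' proj_in_wt])
				also have "cinner (rp (dia t) z) (proj n w) = of_real c * cinner z w"
					by (simp add: c[OF z'] cinner_scaleR_left scaleR_conv_of_real flip: cinner_proj_proj)
				finally show "cinner (proj n (rp g z)) w = cinner ((cis (- of_int n * (al + bt)) * of_real c) *% z) w"
					by (simp add: cinner_scaleC_left mult.assoc)
			qed
			moreover have "c *% z \<in> W" for c
			proof -
				have "?N *% (c *% z) = c *% (?N *% z)" by (simp only: scaleC_scaleC mult.commute)
				also have "?N *% z = cinner z e *% e" using z by (simp add: W_def)
				finally show ?thesis using z by (simp add: W_def wt_scaleC cinner_scaleC_left scaleC_scaleC)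
			qed
			ultimately show ?thesis by simp
		qed
		show "e \<in> W" using e by (simp add: W_def cinner_norm)
	qed (use e x in auto)
	then have "?N *% x = cinner x e *% e" by (simp add: W_def)
	then have "(1 / ?N) *% (?N *% x) = (1 / ?N) *% (cinner x e *% e)" by simp
	then show ?thesis using N by (simp add: scaleC_scaleC)
qed

end

section \<open>Calculus tools for smoothing: parameter derivatives, bumps, Iwasawa
  coordinates\<close>

text \<open>Moves the dependence on x from f, merely a matrix coefficient, to the smooth kernel b;
  the fixed interval makes differentiation under the integral possible.\<close>

lemma integral_convolution_commute:
	fixes f :: "real => complex" and b :: "real => real"
	assumes supp: "!!x. x \<notin> {-ep..ep} ==> b x = 0" and L: "\<bar>x\<bar> + ep <= L"
	shows "integral {-ep..ep} (%p. b p *\<^sub>R f (x - p)) = integral {-L..L} (%P. b (x - P) *\<^sub>R f P)"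
proof -
	let ?g = "%P. b (x - P) *\<^sub>R f P"
	have "integral {-L..L} ?g = integral {-L..L} (%P. if P \<in> {-ep + x..ep + x} then ?g P else 0)"
		by (rule Henstock_Kurzweil_Integration.integral_cong) (use supp[of "x - P" for P] in auto)
	also have "... = integral ({-ep + x..ep + x} \<inter> {-L..L}) ?g"
		by (rule integral_restrict_Int)
	also have "{-ep + x..ep + x} \<inter> {-L..L} = {-ep + x..ep + x}"
		using L by auto
	also have "integral {-ep + x..ep + x} ?g = integral {-ep..ep} (%y. b (- y) *\<^sub>R f (x + y))"
		using integral_shift_Icc_real[of "-ep" ep ?g x] by (simp add: o_def)
	also have "... = integral {-ep..ep} (%p. b p *\<^sub>R f (x - p))"
		using Henstock_Kurzweil_Integration.integral_reflect_real[of ep "-ep" "%p. b p *\<^sub>R f (x - p)"]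
		by (simp only: minus_minus diff_minus_eq_add)
	finally show ?thesis ..
qed

text \<open>Two derivatives in s, jointly continuous with the parameter y: exactly what two
  applications of the Leibniz rule require. The closure lemmas below allow the integrand to be
  checked by its syntax.\<close>

definition smooth2 :: "(real => 'y::topological_space => 'b::real_normed_vector) => bool" where
	"smooth2 f \<longleftrightarrow> (\<exists>f1 f2.
		 (\<forall>s y. ((%s. f s y) has_vector_derivative f1 s y) (at s)) &
		 (\<forall>s y. ((%s. f1 s y) has_vector_derivative f2 s y) (at s)) &
		 continuous_on UNIV (%(s, y). f s y) & continuous_on UNIV (%(s, y). f1 s y) &
		 continuous_on UNIV (%(s, y). f2 s y))"

lemma smooth2I:
	assumes "!!s y. ((%s. f s y) has_vector_derivative f1 s y) (at s)"
		"!!s y. ((%s. f1 s y) has_vector_derivative f2 s y) (at s)"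
		"continuous_on UNIV (%(s, y). f s y)" "continuous_on UNIV (%(s, y). f1 s y)"
		"continuous_on UNIV (%(s, y). f2 s y)"
	shows "smooth2 f"
	using assms unfolding smooth2_def by blast

lemma smooth2_const:
	assumes "continuous_on UNIV g"
	shows "smooth2 (%s y. g y)"
	by (rule smooth2I[where ?f1.0 = "%s y. 0" and ?f2.0 = "%s y. 0"])
		(auto simp: case_prod_unfold intro!: continuous_intros continuous_on_compose2[OF assms])

lemma smooth2_ident: "smooth2 (%s y. s)"
	by (rule smooth2I[where ?f1.0 = "%s y. 1" and ?f2.0 = "%s y. 0"])
		(auto simp: case_prod_unfold intro!: continuous_intros derivative_eq_intros)

lemma smooth2_add:
	assumes "smooth2 f" "smooth2 g"
	shows "smooth2 (%s y. f s y + g s y)"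
proof -
	obtain f1 f2 where f: "!!s y. ((%s. f s y) has_vector_derivative f1 s y) (at s)"
		"!!s y. ((%s. f1 s y) has_vector_derivative f2 s y) (at s)"
		"continuous_on UNIV (%(s, y). f s y)" "continuous_on UNIV (%(s, y). f1 s y)"
		"continuous_on UNIV (%(s, y). f2 s y)" using assms(1) unfolding smooth2_def by blast
	obtain g1 g2 where g: "!!s y. ((%s. g s y) has_vector_derivative g1 s y) (at s)"
		"!!s y. ((%s. g1 s y) has_vector_derivative g2 s y) (at s)"
		"continuous_on UNIV (%(s, y). g s y)" "continuous_on UNIV (%(s, y). g1 s y)"
		"continuous_on UNIV (%(s, y). g2 s y)" using assms(2) unfolding smooth2_def by blast
	show ?thesis
		by (rule smooth2I[where ?f1.0 = "%s y. f1 s y + g1 s y" and ?f2.0 = "%s y. f2 s y + g2 s y"])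
			(use f g in \<open>auto simp: case_prod_unfold intro!: continuous_intros has_vector_derivative_add\<close>)
qed

lemma smooth2_mult:
	fixes f g :: "real => 'y::topological_space => 'b::real_normed_algebra"
	assumes "smooth2 f" "smooth2 g"
	shows "smooth2 (%s y. f s y * g s y)"
proof -
	obtain f1 f2 where f: "!!s y. ((%s. f s y) has_vector_derivative f1 s y) (at s)"
		"!!s y. ((%s. f1 s y) has_vector_derivative f2 s y) (at s)"
		"continuous_on UNIV (%(s, y). f s y)" "continuous_on UNIV (%(s, y). f1 s y)"
		"continuous_on UNIV (%(s, y). f2 s y)" using assms(1) unfolding smooth2_def by blast
	obtain g1 g2 where g: "!!s y. ((%s. g s y) has_vector_derivative g1 s y) (at s)"
		"!!s y. ((%s. g1 s y) has_vector_derivative g2 s y) (at s)"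
		"continuous_on UNIV (%(s, y). g s y)" "continuous_on UNIV (%(s, y). g1 s y)"
		"continuous_on UNIV (%(s, y). g2 s y)" using assms(2) unfolding smooth2_def by blast
	show ?thesis
		by (rule smooth2I[where ?f1.0 = "%s y. f s y * g1 s y + f1 s y * g s y"
					and ?f2.0 = "%s y. (f s y * g2 s y + f1 s y * g1 s y) + (f1 s y * g1 s y + f2 s y * g s y)"])
			(use f g in \<open>auto simp: case_prod_unfold
				intro!: continuous_intros has_vector_derivative_add has_vector_derivative_mult\<close>)
qed

lemma smooth2_power:
	fixes f :: "real => 'y::topological_space => 'b::real_normed_algebra_1"
	assumes "smooth2 f"
	shows "smooth2 (%s y. f s y ^ k)"
proof (induct k)
	case 0
	show ?case using smooth2_const[of "%y::'y. 1::'b"] by simp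
next
	case (Suc k)
	then show ?case using smooth2_mult[OF assms Suc] by simp
qed

lemma smooth2_compose:
	fixes f :: "real => 'y::topological_space => real"
	assumes "smooth2 f" and S: "!!s y. f s y \<in> S" and "open S"
		and h: "!!x. x \<in> S ==> (h has_real_derivative h1 x) (at x)"
		and h1: "!!x. x \<in> S ==> (h1 has_real_derivative h2 x) (at x)"
		and h2: "continuous_on S h2"
	shows "smooth2 (%s y. h (f s y))"
proof -
	obtain f1 f2 where f: "!!s y. ((%s. f s y) has_vector_derivative f1 s y) (at s)"
		"!!s y. ((%s. f1 s y) has_vector_derivative f2 s y) (at s)"
		"continuous_on UNIV (%(s, y). f s y)" "continuous_on UNIV (%(s, y). f1 s y)"
		"continuous_on UNIV (%(s, y). f2 s y)" using assms(1) unfolding smooth2_def by blast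
	have fr: "((%s. f s y) has_real_derivative f1 s y) (at s)"
		"((%s. f1 s y) has_real_derivative f2 s y) (at s)" for s y
		using f(1,2) by (simp_all add: has_real_derivative_iff_has_vector_derivative)
	have ch: "continuous_on S h" "continuous_on S h1"
		using DERIV_isCont[OF h] DERIV_isCont[OF h1] by (auto simp: continuous_at_imp_continuous_on)
	show ?thesis
	proof (rule smooth2I[where ?f1.0 = "%s y. h1 (f s y) * f1 s y"
				and ?f2.0 = "%s y. h2 (f s y) * f1 s y * f1 s y + f2 s y * h1 (f s y)"])
		show "((%s. h (f s y)) has_vector_derivative h1 (f s y) * f1 s y) (at s)" for s y
			using DERIV_chain2[OF h[OF S] fr(1)]
			by (simp add: has_real_derivative_iff_has_vector_derivative)
		show "((%s. h1 (f s y) * f1 s y) has_vector_derivative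
				h2 (f s y) * f1 s y * f1 s y + f2 s y * h1 (f s y)) (at s)" for s y
			using DERIV_mult[OF DERIV_chain2[OF h1[OF S] fr(1)] fr(2)]
			by (simp add: has_real_derivative_iff_has_vector_derivative)
	qed (use f(3-5) S in \<open>auto simp: case_prod_unfold
		intro!: continuous_intros continuous_on_compose2[OF ch(1)] continuous_on_compose2[OF ch(2)]
			continuous_on_compose2[OF h2]\<close>)
qed

lemma smooth2_of_real:
	fixes f :: "real => 'y::topological_space => real"
	assumes "smooth2 f"
	shows "smooth2 (%s y. complex_of_real (f s y))"
proof -
	obtain f1 f2 where f: "!!s y. ((%s. f s y) has_vector_derivative f1 s y) (at s)"
		"!!s y. ((%s. f1 s y) has_vector_derivative f2 s y) (at s)"
		"continuous_on UNIV (%(s, y). f s y)" "continuous_on UNIV (%(s, y). f1 s y)"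
		"continuous_on UNIV (%(s, y). f2 s y)" using assms(1) unfolding smooth2_def by blast
	show ?thesis
		by (rule smooth2I[where ?f1.0 = "%s y. of_real (f1 s y)" and ?f2.0 = "%s y. of_real (f2 s y)"])
			(use f in \<open>auto simp: case_prod_unfold
				intro!: continuous_intros bounded_linear.has_vector_derivative[OF bounded_linear_of_real]\<close>)
qed

lemma smooth2_exp: "smooth2 f ==> smooth2 (%s y. exp (f s y :: real))"
	by (rule smooth2_compose[where S = UNIV and ?h1.0 = exp and ?h2.0 = exp]) (auto intro!: continuous_intros DERIV_exp)

lemma smooth2_ln:
	assumes "smooth2 f" "!!s y. f s y > 0"
	shows "smooth2 (%s y. ln (f s y :: real))"
proof (rule smooth2_compose[where f = f and h = ln and S = "{0<..}" and ?h1.0 = "%x. inverse x" and ?h2.0 = "%x. - (inverse x ^ 2)"])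
	show "(ln has_real_derivative inverse x) (at x)" if "x \<in> {0<..}" for x :: real
		using that by (auto intro!: DERIV_ln)
	show "(inverse has_real_derivative - ((inverse x)\<^sup>2)) (at x)" if "x \<in> {0<..}" for x :: real
		using that DERIV_inverse[of x] by (simp add: power2_eq_square)
qed (use assms in \<open>auto intro!: continuous_intros\<close>)

lemma smooth2_minus:
	fixes f :: "real => 'y::topological_space => real"
	assumes "smooth2 f"
	shows "smooth2 (%s y. - f s y)"
	using smooth2_mult[OF smooth2_const[of "%_::'y. -1::real"] assms] by simp

text \<open>Exponents of at least 2 make the two one-sided derivatives agree at the corner.\<close>

lemma DERIV_max_power:
	"((%t. max 0 t ^ Suc (Suc k)) has_real_derivative real (Suc (Suc k)) * max 0 t ^ Suc k) (at (t::real))"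
proof -
	consider "t > 0" | "t < 0" | "t = 0" by linarith
	then show ?thesis
	proof cases
		case 1
		have "((%t. t ^ Suc (Suc k)) has_real_derivative real (Suc (Suc k)) * t ^ Suc k) (at t)"
			by (rule derivative_eq_intros refl | simp)+
		then have "((%t. max 0 t ^ Suc (Suc k)) has_real_derivative real (Suc (Suc k)) * t ^ Suc k) (at t)"
			by (rule DERIV_cong_ev[THEN iffD1, rotated -1, OF _ refl _ refl])
				(use 1 in \<open>auto intro!: eventually_mono[OF eventually_nhds_in_open[of "{0<..}"]]\<close>)
		then show ?thesis using 1 by simp
	next
		case 2
		have "((%t. 0) has_real_derivative 0) (at t)" by simp
		then have "((%t. max 0 t ^ Suc (Suc k)) has_real_derivative 0) (at t)"
			by (rule DERIV_cong_ev[THEN iffD1, rotated -1, OF _ refl _ refl])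
				(use 2 in \<open>auto intro!: eventually_mono[OF eventually_nhds_in_open[of "{..<0}"]]\<close>)
		then show ?thesis using 2 by simp
	next
		case 3
		have "((%h. max 0 h ^ Suc k) \<longlongrightarrow> max 0 0 ^ Suc k) (at (0::real))"
			by (intro tendsto_intros)
		then have l: "((%h. max 0 h ^ Suc k) \<longlongrightarrow> 0) (at (0::real))" by simp
		have "((%h. (max 0 (0 + h) ^ Suc (Suc k) - max 0 0 ^ Suc (Suc k)) / h) \<longlongrightarrow> 0) (at (0::real))"
		proof (rule Lim_null_comparison[OF _ l])
			show "\<forall>\<^sub>F h in at (0::real). norm ((max 0 (0 + h) ^ Suc (Suc k) - max 0 0 ^ Suc (Suc k)) / h) <= max 0 h ^ Suc k"
			proof (rule always_eventually, rule allI)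
				fix h :: real
				show "norm ((max 0 (0 + h) ^ Suc (Suc k) - max 0 0 ^ Suc (Suc k)) / h) <= max 0 h ^ Suc k"
					by (cases "h > 0") (auto simp: max_def abs_mult power_abs)
			qed
		qed
		then show ?thesis using 3 by (simp add: DERIV_def)
	qed
qed

text \<open>The cube is the smallest integer power of the positive part with two continuous
  derivatives, which is all that is used.\<close>

definition bump :: "real => real => real" where
	"bump ep x = max 0 (ep\<^sup>2 - x\<^sup>2) ^ 3"

lemma bump_zero: "0 < ep ==> x \<notin> {-ep..ep} ==> bump ep x = 0"
proof -
	assume "0 < ep" "x \<notin> {-ep..ep}"
	then have "\<bar>ep\<bar> <= \<bar>x\<bar>" by auto
	then have "ep\<^sup>2 <= x\<^sup>2" by (simp add: abs_le_square_iff)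
	then show ?thesis by (simp add: bump_def)
qed

lemma continuous_bump [continuous_intros]:
	"continuous_on S f ==> continuous_on S (%x. bump ep (f x))"
	unfolding bump_def by (intro continuous_intros)

lemma bump_nonneg: "0 <= bump ep x"
	by (simp add: bump_def)

lemma bump_pos: "0 < ep ==> bump ep 0 > 0"
	by (simp add: bump_def)

lemma smooth2_bump:
	assumes "smooth2 f"
	shows "smooth2 (%s y. bump ep (f s y))"
	unfolding bump_def
proof (rule smooth2_compose[where S = UNIV and h = "%t. max 0 t ^ 3" and ?h1.0 = "%t. 3 * max 0 t ^ 2"
				and ?h2.0 = "%t. 6 * max 0 t"])
	show "smooth2 (%s y. ep\<^sup>2 - (f s y)\<^sup>2)"
		using smooth2_add[OF smooth2_const[of "%_. ep\<^sup>2"] smooth2_minus[OF smooth2_power[OF assms, of 2]]] by simp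
	show "((%t. max 0 t ^ 3) has_real_derivative 3 * max 0 x ^ 2) (at x)" for x :: real
		using DERIV_max_power[of 1 x] by (simp add: numeral_eq_Suc)
	show "((%t. 3 * max 0 t ^ 2) has_real_derivative 6 * max 0 x) (at x)" for x :: real
		using DERIV_cmult[OF DERIV_max_power[of 0 x], of 3] by (simp add: numeral_eq_Suc)
qed (auto intro!: continuous_intros)

text \<open>Squared length of the bottom row of \<open>rot th ** dia s\<close>. In an NAK product
  with diagonal parameter q this length is \<open>exp (- 2 * q)\<close>, whence
  \<open>iwaq\<close>.\<close>

definition iwaR :: "real => real => real" where
	"iwaR s th = (sin th)\<^sup>2 * exp (2 * s) + (cos th)\<^sup>2 * exp (- (2 * s))"

lemma iwaR_bounds: "exp (- (2 * \<bar>s\<bar>)) <= iwaR s th" "iwaR s th <= exp (2 * \<bar>s\<bar>)"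
proof -
	have 1: "exp (- (2 * \<bar>s\<bar>)) <= exp (2 * s)" "exp (- (2 * \<bar>s\<bar>)) <= exp (- (2 * s))"
		"exp (2 * s) <= exp (2 * \<bar>s\<bar>)" "exp (- (2 * s)) <= exp (2 * \<bar>s\<bar>)" by auto
	have sc: "x = (sin th)\<^sup>2 * x + (cos th)\<^sup>2 * x" for x :: real
		by (metis mult_1 distrib_right sin_cos_squared_add)
	show "exp (- (2 * \<bar>s\<bar>)) <= iwaR s th" unfolding iwaR_def
		by (subst sc) (intro add_mono mult_left_mono 1 zero_le_power2)
	show "iwaR s th <= exp (2 * \<bar>s\<bar>)" unfolding iwaR_def
		by (subst (3) sc) (intro add_mono mult_left_mono 1 zero_le_power2)
qed

lemma iwaR_pos: "iwaR s th > 0"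
	using iwaR_bounds(1)[of s th] exp_gt_zero[of "- (2 * \<bar>s\<bar>)"] by linarith

definition iwaq :: "real => real => real" where
	"iwaq s th = - (ln (iwaR s th) / 2)"

definition iwap :: "real => real => real" where
	"iwap s th = sinh (2 * s) * sin (2 * th) / iwaR s th"

text \<open>The bottom row divided by its length is a unit vector and gives the angle
  \<open>ka\<close>. The top row is then verified with only \<open>a * b = 1\<close>,
  \<open>S\<^sup>2 + C\<^sup>2 = 1\<close> and the formula for \<open>r\<^sup>2\<close>.\<close>

lemma iwasawa_rot_dia:
	obtains ka where "rot th ** dia s = upp (iwap s th) ** dia (iwaq s th) ** rot ka"
		"cos ka = cos th * exp (- s) * exp (iwaq s th)" "sin ka = sin th * exp s * exp (iwaq s th)"
proof -
	define S C a b r where "S = sin th" and "C = cos th" and "a = exp s" and "b = exp (- s)"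
		and "r = exp (- iwaq s th)"
	have r2: "r\<^sup>2 = S\<^sup>2 * a\<^sup>2 + C\<^sup>2 * b\<^sup>2"
	proof -
		have "r\<^sup>2 = exp (ln (iwaR s th))" by (simp add: r_def iwaq_def flip: exp_double)
		then show ?thesis
			using iwaR_pos[of s th] by (simp add: iwaR_def S_def C_def a_def b_def flip: exp_double)
	qed
	have r: "r > 0" "exp (iwaq s th) = 1 / r" by (simp_all add: r_def exp_minus field_simps)
	have ab: "a * b = 1" and SC: "S\<^sup>2 + C\<^sup>2 = 1"
		by (simp_all add: a_def b_def S_def C_def flip: exp_add)
	have p: "iwap s th = (a\<^sup>2 - b\<^sup>2) * S * C / r\<^sup>2"
	proof -
		have "iwaR s th = r\<^sup>2" unfolding r2 by (simp add: iwaR_def S_def C_def a_def b_def flip: exp_double)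
		moreover have "sinh (2 * s) = (a\<^sup>2 - b\<^sup>2) / 2"
			by (simp add: sinh_def a_def b_def flip: exp_double)
		ultimately show ?thesis by (simp add: iwap_def sin_double S_def C_def)
	qed
	have "(C * b / r)\<^sup>2 + (S * a / r)\<^sup>2 = 1"
	proof -
		have "(C * b / r)\<^sup>2 + (S * a / r)\<^sup>2 = (S\<^sup>2 * a\<^sup>2 + C\<^sup>2 * b\<^sup>2) / r\<^sup>2"
			by (simp add: power_divide power_mult_distrib add_divide_distrib)
		also have "... = 1" unfolding r2[symmetric] using r by simp
		finally show ?thesis .
	qed
	then obtain ka where k: "C * b / r = cos ka" "S * a / r = sin ka"
		using sincos_total_2pi by metis
	have top1: "cos th * a = 1 / r * cos ka + iwap s th * r * sin ka"
	proof -
		have "C * a * r\<^sup>2 = C * b + (a\<^sup>2 - b\<^sup>2) * S * C * S * a"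
			using r2 ab SC by algebra
		moreover have "1 / r * (C * b / r) + (a\<^sup>2 - b\<^sup>2) * S * C / r\<^sup>2 * r * (S * a / r)
				= (C * b + (a\<^sup>2 - b\<^sup>2) * S * C * S * a) / r\<^sup>2"
			using r(1) by (simp add: power2_eq_square add_divide_distrib)
		ultimately show ?thesis unfolding p k[symmetric] C_def[symmetric] using r(1)
			by (metis nonzero_mult_div_cancel_right power_not_zero less_irrefl)
	qed
	have top2: "- (sin th * b) = - (1 / r * sin ka) + iwap s th * r * cos ka"
	proof -
		have "- (S * b * r\<^sup>2) = - (S * a) + (a\<^sup>2 - b\<^sup>2) * S * C * C * b"
			using r2 ab SC by algebra
		moreover have "- (1 / r * (S * a / r)) + (a\<^sup>2 - b\<^sup>2) * S * C / r\<^sup>2 * r * (C * b / r)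
				= (- (S * a) + (a\<^sup>2 - b\<^sup>2) * S * C * C * b) / r\<^sup>2"
			using r(1) by (simp add: power2_eq_square add_divide_distrib diff_divide_distrib mult.assoc)
		ultimately show ?thesis unfolding p k[symmetric] S_def[symmetric] using r(1)
			by (metis minus_divide_left nonzero_mult_div_cancel_right power_not_zero less_irrefl)
	qed
	have E: "exp (iwaq s th) = 1 / r" "exp (- iwaq s th) = r" using r by (simp_all add: r_def)
	have bot: "sin th * a = r * sin ka" "cos th * b = r * cos ka"
		unfolding k[symmetric] S_def C_def using r(1) by simp_all
	have "rot th ** dia s = m22 (cos th * a) (- (sin th * b)) (sin th * a) (cos th * b)"
		by (simp add: rot_def dia_def a_def b_def)
	also have "... = upp (iwap s th) ** dia (iwaq s th) ** rot ka"
		unfolding top1 top2 bot by (simp add: rot_def dia_def upp_def E)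
	finally have "rot th ** dia s = upp (iwap s th) ** dia (iwaq s th) ** rot ka" .
	with k r show ?thesis
		by (intro that) (simp_all add: S_def C_def a_def b_def)
qed

text \<open>The phase \<open>cis (n * th) * cis (- n * ka)\<close>, written through the cosine and
  sine of \<open>ka\<close> alone. The angle itself is only chosen and need not be smooth in s; the
  power with exponent \<open>nat \<bar>n\<bar>\<close>, with a sign for negative n, visibly
  is.\<close>

definition iwaph :: "int => real => real => complex" where
	"iwaph n s th = (cis (sgn (of_int n) * th) *
		 (of_real (cos th * exp (- s) * exp (iwaq s th))
			 - \<i> * of_real (sgn (of_int n) * (sin th * exp s * exp (iwaq s th))))) ^ nat \<bar>n\<bar>"

lemma smooth2_iwaR: "smooth2 (%s (y::real \<times> real \<times> real). iwaR s (fst y))"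
proof -
	have e: "smooth2 (%s y::real \<times> real \<times> real. exp (2 * s))"
		using smooth2_exp[OF smooth2_mult[OF smooth2_const[of "%_. 2"] smooth2_ident]] by simp
	have e': "smooth2 (%s y::real \<times> real \<times> real. exp (- (2 * s)))"
		using smooth2_exp[OF smooth2_minus[OF smooth2_mult[OF smooth2_const[of "%_. 2"] smooth2_ident]]] by simp
	show ?thesis
		unfolding iwaR_def
		by (intro smooth2_add smooth2_mult e e' smooth2_const continuous_intros)
qed

lemma smooth2_iwaq: "smooth2 (%s (y::real \<times> real \<times> real). iwaq s (fst y))"
proof -
	have "smooth2 (%s (y::real \<times> real \<times> real). - (ln (iwaR s (fst y)) * (1/2)))"
		by (intro smooth2_minus smooth2_mult smooth2_ln smooth2_iwaR smooth2_const continuous_intros iwaR_pos)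
	then show ?thesis by (simp add: iwaq_def)
qed

lemma smooth2_iwaph: "smooth2 (%s (y::real \<times> real \<times> real). iwaph n s (fst y))"
proof -
	have e: "smooth2 (%s y::real \<times> real \<times> real. exp s)" "smooth2 (%s y::real \<times> real \<times> real. exp (- s))"
		by (intro smooth2_exp smooth2_minus smooth2_ident)+
	have 1: "smooth2 (%s (y::real \<times> real \<times> real). complex_of_real (cos (fst y) * exp (- s) * exp (iwaq s (fst y))))"
		by (intro smooth2_of_real smooth2_mult smooth2_exp smooth2_iwaq e smooth2_const continuous_intros smooth2_minus smooth2_ident)
	have 2: "smooth2 (%s (y::real \<times> real \<times> real). complex_of_real (sgn (of_int n) * (sin (fst y) * exp s * exp (iwaq s (fst y)))))"
		by (intro smooth2_of_real smooth2_mult smooth2_exp smooth2_iwaq e smooth2_const continuous_intros smooth2_ident)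
	have 3: "smooth2 (%s (y::real \<times> real \<times> real). - \<i> * complex_of_real (sgn (of_int n) * (sin (fst y) * exp s * exp (iwaq s (fst y)))))"
		by (intro smooth2_mult 2 smooth2_const continuous_intros)
	have "smooth2 (%s (y::real \<times> real \<times> real). (cis (sgn (of_int n) * fst y) *
		 (of_real (cos (fst y) * exp (- s) * exp (iwaq s (fst y)))
			 + (- \<i> * of_real (sgn (of_int n) * (sin (fst y) * exp s * exp (iwaq s (fst y))))))) ^ nat \<bar>n\<bar>)"
		by (intro smooth2_power smooth2_mult[OF smooth2_const] smooth2_add 1 3 continuous_intros)
	then show ?thesis by (simp add: iwaph_def)
qed

lemma iwaph_eq:
	assumes "cos ka = cos th * exp (- s) * exp (iwaq s th)" "sin ka = sin th * exp s * exp (iwaq s th)"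
	shows "cis (of_int n * th) * cis (- of_int n * ka) = iwaph n s th"
proof -
	define sg :: real where "sg = sgn (of_int n)"
	have n: "of_int n = sg * real (nat \<bar>n\<bar>)"
		by (simp add: sg_def sgn_if)
	show ?thesis
	proof (cases "n = 0")
		case False
		then have sg: "sg = 1 \<or> sg = -1" by (auto simp: sg_def sgn_if)
		have "of_real (cos ka) - \<i> * of_real (sg * sin ka) = cis (- (sg * ka))"
			using sg by (auto simp: complex_eq_iff)
		then have "iwaph n s th = (cis (sg * th) * cis (- (sg * ka))) ^ nat \<bar>n\<bar>"
			unfolding iwaph_def assms[symmetric] sg_def[symmetric] by simp
		also have "... = cis (real (nat \<bar>n\<bar>) * (sg * th - sg * ka))"
			by (simp only: cis_mult Complex.DeMoivre diff_conv_add_uminus)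
		also have "real (nat \<bar>n\<bar>) * (sg * th - sg * ka) = of_int n * th + - of_int n * ka"
			unfolding n by (simp add: algebra_simps)
		finally show ?thesis by (simp add: cis_mult)
	qed (simp add: iwaph_def)
qed

section \<open>Differentiability of weight vectors along the diagonal group\<close>

context irrep
begin

definition sph :: "'h => real => real" where
	"sph e s = Re (cinner (rp (dia s) e) e)"

lemma sph_coeff: "e \<in> wt n ==> cinner (rp (dia s) e) e = of_real (sph e s)"
	using hecke_dia_selfadjoint[of e n e s] cinner_commute[of "rp (dia s) e" e]
	by (simp add: sph_def complex_eq_iff)

lemma sph_proj: "e \<in> wt n ==> norm e = 1 ==> proj n (rp (dia s) e) = sph e s *\<^sub>R e"
proof -
	assume e: "e \<in> wt n" "norm e = 1"
	obtain c where c: "proj n (rp (dia s) e) = c *\<^sub>R e" using hecke_dia_scalar e(1) by blast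
	have "of_real (sph e s) = cinner (proj n (rp (dia s) e)) e"
		using e by (simp add: cinner_proj sph_coeff)
	also have "... = of_real c" using e by (simp add: c cinner_scaleR_left cinner_norm scaleR_conv_of_real)
	finally show ?thesis using c by simp
qed

text \<open>The projection of \<open>rp (dia s) e\<close> to its weight is \<open>sph e s\<close>
  times e by multiplicity one. Written as an average over rotations and moved to Iwasawa
  coordinates, the right K-part acts on e by a scalar, and only N and A remain.\<close>

lemma sph_mean_value:
	assumes e: "e \<in> wt n" "norm e = 1"
	shows "of_real (sph e s) * cinner e x = (1 / (2*pi)) *\<^sub>R integral {0..2*pi}
		(%th. iwaph n s th * cinner (rp (upp (iwap s th) ** dia (iwaq s th)) e) x)"
proof -
	have "cis (of_int n * th) * cinner (rp (rot th) (rp (dia s) e)) x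
			= iwaph n s th * cinner (rp (upp (iwap s th) ** dia (iwaq s th)) e) x" for th
	proof -
		obtain ka where k: "rot th ** dia s = upp (iwap s th) ** dia (iwaq s th) ** rot ka"
			"cos ka = cos th * exp (- s) * exp (iwaq s th)" "sin ka = sin th * exp s * exp (iwaq s th)"
			by (rule iwasawa_rot_dia)
		have "rp (rot th) (rp (dia s) e) = rp (rot th ** dia s) e" by (simp add: rep_mult)
		also have "... = cis (- of_int n * ka) *% rp (upp (iwap s th) ** dia (iwaq s th)) e"
			unfolding k(1) using e by (simp add: rep_mult SL2R_mult wtD rep_scaleC)
		finally show ?thesis
			by (simp add: cinner_scaleC_left iwaph_eq[OF k(2,3), symmetric])
	qed
	then show ?thesis
		using cinner_proj_integral[of n "rp (dia s) e" x] sph_proj[OF e, of s]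
		by (simp add: cinner_scaleR_left scaleR_conv_of_real)
qed

lemma continuous_an [continuous_intros]:
	"continuous_on S f ==> continuous_on S g ==> continuous_on S (%y. rp (upp (f y) ** dia (g y)) e)"
	by (rule rep_continuous) (auto simp: upp_def dia_def simp flip: exp_add intro!: continuous_intros)

text \<open>The mean value formula holds for every test vector x. Taking x to be e averaged over A
  and N against bumps turns the right side into an integral depending on s through smooth functions
  only, and x is chosen close enough to e that the factor on the left is not zero.\<close>

lemma sph_smooth:
	assumes e: "e \<in> wt n" "norm e = 1"
	obtains \<phi>1 \<phi>2 where
		"!!s. \<bar>s\<bar> < 1 ==> (sph e has_real_derivative \<phi>1 s) (at s)"
		"!!s. \<bar>s\<bar> < 1 ==> (\<phi>1 has_real_derivative \<phi>2 s) (at s)"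
		"isCont \<phi>2 0"
proof -
	define f0 where "f0 y = Re (cinner (rp (dia (fst y) ** upp (snd y)) e) e)" for y :: "real \<times> real"
	have "continuous_on UNIV f0"
		unfolding f0_def by (intro continuous_intros rep_continuous)
			(auto simp: upp_def dia_def simp flip: exp_add intro!: continuous_intros)
	then have "isCont f0 (0, 0)" by (simp add: continuous_on_eq_continuous_at)
	moreover have f00: "f0 (0, 0) = 1" using e by (simp add: f0_def dia_0 upp_0 cinner_norm)
	ultimately obtain d where d0: "d > 0" "!!y. dist y (0, 0) < d ==> dist (f0 y) (f0 (0, 0)) < 1"
		unfolding continuous_at_eps_delta using zero_less_one by blast
	have d: "d > 0" "!!y. dist y (0, 0) < d ==> Re (cinner (rp (dia (fst y) ** upp (snd y)) e) e) > 0"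
	proof -
		show "Re (cinner (rp (dia (fst y) ** upp (snd y)) e) e) > 0" if "dist y (0, 0) < d" for y
		proof -
			have "\<bar>f0 y - 1\<bar> < 1" using d0(2)[OF that] by (simp add: f00 dist_real_def)
			then have "f0 y > 0" by linarith
			then show ?thesis by (simp add: f0_def)
		qed
	qed (rule d0)
	\<comment> \<open>Both bump variables stay within ep, so their pair stays within 2 ep < d, where
	  the coefficient has positive real part; ep <= 1 enters the size estimates for L.\<close>
	define ep where "ep = min 1 (d / 3)"
	have ep: "ep > 0" "ep <= 1" "2 * ep < d" using d(1) by (auto simp: ep_def)
	define b where "b = bump ep"
	have b0: "!!x. x \<notin> {-ep..ep} ==> b x = 0" using bump_zero[OF ep(1)] by (simp add: b_def)
	have bc [continuous_intros]: "continuous_on S f ==> continuous_on S (%x. b (f x))" for S and f :: "'z::topological_space => real"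
		unfolding b_def by (rule continuous_bump)
	define x1 where "x1 = integral {-ep..ep} (%p. b p *\<^sub>R rp (upp p) e)"
	define x where "x = integral {-ep..ep} (%q. b q *\<^sub>R rp (dia q) x1)"
	have cu: "continuous_on S (%p. rp (upp p) e)" for S
		by (rule rep_continuous) (auto simp: upp_def intro!: continuous_intros)
	have i1: "(%p. b p *\<^sub>R rp (upp p) e) integrable_on {-ep..ep}"
		by (intro integrable_continuous_interval continuous_intros cu)
	have i2: "(%q. b q *\<^sub>R rp (dia q) x1) integrable_on {-ep..ep}"
		by (intro integrable_continuous_interval continuous_intros continuous_dia)
	have in_x1: "cinner z x1 = integral {-ep..ep} (%p. b p *\<^sub>R cinner z (rp (upp p) e))" for z
		using integral_linear[OF i1 bounded_linear_cinner_right[of z]]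
		by (simp add: x1_def o_def cinner_scaleR_right)
	have in_x: "cinner z x = integral {-ep..ep} (%q. b q *\<^sub>R cinner (rp (dia (- q)) z) x1)" for z
	proof -
		have "cinner z (rp (dia q) x1) = cinner (rp (dia (- q)) z) x1" for q
			using rep_adjoint[of "dia (- q)" z x1] by (simp add: dia_adj)
		then show ?thesis
			using integral_linear[OF i2 bounded_linear_cinner_right[of z]]
			by (simp add: x_def o_def cinner_scaleR_right)
	qed
	define m where "m y = cinner (rp (upp (snd y) ** dia (fst y)) e) e" for y :: "real \<times> real"
	have mc [continuous_intros]: "continuous_on S f ==> continuous_on S (%x. m (f x))"
		for S and f :: "'z::topological_space => real \<times> real"
		unfolding m_def by (intro continuous_intros)
	\<comment> \<open>Large enough for both translations: the diagonal variable moves within 1 + ep <=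
	  2, and the unipotent one within \<open>exp 6\<close> + ep, as \<open>exp 2\<close> times
	  \<open>iwap\<close> is at most \<open>exp 6\<close> for |s| < 1.\<close>
	define L :: real where "L = 2 + exp 6"
	\<comment> \<open>Averaging against the bump turns the mean value formula into an integral whose dependence on
		\<open>s\<close> is only through smooth functions.\<close>
	have avg: "cinner (rp (upp p' ** dia q') e) x
			= integral {-L..L} (%Q. integral {-L..L} (%P. b (q' - Q) *\<^sub>R (b (exp (- (2 * (q' - Q))) * p' - P) *\<^sub>R m (Q, P))))"
		if q1: "\<bar>q'\<bar> <= 1" and p1: "exp 2 * \<bar>p'\<bar> <= exp 6" for p' q'
	proof -
		have inner: "cinner (rp (dia (- q)) (rp (upp p' ** dia q') e)) x1
				= integral {-L..L} (%P. b (exp (- (2 * q)) * p' - P) *\<^sub>R m (q' - q, P))" if q: "q \<in> {-ep..ep}" for q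
		proof -
			have dd: "dia (- q) ** (upp p' ** dia q') = upp (exp (- (2 * q)) * p') ** dia (q' - q)"
				by (simp add: dia_def upp_def algebra_simps flip: exp_add)
			have "rp (dia (- q)) (rp (upp p' ** dia q') e) = rp (dia (- q) ** (upp p' ** dia q')) e"
				by (simp add: rep_mult SL2R_mult)
			then have 1: "rp (dia (- q)) (rp (upp p' ** dia q') e) = rp (upp (exp (- (2 * q)) * p') ** dia (q' - q)) e"
				by (simp add: dd)
			have 2: "cinner (rp (upp X ** dia (q' - q)) e) (rp (upp p) e) = m (q' - q, X - p)" for X p
			proof -
				have "cinner (rp (upp X ** dia (q' - q)) e) (rp (upp p) e)
						= cinner (rp (upp (- p)) (rp (upp X ** dia (q' - q)) e)) e"
					by (subst rep_adjoint[of "upp (- p)"]) (simp_all add: upp_def adj22_def)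
				also have "rp (upp (- p)) (rp (upp X ** dia (q' - q)) e) = rp (upp (X - p) ** dia (q' - q)) e"
					using rep_mult[of "upp (- p)" "upp X ** dia (q' - q)" e]
					by (simp add: SL2R_mult matrix_mul_assoc upp_mult)
				finally show ?thesis by (simp add: m_def)
			qed
			have "\<bar>exp (- (2 * q)) * p'\<bar> + ep <= L"
			proof -
				have "exp (- (2 * q)) <= exp 2" using q ep(2) by auto
				then have "exp (- (2 * q)) * \<bar>p'\<bar> <= exp 2 * \<bar>p'\<bar>" by (rule mult_right_mono) simp
				then show ?thesis using p1 ep(2) by (simp add: abs_mult L_def)
			qed
			from integral_convolution_commute[of ep b, OF b0 this, of "%P. m (q' - q, P)"]
			show ?thesis by (simp add: 1 2 in_x1)
		qed
		define G where "G Q = integral {-L..L} (%P. b (exp (- (2 * (q' - Q))) * p' - P) *\<^sub>R m (Q, P))" for Q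
		have "cinner (rp (upp p' ** dia q') e) x = integral {-ep..ep} (%q. b q *\<^sub>R G (q' - q))"
			unfolding in_x G_def
			by (rule Henstock_Kurzweil_Integration.integral_cong) (simp add: inner)
		also have "... = integral {-L..L} (%Q. b (q' - Q) *\<^sub>R G Q)"
			by (rule integral_convolution_commute[OF b0]) (use q1 ep(2) in \<open>auto simp: L_def intro: add_increasing2\<close>)
		also have "... = integral {-L..L} (%Q. integral {-L..L} (%P. b (q' - Q) *\<^sub>R (b (exp (- (2 * (q' - Q))) * p' - P) *\<^sub>R m (Q, P))))"
			by (simp only: G_def integral_cmul)
		finally show ?thesis .
	qed
	\<comment> \<open>The variable y collects the angle, the diagonal and the unipotent variable. The
	  kernel of the last one carries no denominator: \<open>exp (- 2 * iwaq s th)\<close> equals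
	  \<open>iwaR s th\<close> and cancels the one in \<open>iwap\<close>.\<close>
	define F where "F s y = iwaph n s (fst y) * (of_real (b (iwaq s (fst y) - fst (snd y))) *
			(of_real (b (exp (2 * fst (snd y)) * (sinh (2 * s) * sin (2 * fst y)) - snd (snd y))) * m (snd y)))"
		for s :: real and y :: "real \<times> real \<times> real"
	have smF: "smooth2 F"
	proof -
		have sh: "smooth2 (%s (y::real\<times>real\<times>real). sinh (2 * s))"
		proof -
			have "smooth2 (%s (y::real\<times>real\<times>real). (1/2) * exp (2 * s) + - ((1/2) * exp (- (2 * s))))"
				by (intro smooth2_add smooth2_minus smooth2_mult smooth2_exp smooth2_ident smooth2_const continuous_intros)
			then show ?thesis by (simp add: sinh_def field_simps)
		qed
		have 1: "smooth2 (%s (y::real\<times>real\<times>real). b (iwaq s (fst y) - fst (snd y)))"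
			unfolding b_def using smooth2_bump[OF smooth2_add[OF smooth2_iwaq smooth2_const[of "%y. - fst (snd y)"]], of ep]
			by (simp add: continuous_on_minus continuous_on_fst continuous_on_snd continuous_on_id)
		have "smooth2 (%s (y::real\<times>real\<times>real). exp (2 * fst (snd y)) * (sinh (2 * s) * sin (2 * fst y)) + - snd (snd y))"
			by (intro smooth2_add smooth2_mult sh smooth2_const continuous_intros)
		then have 2: "smooth2 (%s (y::real\<times>real\<times>real). b (exp (2 * fst (snd y)) * (sinh (2 * s) * sin (2 * fst y)) - snd (snd y)))"
			unfolding b_def by (intro smooth2_bump) simp
		show ?thesis
			unfolding F_def by (intro smooth2_mult smooth2_iwaph smooth2_of_real 1 2 smooth2_const continuous_intros)
	qed
	obtain F1 F2 where F12: "!!s y. ((%s. F s y) has_vector_derivative F1 s y) (at s)"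
		"!!s y. ((%s. F1 s y) has_vector_derivative F2 s y) (at s)"
		"continuous_on UNIV (%(s, y). F s y)" "continuous_on UNIV (%(s, y). F1 s y)"
		"continuous_on UNIV (%(s, y). F2 s y)" using smF unfolding smooth2_def by blast
	define Box where "Box = cbox (0, -L, -L) (2*pi, L, L)"
	have Fc: "continuous_on S (%y. F s y)" for s S
		using continuous_on_compose2[OF F12(3), of S "%y. (s, y)"] by (simp add: continuous_intros)
	have F1c: "continuous_on S (%y. F1 s y)" for s S
		using continuous_on_compose2[OF F12(4), of S "%y. (s, y)"] by (simp add: continuous_intros)
	have main: "of_real (sph e s) * cinner e x = (1 / (2*pi)) *\<^sub>R integral Box (F s)" if s: "\<bar>s\<bar> < 1" for s
	proof -
		have q: "\<bar>iwaq s th\<bar> <= 1" for th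
		proof -
			have "ln (iwaR s th) <= 2 * \<bar>s\<bar>" "- (2 * \<bar>s\<bar>) <= ln (iwaR s th)"
				using iwaR_bounds[of s th] iwaR_pos[of s th] by (simp_all add: ln_ge_iff ln_le_cancel_iff[of _ "exp _", simplified])
			then show ?thesis using s by (auto simp: iwaq_def)
		qed
		have p: "exp 2 * \<bar>iwap s th\<bar> <= exp 6" for th
		proof -
			have "\<bar>sinh (2 * s)\<bar> <= exp 2"
			proof -
				have gen: "x <= z ==> y <= z ==> 0 < x ==> 0 < y ==> \<bar>(x - y) / 2\<bar> <= z" for x y z :: real
					by (auto simp: abs_le_iff)
				have "sinh (2 * s) = (exp (2 * s) - exp (- (2 * s))) / 2" by (simp add: sinh_def)
				then show ?thesis using s by (simp only:) (rule gen, auto)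
			qed
			then have "\<bar>sinh (2 * s)\<bar> * \<bar>sin (2 * th)\<bar> <= exp 2 * 1" by (intro mult_mono) auto
			moreover have "inverse (iwaR s th) <= exp 2"
			proof -
				have "exp (- 2) <= exp (- (2 * \<bar>s\<bar>))" using s by auto
				also have "... <= iwaR s th" by (rule iwaR_bounds)
				finally have "inverse (iwaR s th) <= inverse (exp (- 2))" by (intro le_imp_inverse_le) auto
				then show ?thesis by (simp add: exp_minus)
			qed
			ultimately have "(\<bar>sinh (2 * s)\<bar> * \<bar>sin (2 * th)\<bar>) * inverse (iwaR s th) <= (exp 2 * 1) * exp 2"
				using iwaR_pos[of s th] by - (rule mult_mono, auto)
			then have "\<bar>iwap s th\<bar> <= exp 2 * exp 2"
				using iwaR_pos[of s th] by (simp add: iwap_def abs_mult divide_inverse)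
			then have "exp 2 * \<bar>iwap s th\<bar> <= exp 2 * (exp 2 * exp 2)" by (rule mult_left_mono) simp
			then show ?thesis by (simp flip: exp_add)
		qed
		have ex: "exp (- (2 * (iwaq s th - Q))) * iwap s th = exp (2 * Q) * (sinh (2 * s) * sin (2 * th))" for th Q
		proof -
			have "exp (- (2 * (iwaq s th - Q))) = exp (2 * Q) * exp (ln (iwaR s th))"
				by (simp add: iwaq_def algebra_simps flip: exp_add)
			also have "exp (ln (iwaR s th)) = iwaR s th" using iwaR_pos by simp
			finally show ?thesis using iwaR_pos[of s th] by (simp add: iwap_def)
		qed
		have "iwaph n s th * cinner (rp (upp (iwap s th) ** dia (iwaq s th)) e) x
				= integral (cbox (-L, -L) (L, L)) (%y. F s (th, y))" for th
		proof -
			have "integral (cbox (-L, -L) (L, L)) (%y. F s (th, y))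
					= integral {-L..L} (%Q. integral {-L..L} (%P. F s (th, Q, P)))"
				using integral_prod_continuous[of "-L" "-L" L L "%y. F s (th, y)"]
					continuous_on_compose2[OF Fc[of UNIV], of "cbox (-L, -L) (L, L)" "%y. (th, y)"]
				by (simp add: continuous_intros)
			also have "... = integral {-L..L} (%Q. integral {-L..L} (%P. iwaph n s th *
					(b (iwaq s th - Q) *\<^sub>R (b (exp (- (2 * (iwaq s th - Q))) * iwap s th - P) *\<^sub>R m (Q, P)))))"
				by (simp only: F_def ex scaleR_conv_of_real fst_conv snd_conv)
			also have "... = iwaph n s th * cinner (rp (upp (iwap s th) ** dia (iwaq s th)) e) x"
				by (simp only: avg[OF q p] integral_mult_right)
			finally show ?thesis ..
		qed
		then have "of_real (sph e s) * cinner e x = (1 / (2*pi)) *\<^sub>R integral {0..2*pi}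
				(%th. integral (cbox (-L, -L) (L, L)) (%y. F s (th, y)))"
			using sph_mean_value[OF e, of s x] by simp
		also have "integral {0..2*pi} (%th. integral (cbox (-L, -L) (L, L)) (%y. F s (th, y))) = integral Box (F s)"
			unfolding Box_def using integral_prod_continuous[of 0 "(-L, -L)" "2*pi" "(L, L)" "F s", OF Fc] by simp
		finally show ?thesis .
	qed
	\<comment> \<open>A double integral of bumps against a coefficient: its real part is nonnegative on
	  the box and strictly positive at the origin.\<close>
	have cx: "Re (cinner x e) > 0"
	proof -
		have ix: "cinner e x = integral {-ep..ep} (%q. b q *\<^sub>R integral {-ep..ep} (%p. b p *\<^sub>R cinner (rp (dia (- q)) e) (rp (upp p) e)))"
			by (simp add: in_x in_x1)
		let ?k = "%y::real\<times>real. b (fst y) *\<^sub>R (b (snd y) *\<^sub>R cinner (rp (dia (- fst y)) e) (rp (upp (snd y)) e))"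
		have kc: "continuous_on S ?k" for S
			by (intro continuous_intros rep_continuous) (auto simp: upp_def dia_def simp flip: exp_add intro!: continuous_intros)
		have "cinner e x = integral (cbox (-ep, -ep) (ep, ep)) ?k"
			unfolding ix using integral_prod_continuous[of "-ep" "-ep" ep ep ?k, OF kc]
			by (simp only: fst_conv snd_conv integral_cmul box_real)
		then have re: "Re (cinner e x) = integral (cbox (-ep, -ep) (ep, ep)) (%y. Re (?k y))"
			using integral_linear[OF integrable_continuous[OF kc] bounded_linear_Re, of "(-ep, -ep)" "(ep, ep)"] by (simp add: o_def)
		have kRe: "Re (?k y) = b (fst y) * (b (snd y) * Re (cinner (rp (dia (fst y) ** upp (snd y)) e) e))" for y
		proof -
			have "cinner (rp (dia (- fst y)) e) (rp (upp (snd y)) e) = cinner e (rp (dia (fst y) ** upp (snd y)) e)"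
				by (simp add: rep_adjoint[of "dia _"] dia_adj rep_mult)
			then show ?thesis using cinner_commute[of e "rp (dia (fst y) ** upp (snd y)) e"] by simp
		qed
		have kpos: "Re (?k y) >= 0" if "y \<in> cbox (-ep, -ep) (ep, ep)" for y
		proof -
			have "dist y (0, 0) <= \<bar>fst y\<bar> + \<bar>snd y\<bar>"
				by (cases y) (simp add: dist_Pair_Pair dist_real_def sqrt_sum_squares_le_sum_abs)
			also have "... < d" using that ep(3) by (cases y) (auto simp: cbox_Pair_eq)
			finally show ?thesis unfolding kRe using d(2) by (intro mult_nonneg_nonneg) (auto simp: b_def bump_nonneg less_imp_le)
		qed
		have k0: "Re (?k (0, 0)) > 0"
			unfolding kRe using d(2)[of "(0,0)"] d(1) bump_pos[OF ep(1)] by (simp add: b_def)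
		have kRc: "continuous_on S (%y. Re (?k y))" for S by (rule continuous_on_Re[OF kc])
		have "(0, 0) \<in> box (-ep, -ep) (ep, ep)" using ep(1) by (auto simp: mem_box Basis_prod_def)
		then have bne: "box (-ep, -ep) (ep, ep) ~= {}" and zin: "(0, 0) \<in> cbox (-ep, -ep) (ep, ep)"
			using box_subset_cbox by blast+
		have "integral (cbox (-ep, -ep) (ep, ep)) (%y. Re (?k y)) ~= 0"
		proof
			assume "integral (cbox (-ep, -ep) (ep, ep)) (%y. Re (?k y)) = 0"
			moreover have "(%y. Re (?k y)) integrable_on cbox (-ep, -ep) (ep, ep)"
				by (rule integrable_continuous[OF kRc])
			ultimately have hi: "((%y. Re (?k y)) has_integral 0) (cbox (-ep, -ep) (ep, ep))"
				unfolding has_integral_iff by (rule conjI[rotated])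
			have "0 <= Re (?k y)" if "y \<in> box (-ep, -ep) (ep, ep)" for y
				using kpos[OF subsetD[OF box_subset_cbox that]] .
			from has_integral_0_cbox_imp_0[OF kRc this hi bne zin] have "Re (?k (0, 0)) = 0" .
			then show False using k0 by linarith
		qed
		moreover have "integral (cbox (-ep, -ep) (ep, ep)) (%y. Re (?k y)) >= 0"
			by (rule Henstock_Kurzweil_Integration.integral_nonneg[OF integrable_continuous[OF kRc] kpos])
		ultimately show ?thesis using re cinner_commute[of x e] by simp
	qed
	define c where "c = 2 * pi * cinner e x"
	have c0: "c ~= 0" using cx cinner_commute[of x e] by (auto simp: c_def)
	\<comment> \<open>Division by the nonzero constant, followed by the real part; being real linear
	  and bounded, it passes through derivatives.\<close>
	define lin where "lin z = Re (z / c)" for z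
	have lin: "bounded_linear lin"
		unfolding lin_def by (intro bounded_linear_compose[OF bounded_linear_Re] bounded_linear_divide)
	have sphF: "sph e s = lin (integral Box (F s))" if "\<bar>s\<bar> < 1" for s
	proof -
		have "cinner e x ~= 0" using c0 by (simp add: c_def)
		then have "complex_of_real (sph e s) = integral Box (F s) / c"
			using main[OF that] by (simp add: c_def scaleR_conv_of_real field_simps)
		then show ?thesis unfolding lin_def by (metis Re_complex_of_real)
	qed
	define \<phi>1 where "\<phi>1 s = lin (integral Box (F1 s))" for s
	define \<phi>2 where "\<phi>2 s = lin (integral Box (F2 s))" for s
	have dF: "((%s. integral Box (F s)) has_vector_derivative integral Box (F1 s)) (at s)" for s
		unfolding Box_def
		by (rule leibniz_rule_vector_derivative[where U = UNIV, simplified])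
			(use F12(1) Fc continuous_on_subset[OF F12(4)] in \<open>auto intro!: integrable_continuous\<close>)
	have dF1: "((%s. integral Box (F1 s)) has_vector_derivative integral Box (F2 s)) (at s)" for s
		unfolding Box_def
		by (rule leibniz_rule_vector_derivative[where U = UNIV, simplified])
			(use F12(2) F1c continuous_on_subset[OF F12(5)] in \<open>auto intro!: integrable_continuous\<close>)
	show ?thesis
	proof
		fix s :: real assume s: "\<bar>s\<bar> < 1"
		have "((%s. lin (integral Box (F s))) has_real_derivative \<phi>1 s) (at s)"
			unfolding has_real_derivative_iff_has_vector_derivative \<phi>1_def
			by (rule bounded_linear.has_vector_derivative[OF lin dF])
		moreover have "\<forall>\<^sub>F s in nhds s. sph e s = lin (integral Box (F s))"
			by (rule eventually_mono[OF eventually_nhds_in_open[of "{-1<..<1}" s]]) (use s sphF in auto)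
		ultimately show "(sph e has_real_derivative \<phi>1 s) (at s)"
			by (subst DERIV_cong_ev[OF refl _ refl])
		show "(\<phi>1 has_real_derivative \<phi>2 s) (at s)"
			unfolding has_real_derivative_iff_has_vector_derivative \<phi>2_def \<phi>1_def[abs_def]
			by (rule bounded_linear.has_vector_derivative[OF lin dF1])
	next
		have "continuous_on UNIV (%s. integral Box (F2 s))"
			unfolding Box_def by (rule integral_continuous_on_param) (rule continuous_on_subset[OF F12(5)], simp)
		then have "continuous_on UNIV \<phi>2"
			unfolding \<phi>2_def by (intro bounded_linear.continuous_on[OF lin])
		then show "isCont \<phi>2 0" by (simp add: continuous_on_eq_continuous_at)
	qed
qed

end

lemma mvt_segment:
	fixes f :: "real => real"
	assumes "!!x. \<bar>x\<bar> < r ==> (f has_real_derivative f' x) (at x)" and "\<bar>a\<bar> < r" "\<bar>b\<bar> < r"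
	shows "\<exists>z. \<bar>z\<bar> <= max \<bar>a\<bar> \<bar>b\<bar> & min a b <= z & z <= max a b & f b - f a = (b - a) * f' z"
proof -
	consider "a < b" | "a = b" | "b < a" by linarith
	then show ?thesis
	proof cases
		case 1
		then obtain z where "a < z" "z < b" "f b - f a = (b - a) * f' z"
			using MVT2[of a b f f'] assms by auto
		then show ?thesis by (intro exI[of _ z]) auto
	next
		case 3
		then obtain z where "b < z" "z < a" "f a - f b = (a - b) * f' z"
			using MVT2[of b a f f'] assms by auto
		then show ?thesis by (intro exI[of _ z]) (auto simp: algebra_simps)
	qed auto
qed

lemma Cauchy_at_0_has_limit:
	fixes q :: "real => 'a::banach"
	assumes ex: "!!e. e > 0 ==> \<exists>d>0. \<forall>t s. t ~= 0 & s ~= 0 & \<bar>t\<bar> < d & \<bar>s\<bar> < d --> norm (q t - q s) < e"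
	obtains h where "(q \<longlongrightarrow> h) (at 0)"
proof -
	define x where "x k = q (inverse (real (Suc k)))" for k
	have "Cauchy x"
	proof (rule CauchyI)
		fix e :: real assume "e > 0"
		from ex[OF this] obtain d where d0: "d > 0" and d1: "\<forall>t s. t ~= 0 & s ~= 0 & \<bar>t\<bar> < d & \<bar>s\<bar> < d --> norm (q t - q s) < e"
			by (elim exE conjE)
		have d: "d > 0" "!!t s. t ~= 0 ==> s ~= 0 ==> \<bar>t\<bar> < d ==> \<bar>s\<bar> < d ==> norm (q t - q s) < e"
			using d0 d1 by simp_all
		obtain M where M: "inverse (real (Suc M)) < d" using reals_Archimedean[OF d(1)] by auto
		have "inverse (real (Suc m)) < d" if "m >= M" for m
			by (rule le_less_trans[OF le_imp_inverse_le M]) (use that in auto)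
		then show "\<exists>M. \<forall>m\<ge>M. \<forall>n\<ge>M. norm (x m - x n) < e"
			by (intro exI[of _ M]) (auto simp: x_def intro!: d(2))
	qed
	then obtain h where h: "x \<longlonglongrightarrow> h" by (meson Cauchy_convergent convergent_def)
	have "(q \<longlongrightarrow> h) (at 0)"
	proof (rule tendstoI)
		fix e :: real assume "e > 0"
		then have "e/2 > 0" by simp
		from ex[OF this] obtain d where d0: "d > 0" and d1: "\<forall>t s. t ~= 0 & s ~= 0 & \<bar>t\<bar> < d & \<bar>s\<bar> < d --> norm (q t - q s) < e/2"
			by (elim exE conjE)
		have d: "d > 0" "!!t s. t ~= 0 ==> s ~= 0 ==> \<bar>t\<bar> < d ==> \<bar>s\<bar> < d ==> norm (q t - q s) < e/2"
			using d0 d1 by simp_all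
		have "\<forall>\<^sub>F k in sequentially. norm (x k - h) < e/2"
			using tendstoD[OF h, of "e/2"] \<open>e > 0\<close> by (simp add: dist_norm)
		moreover have "\<forall>\<^sub>F k in sequentially. inverse (real (Suc k)) < d"
			using order_tendstoD(2)[OF LIMSEQ_inverse_real_of_nat d(1)] .
		ultimately have "\<forall>\<^sub>F k in sequentially. norm (x k - h) < e/2 & inverse (real (Suc k)) < d"
			by eventually_elim simp
		then obtain k where k: "norm (x k - h) < e/2" "inverse (real (Suc k)) < d"
			using eventually_happens by fastforce
		have "dist (q t) h < e" if "t ~= 0" "\<bar>t\<bar> < d" for t
		proof -
			have "norm (q t - x k) < e/2" unfolding x_def using d(2) that k(2) by auto
			then show ?thesis using k(1) norm_triangle_ineq[of "q t - x k" "x k - h"] by (simp add: dist_norm)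
		qed
		then show "\<forall>\<^sub>F t in at 0. dist (q t) h < e"
			unfolding eventually_at using d(1) by (auto simp: dist_real_def)
	qed
	then show ?thesis by (rule that)
qed

text \<open>Witnesses: pi/2 for k = 0, pi for odd k, and pi/|k| for |k| >= 4, where the left side is
  -1 while the double angle is still at most pi/2.\<close>

lemma cos_mult_neq_cos_double:
	fixes k :: int
	assumes "k ~= 2" "k ~= -2"
	obtains th :: real where "cos (of_int k * th) ~= cos (2 * th)"
proof -
	have "k = 0 \<or> odd k \<or> \<bar>k\<bar> >= 4" using assms by presburger
	then consider "k = 0" | "odd k" | "\<bar>k\<bar> >= 4" by blast
	then show ?thesis
	proof cases
		case 1
		then show ?thesis using that[of "pi/2"] by simp
	next
		case 2
		then have "cos (of_int k * pi) = -1" using cos_npi_int[of k] by (simp add: mult.commute)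
		then show ?thesis using that[of pi] by simp
	next
		case 3
		define j where "j = real_of_int \<bar>k\<bar>"
		have j: "j >= 4" using 3 by (simp add: j_def)
		have "cos (of_int k * (pi / j)) = -1"
		proof -
			have "of_int k * (pi / j) = pi \<or> of_int k * (pi / j) = - pi"
				using 3 by (auto simp: j_def abs_if field_simps)
			then show ?thesis by auto
		qed
		moreover have "cos (2 * (pi / j)) >= 0"
		proof (rule cos_ge_zero)
			have "0 <= 2 * (pi / j)" using j by simp
			then show "- (pi / 2) <= 2 * (pi / j)" using pi_gt_zero by linarith
			show "2 * (pi / j) <= pi / 2" using j by (simp add: field_simps)
		qed
		ultimately show ?thesis using that[of "pi / j"] by auto
	qed
qed

context irrep
begin

text \<open>The inner product of two difference quotients is a mixed second difference of
  \<open>sph e\<close>, so by two mean value steps it is a value of minus its second derivative near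
  0. As all entries of the Gram matrix have the same limit, the quotients are Cauchy.\<close>

lemma dia_differentiable_unit:
	assumes e: "e \<in> wt n" "norm e = 1"
	obtains h where "((%t. rp (dia t) e) has_vector_derivative h) (at 0)"
proof -
	obtain \<phi>1 \<phi>2 where d1: "!!s. \<bar>s\<bar> < 1 ==> (sph e has_real_derivative \<phi>1 s) (at s)"
		and d2: "!!s. \<bar>s\<bar> < 1 ==> (\<phi>1 has_real_derivative \<phi>2 s) (at s)" and c2: "isCont \<phi>2 0"
		using sph_smooth[OF e] by blast
	define q where "q t = (1/t) *\<^sub>R (rp (dia t) e - e)" for t
	have inner: "\<exists>et. \<bar>et\<bar> <= \<bar>t\<bar> + \<bar>s\<bar> & Re (cinner (q t) (q s)) = - \<phi>2 et"
		if ts: "t ~= 0" "s ~= 0" "\<bar>t\<bar> < 1/2" "\<bar>s\<bar> < 1/2" for t s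
	proof -
		have neg: "sph e (- s) = sph e s" for s
			using rep_adjoint[of "dia s" e e] cinner_commute[of "rp (dia (- s)) e" e]
			by (simp add: sph_def dia_adj)
		have "cinner (rp (dia t) e) (rp (dia s) e) = cinner (rp (dia (t - s)) e) e"
			using rep_adjoint[of "dia (-s)" "rp (dia t) e" e] rep_mult[of "dia (- s)" "dia t" e]
			by (simp add: dia_adj dia_mult)
		then have 1: "Re (cinner (rp (dia t) e - e) (rp (dia s) e - e)) = sph e (t - s) - sph e t - sph e s + 1"
			using e cinner_commute[of e "rp (dia s) e"]
			by (simp add: cinner_diff_left cinner_diff_right sph_def cinner_norm)
		\<comment> \<open>\<open>sph e\<close> is even with value 1 at 0, so \<open>g t - g 0\<close> is
		  precisely the combination found above.\<close>
		define g where "g x = sph e (x - s) - sph e x" for x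
		have dg: "(g has_real_derivative (\<phi>1 (x - s) - \<phi>1 x)) (at x)" if "\<bar>x\<bar> < 1/2" for x
			unfolding g_def
			using DERIV_diff[OF DERIV_shift[THEN iffD1, of "sph e" "\<phi>1 (x - s)" x "-s"] d1[of x]] d1[of "x - s"] that ts
			by simp
		obtain z where z: "\<bar>z\<bar> <= max \<bar>0\<bar> \<bar>t\<bar>" "g t - g 0 = (t - 0) * (\<phi>1 (z - s) - \<phi>1 z)"
			using mvt_segment[of "1/2" g _ 0 t, OF dg] ts by auto
		have zt: "\<bar>z\<bar> <= \<bar>t\<bar>" using z(1) by simp
		obtain w where w: "\<bar>w\<bar> <= max \<bar>z\<bar> \<bar>z - s\<bar>" "\<phi>1 (z - s) - \<phi>1 z = ((z - s) - z) * \<phi>2 w"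
		proof -
			have "\<bar>z\<bar> < 1" "\<bar>z - s\<bar> < 1" using zt ts by linarith+
			from mvt_segment[of 1 \<phi>1 \<phi>2 z "z - s", OF d2 this] show ?thesis using that by blast
		qed
		have "sph e 0 = 1" using e by (simp add: sph_def dia_0 cinner_norm)
		then have "Re (cinner (rp (dia t) e - e) (rp (dia s) e - e)) = - (t * s * \<phi>2 w)"
			unfolding 1 using z(2) w(2) neg[of s] by (simp add: g_def)
		then have "Re (cinner (q t) (q s)) = - \<phi>2 w"
			using ts by (simp add: q_def cinner_scaleR_left cinner_scaleR_right)
		then show ?thesis using w(1) zt by (intro exI[of _ w]) auto
	qed
	have "\<exists>d>0. \<forall>t s. t ~= 0 & s ~= 0 & \<bar>t\<bar> < d & \<bar>s\<bar> < d --> norm (q t - q s) < ep" if ep: "ep > 0" for ep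
	proof -
		\<comment> \<open>The squared distance combines three second derivatives with weights -1, 2, -1;
		  replacing each by its value at 0 costs at most 4 dl < 5 dl.\<close>
		define dl where "dl = ep\<^sup>2 / 5"
		have "dl > 0" using ep by (simp add: dl_def)
		then obtain r where r: "r > 0" "!!x. \<bar>x\<bar> < r ==> \<bar>\<phi>2 x - \<phi>2 0\<bar> < dl"
			using c2 unfolding continuous_at_eps_delta by (force simp: dist_real_def)
		show ?thesis
		\<comment> \<open>The bound 1/2 keeps the mean value points inside the unit interval where
		  \<open>sph e\<close> is differentiable; r/2 keeps |t| + |s| below r.\<close>
		proof (intro exI[of _ "min (1/2) (r/2)"] conjI allI impI)
			show "0 < min (1/2) (r/2)" using r(1) by simp
			fix t s assume "t ~= 0 & s ~= 0 & \<bar>t\<bar> < min (1/2) (r/2) & \<bar>s\<bar> < min (1/2) (r/2)"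
			then have ts: "t ~= 0" "s ~= 0" "\<bar>t\<bar> < 1/2" "\<bar>s\<bar> < 1/2" "\<bar>t\<bar> < r/2" "\<bar>s\<bar> < r/2" by auto
			obtain a where a: "\<bar>a\<bar> <= \<bar>t\<bar> + \<bar>t\<bar>" "Re (cinner (q t) (q t)) = - \<phi>2 a" using inner[of t t] ts by auto
			obtain b where b: "\<bar>b\<bar> <= \<bar>t\<bar> + \<bar>s\<bar>" "Re (cinner (q t) (q s)) = - \<phi>2 b" using inner[of t s] ts by auto
			obtain c where c: "\<bar>c\<bar> <= \<bar>s\<bar> + \<bar>s\<bar>" "Re (cinner (q s) (q s)) = - \<phi>2 c" using inner[of s s] ts by auto
			have "\<bar>a\<bar> < r" "\<bar>b\<bar> < r" "\<bar>c\<bar> < r" using a(1) b(1) c(1) ts by auto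
			then have "\<bar>\<phi>2 a - \<phi>2 0\<bar> < dl" "\<bar>\<phi>2 b - \<phi>2 0\<bar> < dl" "\<bar>\<phi>2 c - \<phi>2 0\<bar> < dl" using r(2) by auto
			moreover have "(norm (q t - q s))\<^sup>2 = - \<phi>2 a + 2 * \<phi>2 b - \<phi>2 c"
			proof -
				have "(norm (q t - q s))\<^sup>2 = Re (cinner (q t - q s) (q t - q s))" by (simp add: cinner_norm)
				also have "... = Re (cinner (q t) (q t)) - 2 * Re (cinner (q t) (q s)) + Re (cinner (q s) (q s))"
					using cinner_commute[of "q s" "q t"] by (simp add: cinner_diff_left cinner_diff_right)
				finally show ?thesis using a(2) b(2) c(2) by simp
			qed
			ultimately have "(norm (q t - q s))\<^sup>2 < 5 * dl" by linarith
			then have "(norm (q t - q s))\<^sup>2 < ep\<^sup>2" by (simp add: dl_def)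
			then show "norm (q t - q s) < ep" using ep by (simp add: power_less_imp_less_base)
		qed
	qed
	then obtain h where h: "(q \<longlongrightarrow> h) (at 0)" using Cauchy_at_0_has_limit[of q] by blast
	have "((%t. rp (dia t) e) has_vector_derivative h) (at 0)"
		unfolding has_vector_derivative_def has_derivative_at
	proof (intro conjI bounded_linear_scaleR_left)
		have "((%t. norm (q t - h)) \<longlongrightarrow> 0) (at 0)" using h by (simp add: LIM_zero tendsto_norm_zero)
		moreover have "norm (rp (dia (0 + t)) e - rp (dia 0) e - t *\<^sub>R h) / norm t = norm (q t - h)" if "t ~= 0" for t
		proof -
			have "q t - h = (1/t) *\<^sub>R (rp (dia t) e - e - t *\<^sub>R h)" using that by (simp add: q_def scaleR_diff_right)
			then show ?thesis by (simp add: dia_0)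
		qed
		ultimately show "((%t. norm (rp (dia (0 + t)) e - rp (dia 0) e - t *\<^sub>R h) / norm t) \<longlongrightarrow> 0) (at 0)"
			by (subst tendsto_cong[where g = "%t. norm (q t - h)"]) (auto simp: eventually_at_filter)
	qed
	then show ?thesis by (rule that)
qed

lemma wt_scaleR: "x \<in> wt n ==> r *\<^sub>R x \<in> wt n"
	using wt_scaleC[of x n "of_real r"] by (simp add: scaleC_of_real)

text \<open>The derived action of diag(1,-1). All further Lie algebra elements are reached by
  rotating it.\<close>

definition Hop :: "'h => 'h" where
	"Hop x = vector_derivative (%t. rp (dia t) x) (at 0)"

lemma Hop_deriv_0:
	assumes x: "x \<in> wt n"
	shows "((%t. rp (dia t) x) has_vector_derivative Hop x) (at 0)"
proof (cases "x = 0")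
	case True
	then show ?thesis by (simp add: Hop_def)
next
	case False
	define e where "e = (1 / norm x) *\<^sub>R x"
	have e: "e \<in> wt n" "norm e = 1"
		using False wt_scaleR[OF x] by (simp_all add: e_def)
	have xe: "x = norm x *\<^sub>R e" using False by (simp add: e_def)
	obtain h where "((%t. rp (dia t) e) has_vector_derivative h) (at 0)" by (rule dia_differentiable_unit[OF e])
	then have "((%t. norm x *\<^sub>R rp (dia t) e) has_vector_derivative norm x *\<^sub>R h) (at 0)"
		by (rule bounded_linear.has_vector_derivative[OF bounded_linear_scaleR_right])
	moreover have "norm x *\<^sub>R rp (dia t) e = rp (dia t) x" for t
		using rep_scaleC[of "dia t" "of_real (norm x)" e] xe by (simp add: scaleC_of_real)
	ultimately have D: "((%t. rp (dia t) x) has_vector_derivative norm x *\<^sub>R h) (at 0)" by simp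
	show ?thesis unfolding Hop_def vector_derivative_at[OF D] by (rule D)
qed

lemma Hop_deriv:
	assumes x: "x \<in> wt n"
	shows "((%t. rp (dia t) x) has_vector_derivative rp (dia t) (Hop x)) (at t)"
proof -
	have "((%s. rp (dia t) (rp (dia s) x)) has_vector_derivative rp (dia t) (Hop x)) (at 0)"
		by (rule bounded_linear.has_vector_derivative[OF rep_bounded_linear Hop_deriv_0[OF x]]) simp
	then have "((%s. rp (dia (s + t)) x) has_vector_derivative rp (dia t) (Hop x)) (at 0)"
		by (simp add: dia_mult add.commute flip: rep_mult)
	moreover have "((%s. s - t) has_vector_derivative 1) (at t)"
		by (auto intro!: derivative_eq_intros)
	ultimately show ?thesis
		using vector_diff_chain_at[of "%s. s - t" 1 t "%s. rp (dia (s + t)) x" "rp (dia t) (Hop x)"]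
		by (simp add: o_def)
qed

lemma Hop_scaleC: "x \<in> wt n ==> Hop (c *% x) = c *% Hop x"
	using bounded_linear.has_vector_derivative[OF bounded_linear_scaleC_right[of c] Hop_deriv_0[of x n]]
	unfolding Hop_def[of "c *% x"] by (simp add: rep_scaleC vector_derivative_at)

lemma Hop_skew:
	assumes "x \<in> wt n" "y \<in> wt m"
	shows "cinner (Hop x) y = - cinner x (Hop y)"
proof -
	have 1: "((%t. cinner (rp (dia t) x) y) has_vector_derivative cinner (Hop x) y) (at 0)"
		by (rule bounded_linear.has_vector_derivative[OF bounded_linear_cinner_left Hop_deriv_0[OF assms(1)]])
	have "((%t. rp (dia (- t)) y) has_vector_derivative (- 1) *\<^sub>R Hop y) (at 0)"
		using vector_diff_chain_at[of uminus "- 1" 0 "%t. rp (dia t) y" "Hop y"] Hop_deriv_0[OF assms(2)]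
		by (simp add: o_def has_vector_derivative_minus[OF has_vector_derivative_id])
	from bounded_linear.has_vector_derivative[OF bounded_linear_cinner_right[of x] this]
	have "((%t. cinner (rp (dia t) x) y) has_vector_derivative - cinner x (Hop y)) (at 0)"
		by (simp add: rep_adjoint dia_adj cinner_scaleR_right)
	with 1 show ?thesis by (rule vector_derivative_unique_at)
qed

lemma dia_lipschitz:
	assumes x: "x \<in> wt n"
	shows "norm (rp (dia t) x - x) <= norm (Hop x) * \<bar>t\<bar>"
proof -
	have "norm (rp (dia t) x - rp (dia 0) x) <= norm (Hop x) * norm (t - 0)"
	proof (rule differentiable_bound[where S = UNIV and f' = "%t h. h *\<^sub>R rp (dia t) (Hop x)"])
		show "((%t. rp (dia t) x) has_derivative (%h. h *\<^sub>R rp (dia t) (Hop x))) (at t within UNIV)" for t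
			using Hop_deriv[OF x, of t] by (simp add: has_vector_derivative_def)
		show "onorm (%h. h *\<^sub>R rp (dia t) (Hop x)) <= norm (Hop x)" for t
			by (rule onorm_le) (simp add: mult.commute)
	qed auto
	then show ?thesis by (simp add: dia_0)
qed

lemma norm_cis_power_diff: "norm (cis (of_int n * a) - 1) <= \<bar>of_int n\<bar> * norm (cis a - 1)"
proof -
	have nat: "norm (cis (real k * a) - 1) <= real k * norm (cis a - 1)" for k a
	proof (induct k)
		case (Suc k)
		have "cis (real (Suc k) * a) - 1 = cis a * (cis (real k * a) - 1) + (cis a - 1)"
			by (simp add: algebra_simps cis_mult)
		also have "norm ... <= norm (cis (real k * a) - 1) + norm (cis a - 1)"
			by (rule order_trans[OF norm_triangle_ineq]) (simp add: norm_mult)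
		finally show ?case using Suc by (simp add: algebra_simps)
	qed simp
	show ?thesis
	proof (cases "n >= 0")
		case True
		then show ?thesis using nat[of "nat n" a] by simp
	next
		case False
		have "norm (cis (- a) - 1) = norm (cnj (cis a - 1))" by (simp add: cis_cnj)
		then have "norm (cis (- a) - 1) = norm (cis a - 1)" by (simp only: complex_mod_cnj)
		then show ?thesis using nat[of "nat (- n)" "- a"] False by simp
	qed
qed

text \<open>A Lipschitz estimate in all directions out of differentiability in one: by the Cartan
  decomposition the A-part is controlled by |sinh t| = |\<open>cayB\<close>| and the total angle by
  the deviation of \<open>cayA\<close> from 1. It lets curves that agree to first order be
  compared.\<close>

lemma rep_lipschitz:
	assumes x: "x \<in> wt n" and g: "g \<in> SL2R"
	shows "norm (rp g x - x) <= norm (Hop x) * norm (cayB (complexify g))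
		+ 2 * \<bar>of_int n\<bar> * norm x * norm (cayA (complexify g) - 1)"
proof -
	obtain al t bt where gd: "g = rot al ** dia t ** rot bt" and "t >= 0" using KAK[OF g] by metis
	have t: "\<bar>t\<bar> <= norm (cayB (complexify g))"
	proof -
		have "t <= sinh t" using real_le_x_sinh[OF \<open>t >= 0\<close>] by (simp add: sinh_def exp_minus)
		then show ?thesis unfolding gd cay_rot_dia_rot using \<open>t >= 0\<close> by (simp add: norm_mult)
	qed
	define \<phi> where "\<phi> = - (al + bt)"
	define z where "z = cayA (complexify g)"
	have z: "z = cis \<phi> * of_real (cosh t)" unfolding z_def gd cay_rot_dia_rot \<phi>_def ..
	have nz: "norm z = cosh t" by (simp add: z norm_mult)
	\<comment> \<open>Enlarging by cosh t and splitting off z - 1 leaves cosh t - 1 = |z| - 1, which is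
	  again at most |z - 1|; hence the factor 2.\<close>
	have "norm (cis \<phi> - 1) <= 2 * norm (z - 1)"
	proof -
		have c1: "cosh t >= 1" by (rule cosh_real_ge_1)
		have "norm (cis \<phi> - 1) <= cosh t * norm (cis \<phi> - 1)" using c1 by (simp add: mult_le_cancel_right1)
		also have "... = norm (of_real (cosh t) * (cis \<phi> - 1))" by (simp add: norm_mult)
		also have "of_real (cosh t) * (cis \<phi> - 1) = (z - 1) - of_real (cosh t - 1)"
			by (simp add: z algebra_simps)
		also have "norm ... <= norm (z - 1) + (cosh t - 1)"
			using norm_triangle_ineq4[of "z - 1" "of_real (cosh t - 1)"] c1 by (simp del: of_real_diff)
		also have "cosh t - 1 <= norm (z - 1)"
			using norm_triangle_ineq2[of z 1] nz by simp
		finally show ?thesis by simp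
	qed
	then have ph: "norm (cis (of_int n * \<phi>) - 1) <= \<bar>of_int n\<bar> * (2 * norm (z - 1))"
		using order_trans[OF norm_cis_power_diff[of n \<phi>] mult_left_mono[OF _ abs_ge_zero]] by blast
	have "rp g x = cis (- of_int n * bt) *% rp (rot al) (rp (dia t) x)"
		unfolding gd using x by (simp add: rep_mult SL2R_mult wtD rep_scaleC)
	also have "... - x = cis (- of_int n * bt) *% rp (rot al) (rp (dia t) x - x) + (cis (of_int n * \<phi>) - 1) *% x"
		using wtD[OF x, of al]
		by (simp add: rep_diff scaleC_diff_right scaleC_scaleC cis_mult \<phi>_def algebra_simps
				complex_vector.scale_left_diff_distrib)
	also have "norm ... <= norm (rp (dia t) x - x) + norm (cis (of_int n * \<phi>) - 1) * norm x"
		by (rule order_trans[OF norm_triangle_ineq]) simp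
	also have "norm (rp (dia t) x - x) <= norm (Hop x) * norm (cayB (complexify g))"
		using dia_lipschitz[OF x, of t] mult_left_mono[OF t, of "norm (Hop x)"] by simp
	also have "norm (cis (of_int n * \<phi>) - 1) * norm x <= (\<bar>of_int n\<bar> * (2 * norm (z - 1))) * norm x"
		by (rule mult_right_mono[OF ph]) simp
	finally show ?thesis by (simp add: z_def algebra_simps)
qed

end

lemma has_vector_derivative_iff_quotient:
	fixes f :: "real => 'a::real_normed_vector"
	shows "(f has_vector_derivative d) (at 0) \<longleftrightarrow> ((%t. (1/t) *\<^sub>R (f t - f 0)) \<longlongrightarrow> d) (at 0)"
proof -
	have eq: "norm (f (0 + t) - f 0 - t *\<^sub>R d) / norm t = norm ((1/t) *\<^sub>R (f t - f 0) - d)" if "t ~= 0" for t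
	proof -
		have "(1/t) *\<^sub>R (f t - f 0) - d = (1/t) *\<^sub>R (f t - f 0 - t *\<^sub>R d)"
			using that by (simp add: scaleR_diff_right)
		then show ?thesis by simp
	qed
	have "((%t. norm (f (0 + t) - f 0 - t *\<^sub>R d) / norm t) \<longlongrightarrow> 0) (at 0)
			\<longleftrightarrow> ((%t. norm ((1/t) *\<^sub>R (f t - f 0) - d)) \<longlongrightarrow> 0) (at 0)"
		using eq by (intro tendsto_cong) (simp add: eventually_at_filter)
	then show ?thesis
		by (simp add: has_vector_derivative_def has_derivative_at bounded_linear_scaleR_left
				tendsto_norm_zero_iff LIM_zero_iff)
qed

lemma tendsto_div_0_of_DERIV_0:
	assumes "(r has_real_derivative 0) (at 0)" "r 0 = 0"
	shows "((%t. r t / t) \<longlongrightarrow> 0) (at (0::real))"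
	using assms by (simp add: DERIV_def)

lemma cis_arctan: "Re z > 0 ==> z = of_real (norm z) * cis (arctan (Im z / Re z))"
proof -
	assume z: "Re z > 0"
	have s: "sqrt (1 + (Im z / Re z)\<^sup>2) = norm z / Re z"
	proof -
		have "1 + (Im z / Re z)\<^sup>2 = ((Re z)\<^sup>2 + (Im z)\<^sup>2) / (Re z)\<^sup>2"
			using z by (simp add: field_simps)
		then show ?thesis using z by (simp add: cmod_def real_sqrt_divide)
	qed
	have "norm z > 0" using z by auto
	then show ?thesis using z
		by (simp add: complex_eq_iff cos_arctan sin_arctan s)
qed

lemma tendsto_sin_arctan_tanh_sq:
	"((%t. sin (c * arctan ((sinh t)\<^sup>2 / (cosh t)\<^sup>2)) / t\<^sup>2) \<longlongrightarrow> c) (at_right (0::real))"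
proof -
	consider "c = 0" | "c > 0" | "c < 0" by linarith
	then show ?thesis
	proof cases
		case 1 then show ?thesis by simp
	next
		case 2 then show ?thesis by real_asymp
	next
		case 3 then show ?thesis by real_asymp
	qed
qed

section \<open>Raising and lowering operators\<close>

context irrep
begin

lemma proj_rot: "proj m (rp (rot th) x) = cis (- of_int m * th) *% proj m x"
proof (rule cinner_eqI)
	fix z
	have "cinner (proj m (rp (rot th) x)) z = cinner (rp (rot th) x) (proj m z)" by (rule cinner_proj_proj)
	also have "... = cis (- of_int m * th) * cinner x (proj m z)"
		by (simp add: rep_adjoint rot_adj wtD[OF proj_in_wt] cinner_scaleC_right cis_cnj)
	finally show "cinner (proj m (rp (rot th) x)) z = cinner (cis (- of_int m * th) *% proj m x) z"
		by (simp add: cinner_scaleC_left cinner_proj_proj)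
qed

text \<open>The one-parameter group generated by diag(1,-1) turned by the angle 2 th within the
  trace-free symmetric matrices.\<close>

definition cdia :: "real => real => real^2^2" where
	"cdia th t = rot th ** dia t ** rot (- th)"

lemma cdia_SL2R [simp]: "cdia th t \<in> SL2R"
	by (simp add: cdia_def SL2R_mult)

lemma cdia_0 [simp]: "cdia th 0 = mat 1"
	by (simp add: cdia_def dia_0 rot_mult rot_0)

lemma cdia_wt: "x \<in> wt n ==> rp (cdia th t) x = cis (of_int n * th) *% rp (rot th) (rp (dia t) x)"
	by (simp add: cdia_def rep_mult SL2R_mult wtD rep_scaleC)

lemma cdia_deriv:
	assumes x: "x \<in> wt n"
	shows "((%t. rp (cdia th t) x) has_vector_derivative cis (of_int n * th) *% rp (rot th) (Hop x)) (at 0)"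
	unfolding cdia_wt[OF x]
	by (intro bounded_linear.has_vector_derivative[OF bounded_linear_scaleC_right]
			bounded_linear.has_vector_derivative[OF rep_bounded_linear] Hop_deriv_0[OF x]) simp

lemma continuous_cdia: "continuous_on S (%t. rp (cdia th t) x)"
proof (rule rep_continuous)
	show "continuous_on S (cdia th)"
		unfolding cdia_def rot_def dia_def by (simp, intro continuous_intros)
qed auto

text \<open>A product rule at the identity. The cross term tends to its limit because the operators
  are isometries and strongly continuous, so the derivatives at a single vector suffice.\<close>

lemma rep_mult_deriv:
	assumes d1: "((%t. rp (a t) x) has_vector_derivative d1) (at 0)"
		and d2: "((%t. rp (b t) x) has_vector_derivative d2) (at 0)"
		and SL: "!!t. a t \<in> SL2R" and one: "a 0 = mat 1" "b 0 = mat 1"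
		and cont: "!!y. isCont (%t. rp (a t) y) 0"
	shows "((%t. rp (a t) (rp (b t) x)) has_vector_derivative d1 + d2) (at 0)"
proof -
	define q1 where "q1 t = (1/t) *\<^sub>R (rp (a t) x - x)" for t
	define q2 where "q2 t = (1/t) *\<^sub>R (rp (b t) x - x)" for t
	have l1: "(q1 \<longlongrightarrow> d1) (at 0)" and l2: "(q2 \<longlongrightarrow> d2) (at 0)"
		using d1 d2 by (simp_all add: has_vector_derivative_iff_quotient one q1_def[abs_def] q2_def[abs_def])
	have "((%t. rp (a t) (q2 t - d2)) \<longlongrightarrow> 0) (at 0)"
		by (rule Lim_null_comparison[OF _ tendsto_norm_zero[OF LIM_zero[OF l2]]]) (simp add: SL)
	moreover have "((%t. rp (a t) d2) \<longlongrightarrow> d2) (at 0)"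
		using cont[of d2] by (simp add: isCont_def one)
	ultimately have "((%t. rp (a t) (q2 t - d2) + rp (a t) d2) \<longlongrightarrow> 0 + d2) (at 0)"
		by (rule tendsto_add)
	then have "((%t. rp (a t) (q2 t)) \<longlongrightarrow> d2) (at 0)" by (simp add: rep_diff SL)
	from tendsto_add[OF l1 this] have "((%t. q1 t + rp (a t) (q2 t)) \<longlongrightarrow> d1 + d2) (at 0)" .
	moreover have "q1 t + rp (a t) (q2 t) = (1/t) *\<^sub>R (rp (a t) (rp (b t) x) - rp (a 0) (rp (b 0) x))" for t
		using linear_scale[OF bounded_linear.linear[OF rep_bounded_linear[OF SL[of t]]]]
		by (simp add: q1_def q2_def one rep_diff SL scaleR_diff_right)
	ultimately show ?thesis by (simp add: has_vector_derivative_iff_quotient)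
qed

text \<open>The generators at angles th and -th add up to 2 cos(2 th) times the diagonal one. The
  four brackets are the Cayley entries of the quotient of the two curves, compared with the
  identity; each vanishes to second order in t.\<close>

lemma cdia_product_lipschitz:
	fixes th :: real
	assumes x: "x \<in> wt n"
	defines "c \<equiv> cos (2 * th)"
	shows "norm (rp (cdia th t) (rp (cdia (- th) t) x) - rp (dia (2 * c * t)) x)
		<= (norm (Hop x) + 2 * \<bar>of_int n\<bar> * norm x) *
			 (\<bar>(cosh t)\<^sup>2 * cosh (2*c*t) - 1 - c * sinh (2*t) * sinh (2*c*t)\<bar> + \<bar>(sinh t)\<^sup>2 * cosh (2*c*t)\<bar>
			+ \<bar>(cosh t)\<^sup>2 * sinh (2*c*t) - c * sinh (2*t) * cosh (2*c*t)\<bar> + \<bar>(sinh t)\<^sup>2 * sinh (2*c*t)\<bar>)"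
		(is "_ <= ?K * (\<bar>?r1\<bar> + \<bar>?r2\<bar> + \<bar>?r3\<bar> + \<bar>?r4\<bar>)")
proof -
	define g where "g = dia (- (2 * c * t)) ** (cdia th t ** cdia (- th) t)"
	have g: "g \<in> SL2R" by (simp add: g_def SL2R_mult)
	define k where "k = cis (- 4 * th)"
	have cA: "cayA (complexify (cdia \<phi> t)) = of_real (cosh t)" "cayB (complexify (cdia \<phi> t)) = - cis (2 * \<phi>) * of_real (sinh t)"
		"cayC (complexify (cdia \<phi> t)) = - cis (- (2 * \<phi>)) * of_real (sinh t)" "cayD (complexify (cdia \<phi> t)) = of_real (cosh t)" for \<phi>
		using cay_rot_dia_rot[of \<phi> t "- \<phi>"] by (simp_all add: cdia_def cay_complexify cis_cnj)
	have c2: "cis (2 * th) + cis (- (2 * th)) = of_real (2 * c)"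
		by (simp add: complex_eq_iff c_def)
	have kk: "cis (- (2 * th)) * cis (- (2 * th)) = k"
		by (simp add: cis_mult k_def)
	have pA: "cayA (complexify (cdia th t ** cdia (- th) t)) = of_real ((cosh t)\<^sup>2) + k * of_real ((sinh t)\<^sup>2)"
		unfolding complexify_mult cay_mult cA kk[symmetric] by (simp add: power2_eq_square)
	have pB: "cayB (complexify (cdia th t ** cdia (- th) t)) = - of_real (c * sinh (2 * t))"
	proof -
		have "cayB (complexify (cdia th t ** cdia (- th) t))
				= - (cis (2 * th) + cis (- (2 * th))) * of_real (sinh t * cosh t)"
			unfolding complexify_mult cay_mult cA by (simp add: algebra_simps)
		then show ?thesis unfolding c2 by (simp add: sinh_double)
	qed
	have gA: "cayA (complexify g) - 1 = of_real ?r1 + k * of_real ?r2"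
		unfolding g_def complexify_mult[of "dia _"] cay_mult pA pB cay_dia by (simp add: algebra_simps)
	have gB: "cayB (complexify g) = of_real ?r3 + k * of_real ?r4"
		unfolding g_def complexify_mult[of "dia _"] cay_mult pA pB cay_dia by (simp add: algebra_simps)
	have nA: "norm (cayA (complexify g) - 1) <= \<bar>?r1\<bar> + \<bar>?r2\<bar>"
		unfolding gA by (rule order_trans[OF norm_triangle_ineq]) (simp add: norm_mult k_def del: of_real_diff of_real_mult of_real_power)
	have nB: "norm (cayB (complexify g)) <= \<bar>?r3\<bar> + \<bar>?r4\<bar>"
		unfolding gB by (rule order_trans[OF norm_triangle_ineq]) (simp add: norm_mult k_def del: of_real_diff of_real_mult of_real_power)
	have "rp g x = rp (dia (- (2 * c * t))) (rp (cdia th t) (rp (cdia (- th) t) x))"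
		by (simp add: g_def rep_mult SL2R_mult)
	then have "rp (dia (2 * c * t)) (rp g x) = rp (cdia th t) (rp (cdia (- th) t) x)"
		by (simp add: dia_mult dia_0 flip: rep_mult[of "dia _" "dia _"])
	then have "norm (rp (cdia th t) (rp (cdia (- th) t) x) - rp (dia (2 * c * t)) x) = norm (rp g x - x)"
		by (metis rep_diff rep_norm dia_SL2R)
	also have "... <= norm (Hop x) * (\<bar>?r3\<bar> + \<bar>?r4\<bar>) + 2 * \<bar>of_int n\<bar> * norm x * (\<bar>?r1\<bar> + \<bar>?r2\<bar>)"
		by (rule order_trans[OF rep_lipschitz[OF x g] add_mono[OF mult_left_mono[OF nB] mult_left_mono[OF nA]]]) auto
	also have "... <= ?K * (\<bar>?r1\<bar> + \<bar>?r2\<bar> + \<bar>?r3\<bar> + \<bar>?r4\<bar>)"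
	proof -
		have gen: "a * (r3 + r4) + b * (r1 + r2) <= (a + b) * (r1 + r2 + r3 + r4)"
			if "a >= 0" "b >= 0" "r1 >= 0" "r2 >= 0" "r3 >= 0" "r4 >= 0" for a b r1 r2 r3 r4 :: real
			using that by (simp add: algebra_simps)
		show ?thesis by (rule gen) auto
	qed
	finally show ?thesis .
qed

text \<open>Additivity of the derived action on the noncompact directions. It is read off from two
  curves with a difference of order t^2 instead of from smoothness on the whole group.\<close>

lemma Hop_rot_sum:
	assumes x: "x \<in> wt n"
	shows "cis (of_int n * th) *% rp (rot th) (Hop x) + cis (- of_int n * th) *% rp (rot (- th)) (Hop x)
		= (2 * cos (2 * th)) *\<^sub>R Hop x"
proof -
	define c where "c = cos (2 * th)"
	define d where "d = cis (of_int n * th) *% rp (rot th) (Hop x) + cis (- of_int n * th) *% rp (rot (- th)) (Hop x)"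
	have "isCont (%t. rp (cdia th t) y) 0" for y
		using continuous_cdia[of UNIV th y] by (simp add: continuous_on_eq_continuous_at)
	then have D1: "((%t. rp (cdia th t) (rp (cdia (- th) t) x)) has_vector_derivative d) (at 0)"
		unfolding d_def using rep_mult_deriv[OF cdia_deriv[OF x, of th] cdia_deriv[OF x, of "- th"]] by simp
	have "((%t. 2 * c * t) has_vector_derivative 2 * c) (at 0)"
		by (auto intro!: derivative_eq_intros)
	then have D2: "((%t. rp (dia (2 * c * t)) x) has_vector_derivative (2 * c) *\<^sub>R Hop x) (at 0)"
		using vector_diff_chain_at[of "%t. 2 * c * t" "2 * c" 0 "%t. rp (dia t) x" "Hop x"] Hop_deriv_0[OF x]
		by (simp add: o_def)
	define f where "f t = rp (cdia th t) (rp (cdia (- th) t) x) - rp (dia (2 * c * t)) x" for t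
	have Df: "(f has_vector_derivative d - (2 * c) *\<^sub>R Hop x) (at 0)"
		unfolding f_def by (rule has_vector_derivative_diff[OF D1 D2])
	define K where "K = norm (Hop x) + 2 * \<bar>of_int n\<bar> * norm x"
	define r1 r2 r3 r4 where
		"r1 t = (cosh t)\<^sup>2 * cosh (2*c*t) - 1 - c * sinh (2*t) * sinh (2*c*t)" and
		"r2 t = (sinh t)\<^sup>2 * cosh (2*c*t)" and
		"r3 t = (cosh t)\<^sup>2 * sinh (2*c*t) - c * sinh (2*t) * cosh (2*c*t)" and
		"r4 t = (sinh t)\<^sup>2 * sinh (2*c*t)" for t :: real
	have z: "r1 0 = 0" "r2 0 = 0" "r3 0 = 0" "r4 0 = 0"
		by (simp_all add: r1_def r2_def r3_def r4_def)
	have "(r1 has_real_derivative 0) (at 0)" "(r2 has_real_derivative 0) (at 0)"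
		"(r3 has_real_derivative 0) (at 0)" "(r4 has_real_derivative 0) (at 0)"
		unfolding r1_def r2_def r3_def r4_def
		by (rule derivative_eq_intros refl | simp)+
	then have "((%t. r1 t / t) \<longlongrightarrow> 0) (at 0)" "((%t. r2 t / t) \<longlongrightarrow> 0) (at 0)"
		"((%t. r3 t / t) \<longlongrightarrow> 0) (at 0)" "((%t. r4 t / t) \<longlongrightarrow> 0) (at 0)"
		by (auto intro!: tendsto_div_0_of_DERIV_0 simp: z)
	then have "((%t. K * (\<bar>r1 t / t\<bar> + \<bar>r2 t / t\<bar> + \<bar>r3 t / t\<bar> + \<bar>r4 t / t\<bar>)) \<longlongrightarrow> K * (\<bar>0\<bar> + \<bar>0\<bar> + \<bar>0\<bar> + \<bar>0\<bar>)) (at 0)"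
		by (intro tendsto_intros)
	then have lim: "((%t. K * (\<bar>r1 t / t\<bar> + \<bar>r2 t / t\<bar> + \<bar>r3 t / t\<bar> + \<bar>r4 t / t\<bar>)) \<longlongrightarrow> 0) (at 0)" by simp
	have f0: "f 0 = 0" by (simp add: f_def dia_0)
	have fb: "norm (f t) <= K * (\<bar>r1 t\<bar> + \<bar>r2 t\<bar> + \<bar>r3 t\<bar> + \<bar>r4 t\<bar>)" for t
		using cdia_product_lipschitz[OF x, of th t] unfolding f_def K_def r1_def r2_def r3_def r4_def c_def .
	have "((%t. (1/t) *\<^sub>R (f t - f 0)) \<longlongrightarrow> 0) (at 0)"
	proof (rule Lim_null_comparison[OF _ lim], rule always_eventually, rule allI)
		fix t
		have "norm ((1/t) *\<^sub>R (f t - f 0)) = norm (f t) / \<bar>t\<bar>" by (simp add: f0)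
		also have "... <= K * (\<bar>r1 t\<bar> + \<bar>r2 t\<bar> + \<bar>r3 t\<bar> + \<bar>r4 t\<bar>) / \<bar>t\<bar>"
			by (rule divide_right_mono[OF fb]) simp
		also have "... = K * (\<bar>r1 t / t\<bar> + \<bar>r2 t / t\<bar> + \<bar>r3 t / t\<bar> + \<bar>r4 t / t\<bar>)"
			by (simp only: abs_divide add_divide_distrib[symmetric] times_divide_eq_right)
		finally show "norm ((1/t) *\<^sub>R (f t - f 0)) <= K * (\<bar>r1 t / t\<bar> + \<bar>r2 t / t\<bar> + \<bar>r3 t / t\<bar> + \<bar>r4 t / t\<bar>)" .
	qed
	then have "(f has_vector_derivative 0) (at 0)" by (simp add: has_vector_derivative_iff_quotient)
	with Df have "d - (2 * c) *\<^sub>R Hop x = 0" by (rule vector_derivative_unique_at)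
	then show ?thesis by (simp add: d_def c_def)
qed

definition up :: "int => 'h => 'h" where "up n x = proj (n + 2) (Hop x)"
definition dn :: "int => 'h => 'h" where "dn n x = proj (n - 2) (Hop x)"

lemma up_wt [simp]: "up n x \<in> wt (n + 2)" and dn_wt [simp]: "dn n x \<in> wt (n - 2)"
	by (simp_all add: up_def dn_def proj_in_wt)

text \<open>On the component of weight m, \<open>Hop_rot_sum\<close> becomes cos((n - m) th) = cos(2
  th) for every th, which only n - m = 2 or -2 satisfies.\<close>

lemma Hop_proj_other:
	assumes x: "x \<in> wt n" and m: "m ~= n + 2" "m ~= n - 2"
	shows "proj m (Hop x) = 0"
proof -
	obtain th :: real where th: "cos (of_int (n - m) * th) ~= cos (2 * th)"
		using cos_mult_neq_cos_double[of "n - m"] m by (metis diff_eq_eq add.commute minus_diff_eq diff_add_cancel add_diff_cancel_left' uminus_add_conv_diff)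
	let ?y = "proj m (Hop x)"
	have "proj m (cis (of_int n * th) *% rp (rot th) (Hop x) + cis (- of_int n * th) *% rp (rot (- th)) (Hop x))
			= (cis (of_int (n - m) * th) + cis (- (of_int (n - m) * th))) *% ?y"
		by (simp add: proj_add proj_scaleC proj_rot scaleC_scaleC cis_mult scaleC_add_left algebra_simps)
	also have "cis (of_int (n - m) * th) + cis (- (of_int (n - m) * th)) = of_real (2 * cos (of_int (n - m) * th))"
		by (simp add: complex_eq_iff)
	finally have "(2 * cos (of_int (n - m) * th)) *\<^sub>R ?y = (2 * cos (2 * th)) *\<^sub>R ?y"
		using linear_scale[OF bounded_linear.linear[OF bounded_linear_proj[of m]], of "2 * cos (2 * th)" "Hop x"]
		by (simp only: Hop_rot_sum[OF x] scaleC_of_real)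
	then have "2 * cos (of_int (n - m) * th) = 2 * cos (2 * th) \<or> ?y = 0"
		by (simp only: scaleR_cancel_right)
	then show ?thesis using th by linarith
qed

lemma Hop_decomp:
	assumes x: "x \<in> wt n"
	shows "Hop x = up n x + dn n x"
proof -
	have "Hop x - (up n x + dn n x) = 0"
	proof (rule eq_zero_if_proj_zero)
		fix m
		consider "m = n + 2" | "m = n - 2" | "m ~= n + 2" "m ~= n - 2" by blast
		then show "proj m (Hop x - (up n x + dn n x)) = 0"
		proof cases
			case 1
			then show ?thesis
				using proj_wt[OF up_wt[of n x]] proj_wt_other[OF dn_wt[of n x], of "n + 2"]
				by (simp add: proj_diff proj_add) (simp add: up_def)
		next
			case 2
			then show ?thesis
				using proj_wt[OF dn_wt[of n x]] proj_wt_other[OF up_wt[of n x], of "n - 2"]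
				by (simp add: proj_diff proj_add) (simp add: dn_def)
		next
			case 3
			then show ?thesis
				using proj_wt_other[OF dn_wt[of n x], of m] proj_wt_other[OF up_wt[of n x], of m] Hop_proj_other[OF x, of m]
				by (simp add: proj_diff proj_add)
		qed
	qed
	then show ?thesis by simp
qed

lemma up_scaleC: "x \<in> wt n ==> up n (c *% x) = c *% up n x"
	and dn_scaleC: "x \<in> wt n ==> dn n (c *% x) = c *% dn n x"
	by (simp_all add: up_def dn_def Hop_scaleC proj_scaleC)

lemma up_dn_adjoint:
	assumes x: "x \<in> wt n" and y: "y \<in> wt (n + 2)"
	shows "cinner (up n x) y = - cinner x (dn (n + 2) y)"
proof -
	have "cinner (up n x) y = cinner (Hop x) y" using cinner_proj[OF y] by (simp add: up_def)
	also have "... = - cinner x (Hop y)" by (rule Hop_skew[OF x y])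
	also have "cinner x (Hop y) = cinner x (dn (n + 2) y)"
		using cinner_proj[OF x, of "Hop y"] by (metis cinner_commute dn_def add_diff_cancel_right')
	finally show ?thesis .
qed

lemma rot_Hop:
	assumes x: "x \<in> wt n"
	shows "cis (of_int n * th) *% rp (rot th) (Hop x) = cis (- (2 * th)) *% up n x + cis (2 * th) *% dn n x"
	unfolding Hop_decomp[OF x]
	by (simp add: rep_add wtD[OF up_wt] wtD[OF dn_wt] scaleC_add_right scaleC_scaleC cis_mult algebra_simps)

text \<open>The phase of a diagonal coefficient depends only on the argument of \<open>cayA\<close>.
  Here \<open>cayA\<close> of the quotient is cosh^2 t + i sinh^2 t, and what remains is real by
  \<open>sph_coeff\<close>.\<close>

lemma coeff_cdia_dia:
	assumes x: "x \<in> wt n"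
	obtains r :: real where "cinner (rp (dia t) x) (rp (cdia (pi/4) t) x)
		= cis (of_int n * arctan ((sinh t)\<^sup>2 / (cosh t)\<^sup>2)) * of_real r"
proof -
	define g where "g = cdia (pi/4) (- t) ** dia t"
	have gS: "g \<in> SL2R" by (simp add: g_def SL2R_mult)
	have inv: "adj22 (cdia (pi/4) (- t)) = cdia (pi/4) t"
		by (simp add: cdia_def rot_def dia_def)
	have 1: "cinner (rp (dia t) x) (rp (cdia (pi/4) t) x) = cinner (rp g x) x"
		using rep_adjoint[of "cdia (pi/4) (- t)" "rp (dia t) x" x] by (simp add: g_def rep_mult inv)
	have "cayA (complexify (cdia (pi/4) (- t))) = of_real (cosh t)" "cayC (complexify (cdia (pi/4) (- t))) = - \<i> * of_real (sinh t)"
		using cay_rot_dia_rot[of "pi/4" "- t" "- pi/4"] by (simp_all add: cdia_def cay_complexify cis_cnj cis_minus_pi_half)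
	then have cg: "cayA (complexify g) = Complex ((cosh t)\<^sup>2) ((sinh t)\<^sup>2)"
		unfolding g_def complexify_mult cay_mult cay_dia by (simp add: complex_eq_iff power2_eq_square)
	obtain al ta bt where gd: "g = rot al ** dia ta ** rot bt" using KAK[OF gS] by metis
	have ct: "cosh t > 0" by (rule cosh_real_pos)
	have "cis (- (al + bt)) * of_real (cosh ta) = cayA (complexify g)" unfolding gd cay_rot_dia_rot ..
	also have "... = of_real (norm (cayA (complexify g))) * cis (arctan ((sinh t)\<^sup>2 / (cosh t)\<^sup>2))"
		using cis_arctan[of "cayA (complexify g)"] ct unfolding cg by simp
	also have "norm (cayA (complexify g)) = cosh ta"
		unfolding gd cay_rot_dia_rot by (simp add: norm_mult)
	finally have "cis (- (al + bt)) = cis (arctan ((sinh t)\<^sup>2 / (cosh t)\<^sup>2))"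
		by (simp add: mult.commute)
	then have ph: "cis (of_int n * (- (al + bt))) = cis (of_int n * arctan ((sinh t)\<^sup>2 / (cosh t)\<^sup>2))"
		by (simp only: cis_power_int[symmetric])
	have "cinner (rp g x) x = cis (of_int n * (- (al + bt))) * cinner (rp (dia ta) x) x"
		unfolding gd coeff_rot_dia_rot[OF x x] by (simp only: mult_minus_left mult_minus_right)
	then show ?thesis using that 1 ph sph_coeff[OF x, of ta] by metis
qed

text \<open>The commutator relation between raising and lowering, in the form of norms. It comes
  from the term of order t^2 in the imaginary part of <dia t x, cdia (pi/4) t x>: difference
  quotients give the left side, and the phase from \<open>coeff_cdia_dia\<close> gives the right
  side.\<close>

lemma up_dn_norm:
	assumes x: "x \<in> wt n"
	shows "(norm (up n x))\<^sup>2 - (norm (dn n x))\<^sup>2 = of_int n * (norm x)\<^sup>2"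
proof -
	define u where "u t = rp (dia t) x" for t
	define v where "v t = rp (cdia (pi/4) t) x" for t
	define E where "E t = cinner (u t) (v t)" for t
	define dl :: "real => real" where "dl t = arctan ((sinh t)\<^sup>2 / (cosh t)\<^sup>2)" for t
	have h: "((%t. (1/t) *\<^sub>R (u t - x)) \<longlongrightarrow> Hop x) (at 0)"
		using Hop_deriv_0[OF x] by (simp add: has_vector_derivative_iff_quotient u_def dia_0)
	have h': "((%t. (1/t) *\<^sub>R (v t - x)) \<longlongrightarrow> - \<i> *% up n x + \<i> *% dn n x) (at 0)"
		using cdia_deriv[OF x, of "pi/4"] rot_Hop[OF x, of "pi/4"]
		by (simp add: has_vector_derivative_iff_quotient v_def cis_minus_pi_half)
	have orth: "cinner (up n x) (dn n x) = 0" "cinner (dn n x) (up n x) = 0"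
		using wt_orthogonal[OF up_wt dn_wt, of n n x x] wt_orthogonal[OF dn_wt up_wt, of n n x x] by auto
	have lim_inner: "((%t. Im (cinner ((1/t) *\<^sub>R (u t - x)) ((1/t) *\<^sub>R (v t - x)))) \<longlongrightarrow>
			Im (cinner (Hop x) (- \<i> *% up n x + \<i> *% dn n x))) (at 0)"
		by (intro tendsto_intros h h')
	have "cinner (Hop x) (- \<i> *% up n x + \<i> *% dn n x) = \<i> * of_real ((norm (up n x))\<^sup>2) - \<i> * of_real ((norm (dn n x))\<^sup>2)"
		unfolding Hop_decomp[OF x]
		by (simp add: cinner_add_left cinner_diff_right cinner_add_right cinner_scaleC_right orth cinner_norm)
	then have im: "Im (cinner (Hop x) (- \<i> *% up n x + \<i> *% dn n x)) = (norm (up n x))\<^sup>2 - (norm (dn n x))\<^sup>2"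
		by simp
	have im_E: "Im (cinner ((1/t) *\<^sub>R (u t - x)) ((1/t) *\<^sub>R (v t - x))) = Im (E t) / t\<^sup>2" for t
	proof -
		have "Im (cinner (u t) x) = 0" using sph_coeff[OF x, of t] by (simp add: u_def)
		moreover have "cinner (v t) x = of_real (sph x t)"
			using coeff_rot_dia_rot[OF x x, of "pi/4" t "- pi/4"] sph_coeff[OF x, of t] by (simp add: v_def cdia_def)
		then have "Im (cinner x (v t)) = 0" using cinner_commute[of x "v t"] by simp
		ultimately have "Im (cinner (u t - x) (v t - x)) = Im (E t)"
			by (simp add: cinner_diff_left cinner_diff_right E_def cinner_norm)
		then show ?thesis by (simp add: cinner_scaleR_left cinner_scaleR_right power2_eq_square)
	qed
	have lim1: "((%t. Im (E t) / t\<^sup>2) \<longlongrightarrow> (norm (up n x))\<^sup>2 - (norm (dn n x))\<^sup>2) (at_right 0)"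
		using lim_inner unfolding im im_E by (rule tendsto_mono[rotated]) (simp add: at_le)
	have "\<exists>r. E t = cis (of_int n * dl t) * of_real r" for t
		using coeff_cdia_dia[OF x, of t] by (metis E_def u_def v_def dl_def)
	then obtain r :: "real => real" where r: "!!t. E t = cis (of_int n * dl t) * of_real (r t)" by metis
	have rE: "r t = Re (E t * cis (- (of_int n * dl t)))" for t
		unfolding r by (simp add: mult.commute mult.left_commute cis_mult flip: mult.assoc)
	have "isCont u 0" unfolding u_def[abs_def]
		using continuous_dia[of UNIV x] by (simp add: continuous_on_eq_continuous_at)
	moreover have "isCont v 0" unfolding v_def[abs_def]
		using continuous_cdia[of UNIV "pi/4" x] by (simp only: continuous_on_eq_continuous_at open_UNIV) simp
	ultimately have "(u \<longlongrightarrow> u 0) (at 0)" "(v \<longlongrightarrow> v 0) (at 0)"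
		by (simp_all add: isCont_def)
	moreover have "(dl \<longlongrightarrow> dl 0) (at 0)"
		unfolding dl_def by (intro tendsto_intros) auto
	ultimately have "((%t. Re (E t * cis (- (of_int n * dl t)))) \<longlongrightarrow> Re (cinner (u 0) (v 0) * cis (- (of_int n * dl 0)))) (at 0)"
		unfolding E_def by (intro tendsto_intros)
	then have "(r \<longlongrightarrow> (norm x)\<^sup>2) (at 0)"
		by (simp add: rE[abs_def] u_def v_def dl_def dia_0 cinner_norm)
	then have r1: "(r \<longlongrightarrow> (norm x)\<^sup>2) (at_right 0)"
		by (rule tendsto_mono[rotated]) (simp add: at_le)
	have "((%t. sin (of_int n * dl t) / t\<^sup>2 * r t) \<longlongrightarrow> of_int n * (norm x)\<^sup>2) (at_right 0)"
		unfolding dl_def by (intro tendsto_mult tendsto_sin_arctan_tanh_sq r1)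
	moreover have "sin (of_int n * dl t) / t\<^sup>2 * r t = Im (E t) / t\<^sup>2" for t
		by (simp add: r)
	ultimately have lim2: "((%t. Im (E t) / t\<^sup>2) \<longlongrightarrow> of_int n * (norm x)\<^sup>2) (at_right 0)"
		by (simp only:)
	show ?thesis by (rule tendsto_unique[OF _ lim1 lim2]) simp
qed

end

lemma eventually_decreasing_bounded:
	fixes f :: "nat => real"
	assumes "!!k. k >= K ==> f (Suc k) <= f k"
	obtains M where "!!k. f k <= M"
proof
	fix k
	have dec: "f (K + i) <= f K" for i
	proof (induct i)
		case (Suc i)
		have "f (Suc (K + i)) <= f (K + i)" by (rule assms) simp
		then show ?case using Suc by simp
	qed simp
	show "f k <= Max (f ` {..K})"
	proof (cases "k <= K")
		case False
		then have "f k <= f K" using dec[of "k - K"] by simp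
		also have "... <= Max (f ` {..K})" by (rule Max_ge) auto
		finally show ?thesis .
	qed (auto intro!: Max_ge)
qed

lemma norm_of_real_diff_le_add:
	assumes "Re nu >= 0" "a >= 0"
	shows "norm (of_real a - nu) <= norm (of_real a + nu)"
proof -
	have "a * Re nu >= 0" using assms by simp
	then have "(norm (of_real a - nu))\<^sup>2 <= (norm (of_real a + nu))\<^sup>2"
		unfolding cmod_power2 by (simp add: power2_eq_square algebra_simps)
	then show ?thesis by (rule power2_le_imp_le) simp
qed

section \<open>The Casimir parameter and the normalised chain of weight vectors\<close>

context irrep
begin

text \<open>A vector killed by \<open>Hop\<close> is fixed by A, since its derivative is zero at
  every time; weight 0 means fixed by K, and K and A generate the group.\<close>

lemma fixed_imp_trivial:
	assumes x: "x \<in> wt 0" "x ~= 0" "Hop x = 0"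
	shows "trivial_rep rp"
proof -
	have dx: "rp (dia t) x = x" for t using dia_lipschitz[OF x(1), of t] x(3) by simp
	have rx: "rp (rot t) x = x" for t using wtD[OF x(1), of t] by simp
	have gx: "rp g x = x" if g: "g \<in> SL2R" for g
	proof -
		obtain al t bt where "g = rot al ** dia t ** rot bt" using KAK[OF g] by metis
		then show ?thesis by (simp add: rep_mult SL2R_mult dx rx)
	qed
	define W where "W = {y. \<forall>g\<in>SL2R. rp g y = y}"
	have "y \<in> W" for y
	proof (rule invariant_subspace[of W x])
		show "complex_vector.subspace W"
			by (auto simp: complex_vector.subspace_def W_def rep_add rep_scaleC)
		have "W = (\<Inter>g\<in>SL2R. {y. rp g y = y})" by (auto simp: W_def)
		moreover have "closed {y. rp g y = y}" if "g \<in> SL2R" for g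
			using linear_continuous_on[OF rep_bounded_linear[OF that], of UNIV]
			by (intro closed_Collect_eq continuous_on_id)
		ultimately show "closed W" by (simp add: closed_INT)
		show "rp g z \<in> W" if "g \<in> SL2R" "z \<in> W" for g z
			using that by (simp add: W_def)
	qed (use x gx in \<open>auto simp: W_def\<close>)
	then show ?thesis by (simp add: W_def trivial_rep_def)
qed

text \<open>\<open>up_dn_norm\<close> makes n times a positive number equal to minus a square.
  Equality at n = 0 would kill \<open>Hop x\<close> and make the representation trivial.\<close>

lemma up_zero_neg:
	assumes x: "x \<in> wt n" "x ~= 0" "up n x = 0" and nt: "\<not> trivial_rep rp"
	shows "n < 0"
proof -
	have n: "of_int n * (norm x)\<^sup>2 = - (norm (dn n x))\<^sup>2" using up_dn_norm[OF x(1)] x(3) by simp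
	have nx: "(norm x)\<^sup>2 > 0" using x(2) by simp
	have "n ~= 0"
	proof
		assume "n = 0"
		then have "dn n x = 0" using n by simp
		then have "Hop x = 0" using Hop_decomp[OF x(1)] x(3) by simp
		then show False using fixed_imp_trivial nt x \<open>n = 0\<close> by blast
	qed
	moreover have "\<not> n > 0"
	proof
		assume "n > 0"
		then have "of_int n * (norm x)\<^sup>2 > 0" using nx by simp
		then show False using n by (smt (verit) zero_le_power2)
	qed
	ultimately show ?thesis by linarith
qed

lemma dn_zero_pos:
	assumes x: "x \<in> wt n" "x ~= 0" "dn n x = 0" and nt: "\<not> trivial_rep rp"
	shows "n > 0"
proof -
	have n: "of_int n * (norm x)\<^sup>2 = (norm (up n x))\<^sup>2" using up_dn_norm[OF x(1)] x(3) by simp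
	have nx: "(norm x)\<^sup>2 > 0" using x(2) by simp
	have "n ~= 0"
	proof
		assume "n = 0"
		then have "up n x = 0" using n by simp
		then have "Hop x = 0" using Hop_decomp[OF x(1)] x(3) by simp
		then show False using fixed_imp_trivial nt x \<open>n = 0\<close> by blast
	qed
	moreover have "\<not> n < 0"
	proof
		assume "n < 0"
		then have "of_int n * (norm x)\<^sup>2 < 0" using nx by (simp add: mult_less_0_iff)
		then show False using n by (smt (verit) zero_le_power2)
	qed
	ultimately show ?thesis by linarith
qed

text \<open>Multiplicity one leaves only a scalar to find, and the adjointness of raising and
  lowering computes it.\<close>

lemma dn_up:
	assumes x: "x \<in> wt n" "x ~= 0"
	shows "dn (n + 2) (up n x) = - ((norm (up n x))\<^sup>2 / (norm x)\<^sup>2) *\<^sub>R x"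
proof -
	let ?y = "up n x"
	have "dn (n + 2) ?y \<in> wt n" using dn_wt[of "n + 2" ?y] by simp
	from wt_one_dim[OF x this]
	have "dn (n + 2) ?y = (cinner (dn (n + 2) ?y) x / of_real ((norm x)\<^sup>2)) *% x" .
	moreover have "cinner x (dn (n + 2) ?y) = - of_real ((norm ?y)\<^sup>2)"
		using up_dn_adjoint[OF x(1) up_wt[of n x]] by (simp add: cinner_norm)
	then have "cinner (dn (n + 2) ?y) x = - of_real ((norm ?y)\<^sup>2)"
		using cinner_commute[of "dn (n + 2) ?y" x] by simp
	ultimately have "dn (n + 2) ?y = of_real (- ((norm ?y)\<^sup>2 / (norm x)\<^sup>2)) *% x" by simp
	then show ?thesis by (simp only: scaleC_of_real)
qed

lemma up_dn:
	assumes x: "x \<in> wt n" "x ~= 0"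
	shows "up (n - 2) (dn n x) = - ((norm (dn n x))\<^sup>2 / (norm x)\<^sup>2) *\<^sub>R x"
proof -
	let ?y = "dn n x"
	have "up (n - 2) ?y \<in> wt n" using up_wt[of "n - 2" ?y] by simp
	from wt_one_dim[OF x this]
	have "up (n - 2) ?y = (cinner (up (n - 2) ?y) x / of_real ((norm x)\<^sup>2)) *% x" .
	moreover have "cinner (up (n - 2) ?y) x = - of_real ((norm ?y)\<^sup>2)"
		using up_dn_adjoint[OF dn_wt[of n x], of x] x(1) by (simp add: cinner_norm)
	ultimately have "up (n - 2) ?y = of_real (- ((norm ?y)\<^sup>2 / (norm x)\<^sup>2)) *% x" by simp
	then show ?thesis by (simp only: scaleC_of_real)
qed

text \<open>\<open>nu\<^sup>2 - 1\<close> is the Casimir eigenvalue, up to normalisation.\<close>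

definition cas :: "complex => int => 'h => bool" where
	"cas nu n x \<longleftrightarrow> of_real (4 * (norm (up n x))\<^sup>2) = ((of_int n + 1)\<^sup>2 - nu\<^sup>2) * of_real ((norm x)\<^sup>2)"

lemma cas_dn:
	assumes "x \<in> wt n" "cas nu n x"
	shows "of_real (4 * (norm (dn n x))\<^sup>2) = ((of_int n - 1)\<^sup>2 - nu\<^sup>2) * of_real ((norm x)\<^sup>2)"
proof -
	have "4 * (norm (dn n x))\<^sup>2 = 4 * (norm (up n x))\<^sup>2 - 4 * of_int n * (norm x)\<^sup>2"
		using up_dn_norm[OF assms(1)] by simp
	then have "complex_of_real (4 * (norm (dn n x))\<^sup>2) = of_real (4 * (norm (up n x))\<^sup>2) - 4 * of_int n * of_real ((norm x)\<^sup>2)"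
		by simp
	also have "... = ((of_int n - 1)\<^sup>2 - nu\<^sup>2) * of_real ((norm x)\<^sup>2)"
		using assms(2) unfolding cas_def by (simp add: power2_eq_square algebra_simps)
	finally show ?thesis .
qed

lemma dn_up_cas:
	assumes x: "x \<in> wt n" "x ~= 0" "cas nu n x"
	shows "dn (n + 2) (up n x) = - (((of_int n + 1)\<^sup>2 - nu\<^sup>2) / 4) *% x"
proof -
	have "complex_of_real ((norm (up n x))\<^sup>2 / (norm x)\<^sup>2) = ((of_int n + 1)\<^sup>2 - nu\<^sup>2) / 4"
		using x(2,3) unfolding cas_def by (simp add: field_simps)
	then show ?thesis unfolding dn_up[OF x(1,2)] scaleC_of_real[symmetric] by simp
qed

lemma up_dn_cas:
	assumes x: "x \<in> wt n" "x ~= 0" "cas nu n x"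
	shows "up (n - 2) (dn n x) = - (((of_int n - 1)\<^sup>2 - nu\<^sup>2) / 4) *% x"
proof -
	have "complex_of_real ((norm (dn n x))\<^sup>2 / (norm x)\<^sup>2) = ((of_int n - 1)\<^sup>2 - nu\<^sup>2) / 4"
		using x(2) cas_dn[OF x(1,3)] by (simp add: field_simps)
	then show ?thesis unfolding up_dn[OF x(1,2)] scaleC_of_real[symmetric] by simp
qed

text \<open>One parameter governs the whole chain: the norm of lowering back is known from
  \<open>dn_up\<close>, and \<open>up_dn_norm\<close> one weight higher then yields the next raising
  norm with the same \<open>nu\<close>.\<close>

lemma cas_up:
	assumes x: "x \<in> wt n" "x ~= 0" "cas nu n x"
	shows "cas nu (n + 2) (up n x)"
proof -
	let ?y = "up n x"
	have "norm (dn (n + 2) ?y) = (norm ?y)\<^sup>2 / norm x"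
		unfolding dn_up[OF x(1,2)] using x(2) by (simp add: power2_eq_square)
	then have "(norm (up (n + 2) ?y))\<^sup>2 = ((norm ?y)\<^sup>2 / norm x)\<^sup>2 + of_int (n + 2) * (norm ?y)\<^sup>2"
		using up_dn_norm[OF up_wt[of n x]] by simp
	then have "4 * (norm (up (n + 2) ?y))\<^sup>2 = (4 * (norm ?y)\<^sup>2 / (norm x)\<^sup>2 + 4 * of_int (n + 2)) * (norm ?y)\<^sup>2"
		using x(2) by (simp add: field_simps power2_eq_square)
	then have "complex_of_real (4 * (norm (up (n + 2) ?y))\<^sup>2)
			= (of_real (4 * (norm ?y)\<^sup>2) / of_real ((norm x)\<^sup>2) + 4 * of_int (n + 2)) * of_real ((norm ?y)\<^sup>2)"
		by simp
	also have "of_real (4 * (norm ?y)\<^sup>2) / of_real ((norm x)\<^sup>2) = (of_int n + 1)\<^sup>2 - nu\<^sup>2"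
		using x(2,3) unfolding cas_def by simp
	also have "(of_int n + 1)\<^sup>2 - nu\<^sup>2 + 4 * of_int (n + 2) = (of_int (n + 2) + 1)\<^sup>2 - nu\<^sup>2"
		by (simp add: power2_eq_square algebra_simps)
	finally show ?thesis unfolding cas_def .
qed

lemma cas_dn_step:
	assumes x: "x \<in> wt n" "x ~= 0" "cas nu n x"
	shows "cas nu (n - 2) (dn n x)"
proof -
	let ?y = "dn n x"
	have "norm (up (n - 2) ?y) = (norm ?y)\<^sup>2 / norm x"
		unfolding up_dn[OF x(1,2)] using x(2) by (simp add: power2_eq_square)
	then have "4 * (norm (up (n - 2) ?y))\<^sup>2 = (4 * (norm ?y)\<^sup>2 / (norm x)\<^sup>2) * (norm ?y)\<^sup>2"
		by (simp add: power2_eq_square)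
	then have "complex_of_real (4 * (norm (up (n - 2) ?y))\<^sup>2)
			= (of_real (4 * (norm ?y)\<^sup>2) / of_real ((norm x)\<^sup>2)) * of_real ((norm ?y)\<^sup>2)"
		by simp
	also have "of_real (4 * (norm ?y)\<^sup>2) / of_real ((norm x)\<^sup>2) = (of_int n - 1)\<^sup>2 - nu\<^sup>2"
		unfolding cas_dn[OF x(1,3)] using x(2) by simp
	also have "(of_int n - 1)\<^sup>2 - nu\<^sup>2 = (of_int (n - 2) + 1)\<^sup>2 - nu\<^sup>2"
		by simp
	finally show ?thesis unfolding cas_def .
qed

lemma cas_scaleC: "x \<in> wt n ==> cas nu n x ==> cas nu n (c *% x)"
	by (simp add: cas_def up_scaleC power_mult_distrib)

lemma cas_exists:
	assumes "v ~= 0"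
	obtains nu where "Re nu >= 0" "cas nu n v"
proof
	define nu where "nu = csqrt (of_real ((of_int n + 1)\<^sup>2 - 4 * (norm (up n v))\<^sup>2 / (norm v)\<^sup>2))"
	show "Re nu >= 0" unfolding nu_def using csqrt_principal[of "of_real ((of_int n + 1)\<^sup>2 - 4 * (norm (up n v))\<^sup>2 / (norm v)\<^sup>2)"] by auto
	have "nu\<^sup>2 = of_real ((of_int n + 1)\<^sup>2 - 4 * (norm (up n v))\<^sup>2 / (norm v)\<^sup>2)" by (simp only: nu_def power2_csqrt)
	then show "cas nu n v" using assms by (simp add: cas_def)
qed

text \<open>Rescaled so that raising has coefficient (m + 1 + nu)/2 at weight m. When that number is
  0, division by zero sets the next vector to 0, which is consistent because raising is then zero by
  \<open>cas_up_zero\<close>.\<close>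

definition tup :: "complex => int => 'h => nat => 'h" where
	"tup nu n v k = rec_nat v (%k x. (2 / (of_int (n + 2 * int k) + 1 + nu)) *% up (n + 2 * int k) x) k"

definition tdn :: "complex => int => 'h => nat => 'h" where
	"tdn nu n v k = rec_nat v (%k x. (- 2 / (of_int (n - 2 * int k) - 1 - nu)) *% dn (n - 2 * int k) x) k"

lemma tup_0: "tup nu n v 0 = v"
	and tup_Suc: "tup nu n v (Suc k) = (2 / (of_int (n + 2 * int k) + 1 + nu)) *% up (n + 2 * int k) (tup nu n v k)"
	by (simp_all add: tup_def)

lemma tdn_0: "tdn nu n v 0 = v"
	and tdn_Suc: "tdn nu n v (Suc k) = (- 2 / (of_int (n - 2 * int k) - 1 - nu)) *% dn (n - 2 * int k) (tdn nu n v k)"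
	by (simp_all add: tdn_def)

lemma Hop_zero [simp]: "Hop 0 = 0"
	by (simp add: Hop_def)

lemma up_zero [simp]: "up n 0 = 0" and dn_zero [simp]: "dn n 0 = 0"
	by (simp_all add: up_def dn_def)

lemma cas_zero [simp]: "cas nu n 0"
	by (simp add: cas_def)

lemma tup_wt_cas:
	assumes v: "v \<in> wt n" "cas nu n v"
	shows "tup nu n v k \<in> wt (n + 2 * int k) & cas nu (n + 2 * int k) (tup nu n v k)"
proof (induct k)
	case (Suc k)
	have e: "n + 2 * int (Suc k) = (n + 2 * int k) + 2" by simp
	show ?case
	proof (cases "tup nu n v k = 0")
		case False
		then show ?thesis unfolding e tup_Suc using Suc cas_up cas_scaleC[OF up_wt] wt_scaleC[OF up_wt] by blast
	next
		case True
		then have "tup nu n v (Suc k) = 0" by (simp add: tup_Suc)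
		then show ?thesis by simp
	qed
qed (use v in \<open>simp add: tup_0\<close>)

lemma tdn_wt_cas:
	assumes v: "v \<in> wt n" "cas nu n v"
	shows "tdn nu n v k \<in> wt (n - 2 * int k) & cas nu (n - 2 * int k) (tdn nu n v k)"
proof (induct k)
	case (Suc k)
	have e: "n - 2 * int (Suc k) = (n - 2 * int k) - 2" by simp
	show ?case
	proof (cases "tdn nu n v k = 0")
		case False
		then show ?thesis unfolding e tdn_Suc using Suc cas_dn_step cas_scaleC[OF dn_wt] wt_scaleC[OF dn_wt] by blast
	next
		case True
		then have "tdn nu n v (Suc k) = 0" by (simp add: tdn_Suc)
		then show ?thesis by simp
	qed
qed (use v in \<open>simp add: tdn_0\<close>)

lemma cas_up_zero: "cas nu n x ==> of_int n + 1 + nu = 0 ==> up n x = 0"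
proof -
	assume c: "cas nu n x" and "of_int n + 1 + nu = 0"
	then have "of_int n + 1 = - nu" by (simp only: eq_neg_iff_add_eq_0)
	then have "(of_int n + 1)\<^sup>2 - nu\<^sup>2 = 0" by simp
	then show ?thesis using c by (simp add: cas_def)
qed

lemma cas_dn_zero: "x \<in> wt n ==> cas nu n x ==> of_int n - 1 - nu = 0 ==> dn n x = 0"
proof -
	assume x: "x \<in> wt n" and c: "cas nu n x" and "of_int n - 1 - nu = 0"
	then have "(of_int n - 1)\<^sup>2 - nu\<^sup>2 = 0" by (simp add: power2_eq_iff)
	then show ?thesis using cas_dn[OF x c] by simp
qed

lemma up_tup:
	assumes "v \<in> wt n" "cas nu n v"
	shows "up (n + 2 * int k) (tup nu n v k) = ((of_int (n + 2 * int k) + 1 + nu) / 2) *% tup nu n v (Suc k)"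
proof (cases "of_int (n + 2 * int k) + 1 + nu = 0")
	case True
	then show ?thesis
		using cas_up_zero[of nu "n + 2 * int k" "tup nu n v k"] tup_wt_cas[OF assms, of k] by simp
next
	case False
	define z where "z = of_int (n + 2 * int k) + 1 + nu"
	have "z ~= 0" using False by (simp add: z_def)
	then have "z / 2 * (2 / z) = 1" by simp
	then show ?thesis unfolding tup_Suc z_def[symmetric] scaleC_scaleC by (simp only: scaleC_one)
qed

lemma dn_tdn:
	assumes "v \<in> wt n" "cas nu n v"
	shows "dn (n - 2 * int k) (tdn nu n v k) = - ((of_int (n - 2 * int k) - 1 - nu) / 2) *% tdn nu n v (Suc k)"
proof (cases "of_int (n - 2 * int k) - 1 - nu = 0")
	case True
	then show ?thesis
		using cas_dn_zero[of "tdn nu n v k" "n - 2 * int k" nu] tdn_wt_cas[OF assms, of k] by simp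
next
	case False
	define z where "z = of_int (n - 2 * int k) - 1 - nu"
	have "z ~= 0" using False by (simp add: z_def)
	then have "- (z / 2) * (- 2 / z) = 1" by simp
	then show ?thesis unfolding tdn_Suc z_def[symmetric] scaleC_scaleC by (simp only: scaleC_one)
qed

text \<open>Lowering multiplies by the quadratic (m + 1)^2 - nu^2 over 4, and the normalisation of
  \<open>tup\<close> cancels exactly one of its linear factors; the other remains as the
  coefficient.\<close>

lemma dn_tup:
	assumes v: "v \<in> wt n" "cas nu n v" and nz: "tup nu n v (Suc k) ~= 0"
	shows "dn (n + 2 * int (Suc k)) (tup nu n v (Suc k)) = - ((of_int (n + 2 * int k) + 1 - nu) / 2) *% tup nu n v k"
proof -
	let ?m = "n + 2 * int k"
	have e: "n + 2 * int (Suc k) = ?m + 2" by simp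
	have m: "of_int ?m + 1 + nu ~= 0" and x: "tup nu n v k ~= 0" using nz by (auto simp: tup_Suc)
	have "dn (?m + 2) (up ?m (tup nu n v k)) = - (((of_int ?m + 1)\<^sup>2 - nu\<^sup>2) / 4) *% tup nu n v k"
		using dn_up_cas x tup_wt_cas[OF v, of k] by blast
	then have "dn (?m + 2) (tup nu n v (Suc k)) = ((2 / (of_int ?m + 1 + nu)) * (- (((of_int ?m + 1)\<^sup>2 - nu\<^sup>2) / 4))) *% tup nu n v k"
		unfolding tup_Suc dn_scaleC[OF up_wt] by (simp only: scaleC_scaleC)
	also have "(2 / (of_int ?m + 1 + nu)) * (- (((of_int ?m + 1)\<^sup>2 - nu\<^sup>2) / 4)) = - ((of_int ?m + 1 - nu) / 2)"
	proof -
		have gen: "a + nu ~= 0 ==> (2 / (a + nu)) * (- ((a\<^sup>2 - nu\<^sup>2) / 4)) = - ((a - nu) / 2)" for a :: complex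
		proof -
			assume "a + nu ~= 0"
			moreover have "a\<^sup>2 - nu\<^sup>2 = (a + nu) * (a - nu)" by (simp add: power2_eq_square algebra_simps)
			moreover have "d ~= 0 ==> (2 / d) * (- ((d * e) / 4)) = - (e / 2)" for d e :: complex by simp
			ultimately show ?thesis by (simp only:)
		qed
		show ?thesis by (rule gen[OF m])
	qed
	finally show ?thesis unfolding e .
qed

lemma up_tdn:
	assumes v: "v \<in> wt n" "cas nu n v" and nz: "tdn nu n v (Suc k) ~= 0"
	shows "up (n - 2 * int (Suc k)) (tdn nu n v (Suc k)) = ((of_int (n - 2 * int k) - 1 + nu) / 2) *% tdn nu n v k"
proof -
	let ?m = "n - 2 * int k"
	have e: "n - 2 * int (Suc k) = ?m - 2" by simp
	have m: "of_int ?m - 1 - nu ~= 0" and x: "tdn nu n v k ~= 0" using nz by (auto simp: tdn_Suc)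
	have "up (?m - 2) (dn ?m (tdn nu n v k)) = - (((of_int ?m - 1)\<^sup>2 - nu\<^sup>2) / 4) *% tdn nu n v k"
		using up_dn_cas x tdn_wt_cas[OF v, of k] by blast
	then have "up (?m - 2) (tdn nu n v (Suc k)) = ((- 2 / (of_int ?m - 1 - nu)) * (- (((of_int ?m - 1)\<^sup>2 - nu\<^sup>2) / 4))) *% tdn nu n v k"
		unfolding tdn_Suc up_scaleC[OF dn_wt] by (simp only: scaleC_scaleC)
	also have "(- 2 / (of_int ?m - 1 - nu)) * (- (((of_int ?m - 1)\<^sup>2 - nu\<^sup>2) / 4)) = (of_int ?m - 1 + nu) / 2"
	proof -
		have gen: "a - nu ~= 0 ==> (- 2 / (a - nu)) * (- ((a\<^sup>2 - nu\<^sup>2) / 4)) = (a + nu) / 2" for a :: complex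
		proof -
			assume "a - nu ~= 0"
			moreover have "a\<^sup>2 - nu\<^sup>2 = (a - nu) * (a + nu)" by (simp add: power2_eq_square algebra_simps)
			moreover have "d ~= 0 ==> (- 2 / d) * (- ((d * e) / 4)) = e / 2" for d e :: complex by simp
			ultimately show ?thesis by (simp only:)
		qed
		show ?thesis by (rule gen[OF m])
	qed
	finally show ?thesis unfolding e .
qed

text \<open>The squared norms change by the ratio |a - nu| / |a + nu| with a = m + 1, so that
  boundedness is decided by the sign of \<open>Re nu\<close>.\<close>

lemma norm_tup_Suc:
	assumes v: "v \<in> wt n" "cas nu n v" and m: "of_int (n + 2 * int k) + 1 + nu ~= 0"
	shows "norm (of_int (n + 2 * int k) + 1 + nu) * (norm (tup nu n v (Suc k)))\<^sup>2
		= norm (of_int (n + 2 * int k) + 1 - nu) * (norm (tup nu n v k))\<^sup>2"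
proof -
	define a where "a = complex_of_int (n + 2 * int k) + 1"
	have m': "a + nu ~= 0" using m unfolding a_def .
	let ?x = "tup nu n v k" and ?u = "up (n + 2 * int k) (tup nu n v k)"
	have "cas nu (n + 2 * int k) ?x" using tup_wt_cas[OF v] by blast
	then have "of_real (4 * (norm ?u)\<^sup>2) = (a - nu) * (a + nu) * of_real ((norm ?x)\<^sup>2)"
		unfolding cas_def a_def by (simp add: power2_eq_square square_diff_square_factored mult.commute mult.left_commute)
	then have "norm (complex_of_real (4 * (norm ?u)\<^sup>2)) = norm ((a - nu) * (a + nu) * of_real ((norm ?x)\<^sup>2))" by simp
	then have 4: "4 * (norm ?u)\<^sup>2 = norm (a - nu) * norm (a + nu) * (norm ?x)\<^sup>2"
		by (simp only: norm_mult norm_of_real abs_mult abs_power2 abs_numeral)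
	have "norm (tup nu n v (Suc k)) = 2 / norm (a + nu) * norm ?u"
		by (simp add: tup_Suc norm_divide a_def)
	moreover have "r ~= 0 ==> r * (2 / r * u)\<^sup>2 = 4 * u\<^sup>2 / r" for r u :: real
		by (simp add: power2_eq_square field_simps)
	ultimately have "norm (a + nu) * (norm (tup nu n v (Suc k)))\<^sup>2 = 4 * (norm ?u)\<^sup>2 / norm (a + nu)"
		using m' by simp
	also have "... = norm (a - nu) * (norm ?x)\<^sup>2" unfolding 4 using m' by simp
	finally show ?thesis by (simp add: a_def)
qed

lemma norm_tdn_Suc:
	assumes v: "v \<in> wt n" "cas nu n v" and m: "of_int (n - 2 * int k) - 1 - nu ~= 0"
	shows "norm (of_int (n - 2 * int k) - 1 - nu) * (norm (tdn nu n v (Suc k)))\<^sup>2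
		= norm (of_int (n - 2 * int k) - 1 + nu) * (norm (tdn nu n v k))\<^sup>2"
proof -
	define a where "a = complex_of_int (n - 2 * int k) - 1"
	have m': "a - nu ~= 0" using m unfolding a_def .
	let ?x = "tdn nu n v k" and ?u = "dn (n - 2 * int k) (tdn nu n v k)"
	have "of_real (4 * (norm ?u)\<^sup>2) = (a\<^sup>2 - nu\<^sup>2) * of_real ((norm ?x)\<^sup>2)"
		unfolding a_def using cas_dn tdn_wt_cas[OF v] by blast
	then have "of_real (4 * (norm ?u)\<^sup>2) = (a - nu) * (a + nu) * of_real ((norm ?x)\<^sup>2)"
		by (simp add: power2_eq_square square_diff_square_factored mult.commute mult.left_commute)
	then have "norm (complex_of_real (4 * (norm ?u)\<^sup>2)) = norm ((a - nu) * (a + nu) * of_real ((norm ?x)\<^sup>2))" by simp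
	then have 4: "4 * (norm ?u)\<^sup>2 = norm (a - nu) * norm (a + nu) * (norm ?x)\<^sup>2"
		by (simp only: norm_mult norm_of_real abs_mult abs_power2 abs_numeral)
	have "norm (tdn nu n v (Suc k)) = 2 / norm (a - nu) * norm ?u"
		by (simp add: tdn_Suc norm_divide a_def)
	moreover have "r ~= 0 ==> r * (2 / r * u)\<^sup>2 = 4 * u\<^sup>2 / r" for r u :: real
		by (simp add: power2_eq_square field_simps)
	ultimately have "norm (a - nu) * (norm (tdn nu n v (Suc k)))\<^sup>2 = 4 * (norm ?u)\<^sup>2 / norm (a - nu)"
		using m' by simp
	also have "... = norm (a + nu) * (norm ?x)\<^sup>2" unfolding 4 using m' by simp
	finally show ?thesis by (simp add: a_def)
qed

text \<open>From k >= |n| on, a = n + 2k + 1 is nonnegative, and with \<open>Re nu >= 0\<close> the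
  ratio in \<open>norm_tup_Suc\<close> is at most 1.\<close>

lemma tup_bounded:
	assumes v: "v \<in> wt n" "cas nu n v" and nu: "Re nu >= 0"
	obtains M where "!!k. norm (tup nu n v k) <= M"
proof -
	have "norm (tup nu n v (Suc k)) <= norm (tup nu n v k)" if k: "k >= nat \<bar>n\<bar>" for k
	proof (cases "of_int (n + 2 * int k) + 1 + nu = 0")
		case True
		then show ?thesis by (simp add: tup_Suc)
	next
		case False
		define a where "a = real_of_int (n + 2 * int k) + 1"
		have a: "a >= 0" using k by (simp add: a_def)
		have ca: "complex_of_int (n + 2 * int k) + 1 = of_real a" by (simp add: a_def)
		have "norm (of_real a + nu) * (norm (tup nu n v (Suc k)))\<^sup>2 = norm (of_real a - nu) * (norm (tup nu n v k))\<^sup>2"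
			using norm_tup_Suc[OF v False] unfolding ca .
		also have "... <= norm (of_real a + nu) * (norm (tup nu n v k))\<^sup>2"
			by (intro mult_right_mono norm_of_real_diff_le_add nu a) simp
		finally have "(norm (tup nu n v (Suc k)))\<^sup>2 <= (norm (tup nu n v k))\<^sup>2"
			using False unfolding ca by (simp add: mult_le_cancel_left)
		then show ?thesis by (rule power2_le_imp_le) simp
	qed
	then show ?thesis using eventually_decreasing_bounded[of "nat \<bar>n\<bar>" "%k. norm (tup nu n v k)"] that by blast
qed

lemma tdn_bounded:
	assumes v: "v \<in> wt n" "cas nu n v" and nu: "Re nu >= 0"
	obtains M where "!!k. norm (tdn nu n v k) <= M"
proof -
	have "norm (tdn nu n v (Suc k)) <= norm (tdn nu n v k)" if k: "k >= nat \<bar>n\<bar>" for k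
	proof (cases "of_int (n - 2 * int k) - 1 - nu = 0")
		case True
		then show ?thesis by (simp add: tdn_Suc)
	next
		case False
		define a where "a = - (real_of_int (n - 2 * int k) - 1)"
		have a: "a >= 0" using k by (simp add: a_def)
		have ca: "complex_of_int (n - 2 * int k) - 1 = - of_real a" by (simp add: a_def)
		have nm: "norm (- of_real a - nu) = norm (of_real a + nu)" "norm (- of_real a + nu) = norm (of_real a - nu)"
			by (metis minus_add_distrib norm_minus_cancel uminus_add_conv_diff diff_conv_add_uminus)
				 (metis norm_minus_commute uminus_add_conv_diff)
		have "norm (of_real a + nu) * (norm (tdn nu n v (Suc k)))\<^sup>2 = norm (of_real a - nu) * (norm (tdn nu n v k))\<^sup>2"
			using norm_tdn_Suc[OF v False] unfolding ca nm .
		also have "... <= norm (of_real a + nu) * (norm (tdn nu n v k))\<^sup>2"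
			by (intro mult_right_mono norm_of_real_diff_le_add nu a) simp
		finally have "norm (of_real a + nu) * (norm (tdn nu n v (Suc k)))\<^sup>2 <= norm (of_real a + nu) * (norm (tdn nu n v k))\<^sup>2" .
		moreover have "norm (of_real a + nu) > 0" using False unfolding ca nm(1)[symmetric] by simp
		ultimately have "(norm (tdn nu n v (Suc k)))\<^sup>2 <= (norm (tdn nu n v k))\<^sup>2"
			by (simp only: mult_le_cancel_left_pos)
		then show ?thesis by (rule power2_le_imp_le) simp
	qed
	then show ?thesis using eventually_decreasing_bounded[of "nat \<bar>n\<bar>" "%k. norm (tdn nu n v k)"] that by blast
qed

text \<open>At the top (n + 1)^2 = nu^2. The root n + 1 = nu clashes with n < 0 and
  \<open>Re nu >= 0\<close> unless both sides vanish, so the raising coefficient of the normalised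
  chain is the one that is zero.\<close>

lemma top_weight:
	assumes x: "x \<in> wt n" "x ~= 0" "cas nu n x" "up n x = 0" and nu: "Re nu >= 0" and nt: "\<not> trivial_rep rp"
	shows "of_int n + 1 + nu = 0"
proof -
	have n: "n < 0" by (rule up_zero_neg[OF x(1,2,4) nt])
	have "(of_int n + 1)\<^sup>2 = nu\<^sup>2" using x(2,3,4) by (simp add: cas_def)
	then have "of_int n + 1 = nu \<or> of_int n + 1 = - nu" by (rule power2_eq_iff[THEN iffD1])
	moreover have "of_int n + 1 = nu ==> nu = 0"
	proof -
		assume e: "of_int n + 1 = nu"
		then have "Re nu = of_int n + 1" by (metis Re_complex_of_real of_real_1 of_real_add of_real_of_int_eq)
		then have "n + 1 >= 0" using nu by linarith
		then have "n + 1 = 0" using n by linarith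
		then show "nu = 0" using e by (metis of_int_0 of_int_1 of_int_add)
	qed
	ultimately show ?thesis by (auto simp: eq_neg_iff_add_eq_0)
qed

lemma bottom_weight:
	assumes x: "x \<in> wt n" "x ~= 0" "cas nu n x" "dn n x = 0" and nu: "Re nu >= 0" and nt: "\<not> trivial_rep rp"
	shows "of_int n - 1 - nu = 0"
proof -
	have n: "n > 0" by (rule dn_zero_pos[OF x(1,2,4) nt])
	have "(of_int n - 1)\<^sup>2 = nu\<^sup>2" using x(2,4) cas_dn[OF x(1,3)] by simp
	then have "of_int n - 1 = nu \<or> of_int n - 1 = - nu" by (rule power2_eq_iff[THEN iffD1])
	moreover have "of_int n - 1 = - nu ==> nu = 0"
	proof -
		assume e: "of_int n - 1 = - nu"
		then have "nu = - (of_int n - 1)" by simp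
		then have "nu = of_real (1 - of_int n)" by simp
		then have "Re nu = 1 - of_int n" by (simp only: Re_complex_of_real)
		then have "1 - n >= 0" using nu by linarith
		then have "n = 1" using n by linarith
		then show "nu = 0" using e by simp
	qed
	ultimately show ?thesis by auto
qed

text \<open>Both halves under one integer index, starting at v, to make the coefficient formulas
  uniform.\<close>

definition tower :: "complex => int => 'h => int => 'h" where
	"tower nu n v j = (if j >= 0 then tup nu n v (nat j) else tdn nu n v (nat (- j)))"

lemma tower_0: "tower nu n v 0 = v"
	by (simp add: tower_def tup_0)

lemma tower_neg: "tower nu n v (- int k) = tdn nu n v k"
	by (cases k) (simp_all add: tower_def tup_0 tdn_0 del: of_nat_Suc)

lemma tower_wt_cas:
	assumes "v \<in> wt n" "cas nu n v"
	shows "tower nu n v j \<in> wt (n + 2 * j)" "cas nu (n + 2 * j) (tower nu n v j)"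
	using tup_wt_cas[OF assms, of "nat j"] tdn_wt_cas[OF assms, of "nat (- j)"]
	by (auto simp: tower_def)

lemma tower_bounded:
	assumes "v \<in> wt n" "cas nu n v" "Re nu >= 0"
	obtains M where "!!j. norm (tower nu n v j) <= M"
proof -
	obtain M1 where "!!k. norm (tup nu n v k) <= M1" using tup_bounded[OF assms] by blast
	moreover obtain M2 where "!!k. norm (tdn nu n v k) <= M2" using tdn_bounded[OF assms] by blast
	ultimately have "norm (tower nu n v j) <= max M1 M2" for j by (simp add: tower_def le_max_iff_disj)
	then show ?thesis by (rule that)
qed

text \<open>Nonvanishing matters for negative j: if a division in \<open>tdn\<close> was by zero,
  the vector is 0 although the next one up may not be, and the formula could fail.\<close>

lemma up_tower:
	assumes v: "v \<in> wt n" "cas nu n v" and nz: "tower nu n v j ~= 0"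
	shows "up (n + 2 * j) (tower nu n v j) = ((of_int (n + 2 * j) + 1 + nu) / 2) *% tower nu n v (j + 1)"
proof (cases "j >= 0")
	case True
	then show ?thesis using up_tup[OF v, of "nat j"] by (simp add: tower_def nat_add_distrib)
next
	case False
	define k where "k = nat (- j) - 1"
	have j: "j = - int (Suc k)" using False by (simp add: k_def)
	have t: "tower nu n v j = tdn nu n v (Suc k)" "tower nu n v (j + 1) = tdn nu n v k"
		using tower_neg[of nu n v k] tower_neg[of nu n v "Suc k"] by (simp_all add: j)
	have e1: "of_int (n - 2 * int k) - 1 + nu = of_int (n + 2 * j) + 1 + nu" by (simp add: j)
	have e2: "n - 2 * int (Suc k) = n + 2 * j" by (simp add: j)
	show ?thesis using up_tdn[OF v, of k] nz unfolding t e1 e2 by blast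
qed

lemma dn_tower:
	assumes v: "v \<in> wt n" "cas nu n v" and nz: "tower nu n v j ~= 0"
	shows "dn (n + 2 * j) (tower nu n v j) = - ((of_int (n + 2 * j) - 1 - nu) / 2) *% tower nu n v (j - 1)"
proof (cases "j <= 0")
	case True
	have "tower nu n v j = tdn nu n v (nat (- j))" "tower nu n v (j - 1) = tdn nu n v (Suc (nat (- j)))"
		using True tower_neg[of nu n v "nat (- j)"] tower_neg[of nu n v "Suc (nat (- j))"] by simp_all
	then show ?thesis using dn_tdn[OF v, of "nat (- j)"] True by simp
next
	case False
	define k where "k = nat j - 1"
	have j: "j = int (Suc k)" using False by (simp add: k_def)
	have t: "tower nu n v j = tup nu n v (Suc k)" "tower nu n v (j - 1) = tup nu n v k"
		by (simp add: j tower_def del: of_nat_Suc) (simp add: j tower_def)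
	have "of_int (n + 2 * int k) + 1 - nu = of_int (n + 2 * j) - 1 - nu" by (simp add: j)
	then show ?thesis using dn_tup[OF v, of k] nz unfolding t by (simp add: j)
qed

lemma Hop_tower:
	assumes v: "v \<in> wt n" "cas nu n v" and nz: "tower nu n v j ~= 0"
	shows "Hop (tower nu n v j) = ((of_int (n + 2 * j) + 1 + nu) / 2) *% tower nu n v (j + 1)
		- ((of_int (n + 2 * j) - 1 - nu) / 2) *% tower nu n v (j - 1)"
	using Hop_decomp[OF tower_wt_cas(1)[OF v]] up_tower[OF assms] dn_tower[OF assms] by simp

text \<open>The chain breaks off only where its own coefficient is zero. Hence the differential
  equations for the nonzero members never refer to a vanished neighbour with nonzero weight.\<close>

lemma tower_top:
	assumes v: "v \<in> wt n" "cas nu n v" and nz: "tower nu n v j ~= 0" and z: "tower nu n v (j + 1) = 0"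
		and "Re nu >= 0" "\<not> trivial_rep rp"
	shows "of_int (n + 2 * j) + 1 + nu = 0"
	using top_weight[OF tower_wt_cas(1)[OF v] nz tower_wt_cas(2)[OF v]] up_tower[OF v nz] z assms(5,6) by simp

lemma tower_bottom:
	assumes v: "v \<in> wt n" "cas nu n v" and nz: "tower nu n v j ~= 0" and z: "tower nu n v (j - 1) = 0"
		and "Re nu >= 0" "\<not> trivial_rep rp"
	shows "of_int (n + 2 * j) - 1 - nu = 0"
	using bottom_weight[OF tower_wt_cas(1)[OF v] nz tower_wt_cas(2)[OF v]] dn_tower[OF v nz] z assms(5,6) by simp

end

section \<open>Vector-valued power series and an infinite linear ODE system\<close>

lemma has_derivative_scaleC:
	assumes "(f has_derivative f') (at x)" "(g has_derivative g') (at x)"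
	shows "((%x. f x *% g x) has_derivative (%h. f x *% g' h + f' h *% (g x::'h::complex_hilbert))) (at x)"
	by (rule bounded_bilinear.FDERIV[OF bounded_bilinear_scaleC assms])

text \<open>Radius of convergence at least 1, phrased as absolute summability for direct use as a
  majorant.\<close>

definition ball_summable :: "(nat => complex) => bool" where
	"ball_summable a \<longleftrightarrow> (\<forall>rho. 0 <= rho --> rho < 1 --> summable (%j. norm (a j) * rho ^ j))"

lemma ball_summable_gchoose: "ball_summable (%j. p gchoose j)"
	unfolding ball_summable_def
proof (intro allI impI)
	fix rho :: real assume r: "0 <= rho" "rho < 1"
	have "ereal (norm (complex_of_real rho)) < conv_radius (%n. p gchoose n)"
		using r by (simp add: conv_radius_gchoose)
	then have "summable (%n. norm ((p gchoose n) * complex_of_real rho ^ n))"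
		by (rule abs_summable_in_conv_radius)
	then show "summable (%j. norm (p gchoose j) * rho ^ j)"
		using r by (simp add: norm_mult norm_power)
qed

lemma ball_summable_deriv:
	assumes a: "ball_summable a" and r: "0 <= r" "r < 1"
	shows "summable (%j. norm (a j) * (real j * r ^ (j - 1)))"
proof -
	have "summable (%n. norm (a n) * x ^ n)" if "norm x < 1" for x :: real
		by (rule summable_comparison_test'[where g = "%n. norm (a n) * \<bar>x\<bar> ^ n"])
			(use a that in \<open>auto simp: ball_summable_def abs_mult power_abs\<close>)
	from termdiff_converges[OF _ this, of r] r
	have "summable (%n. norm (a (Suc n)) * (real (Suc n) * r ^ n))"
		by (simp add: diffs_def mult.commute mult.left_commute)
	then show ?thesis by (subst summable_Suc_iff[symmetric]) simp
qed

text \<open>Termwise differentiation with vector coefficients that depend on the point. One majorant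
  N serves the terms and their derivatives; it converges because r < 1 also allows a factor
  j.\<close>

lemma series_has_derivative:
	fixes I :: "nat => 'a::real_normed_vector => 'h::complex_hilbert" and \<zeta> :: "'a => complex"
	assumes S: "open S" "convex S" and x: "x \<in> S"
		and d\<zeta>: "!!x. x \<in> S ==> (\<zeta> has_derivative \<zeta>' x) (at x)"
		and b\<zeta>: "!!x. x \<in> S ==> norm (\<zeta> x) <= r" "!!x h. x \<in> S ==> norm (\<zeta>' x h) <= M * norm h"
		and dI: "!!j x. x \<in> S ==> (I j has_derivative I' j x) (at x)"
		and bI: "!!j x. x \<in> S ==> norm (I j x) <= M" "!!j x h. x \<in> S ==> norm (I' j x h) <= M * norm h"
		and r: "0 <= r" "r < 1" and a: "ball_summable a"
	defines "f' \<equiv> %j x h. (a j * \<zeta> x ^ j) *% I' j x h + (a j * (of_nat j * \<zeta> x ^ (j - 1) * \<zeta>' x h)) *% I j x"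
		and "N \<equiv> %j. norm (a j) * r ^ j * M + norm (a j) * (real j * r ^ (j - 1)) * M * M"
	shows "((%x. \<Sum>j. (a j * \<zeta> x ^ j) *% I j x) has_derivative (%h. \<Sum>j. f' j x h)) (at x)"
		and "summable N" and "summable (%j. f' j x h)" and "norm (\<Sum>j. f' j x h) <= (\<Sum>j. N j) * norm h"
		and "summable (%j. (a j * \<zeta> x ^ j) *% I j x)"
		and "norm (\<Sum>j. (a j * \<zeta> x ^ j) *% I j x) <= (\<Sum>j. N j)"
proof -
	have M0: "M >= 0" using bI(1)[OF x, of 0] norm_ge_zero order_trans by blast
	have s0: "summable (%j. norm (a j) * r ^ j)" using a r by (simp add: ball_summable_def)
	show sN: "summable N"
		unfolding N_def using s0 ball_summable_deriv[OF a r]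
		by (intro summable_add summable_mult2) auto
	have fb: "norm (f' j x h) <= N j * norm h" if x: "x \<in> S" for j x h
	proof -
		have "norm (f' j x h) <= norm (a j) * norm (\<zeta> x) ^ j * norm (I' j x h)
				+ norm (a j) * (real j * norm (\<zeta> x) ^ (j - 1) * norm (\<zeta>' x h)) * norm (I j x)"
			unfolding f'_def by (rule order_trans[OF norm_triangle_ineq]) (simp add: norm_mult norm_power)
		also have "... <= norm (a j) * r ^ j * (M * norm h) + norm (a j) * (real j * r ^ (j - 1) * (M * norm h)) * M"
			using b\<zeta>[OF x] bI[OF x] r M0
			by (intro add_mono mult_mono power_mono mult_nonneg_nonneg) auto
		finally show ?thesis by (simp add: N_def algebra_simps)
	qed
	have tb: "norm ((a j * \<zeta> x ^ j) *% I j x) <= N j" if x: "x \<in> S" for j x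
	proof -
		have "norm ((a j * \<zeta> x ^ j) *% I j x) <= norm (a j) * r ^ j * M"
			using b\<zeta>[OF x] bI[OF x] r by (auto simp: norm_mult norm_power intro!: mult_mono power_mono)
		also have "... <= N j" using r M0 by (simp add: N_def)
		finally show ?thesis .
	qed
	have sf: "summable (%j. f' j x h)" if "x \<in> S" for x h
		by (rule summable_comparison_test'[OF summable_mult2[OF sN] fb[OF that]])
	have st: "summable (%j. (a j * \<zeta> x ^ j) *% I j x)" if "x \<in> S" for x
		by (rule summable_comparison_test'[OF sN tb[OF that]])
	show "summable (%j. f' j x h)" by (rule sf[OF x])
	show "summable (%j. (a j * \<zeta> x ^ j) *% I j x)" by (rule st[OF x])
	show "norm (\<Sum>j. (a j * \<zeta> x ^ j) *% I j x) <= (\<Sum>j. N j)"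
		by (rule norm_suminf_le[OF tb[OF x] sN])
	have "norm (\<Sum>j. f' j x h) <= (\<Sum>j. N j * norm h)"
		by (rule norm_suminf_le[OF fb[OF x] summable_mult2[OF sN]])
	then show "norm (\<Sum>j. f' j x h) <= (\<Sum>j. N j) * norm h"
		by (simp add: suminf_mult2[OF sN])
	have D: "((%x. (a j * \<zeta> x ^ j) *% I j x) has_derivative f' j x) (at x within S)" if "x \<in> S" for j x
	proof -
		have "((%x. a j * \<zeta> x ^ j) has_derivative (%h. a j * (of_nat j * \<zeta>' x h * \<zeta> x ^ (j - 1)))) (at x)"
			by (intro has_derivative_mult_right has_derivative_power d\<zeta> that)
		then have "((%x. a j * \<zeta> x ^ j) has_derivative (%h. a j * (of_nat j * \<zeta> x ^ (j - 1) * \<zeta>' x h))) (at x)"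
			by (simp only: ac_simps)
		from has_derivative_at_withinI[OF has_derivative_scaleC[OF this dI[OF that, of j]]]
		show ?thesis unfolding f'_def .
	qed
	have "\<exists>g. \<forall>x\<in>S. (%j. (a j * \<zeta> x ^ j) *% I j x) sums g x & (g has_derivative (%h. \<Sum>j. f' j x h)) (at x within S)"
	proof (rule has_derivative_series[OF S(2) D _ x summable_sums[OF st[OF x]]])
		fix e :: real assume e: "e > 0"
		obtain n0 where n0: "!!n. n >= n0 ==> norm (\<Sum>i. N (i + n)) < e"
			using suminf_exist_split[OF e sN] by blast
		show "\<forall>\<^sub>F n in sequentially. \<forall>x\<in>S. \<forall>h. norm ((\<Sum>i<n. f' i x h) - (\<Sum>j. f' j x h)) <= e * norm h"
			unfolding eventually_sequentially
		proof (intro exI[of _ n0] allI impI ballI)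
			fix n x h assume n: "n0 <= n" and xS: "x \<in> S"
			have "(\<Sum>i<n. f' i x h) - (\<Sum>j. f' j x h) = - (\<Sum>j. f' (j + n) x h)"
				using suminf_split_initial_segment[OF sf[OF xS, of h], of n] by simp
			then have "norm ((\<Sum>i<n. f' i x h) - (\<Sum>j. f' j x h)) = norm (\<Sum>j. f' (j + n) x h)" by simp
			also have "... <= (\<Sum>j. N (j + n) * norm h)"
			proof -
				have s2: "summable (%j. N (j + n) * norm h)" by (intro summable_mult2 summable_ignore_initial_segment sN)
				show ?thesis by (rule norm_suminf_le[OF fb[OF xS] s2])
			qed
			also have "... = (\<Sum>j. N (j + n)) * norm h"
				by (rule suminf_mult2[symmetric]) (intro summable_ignore_initial_segment sN)
			also have "... <= e * norm h"
				using n0[OF n] by (intro mult_right_mono) auto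
			finally show "norm ((\<Sum>i<n. f' i x h) - (\<Sum>j. f' j x h)) <= e * norm h" .
		qed
	qed
	then obtain g where g0: "\<forall>x\<in>S. (%j. (a j * \<zeta> x ^ j) *% I j x) sums g x
			& (g has_derivative (%h. \<Sum>j. f' j x h)) (at x within S)" by (elim exE)
	have g: "!!x. x \<in> S ==> g x = (\<Sum>j. (a j * \<zeta> x ^ j) *% I j x)"
		"(g has_derivative (%h. \<Sum>j. f' j x h)) (at x within S)"
		using g0 x by (auto dest!: bspec simp: sums_iff)
	from g(2) have "(g has_derivative (%h. \<Sum>j. f' j x h)) (at x)"
		using at_within_open[OF x S(1)] by simp
	then show "((%x. \<Sum>j. (a j * \<zeta> x ^ j) *% I j x) has_derivative (%h. \<Sum>j. f' j x h)) (at x)"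
		by (rule has_derivative_transform_within_open[OF _ S(1) x]) (rule g(1))
qed

text \<open>The coefficients grow linearly with the index, so no Lipschitz constant exists.
  Iterating the integral inequality p times reaches indices up to |j| + p: the product of
  coefficients over p! grows only geometrically, and so does the bound L, which leaves a time step
  of length independent of j and of the starting time.\<close>

lemma ode_tower_step:
	fixes Dl :: "int => real => 'a::real_normed_vector" and N :: "int set" and ka L C b :: real
	assumes deriv: "!!j t. j \<in> N ==> t0 <= t ==> t <= b ==> (Dl j has_vector_derivative Dl' j t) (at t)"
		and bd: "!!j t c. j \<in> N ==> t0 <= t ==> t <= b ==> c >= 0 ==> (!!i. i \<in> N ==> \<bar>i\<bar> <= \<bar>j\<bar> + 1 ==> norm (Dl i t) <= c)
				==> norm (Dl' j t) <= 2 * (ka + of_int \<bar>j\<bar>) * c"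
		and ka: "ka >= 0" and L: "L >= 1" and C: "C >= 0"
		and growth: "!!j t. j \<in> N ==> t0 <= t ==> t <= b ==> norm (Dl j t) <= C * L ^ nat \<bar>j\<bar>"
		and init: "!!j. j \<in> N ==> Dl j t0 = 0"
		and t: "t0 <= t" "t <= b" "t <= t0 + 1 / (8 * L)" and j: "j \<in> N"
	shows "Dl j t = 0"
proof -
	\<comment> \<open>The product of the coefficient bounds met on a path that climbs p indices,
	  divided by the p! of the iterated integral.\<close>
	define P :: "nat => nat => real" where "P J p = (\<Prod>i<p. 2 * (ka + real J + real i)) / fact p" for J p
	have P0: "P J p >= 0" for J p
		using ka by (auto simp: P_def intro!: divide_nonneg_pos prod_nonneg)
	have Pmono: "P J p <= P J' p" if "J <= J'" for J J' p
		unfolding P_def using that ka by (intro divide_right_mono prod_mono) auto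
	have Pstep: "2 * (ka + real J) * P (J + 1) p / real (Suc p) = P J (Suc p)" for J p
	proof -
		have "(\<Prod>i<Suc p. 2 * (ka + real J + real i)) = 2 * (ka + real J) * (\<Prod>i<p. 2 * (ka + real (J + 1) + real i))"
			by (subst prod.lessThan_Suc_shift) (simp add: add.assoc add.left_commute)
		then show ?thesis by (simp add: P_def)
	qed
	\<comment> \<open>Induction on p, for all j and t at once: the estimate for indices up to |j| + 1
	  is inserted in the derivative and integrated.\<close>
	have claim: "norm (Dl j t) <= C * L ^ (nat \<bar>j\<bar> + p) * P (nat \<bar>j\<bar>) p * (t - t0) ^ p"
		if "j \<in> N" "t0 <= t" "t <= b" for j t p
		using that
	proof (induct p arbitrary: j t)
		case 0
		then show ?case using growth by (simp add: P_def)
	next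
		case (Suc p)
		let ?J = "nat \<bar>j\<bar>"
		define K where "K = C * L ^ (?J + Suc p) * P (?J + 1) p"
		have K0: "K >= 0" using C L P0 by (simp add: K_def)
		have db: "norm (Dl' j s) <= 2 * (ka + real ?J) * (K * (s - t0) ^ p)" if s: "t0 <= s" "s <= b" for s
		proof -
			have "norm (Dl' j s) <= 2 * (ka + of_int \<bar>j\<bar>) * (K * (s - t0) ^ p)"
			proof (rule bd[OF Suc.prems(1) s])
				show "0 <= K * (s - t0) ^ p" using K0 s by simp
				fix i assume i: "i \<in> N" "\<bar>i\<bar> <= \<bar>j\<bar> + 1"
				then have J: "nat \<bar>i\<bar> <= ?J + 1" by linarith
				have "norm (Dl i s) <= C * L ^ (nat \<bar>i\<bar> + p) * P (nat \<bar>i\<bar>) p * (s - t0) ^ p"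
					by (rule Suc.hyps[OF i(1) s])
				also have "... <= K * (s - t0) ^ p"
					unfolding K_def using J L C P0 s Pmono[OF J, of p]
					by (intro mult_right_mono mult_mono mult_left_mono power_increasing) auto
				finally show "norm (Dl i s) <= K * (s - t0) ^ p" .
			qed
			then show ?thesis by simp
		qed
		define Z where "Z = 2 * (ka + real ?J) * K / real (Suc p)"
		have "norm (Dl j t) <= Z * (t - t0) ^ Suc p"
		proof (cases "t = t0")
			case True
			then show ?thesis using init[OF Suc.prems(1)] by simp
		next
			case False
			then have "t0 < t" using Suc.prems by simp
			have "norm (Dl j t - Dl j t0) <= Z * (t - t0) ^ Suc p - Z * (t0 - t0) ^ Suc p"
			proof (rule differentiable_bound_general[where f' = "Dl' j" and \<phi>' = "%s. 2 * (ka + real ?J) * (K * (s - t0) ^ p)"])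
				show "t0 < t" by fact
				have "\<forall>s\<in>{t0..t}. isCont (Dl j) s"
					using deriv[OF Suc.prems(1)] Suc.prems has_vector_derivative_continuous by fastforce
				then show "continuous_on {t0..t} (Dl j)" by (rule continuous_at_imp_continuous_on)
				show "continuous_on {t0..t} (%s. Z * (s - t0) ^ Suc p)" by (intro continuous_intros)
				fix s assume s: "t0 < s" "s < t"
				show "(Dl j has_vector_derivative Dl' j s) (at s)" using deriv[OF Suc.prems(1)] s Suc.prems by simp
				have "((%s. Z * (s - t0) ^ Suc p) has_real_derivative Z * (real (Suc p) * (s - t0) ^ p)) (at s)"
					by (rule derivative_eq_intros refl | simp)+
				moreover have "Z * (real (Suc p) * (s - t0) ^ p) = 2 * (ka + real ?J) * (K * (s - t0) ^ p)"
					by (simp add: Z_def)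
				ultimately show "((%s. Z * (s - t0) ^ Suc p) has_vector_derivative 2 * (ka + real ?J) * (K * (s - t0) ^ p)) (at s)"
					by (simp only: has_real_derivative_iff_has_vector_derivative)
				show "norm (Dl' j s) <= 2 * (ka + real ?J) * (K * (s - t0) ^ p)"
					using db s Suc.prems by simp
			qed
			then show ?thesis using init[OF Suc.prems(1)] by simp
		qed
		also have "Z = C * L ^ (?J + Suc p) * (2 * (ka + real ?J) * P (?J + 1) p / real (Suc p))"
			unfolding Z_def K_def by (simp only: times_divide_eq_right ac_simps)
		finally show ?case unfolding Pstep .
	qed
	have ratio_bound: "x = q * y ==> q <= 1/2 ==> q >= 0 ==> \<bar>x\<bar> <= 1/2 * \<bar>y\<bar>" for x q y :: real
		using mult_right_mono[of q "1/2" "\<bar>y\<bar>"] by (simp add: abs_mult)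
	define J where "J = nat \<bar>j\<bar>"
	define u where "u p = C * L ^ (J + p) * P J p * (t - t0) ^ p" for p
	\<comment> \<open>From p >= ka + J on the coefficient factor is at most 4, and
	  \<open>L * (t - t0) <= 1/8\<close>, so the ratio is at most 1/2. The terms tend to 0 and bound
	  the norm for every p.\<close>
	have "summable u"
	proof (rule summable_ratio_test[where c = "1/2" and N = "nat \<lceil>ka + real J\<rceil>"])
		fix p assume p: "nat \<lceil>ka + real J\<rceil> <= p"
		have "u (Suc p) = (L * (t - t0) * (2 * (ka + real J + real p) / real (Suc p))) * u p"
			by (simp add: u_def P_def)
		moreover have "L * (t - t0) * (2 * (ka + real J + real p) / real (Suc p)) <= 1/2"
		proof -
			have "ka + real J <= real p" using p ka by linarith
			then have "2 * (ka + real J + real p) / real (Suc p) <= 4" by (simp add: field_simps)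
			moreover have "L * (t - t0) <= 1/8" using t L by (simp add: field_simps)
			moreover have "0 <= 2 * (ka + real J + real p) / real (Suc p)" using ka by simp
			ultimately have "L * (t - t0) * (2 * (ka + real J + real p) / real (Suc p)) <= 1/8 * 4"
				using t L by (intro mult_mono) auto
			then show ?thesis by simp
		qed
		moreover have "L * (t - t0) * (2 * (ka + real J + real p) / real (Suc p)) >= 0"
			using t L ka by simp
		ultimately show "norm (u (Suc p)) <= 1/2 * norm (u p)"
			using ratio_bound unfolding real_norm_def by blast
	qed simp
	then have "u \<longlonglongrightarrow> 0" by (rule summable_LIMSEQ_zero)
	moreover have "norm (Dl j t) <= u p" for p
		using claim[OF j t(1,2), of p] by (simp add: u_def J_def)
	ultimately have "norm (Dl j t) <= 0" by (intro LIMSEQ_le_const) auto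
	then show ?thesis by simp
qed

text \<open>The step of length 1/(8L) is repeated; it does not shrink because the growth hypothesis
  is uniform on the whole interval.\<close>

lemma ode_tower_unique:
	fixes Dl :: "int => real => 'a::real_normed_vector" and N :: "int set" and ka L C b :: real
	assumes deriv: "!!j t. j \<in> N ==> 0 <= t ==> t <= b ==> (Dl j has_vector_derivative Dl' j t) (at t)"
		and bd: "!!j t c. j \<in> N ==> 0 <= t ==> t <= b ==> c >= 0 ==> (!!i. i \<in> N ==> \<bar>i\<bar> <= \<bar>j\<bar> + 1 ==> norm (Dl i t) <= c)
				==> norm (Dl' j t) <= 2 * (ka + of_int \<bar>j\<bar>) * c"
		and ka: "ka >= 0" and L: "L >= 1" and C: "C >= 0"
		and growth: "!!j t. j \<in> N ==> 0 <= t ==> t <= b ==> norm (Dl j t) <= C * L ^ nat \<bar>j\<bar>"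
		and init: "!!j. j \<in> N ==> Dl j 0 = 0" and b: "b >= 0" and j: "j \<in> N"
	shows "Dl j b = 0"
proof -
	define dl where "dl = 1 / (8 * L)"
	have dl: "dl > 0" using L by (simp add: dl_def)
	have "\<forall>j\<in>N. \<forall>t. 0 <= t --> t <= b --> t <= real k * dl --> Dl j t = 0" for k
	proof (induct k)
		case 0
		then show ?case using init by auto
	next
		case (Suc k)
		show ?case
		proof (intro ballI allI impI)
			fix j t assume j: "j \<in> N" and t: "0 <= t" "t <= b" "t <= real (Suc k) * dl"
			show "Dl j t = 0"
			proof (cases "t <= real k * dl")
				case True
				then show ?thesis using Suc j t by blast
			next
				case False
				have k0: "0 <= real k * dl" using dl by simp
				show ?thesis
				proof (rule ode_tower_step[where N = N and Dl' = Dl' and b = b and ka = ka and L = L and C = C and Dl = Dl and ?t0.0 = "real k * dl"])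
					show "t <= real k * dl + 1 / (8 * L)" using t(3) by (simp add: dl_def algebra_simps add_divide_distrib)
					show "Dl j (real k * dl) = 0" if "j \<in> N" for j using Suc that k0 False t by simp
				next
					fix j t assume "j \<in> N" "real k * dl <= t" "t <= b"
					then show "(Dl j has_vector_derivative Dl' j t) (at t)" using deriv k0 by simp
				next
					fix j t assume "j \<in> N" "real k * dl <= t" "t <= b"
					then show "norm (Dl j t) <= C * L ^ nat \<bar>j\<bar>" using growth k0 by simp
				next
					fix j t c assume a: "j \<in> N" "real k * dl <= t" "t <= b" "0 <= c"
						"!!i. i \<in> N ==> \<bar>i\<bar> <= \<bar>j\<bar> + 1 ==> norm (Dl i t) <= c"
					have "0 <= t" using a(2) k0 by linarith
					then show "norm (Dl' j t) <= 2 * (ka + of_int \<bar>j\<bar>) * c" by (rule bd[OF a(1) _ a(3,4,5)])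
				qed (use ka L C j t False in auto)
			qed
		qed
	qed
	moreover obtain k where "b / dl <= real k" using real_arch_simple by blast
	then have "b <= real k * dl" using dl by (simp add: field_simps)
	ultimately show ?thesis using b j by blast
qed

text \<open>
	\<open>inner_ser Q w j y\<close> is the image of \<open>X\<^sup>j (1 + y X)\<^sup>Q\<close>, and \<open>outer_ser P Q w j x y\<close> that of
	\<open>X\<^sup>j (1 + x / X)\<^sup>P (1 + y X)\<^sup>Q\<close>, under \<open>X\<^sup>i \<mapsto> w i\<close>.
\<close>

definition inner_ser :: "complex => (int => 'h::complex_hilbert) => int => complex => 'h" where
	"inner_ser Q w j y = (\<Sum>k. ((Q gchoose k) * y ^ k) *% w (j + int k))"

definition outer_ser :: "complex => complex => (int => 'h::complex_hilbert) => int => complex => complex => 'h" where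
	"outer_ser P Q w j x y = (\<Sum>i. ((P gchoose i) * x ^ i) *% inner_ser Q w (j - int i) y)"

text \<open>The majorant of (1 + X)^P at radius rho; it bounds every series below in which the
  vectors are bounded.\<close>

definition absN :: "complex => real => real" where
	"absN P rho = (\<Sum>j. norm (P gchoose j) * rho ^ j)"

lemma absN_summable: "0 <= rho ==> rho < 1 ==> summable (%j. norm (P gchoose j :: complex) * rho ^ j)"
	using ball_summable_gchoose[of P] by (simp add: ball_summable_def)

lemma absN_nonneg: "0 <= rho ==> rho < 1 ==> 0 <= absN P rho"
	unfolding absN_def by (intro suminf_nonneg absN_summable) auto

lemma ser_summable:
	fixes x P :: complex
	assumes "norm x < 1" "!!i::nat. norm (u i) <= M"
	shows "summable (%i. ((P gchoose i) * x ^ i) *% (u i::'h::complex_hilbert))"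
		and "norm (\<Sum>i. ((P gchoose i) * x ^ i) *% u i) <= absN P (norm x) * M"
proof -
	have s: "summable (%i. norm (P gchoose i) * norm x ^ i * M)"
		using absN_summable[of "norm x" P] assms(1) by (intro summable_mult2) auto
	have b: "norm (((P gchoose i) * x ^ i) *% u i) <= norm (P gchoose i) * norm x ^ i * M" for i
		using assms(2)[of i] by (simp add: norm_mult norm_power mult_left_mono)
	show "summable (%i. ((P gchoose i) * x ^ i) *% u i)"
		by (rule summable_comparison_test'[OF s b])
	have "norm (\<Sum>i. ((P gchoose i) * x ^ i) *% u i) <= (\<Sum>i. norm (P gchoose i) * norm x ^ i * M)"
		by (rule norm_suminf_le[OF b s])
	then show "norm (\<Sum>i. ((P gchoose i) * x ^ i) *% u i) <= absN P (norm x) * M"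
		using suminf_mult2[OF absN_summable[of "norm x" P], of M] assms(1) by (simp add: absN_def)
qed

text \<open>Pascal's rule, i.e. (1 + xX)^(P+1) = (1 + xX)^P (1 + xX) with X acting as the shift of
  u.\<close>

lemma gchoose_ser_step:
	fixes x P :: complex
	assumes "norm x < 1" "!!i::nat. norm (u i) <= M"
	shows "(\<Sum>i. (((P + 1) gchoose i) * x ^ i) *% (u i::'h::complex_hilbert))
		= (\<Sum>i. ((P gchoose i) * x ^ i) *% u i) + x *% (\<Sum>i. ((P gchoose i) * x ^ i) *% u (Suc i))"
proof -
	have s1: "summable (%i. (((P + 1) gchoose i) * x ^ i) *% u i)" "summable (%i. ((P gchoose i) * x ^ i) *% u i)"
		"summable (%i. ((P gchoose i) * x ^ i) *% u (Suc i))"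
		by (rule ser_summable[OF assms(1)], rule assms(2))+
	have "(\<Sum>i. (((P + 1) gchoose i) * x ^ i) *% u i)
			= u 0 + (\<Sum>i. (((P + 1) gchoose Suc i) * x ^ Suc i) *% u (Suc i))"
		using suminf_split_head[OF s1(1)] by simp
	also have "(%i. (((P + 1) gchoose Suc i) * x ^ Suc i) *% u (Suc i))
			= (%i. ((P gchoose Suc i) * x ^ Suc i) *% u (Suc i) + x *% (((P gchoose i) * x ^ i) *% u (Suc i)))"
	proof
		fix i
		have "((P + 1) gchoose Suc i) * x ^ Suc i = (P gchoose Suc i) * x ^ Suc i + x * ((P gchoose i) * x ^ i)"
			unfolding gbinomial_Suc_Suc by (simp add: algebra_simps)
		then show "(((P + 1) gchoose Suc i) * x ^ Suc i) *% u (Suc i)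
				= ((P gchoose Suc i) * x ^ Suc i) *% u (Suc i) + x *% (((P gchoose i) * x ^ i) *% u (Suc i))"
			by (simp only: scaleC_add_left scaleC_scaleC)
	qed
	also have "(\<Sum>i. ((P gchoose Suc i) * x ^ Suc i) *% u (Suc i) + x *% (((P gchoose i) * x ^ i) *% u (Suc i)))
			= (\<Sum>i. ((P gchoose Suc i) * x ^ Suc i) *% u (Suc i)) + x *% (\<Sum>i. ((P gchoose i) * x ^ i) *% u (Suc i))"
	proof -
		have sA: "summable (%i. ((P gchoose Suc i) * x ^ Suc i) *% u (Suc i))"
			using s1(2) by (rule summable_Suc_iff[THEN iffD2])
		have sB: "summable (%i. x *% (((P gchoose i) * x ^ i) *% u (Suc i)))"
			by (rule bounded_linear.summable[OF bounded_linear_scaleC_right s1(3)])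
		show ?thesis
			by (simp only: suminf_add[OF sA sB, symmetric] bounded_linear.suminf[OF bounded_linear_scaleC_right s1(3)])
	qed
	also have "u 0 + ((\<Sum>i. ((P gchoose Suc i) * x ^ Suc i) *% u (Suc i)) + x *% (\<Sum>i. ((P gchoose i) * x ^ i) *% u (Suc i)))
			= (\<Sum>i. ((P gchoose i) * x ^ i) *% u i) + x *% (\<Sum>i. ((P gchoose i) * x ^ i) *% u (Suc i))"
		using suminf_split_head[OF s1(2)] by simp
	finally show ?thesis .
qed

text \<open>The absorption identity: the derivative of (1 + xX)^P is P X (1 + xX)^(P-1), again with
  X as the shift.\<close>

lemma gchoose_ser_deriv:
	fixes x P :: complex
	assumes "norm x < 1" "!!i::nat. norm (u i) <= M"
	shows "(\<Sum>i. ((P gchoose i) * (of_nat i * x ^ (i - 1) * d)) *% (u i::'h::complex_hilbert))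
		= (P * d) *% (\<Sum>i. (((P - 1) gchoose i) * x ^ i) *% u (Suc i))"
		and "summable (%i. ((P gchoose i) * (of_nat i * x ^ (i - 1) * d)) *% u i)"
proof -
	have s: "summable (%i. (((P - 1) gchoose i) * x ^ i) *% u (Suc i))"
		by (rule ser_summable[OF assms(1)]) (rule assms(2))
	have e: "((P gchoose Suc i) * (of_nat (Suc i) * x ^ (Suc i - 1) * d)) *% u (Suc i)
			= (P * d) *% ((((P - 1) gchoose i) * x ^ i) *% u (Suc i))" for i
	proof -
		have "(P gchoose Suc i) * (of_nat (Suc i) * x ^ (Suc i - 1) * d) = (of_nat (Suc i) * (P gchoose Suc i)) * (x ^ i * d)"
			by (simp only: diff_Suc_1 ac_simps)
		also have "... = P * d * (((P - 1) gchoose i) * x ^ i)" by (simp only: gbinomial_absorption ac_simps)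
		finally show ?thesis by (simp only: scaleC_scaleC)
	qed
	have "summable (%i. ((P gchoose Suc i) * (of_nat (Suc i) * x ^ (Suc i - 1) * d)) *% u (Suc i))"
		unfolding e by (rule bounded_linear.summable[OF bounded_linear_scaleC_right s])
	then show sm: "summable (%i. ((P gchoose i) * (of_nat i * x ^ (i - 1) * d)) *% u i)"
		using summable_Suc_iff[of "%i. ((P gchoose i) * (of_nat i * x ^ (i - 1) * d)) *% u i"] by blast
	show "(\<Sum>i. ((P gchoose i) * (of_nat i * x ^ (i - 1) * d)) *% u i)
		= (P * d) *% (\<Sum>i. (((P - 1) gchoose i) * x ^ i) *% u (Suc i))"
	proof -
		have "(\<Sum>i. ((P gchoose i) * (of_nat i * x ^ (i - 1) * d)) *% u i)
				= (\<Sum>i. ((P gchoose Suc i) * (of_nat (Suc i) * x ^ (Suc i - 1) * d)) *% u (Suc i))"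
			using suminf_split_head[OF sm] by simp
		also have "... = (P * d) *% (\<Sum>i. (((P - 1) gchoose i) * x ^ i) *% u (Suc i))"
			unfolding e by (rule bounded_linear.suminf[OF bounded_linear_scaleC_right s, symmetric])
		finally show ?thesis .
	qed
qed

section \<open>Holomorphic families and the explicit extensions\<close>

text \<open>Lets scalar functions be treated by the same lemmas as vector-valued ones.\<close>

instantiation complex :: complex_hilbert
begin

definition scaleC_complex :: "complex => complex => complex" where
	[simp]: "scaleC_complex c x = c * x"

definition cinner_complex :: "complex => complex => complex" where
	"cinner_complex x y = x * cnj y"

instance
	by standard (auto simp: cinner_complex_def algebra_simps scaleR_conv_of_real mult_cnj_norm)

end

lemma cay_add: "cayA (x + y) = cayA x + cayA y" "cayB (x + y) = cayB x + cayB y"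
	"cayC (x + y) = cayC x + cayC y" "cayD (x + y) = cayD x + cayD y"
	by (simp_all add: cay_defs algebra_simps add_divide_distrib diff_divide_distrib)

lemma cay_smult: "cayA (smult_matrix c x) = c * cayA x" "cayB (smult_matrix c x) = c * cayB x"
	"cayC (smult_matrix c x) = c * cayC x" "cayD (smult_matrix c x) = c * cayD x"
	by (simp_all add: cay_defs smult_matrix_def map_matrix_def algebra_simps add_divide_distrib diff_divide_distrib)

lemma scaleR_smult: "r *\<^sub>R x = smult_matrix (of_real r) x"
	by (simp add: vec_eq_iff smult_matrix_def map_matrix_def scaleR_conv_of_real[where 'a = complex])

lemma cay_bounded_linear: "bounded_linear cayA" "bounded_linear cayB" "bounded_linear cayC" "bounded_linear cayD"
	by (auto intro!: linear_conv_bounded_linear[THEN iffD1] linearI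
			simp: cay_add scaleR_smult cay_smult scaleR_conv_of_real)

text \<open>A family holomorphic with bounds on values and derivatives that are locally uniform in
  the index as well. This uniformity is what \<open>fholo_series\<close> needs, since it sums over
  the index, and it is reproduced there, so the two nested series can be handled one after the
  other.\<close>

definition fholo :: "(complex^2^2) set => (int => complex^2^2 => 'h::complex_hilbert) => bool" where
	"fholo U I \<longleftrightarrow> (\<forall>z\<in>U. \<exists>e>0. \<exists>M I'. ball z e \<subseteq> U & (\<forall>m. \<forall>x\<in>ball z e.
		 (I m has_derivative I' m x) (at x) & (\<forall>c Y. I' m x (smult_matrix c Y) = c *% I' m x Y) &
		 norm (I m x) <= M & (\<forall>Y. norm (I' m x Y) <= M * norm Y)))"

lemma fholoE:
	assumes "fholo U I" "z \<in> U"
	obtains e M I' where "e > 0" "M >= 0" "ball z e \<subseteq> U"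
		"\<forall>m x. x \<in> ball z e --> (I m has_derivative I' m x) (at x)"
		"\<forall>m x c Y. x \<in> ball z e --> I' m x (smult_matrix c Y) = c *% I' m x Y"
		"\<forall>m x. x \<in> ball z e --> norm (I m x) <= M"
		"\<forall>m x Y. x \<in> ball z e --> norm (I' m x Y) <= M * norm Y"
proof -
	from assms(1)[unfolded fholo_def, rule_format, OF assms(2)]
	obtain e M I' where e: "e > 0" "ball z e \<subseteq> U" and a: "\<forall>m. \<forall>x\<in>ball z e.
		 (I m has_derivative I' m x) (at x) & (\<forall>c Y. I' m x (smult_matrix c Y) = c *% I' m x Y) &
		 norm (I m x) <= M & (\<forall>Y. norm (I' m x Y) <= M * norm Y)" by (elim exE conjE)
	have "norm (I 0 z) <= M" using a e(1) by simp
	then have "M >= 0" using norm_ge_zero order_trans by blast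
	then show ?thesis using that[of e M I'] e a by simp
qed

lemma fholoI:
	assumes "!!z. z \<in> U ==> \<exists>e>0. \<exists>M I'. ball z e \<subseteq> U & (\<forall>m. \<forall>x\<in>ball z e.
		 (I m has_derivative I' m x) (at x) & (\<forall>c Y. I' m x (smult_matrix c Y) = c *% I' m x Y) &
		 norm (I m x) <= M & (\<forall>Y. norm (I' m x Y) <= M * norm Y))"
	shows "fholo U I"
	using assms by (simp add: fholo_def)

lemma fholo_imp_complex_differentiable: "fholo U I ==> z \<in> U ==> complex_differentiable_at (I m) z"
proof -
	assume "fholo U I" "z \<in> U"
	then obtain e M I' where f0: "e > 0" "M >= 0" "ball z e \<subseteq> U"
		"\<forall>m x. x \<in> ball z e --> (I m has_derivative I' m x) (at x)"
		"\<forall>m x c Y. x \<in> ball z e --> I' m x (smult_matrix c Y) = c *% I' m x Y"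
		"\<forall>m x. x \<in> ball z e --> norm (I m x) <= M"
		"\<forall>m x Y. x \<in> ball z e --> norm (I' m x Y) <= M * norm Y"
		by (rule fholoE)
	have "z \<in> ball z e" using f0(1) by simp
	then show ?thesis unfolding complex_differentiable_at_def using f0(4,5)
		by (intro exI[of _ "I' m z"] conjI allI) auto
qed

lemma fholo_const:
	assumes "open U" "!!m. norm (w m) <= M"
	shows "fholo U (%m z. w m)"
proof (rule fholoI)
	fix z assume "z \<in> U"
	then obtain e where "e > 0" "ball z e \<subseteq> U" using assms(1) open_contains_ball by blast
	moreover have "M >= 0" using assms(2)[of 0] norm_ge_zero order_trans by blast
	ultimately show "\<exists>e>0. \<exists>M I'. ball z e \<subseteq> U & (\<forall>m. \<forall>x\<in>ball z e.
		 ((%z. w m) has_derivative I' m x) (at x) & (\<forall>c Y. I' m x (smult_matrix c Y) = c *% I' m x Y) &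
		 norm (w m) <= M & (\<forall>Y. norm (I' m x Y) <= M * norm Y))"
		using assms(2) by (intro exI[of _ e] conjI exI[of _ M] exI[of _ "%m x Y. 0"]) auto
qed

lemma fholo_linear:
	fixes f :: "complex^2^2 => complex"
	assumes "open U" "bounded_linear f" "!!c Y. f (smult_matrix c Y) = c * f Y"
	shows "fholo U (%m. f)"
proof (rule fholoI)
	fix z assume "z \<in> U"
	then obtain e where e: "e > 0" "ball z e \<subseteq> U" using assms(1) open_contains_ball by blast
	obtain K where K: "!!x. norm (f x) <= norm x * K" using bounded_linear.bounded[OF assms(2)] by blast
	have K0: "\<bar>K\<bar> >= K" by simp
	define M where "M = \<bar>K\<bar> * (norm z + e + 1)"
	have b1: "norm (f Y) <= M * norm Y" for Y
	proof -
		have "norm (f Y) <= norm Y * \<bar>K\<bar>" using K[of Y] mult_left_mono[OF K0, of "norm Y"] by simp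
		also have "... <= M * norm Y"
		proof -
			have "\<bar>K\<bar> <= M" using mult_left_mono[of 1 "norm z + e + 1" "\<bar>K\<bar>"] e(1) by (simp add: M_def)
			from mult_right_mono[OF this norm_ge_zero, of Y] show ?thesis by (simp only: mult.commute)
		qed
		finally show ?thesis .
	qed
	have b2: "norm (f x) <= M" if "x \<in> ball z e" for x
	proof -
		have "norm x <= norm z + e + 1" using that norm_triangle_sub[of x z] by (simp add: dist_norm norm_minus_commute)
		then have "norm x * \<bar>K\<bar> <= M" unfolding M_def by (subst mult.commute) (rule mult_left_mono, auto)
		then show ?thesis using K[of x] mult_left_mono[OF K0, of "norm x"] by simp
	qed
	show "\<exists>e>0. \<exists>M I'. ball z e \<subseteq> U & (\<forall>m. \<forall>x\<in>ball z e.
		 (f has_derivative I' m x) (at x) & (\<forall>c Y. I' m x (smult_matrix c Y) = c *% I' m x Y) &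
		 norm (f x) <= M & (\<forall>Y. norm (I' m x Y) <= M * norm Y))"
		using e b1 b2 assms(3) bounded_linear_imp_has_derivative[OF assms(2)]
		by (intro exI[of _ e] conjI exI[of _ M] exI[of _ "%m x. f"]) auto
qed

lemma fholo_cay:
	assumes "open U"
	shows "fholo U (%m. cayA)" "fholo U (%m. cayB)" "fholo U (%m. cayC)" "fholo U (%m. cayD)"
	by (rule fholo_linear[OF assms]; simp add: cay_bounded_linear cay_smult)+

lemma fholo_scale:
	fixes f :: "complex^2^2 => complex"
	assumes "fholo U (%m. f)" "fholo U I"
	shows "fholo U (%m z. f z *% I m z)"
proof (rule fholoI)
	fix z assume z: "z \<in> U"
	obtain e1 M1 f' where f0: "e1 > 0" "M1 >= 0" "ball z e1 \<subseteq> U"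
		"\<forall>(m::int) x. x \<in> ball z e1 --> (f has_derivative f' m x) (at x)"
		"\<forall>m x c Y. x \<in> ball z e1 --> f' m x (smult_matrix c Y) = c *% f' m x Y"
		"\<forall>(m::int) x. x \<in> ball z e1 --> norm (f x) <= M1"
		"\<forall>m x Y. x \<in> ball z e1 --> norm (f' m x Y) <= M1 * norm Y"
		by (rule fholoE[OF assms(1) z])
	note f = f0(1-3) f0(4)[rule_format] f0(5)[rule_format] f0(6)[rule_format] f0(7)[rule_format]
	obtain e2 M2 I' where I0: "e2 > 0" "M2 >= 0" "ball z e2 \<subseteq> U"
		"\<forall>m x. x \<in> ball z e2 --> (I m has_derivative I' m x) (at x)"
		"\<forall>m x c Y. x \<in> ball z e2 --> I' m x (smult_matrix c Y) = c *% I' m x Y"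
		"\<forall>m x. x \<in> ball z e2 --> norm (I m x) <= M2"
		"\<forall>m x Y. x \<in> ball z e2 --> norm (I' m x Y) <= M2 * norm Y"
		by (rule fholoE[OF assms(2) z])
	note I = I0(1-3) I0(4)[rule_format] I0(5)[rule_format] I0(6)[rule_format] I0(7)[rule_format]
	define e where "e = min e1 e2"
	define D where "D m x h = f x *% I' m x h + f' 0 x h *% I m x" for m x h
	have *: "((%z. f z *% I m z) has_derivative D m x) (at x) & (\<forall>c Y. D m x (smult_matrix c Y) = c *% D m x Y) &
			norm (f x *% I m x) <= M1 * M2 + M1 * M2 & (\<forall>Y. norm (D m x Y) <= (M1 * M2 + M1 * M2) * norm Y)"
		if x: "x \<in> ball z e" for m x
	proof (intro conjI allI)
		have x1: "x \<in> ball z e1" and x2: "x \<in> ball z e2" using x by (auto simp: e_def)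
		show "((%z. f z *% I m z) has_derivative D m x) (at x)"
			unfolding D_def by (rule has_derivative_scaleC[OF f(4)[OF x1] I(4)[OF x2]])
		show "D m x (smult_matrix c Y) = c *% D m x Y" for c Y
			by (simp add: D_def f(5)[OF x1] I(5)[OF x2] scaleC_add_right scaleC_scaleC mult.commute)
		have "norm (f x) * norm (I m x) <= M1 * M2" using f(2,6) I(6) x1 x2 by (intro mult_mono) auto
		then show "norm (f x *% I m x) <= M1 * M2 + M1 * M2" using mult_nonneg_nonneg[OF f(2) I(2)] by simp
		fix Y
		have "norm (D m x Y) <= norm (f x) * norm (I' m x Y) + norm (f' 0 x Y) * norm (I m x)"
			unfolding D_def by (rule order_trans[OF norm_triangle_ineq]) simp
		also have "... <= M1 * (M2 * norm Y) + (M1 * norm Y) * M2"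
			using f(2,6,7) I(6,7) x1 x2 by (intro add_mono mult_mono) auto
		finally show "norm (D m x Y) <= (M1 * M2 + M1 * M2) * norm Y" by (simp add: algebra_simps)
	qed
	have "e > 0" "ball z e \<subseteq> U" using f(1,3) I(1) by (auto simp: e_def)
	then show "\<exists>e>0. \<exists>M I'. ball z e \<subseteq> U & (\<forall>m. \<forall>x\<in>ball z e.
		 ((%z. f z *% I m z) has_derivative I' m x) (at x) & (\<forall>c Y. I' m x (smult_matrix c Y) = c *% I' m x Y) &
		 norm (f x *% I m x) <= M & (\<forall>Y. norm (I' m x Y) <= M * norm Y))"
		using * by (intro exI[of _ e] conjI exI[of _ "M1 * M2 + M1 * M2"] exI[of _ D]) blast+
qed

lemma fholo_add:
	assumes "fholo U I" "fholo U J"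
	shows "fholo U (%m z. I m z + J m z)"
proof (rule fholoI)
	fix z assume z: "z \<in> U"
	obtain e1 M1 I' where f0: "e1 > 0" "M1 >= 0" "ball z e1 \<subseteq> U"
		"\<forall>m x. x \<in> ball z e1 --> (I m has_derivative I' m x) (at x)"
		"\<forall>m x c Y. x \<in> ball z e1 --> I' m x (smult_matrix c Y) = c *% I' m x Y"
		"\<forall>m x. x \<in> ball z e1 --> norm (I m x) <= M1"
		"\<forall>m x Y. x \<in> ball z e1 --> norm (I' m x Y) <= M1 * norm Y"
		by (rule fholoE[OF assms(1) z])
	note f = f0(1-3) f0(4)[rule_format] f0(5)[rule_format] f0(6)[rule_format] f0(7)[rule_format]
	obtain e2 M2 J' where I0: "e2 > 0" "M2 >= 0" "ball z e2 \<subseteq> U"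
		"\<forall>m x. x \<in> ball z e2 --> (J m has_derivative J' m x) (at x)"
		"\<forall>m x c Y. x \<in> ball z e2 --> J' m x (smult_matrix c Y) = c *% J' m x Y"
		"\<forall>m x. x \<in> ball z e2 --> norm (J m x) <= M2"
		"\<forall>m x Y. x \<in> ball z e2 --> norm (J' m x Y) <= M2 * norm Y"
		by (rule fholoE[OF assms(2) z])
	note I = I0(1-3) I0(4)[rule_format] I0(5)[rule_format] I0(6)[rule_format] I0(7)[rule_format]
	define e where "e = min e1 e2"
	define D where "D m x h = I' m x h + J' m x h" for m x h
	have *: "((%z. I m z + J m z) has_derivative D m x) (at x) & (\<forall>c Y. D m x (smult_matrix c Y) = c *% D m x Y) &
			norm (I m x + J m x) <= M1 + M2 & (\<forall>Y. norm (D m x Y) <= (M1 + M2) * norm Y)"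
		if x: "x \<in> ball z e" for m x
	proof (intro conjI allI)
		have x1: "x \<in> ball z e1" and x2: "x \<in> ball z e2" using x by (auto simp: e_def)
		show "((%z. I m z + J m z) has_derivative D m x) (at x)"
			unfolding D_def by (rule has_derivative_add[OF f(4)[OF x1] I(4)[OF x2]])
		show "D m x (smult_matrix c Y) = c *% D m x Y" for c Y
			by (simp add: D_def f(5)[OF x1] I(5)[OF x2] scaleC_add_right)
		show "norm (I m x + J m x) <= M1 + M2" using norm_triangle_le[OF add_mono[OF f(6)[OF x1] I(6)[OF x2]]] .
		fix Y
		show "norm (D m x Y) <= (M1 + M2) * norm Y"
			unfolding D_def distrib_right by (rule norm_triangle_le[OF add_mono[OF f(7)[OF x1] I(7)[OF x2]]])
	qed
	have "e > 0" "ball z e \<subseteq> U" using f(1,3) I(1) by (auto simp: e_def)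
	then show "\<exists>e>0. \<exists>M I'. ball z e \<subseteq> U & (\<forall>m. \<forall>x\<in>ball z e.
		 ((%z. I m z + J m z) has_derivative I' m x) (at x) & (\<forall>c Y. I' m x (smult_matrix c Y) = c *% I' m x Y) &
		 norm (I m x + J m x) <= M & (\<forall>Y. norm (I' m x Y) <= M * norm Y))"
		using * by (intro exI[of _ e] conjI exI[of _ "M1 + M2"] exI[of _ D]) blast+
qed

lemma fholo_sum:
	assumes "open U" "finite K" "!!k. k \<in> K ==> fholo U (I k)"
	shows "fholo U (%m z. \<Sum>k\<in>K. I k m z)"
	using assms(2,3)
proof (induction K rule: finite_induct)
	case empty
	show ?case using fholo_const[OF assms(1), of "%m. 0" 0] by simp
next
	case (insert k K)
	then show ?case using fholo_add[of U "I k" "%m z. \<Sum>k\<in>K. I k m z"] by simp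
qed

lemma fholo_compose:
	fixes f :: "complex^2^2 => complex"
	assumes f: "fholo U (%m. f)" and g: "g holomorphic_on S" "open S" and fS: "!!z. z \<in> U ==> f z \<in> S"
	shows "fholo U (%m z. g (f z))"
proof (rule fholoI)
	fix z assume z: "z \<in> U"
	obtain e1 M1 f' where f0: "e1 > 0" "M1 >= 0" "ball z e1 \<subseteq> U"
		"\<forall>(m::int) x. x \<in> ball z e1 --> (f has_derivative f' m x) (at x)"
		"\<forall>m x c Y. x \<in> ball z e1 --> f' m x (smult_matrix c Y) = c *% f' m x Y"
		"\<forall>(m::int) x. x \<in> ball z e1 --> norm (f x) <= M1"
		"\<forall>m x Y. x \<in> ball z e1 --> norm (f' m x Y) <= M1 * norm Y"
		by (rule fholoE[OF assms(1) z])
	note f = f0(1-3) f0(4)[rule_format] f0(5)[rule_format] f0(6)[rule_format] f0(7)[rule_format]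
	obtain r where r: "r > 0" "cball (f z) r \<subseteq> S" using g(2) fS[OF z] open_contains_cball by blast
	have cont: "continuous_on (cball (f z) r) g" "continuous_on (cball (f z) r) (deriv g)"
		using holomorphic_on_imp_continuous_on[OF g(1)] holomorphic_on_imp_continuous_on[OF holomorphic_deriv[OF g]] r(2)
		by (auto intro: continuous_on_subset)
	have "bounded (g ` cball (f z) r)" "bounded (deriv g ` cball (f z) r)"
		by (intro compact_imp_bounded compact_continuous_image cont compact_cball)+
	then obtain K1 K2 where K': "\<forall>w\<in>cball (f z) r. norm (g w) <= K1" "\<forall>w\<in>cball (f z) r. norm (deriv g w) <= K2"
		unfolding bounded_iff by auto
	note K = K'[rule_format]
	have "isCont f z" using f(4)[of z 0] f(1) has_derivative_continuous by auto
	then obtain d where d: "d > 0" "!!x. dist x z < d ==> dist (f x) (f z) < r"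
		unfolding continuous_at_eps_delta using r(1) by blast
	define e where "e = min e1 d"
	have fb: "f x \<in> cball (f z) r" if "x \<in> ball z e" for x
		using that d(2)[of x] by (auto simp: e_def dist_commute less_imp_le)
	have fz: "f z \<in> cball (f z) r" using r(1) by simp
	have K0: "K1 >= 0" "K2 >= 0"
		by (rule order_trans[OF norm_ge_zero K(1)[OF fz]], rule order_trans[OF norm_ge_zero K(2)[OF fz]])
	define D where "D m x h = deriv g (f x) * f' m x h" for m x h
	define M where "M = K1 + K2 * M1"
	have *: "((%z. g (f z)) has_derivative D m x) (at x) & (\<forall>c Y. D m x (smult_matrix c Y) = c *% D m x Y) &
			norm (g (f x)) <= M & (\<forall>Y. norm (D m x Y) <= M * norm Y)"
		if x: "x \<in> ball z e" for m x
	proof (intro conjI allI)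
		have x1: "x \<in> ball z e1" using x by (auto simp: e_def)
		have "f x \<in> S" using x1 f(3) fS by auto
		then have "(g has_field_derivative deriv g (f x)) (at (f x))"
			using holomorphic_derivI[OF g] by blast
		then have "(g has_derivative (*) (deriv g (f x))) (at (f x))" by (simp add: has_field_derivative_def)
		from diff_chain_at[OF f(4)[OF x1, of m] this]
		show "((%z. g (f z)) has_derivative D m x) (at x)"
			by (simp add: o_def D_def[abs_def])
		show "D m x (smult_matrix c Y) = c *% D m x Y" for c Y
			by (simp add: D_def f(5)[OF x1])
		show "norm (g (f x)) <= M" using K(1)[OF fb[OF x]] K0 f(2) by (simp add: M_def add_increasing2)
		fix Y
		have "norm (D m x Y) <= K2 * (M1 * norm Y)"
			unfolding D_def norm_mult using K(2)[OF fb[OF x]] f(7)[OF x1] K0 by (intro mult_mono) auto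
		also have "... <= M * norm Y" using K0 by (simp add: M_def algebra_simps)
		finally show "norm (D m x Y) <= M * norm Y" .
	qed
	have e0: "e > 0" "ball z e \<subseteq> U" using f(1,3) d(1) by (auto simp: e_def)
	have **: "\<forall>m. \<forall>x\<in>ball z e. ((%z. g (f z)) has_derivative D m x) (at x) & (\<forall>c Y. D m x (smult_matrix c Y) = c *% D m x Y) &
			norm (g (f x)) <= M & (\<forall>Y. norm (D m x Y) <= M * norm Y)"
		by (intro allI ballI) (rule *)
	show "\<exists>e>0. \<exists>M I'. ball z e \<subseteq> U & (\<forall>m::int. \<forall>x\<in>ball z e.
		 ((%z. g (f z)) has_derivative I' m x) (at x) & (\<forall>c Y. I' m x (smult_matrix c Y) = c *% I' m x Y) &
		 norm (g (f x)) <= M & (\<forall>Y. norm (I' m x Y) <= M * norm Y))"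
		by (rule exI[of _ e], rule conjI[OF e0(1)], rule exI[of _ M], rule exI[of _ D], rule conjI[OF e0(2) **])
qed

lemma fholo_series:
	fixes \<zeta> :: "complex^2^2 => complex" and g :: "int => nat => int"
	assumes \<zeta>: "fholo U (%m. \<zeta>)" and \<zeta>1: "!!z. z \<in> U ==> norm (\<zeta> z) < 1" and I: "fholo U I" and a: "ball_summable a"
	shows "fholo U (%m z. \<Sum>i. (a i * \<zeta> z ^ i) *% I (g m i) z)"
proof (rule fholoI)
	fix z assume z: "z \<in> U"
	obtain e1 M1 f' where f0: "e1 > 0" "M1 >= 0" "ball z e1 \<subseteq> U"
		"\<forall>(m::int) x. x \<in> ball z e1 --> (\<zeta> has_derivative f' m x) (at x)"
		"\<forall>m x c Y. x \<in> ball z e1 --> f' m x (smult_matrix c Y) = c *% f' m x Y"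
		"\<forall>(m::int) x. x \<in> ball z e1 --> norm (\<zeta> x) <= M1"
		"\<forall>m x Y. x \<in> ball z e1 --> norm (f' m x Y) <= M1 * norm Y"
		by (rule fholoE[OF \<zeta> z])
	note f = f0(1-3) f0(4)[rule_format] f0(5)[rule_format] f0(6)[rule_format] f0(7)[rule_format]
	obtain e2 M2 I' where I0: "e2 > 0" "M2 >= 0" "ball z e2 \<subseteq> U"
		"\<forall>m x. x \<in> ball z e2 --> (I m has_derivative I' m x) (at x)"
		"\<forall>m x c Y. x \<in> ball z e2 --> I' m x (smult_matrix c Y) = c *% I' m x Y"
		"\<forall>m x. x \<in> ball z e2 --> norm (I m x) <= M2"
		"\<forall>m x Y. x \<in> ball z e2 --> norm (I' m x Y) <= M2 * norm Y"
		by (rule fholoE[OF I z])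
	note I = I0(1-3) I0(4)[rule_format] I0(5)[rule_format] I0(6)[rule_format] I0(7)[rule_format]
	\<comment> \<open>Halfway between the modulus at z and 1: continuity keeps the variable below r
	  nearby while the coefficients are still summable at r.\<close>
	define r where "r = (1 + norm (\<zeta> z)) / 2"
	have r: "0 <= r" "r < 1" "norm (\<zeta> z) < r" using \<zeta>1[OF z] by (auto simp: r_def)
	have "isCont \<zeta> z" using f(4)[of z 0] f(1) has_derivative_continuous by auto
	then obtain d where d: "d > 0" "!!x. dist x z < d ==> dist (\<zeta> x) (\<zeta> z) < r - norm (\<zeta> z)"
		unfolding continuous_at_eps_delta using r(3) by (metis diff_gt_0_iff_gt)
	define e where "e = min (min e1 e2) d"
	define M where "M = max M1 M2"
	define S where "S = ball z e"
	have sub: "x \<in> ball z e1" "x \<in> ball z e2" if "x \<in> S" for x using that by (auto simp: S_def e_def)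
	have \<zeta>r: "norm (\<zeta> x) <= r" if "x \<in> S" for x
	proof -
		have "dist (\<zeta> x) (\<zeta> z) < r - norm (\<zeta> z)" using d(2)[of x] that by (auto simp: S_def e_def dist_commute)
		then show ?thesis using norm_triangle_sub[of "\<zeta> x" "\<zeta> z"] by (simp add: dist_norm)
	qed
	have b1: "norm (f' 0 x h) <= M * norm h" if "x \<in> S" for x h
		using f(7)[OF sub(1)[OF that], of 0 h] mult_right_mono[of M1 M "norm h"] by (simp add: M_def)
	have b2: "norm (I m x) <= M" if "x \<in> S" for m x
		using I(6)[OF sub(2)[OF that], of m] by (simp add: M_def)
	have b3: "norm (I' m x h) <= M * norm h" if "x \<in> S" for m x h
		using I(7)[OF sub(2)[OF that], of m h] mult_right_mono[of M2 M "norm h"] by (simp add: M_def)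
	have S: "open S" "convex S" by (simp_all add: S_def)
	define D where "D m x h = (\<Sum>j. (a j * \<zeta> x ^ j) *% I' (g m j) x h + (a j * (of_nat j * \<zeta> x ^ (j - 1) * f' 0 x h)) *% I (g m j) x)" for m x h
	define N where "N = (\<Sum>j. norm (a j) * r ^ j * M + norm (a j) * (real j * r ^ (j - 1)) * M * M)"
	note ser = series_has_derivative[where S = S and \<zeta> = \<zeta> and \<zeta>' = "f' 0" and M = M and r = r and a = a,
		OF S _ f(4)[OF sub(1)] \<zeta>r b1 I(4)[OF sub(2)] b2 b3 r(1,2) a]
	have *: "((%z. \<Sum>i. (a i * \<zeta> z ^ i) *% I (g m i) z) has_derivative D m x) (at x) & (\<forall>c Y. D m x (smult_matrix c Y) = c *% D m x Y) &
			norm (\<Sum>i. (a i * \<zeta> x ^ i) *% I (g m i) x) <= N & (\<forall>Y. norm (D m x Y) <= N * norm Y)"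
		if x: "x \<in> S" for m x
	proof (intro conjI allI)
		show "((%z. \<Sum>i. (a i * \<zeta> z ^ i) *% I (g m i) z) has_derivative D m x) (at x)"
			unfolding D_def by (rule ser(1)[OF x])
		show "norm (\<Sum>i. (a i * \<zeta> x ^ i) *% I (g m i) x) <= N"
			unfolding N_def by (rule ser(6)[OF x])
		show "norm (D m x Y) <= N * norm Y" for Y
			unfolding D_def N_def by (rule ser(4)[OF x])
		fix c Y
		have "D m x (smult_matrix c Y) = (\<Sum>j. c *% ((a j * \<zeta> x ^ j) *% I' (g m j) x Y + (a j * (of_nat j * \<zeta> x ^ (j - 1) * f' 0 x Y)) *% I (g m j) x))"
			unfolding D_def f(5)[OF sub(1)[OF x]] I(5)[OF sub(2)[OF x]]
			by (simp only: scaleC_add_right scaleC_scaleC scaleC_complex_def ac_simps)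
		also have "... = c *% D m x Y"
			unfolding D_def by (rule bounded_linear.suminf[OF bounded_linear_scaleC_right ser(3)[OF x], symmetric])
		finally show "D m x (smult_matrix c Y) = c *% D m x Y" .
	qed
	have "e > 0" "ball z e \<subseteq> U" using f(1,3) d(1) I(1) by (auto simp: e_def)
	then show "\<exists>e>0. \<exists>M I'. ball z e \<subseteq> U & (\<forall>m. \<forall>x\<in>ball z e.
		 ((%z. \<Sum>i. (a i * \<zeta> z ^ i) *% I (g m i) z) has_derivative I' m x) (at x) & (\<forall>c Y. I' m x (smult_matrix c Y) = c *% I' m x Y) &
		 norm (\<Sum>i. (a i * \<zeta> x ^ i) *% I (g m i) x) <= M & (\<forall>Y. norm (I' m x Y) <= M * norm Y))"
		using * unfolding S_def by (intro exI[of _ e] conjI exI[of _ N] exI[of _ D]) blast+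
qed

text \<open>An open set of all matrices, as holomorphy on SL(2,C) asks for ambient neighbourhoods.
  The last condition keeps \<open>Ln\<close> off its cut; inside SL(2,C) it follows from the other
  two by \<open>crown_U_crown\<close>.\<close>

definition U_crown :: "(complex^2^2) set" where
	"U_crown = {z. norm (cayB z) < norm (cayA z) & norm (cayC z) < norm (cayD z) & 0 < Re (cayA z * cayD z)}"

definition U_plus :: "(complex^2^2) set" where
	"U_plus = {z. norm (cayB z) < norm (cayA z)}"

lemmas cay_continuous [continuous_intros] =
	bounded_linear.continuous_on[OF cay_bounded_linear(1)] bounded_linear.continuous_on[OF cay_bounded_linear(2)]
	bounded_linear.continuous_on[OF cay_bounded_linear(3)] bounded_linear.continuous_on[OF cay_bounded_linear(4)]

lemma open_U_plus: "open U_plus"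
	unfolding U_plus_def by (intro open_Collect_less continuous_intros)

lemma open_U_crown: "open U_crown"
	unfolding U_crown_def by (intro open_Collect_conj open_Collect_less continuous_intros)

text \<open>With a, b, c, d the Cayley entries and P - Q = n, which holds for
  \<open>Pp nu n 0\<close> and \<open>Qq nu n 0\<close>, this is the image of X^j (a + b/X)^P (d +
  cX)^Q. The factor a^P d^Q is written a^n (ad)^Q so that a branch is chosen only for ad, which is
  positive on the real group.\<close>

definition Fser :: "int => complex => complex => (int => 'h::complex_hilbert) => int => complex^2^2 => 'h" where
	"Fser n P Q w j z = (cayA z powi n * exp (Q * Ln (cayA z * cayD z))) *%
		 outer_ser P Q w j (cayB z * inverse (cayA z)) (cayC z * inverse (cayD z))"

text \<open>The same expression for a natural number Q = q, with (d + cX)^q expanded. No division by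
  d remains, so d may vanish and only |b| < |a| is required.\<close>

definition Fpol :: "int => nat => complex => (int => 'h::complex_hilbert) => int => complex^2^2 => 'h" where
	"Fpol n q P w j z = (cayA z powi n * cayA z ^ q) *%
		 (\<Sum>i. ((P gchoose i) * (cayB z * inverse (cayA z)) ^ i) *%
				(\<Sum>k\<le>q. (of_nat (q choose k) * (cayD z ^ (q - k) * cayC z ^ k)) *% w (j - int i + int k)))"

lemma fholo_mult:
	fixes f g :: "complex^2^2 => complex"
	shows "fholo U (%m. f) ==> fholo U (%m. g) ==> fholo U (%m z. f z * g z)"
	using fholo_scale[of U f "%m. g"] by simp

lemma norm_mult_inverse_less_1: "norm b < norm a ==> norm (b * inverse a) < (1::real)" for a b :: complex
proof -
	assume *: "norm b < norm a"
	then have "norm a > 0" by (rule le_less_trans[OF norm_ge_zero])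
	with * have "norm b / norm a < 1" by (simp only: divide_less_eq_1_pos)
	then show ?thesis by (simp only: norm_mult norm_inverse divide_inverse)
qed

lemma fholo_ratio:
	assumes "open U" "!!z. z \<in> U ==> f z ~= 0" "fholo U (%m. f)" "fholo U (%m. g)"
	shows "fholo U (%m z. (g z :: complex) * inverse (f z))"
	using assms(2)
	by (intro fholo_mult[OF assms(4)] fholo_compose[OF assms(3), where S = "- {0}"])
		(auto intro!: holomorphic_intros)

lemma Fser_complex_differentiable:
	assumes z: "z \<in> U_crown" and M: "!!j. norm (w j) <= M"
	shows "complex_differentiable_at (Fser n P Q w j) z"
proof -
	let ?U = U_crown
	have A0: "cayA z ~= 0" "cayD z ~= 0" if "z \<in> ?U" for z
		using that unfolding U_crown_def by auto
	note cay = fholo_cay[OF open_U_crown]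
	have y: "fholo ?U (%m z. cayC z * inverse (cayD z))" and x: "fholo ?U (%m z. cayB z * inverse (cayA z))"
		by (rule fholo_ratio[OF open_U_crown A0(2) cay(4,3)], assumption, rule fholo_ratio[OF open_U_crown A0(1) cay(1,2)], assumption)
	have b: "norm (cayC z * inverse (cayD z)) < 1" "norm (cayB z * inverse (cayA z)) < 1" if "z \<in> ?U" for z
		using that by (auto simp: U_crown_def intro!: norm_mult_inverse_less_1)
	have "fholo ?U (%m z. w m)" by (rule fholo_const[OF open_U_crown M])
	from fholo_series[OF y b(1) this ball_summable_gchoose, where g = "%m k. m + int k"]
	have "fholo ?U (%m z. inner_ser Q w m (cayC z * inverse (cayD z)))" unfolding inner_ser_def .
	from fholo_series[OF x b(2) this ball_summable_gchoose, where g = "%m i. m - int i"]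
	have o: "fholo ?U (%m z. outer_ser P Q w m (cayB z * inverse (cayA z)) (cayC z * inverse (cayD z)))"
		unfolding outer_ser_def .
	have "(%w. w powi n) holomorphic_on - {0}" by (intro holomorphic_intros) auto
	then have p: "fholo ?U (%m z. cayA z powi n)"
		by (rule fholo_compose[OF cay(1)]) (use A0 in auto)
	have "(%w. exp (Q * Ln w)) holomorphic_on - \<real>\<^sub>\<le>\<^sub>0" by (intro holomorphic_intros) auto
	then have e: "fholo ?U (%m z. exp (Q * Ln (cayA z * cayD z)))"
		by (rule fholo_compose[OF fholo_mult[OF cay(1,4)]])
			(auto simp: U_crown_def complex_nonpos_Reals_iff)
	show ?thesis
		unfolding Fser_def
		by (rule fholo_imp_complex_differentiable[OF fholo_scale[OF fholo_mult[OF p e] o] z])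
qed

lemma Fpol_complex_differentiable:
	assumes z: "z \<in> U_plus" and M: "!!j. norm (w j) <= M"
	shows "complex_differentiable_at (Fpol n q P w j) z"
proof -
	let ?U = U_plus
	have A0: "cayA z ~= 0" if "z \<in> ?U" for z
		using that unfolding U_plus_def by auto
	note cay = fholo_cay[OF open_U_plus]
	have x: "fholo ?U (%m z. cayB z * inverse (cayA z))"
		by (rule fholo_ratio[OF open_U_plus A0 cay(1,2)])
	have b: "norm (cayB z * inverse (cayA z)) < 1" if "z \<in> ?U" for z
		using that by (auto simp: U_plus_def intro!: norm_mult_inverse_less_1)
	have pw: "fholo ?U (%m z. f z ^ k)" if "fholo ?U (%m. f)" for f :: "complex^2^2 => complex" and k
		by (rule fholo_compose[OF that, where S = UNIV]) (auto intro!: holomorphic_intros)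
	have c: "fholo ?U (%m z. c)" for c :: complex by (rule fholo_const[OF open_U_plus, of _ "norm c"]) simp
	have "fholo ?U (%m z. \<Sum>k\<le>q. (of_nat (q choose k) * (cayD z ^ (q - k) * cayC z ^ k)) *% w (m + int k))"
		by (intro fholo_sum[OF open_U_plus] fholo_scale fholo_mult c pw cay fholo_const[OF open_U_plus M]) simp
	from fholo_series[OF x b this ball_summable_gchoose, where g = "%m i. m - int i"]
	have o: "fholo ?U (%m z. \<Sum>i. ((P gchoose i) * (cayB z * inverse (cayA z)) ^ i) *%
				(\<Sum>k\<le>q. (of_nat (q choose k) * (cayD z ^ (q - k) * cayC z ^ k)) *% w (m - int i + int k)))" .
	have "(%w. w powi n) holomorphic_on - {0}" by (intro holomorphic_intros) auto
	then have p: "fholo ?U (%m z. cayA z powi n)"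
		by (rule fholo_compose[OF cay(1)]) (use A0 in auto)
	show ?thesis
		unfolding Fpol_def
		by (rule fholo_imp_complex_differentiable[OF fholo_scale[OF fholo_mult[OF p pw[OF cay(1)]] o] z])
qed

lemma inner_ser_bound:
	assumes "norm y <= rho" "rho < 1" "!!j. norm (w j) <= M"
	shows "norm (inner_ser Q w j y) <= absN Q rho * M"
proof -
	have "norm (inner_ser Q w j y) <= absN Q (norm y) * M"
		unfolding inner_ser_def by (rule ser_summable(2)) (use assms in auto)
	also have "... <= absN Q rho * M"
	proof (rule mult_right_mono)
		have r: "0 <= rho" using assms(1) norm_ge_zero order_trans by blast
		show "absN Q (norm y) <= absN Q rho"
			unfolding absN_def
			by (rule suminf_le) (use assms r in \<open>auto intro!: mult_left_mono power_mono absN_summable\<close>)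
		show "0 <= M" using assms(3)[of 0] norm_ge_zero order_trans by blast
	qed
	finally show ?thesis .
qed

lemma inner_ser_of_nat:
	"inner_ser (of_nat q) w j y = (\<Sum>k\<le>q. (of_nat (q choose k) * y ^ k) *% w (j + int k))"
proof -
	have "inner_ser (of_nat q) w j y = (\<Sum>k\<in>{..q}. ((of_nat q gchoose k) * y ^ k) *% w (j + int k))"
		unfolding inner_ser_def
		by (rule suminf_finite) (auto simp: binomial_gbinomial[symmetric] binomial_eq_0)
	then show ?thesis by (simp add: binomial_gbinomial)
qed

text \<open>Pulling d^q out of the finite inner sums restores the quotient c/d; for an integer
  exponent the branch of the logarithm does not matter.\<close>

lemma Fpol_eq_Fser:
	assumes z: "z \<in> U_crown" and M: "!!j. norm (w j) <= M"
	shows "Fpol n q P w j z = Fser n P (of_nat q) w j z"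
proof -
	define a b c d where "a = cayA z" and "b = cayB z" and "c = cayC z" and "d = cayD z"
	have d0: "d ~= 0" and a0: "a ~= 0" and y1: "norm (c * inverse d) < 1" and x1: "norm (b * inverse a) < 1"
		using z by (auto simp: U_crown_def a_def b_def c_def d_def intro!: norm_mult_inverse_less_1)
	have ex: "exp (of_nat q * Ln (a * d)) = a ^ q * d ^ q"
		using a0 d0 by (simp add: exp_of_nat_mult power_mult_distrib)
	have inner: "(\<Sum>k\<le>q. (of_nat (q choose k) * (d ^ (q - k) * c ^ k)) *% w (i + int k)) = d ^ q *% inner_ser (of_nat q) w i (c * inverse d)" for i
	proof -
		have "of_nat (q choose k) * (d ^ (q - k) * c ^ k) = d ^ q * (of_nat (q choose k) * (c * inverse d) ^ k)" if "k <= q" for k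
		proof -
			have "d ^ q = d ^ (q - k) * d ^ k" using that by (simp flip: power_add)
			then show ?thesis using d0 by (simp add: power_mult_distrib power_inverse)
		qed
		then show ?thesis
			unfolding inner_ser_of_nat complex_vector.scale_sum_right scaleC_scaleC
			by (intro sum.cong refl) simp
	qed
	have sm: "summable (%i. ((P gchoose i) * (b * inverse a) ^ i) *% inner_ser (of_nat q) w (j - int i) (c * inverse d))"
		by (rule ser_summable[OF x1 inner_ser_bound[where w = w, OF order_refl y1 M]])
	have "Fpol n q P w j z = (a powi n * a ^ q) *% (\<Sum>i. d ^ q *% (((P gchoose i) * (b * inverse a) ^ i) *% inner_ser (of_nat q) w (j - int i) (c * inverse d)))"
		unfolding Fpol_def a_def[symmetric] b_def[symmetric] c_def[symmetric] d_def[symmetric] inner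
		by (simp only: scaleC_scaleC mult.commute[of "d ^ q"])
	also have "... = (a powi n * a ^ q * d ^ q) *% outer_ser P (of_nat q) w j (b * inverse a) (c * inverse d)"
		unfolding outer_ser_def bounded_linear.suminf[OF bounded_linear_scaleC_right sm, symmetric] by (simp only: scaleC_scaleC)
	finally show ?thesis
		unfolding Fser_def a_def[symmetric] b_def[symmetric] c_def[symmetric] d_def[symmetric] ex by (simp only: mult.assoc)
qed

lemma outer_ser_step_P:
	assumes "norm x < 1" "norm y < 1" "!!j. norm (w j) <= M"
	shows "outer_ser (P + 1) Q w j x y = outer_ser P Q w j x y + x *% outer_ser P Q w (j - 1) x y"
proof -
	have e: "j - int (Suc i) = j - 1 - int i" for i by simp
	show ?thesis
		unfolding outer_ser_def
		using gchoose_ser_step[OF assms(1), of "%i. inner_ser Q w (j - int i) y" "absN Q (norm y) * M" P]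
			inner_ser_bound[where w = w, OF order_refl assms(2,3)] unfolding e by simp
qed

lemma inner_ser_step:
	assumes "norm y < 1" "!!j. norm (w j) <= M"
	shows "inner_ser (Q + 1) w j y = inner_ser Q w j y + y *% inner_ser Q w (j + 1) y"
proof -
	have e: "j + int (Suc i) = j + 1 + int i" for i by simp
	show ?thesis
		unfolding inner_ser_def
		using gchoose_ser_step[OF assms(1), of "%i. w (j + int i)" M Q] assms(2) unfolding e by simp
qed

lemma outer_ser_step_Q:
	assumes "norm x < 1" "norm y < 1" "!!j. norm (w j) <= M"
	shows "outer_ser P (Q + 1) w j x y = outer_ser P Q w j x y + y *% outer_ser P Q w (j + 1) x y"
proof -
	have s: "summable (%i. ((P gchoose i) * x ^ i) *% inner_ser Q w (k - int i) y)" for k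
		by (rule ser_summable[OF assms(1) inner_ser_bound[where w = w, OF order_refl assms(2,3)]])
	have e: "(%i. ((P gchoose i) * x ^ i) *% inner_ser (Q + 1) w (j - int i) y)
			= (%i. ((P gchoose i) * x ^ i) *% inner_ser Q w (j - int i) y
				+ y *% (((P gchoose i) * x ^ i) *% inner_ser Q w (j + 1 - int i) y))"
	proof
		fix i
		have "j - int i + 1 = j + 1 - int i" by simp
		then show "((P gchoose i) * x ^ i) *% inner_ser (Q + 1) w (j - int i) y
			= ((P gchoose i) * x ^ i) *% inner_ser Q w (j - int i) y
				+ y *% (((P gchoose i) * x ^ i) *% inner_ser Q w (j + 1 - int i) y)"
			unfolding inner_ser_step[OF assms(2,3)] scaleC_add_right scaleC_scaleC by (simp only: mult.commute)
	qed
	show ?thesis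
		unfolding outer_ser_def e suminf_add[OF s bounded_linear.summable[OF bounded_linear_scaleC_right s], symmetric]
			bounded_linear.suminf[OF bounded_linear_scaleC_right s] ..
qed

lemma inner_ser_deriv:
	fixes T :: real
	assumes T: "\<bar>T\<bar> < 1" and M: "!!j. norm (w j) <= M"
	shows "((%T. inner_ser Q w j (- of_real T)) has_derivative (%h. (Q * (- of_real h)) *% inner_ser (Q - 1) w (j + 1) (- of_real T))) (at T)"
proof -
	obtain rho where rho: "\<bar>T\<bar> < rho" "rho < 1" using T dense by blast
	have e: "j + int (Suc i) = j + 1 + int i" for i by simp
	have "((%T. \<Sum>k. ((Q gchoose k) * (- complex_of_real T) ^ k) *% w (j + int k)) has_derivative
		 (%h. \<Sum>k. ((Q gchoose k) * (- complex_of_real T) ^ k) *% 0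
				+ ((Q gchoose k) * (of_nat k * (- complex_of_real T) ^ (k - 1) * (- of_real h))) *% w (j + int k))) (at T)"
	proof (rule series_has_derivative(1)[where S = "{-rho<..<rho}" and \<zeta> = "%T. - of_real T" and \<zeta>' = "%T h. - of_real h"
				and r = rho and M = "max M 1" and I = "%k T. w (j + int k)" and I' = "%k T h. 0" and a = "%k. Q gchoose k"])
		show "((%T. - complex_of_real T) has_derivative (%h. - complex_of_real h)) (at x)" for x
			by (intro derivative_intros)
		show "norm (w (j + int k)) <= max M 1" for k using M[of "j + int k"] by simp
		show "norm (- complex_of_real h) <= max M 1 * norm h" for h :: real
			using mult_right_mono[of 1 "max M 1" "\<bar>h\<bar>"] by simp
	qed (use rho ball_summable_gchoose in \<open>auto simp: max_def\<close>)
	moreover have "(\<Sum>k. ((Q gchoose k) * (- complex_of_real T) ^ k) *% 0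
				+ ((Q gchoose k) * (of_nat k * (- complex_of_real T) ^ (k - 1) * (- of_real h))) *% w (j + int k))
			= (Q * (- of_real h)) *% (\<Sum>k. ((Q - 1 gchoose k) * (- complex_of_real T) ^ k) *% w (j + 1 + int k))" for h
	proof -
		have x1: "norm (- complex_of_real T) < 1" using T by simp
		define u where "u k = w (j + int k)" for k :: nat
		have ub: "norm (u k) <= M" for k unfolding u_def by (rule M)
		have uS: "w (j + 1 + int k) = u (Suc k)" for k unfolding u_def e ..
		show ?thesis
			unfolding uS u_def[symmetric] complex_vector.scale_zero_right add_0_left
			by (rule gchoose_ser_deriv(1)[OF x1 ub])
	qed
	ultimately show ?thesis unfolding inner_ser_def by (simp only:)
qed

text \<open>Both variables run along - T at once, so the two product-rule terms appear: the outer
  exponent drops with a shift down, the inner one with a shift up.\<close>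

lemma outer_ser_deriv:
	fixes T :: real
	assumes T: "\<bar>T\<bar> < 1" and M: "!!j. norm (w j) <= M"
	shows "((%T. outer_ser P Q w j (- of_real T) (- of_real T)) has_vector_derivative
		 (- P) *% outer_ser (P - 1) Q w (j - 1) (- of_real T) (- of_real T)
		 + (- Q) *% outer_ser P (Q - 1) w (j + 1) (- of_real T) (- of_real T)) (at T)"
proof -
	obtain rho where rho: "\<bar>T\<bar> < rho" "rho < 1" using T dense by blast
	let ?x = "- complex_of_real T"
	have x1: "norm ?x < 1" using T by simp
	have e: "j - int (Suc i) = j - 1 - int i" "j - int i + 1 = j + 1 - int i" for i by simp_all
	have M0: "M >= 0" using M[of 0] norm_ge_zero order_trans by blast
	define M' where "M' = max 1 (max (absN Q rho * M) (norm Q * (absN (Q - 1) rho * M)))"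
	have b1: "norm (inner_ser Q w i (- of_real x)) <= M'" if "\<bar>x\<bar> < rho" for x i
		using inner_ser_bound[of "- of_real x" rho w M Q i] that rho M by (simp add: M'_def)
	have b2: "norm ((Q * (- of_real h)) *% inner_ser (Q - 1) w i (- of_real x)) <= M' * norm h" if "\<bar>x\<bar> < rho" for x h :: real and i
	proof -
		have "norm (inner_ser (Q - 1) w i (- of_real x)) <= absN (Q - 1) rho * M"
			using inner_ser_bound[of "- of_real x" rho w M "Q - 1" i] that rho M by simp
		then have "norm Q * norm (inner_ser (Q - 1) w i (- of_real x)) <= norm Q * (absN (Q - 1) rho * M)"
			by (rule mult_left_mono) simp
		also have "... <= M'" by (simp add: M'_def)
		finally have "(norm Q * norm (inner_ser (Q - 1) w i (- of_real x))) * norm h <= M' * norm h"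
			by (rule mult_right_mono) simp
		then show ?thesis by (simp add: norm_mult mult.commute mult.left_commute)
	qed
	have D: "((%T. \<Sum>i. ((P gchoose i) * (- complex_of_real T) ^ i) *% inner_ser Q w (j - int i) (- of_real T)) has_derivative
		 (%h. \<Sum>i. ((P gchoose i) * ?x ^ i) *% ((Q * (- of_real h)) *% inner_ser (Q - 1) w (j - int i + 1) (- of_real T))
				+ ((P gchoose i) * (of_nat i * ?x ^ (i - 1) * (- of_real h))) *% inner_ser Q w (j - int i) (- of_real T))) (at T)"
	proof (rule series_has_derivative(1)[where S = "{-rho<..<rho}" and \<zeta> = "%T. - of_real T" and \<zeta>' = "%T h. - of_real h"
				and r = rho and M = M' and I = "%i T. inner_ser Q w (j - int i) (- of_real T)" and a = "%k. P gchoose k"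
				and I' = "%i T h. (Q * (- of_real h)) *% inner_ser (Q - 1) w (j - int i + 1) (- of_real T)"])
		show "((%T. - complex_of_real T) has_derivative (%h. - complex_of_real h)) (at x)" for x
			by (intro derivative_intros)
		show "norm (- complex_of_real h) <= M' * norm h" for h :: real
			using mult_right_mono[of 1 M' "\<bar>h\<bar>"] by (simp add: M'_def)
		show "((%T. inner_ser Q w (j - int i) (- of_real T)) has_derivative
			(%h. (Q * (- of_real h)) *% inner_ser (Q - 1) w (j - int i + 1) (- of_real x))) (at x)" if "x \<in> {-rho<..<rho}" for i x
			by (rule inner_ser_deriv[OF _ M]) (use that rho in auto)
		show "norm (inner_ser Q w (j - int i) (- of_real x)) <= M'" if "x \<in> {-rho<..<rho}" for i x
			using b1 that by (simp add: abs_less_iff)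
		show "norm ((Q * (- of_real h)) *% inner_ser (Q - 1) w (j - int i + 1) (- of_real x)) <= M' * norm h" if "x \<in> {-rho<..<rho}" for i x h
			using b2 that by (simp add: abs_less_iff)
	qed (use rho ball_summable_gchoose in auto)
	have s1: "summable (%i. ((P gchoose i) * ?x ^ i) *% inner_ser (Q - 1) w (j + 1 - int i) ?x)"
		by (rule ser_summable[OF x1 inner_ser_bound[where w = w, OF order_refl x1 M]])
	have "(\<Sum>i. ((P gchoose i) * ?x ^ i) *% ((Q * (- of_real h)) *% inner_ser (Q - 1) w (j - int i + 1) ?x)
				+ ((P gchoose i) * (of_nat i * ?x ^ (i - 1) * (- of_real h))) *% inner_ser Q w (j - int i) ?x)
			= h *\<^sub>R ((- P) *% outer_ser (P - 1) Q w (j - 1) ?x ?x + (- Q) *% outer_ser P (Q - 1) w (j + 1) ?x ?x)" for h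
	proof -
		have 1: "((P gchoose i) * ?x ^ i) *% ((Q * (- of_real h)) *% inner_ser (Q - 1) w (j - int i + 1) ?x)
				= (Q * (- of_real h)) *% (((P gchoose i) * ?x ^ i) *% inner_ser (Q - 1) w (j + 1 - int i) ?x)" for i
			unfolding e by (simp only: scaleC_scaleC mult.commute)
		define u where "u i = inner_ser Q w (j - int i) ?x" for i :: nat
		have ub: "norm (u i) <= absN Q (norm ?x) * M" for i
			unfolding u_def by (rule inner_ser_bound[where w = w, OF order_refl x1 M])
		have uS: "inner_ser Q w (j - 1 - int i) ?x = u (Suc i)" for i unfolding u_def e(1) ..
		note gd = gchoose_ser_deriv[OF x1 ub]
		have 2: "(\<Sum>i. ((P gchoose i) * (of_nat i * ?x ^ (i - 1) * (- of_real h))) *% inner_ser Q w (j - int i) ?x)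
				= (P * (- of_real h)) *% outer_ser (P - 1) Q w (j - 1) ?x ?x"
			unfolding outer_ser_def uS u_def[symmetric] by (rule gd(1))
		have 3: "summable (%i. ((P gchoose i) * (of_nat i * ?x ^ (i - 1) * (- of_real h))) *% inner_ser Q w (j - int i) ?x)"
			unfolding u_def[symmetric] by (rule gd(2))
		have "(\<Sum>i. ((P gchoose i) * ?x ^ i) *% ((Q * (- of_real h)) *% inner_ser (Q - 1) w (j - int i + 1) ?x)
				+ ((P gchoose i) * (of_nat i * ?x ^ (i - 1) * (- of_real h))) *% inner_ser Q w (j - int i) ?x)
				= (Q * (- of_real h)) *% outer_ser P (Q - 1) w (j + 1) ?x ?x + (P * (- of_real h)) *% outer_ser (P - 1) Q w (j - 1) ?x ?x"
			unfolding 1 suminf_add[OF bounded_linear.summable[OF bounded_linear_scaleC_right s1] 3, symmetric] 2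
				bounded_linear.suminf[OF bounded_linear_scaleC_right s1, symmetric] outer_ser_def ..
		also have "... = h *\<^sub>R ((- P) *% outer_ser (P - 1) Q w (j - 1) ?x ?x + (- Q) *% outer_ser P (Q - 1) w (j + 1) ?x ?x)"
			unfolding scaleC_of_real[symmetric] by (simp add: complex_vector.scale_right_diff_distrib scaleC_scaleC mult.commute)
		finally show ?thesis .
	qed
	then show ?thesis using D unfolding has_vector_derivative_def outer_ser_def by (simp only:)
qed

text \<open>Pascal's rule bounds P + 1 by P with factor 1 + rho, and read backwards P - 1 by P with
  factor 1/(1 - rho); 2/(1 - rho) covers both.\<close>

lemma absN_step:
	assumes "0 <= rho" "rho < 1"
	shows "absN (P + 1) rho <= 2 / (1 - rho) * absN P rho" "absN (P - 1) rho <= 2 / (1 - rho) * absN P rho"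
proof -
	have s: "summable (%j. norm (R gchoose j) * rho ^ j)" for R :: complex by (rule absN_summable[OF assms])
	have sS: "summable (%j. norm (R gchoose (Suc j)) * rho ^ Suc j)" for R :: complex
		using s[of R] by (rule summable_Suc_iff[THEN iffD2])
	have head: "absN R rho = 1 + (\<Sum>j. norm (R gchoose (Suc j)) * rho ^ Suc j)" for R
		unfolding absN_def using suminf_split_head[OF s[of R]] by simp
	have s2: "summable (%j. rho * (norm (R gchoose j) * rho ^ j))" for R :: complex by (intro summable_mult s)
	have mul: "(\<Sum>j. rho * (norm (R gchoose j) * rho ^ j)) = rho * absN R rho" for R :: complex
		unfolding absN_def by (rule suminf_mult[OF s])
	have up: "absN (R + 1) rho <= absN R rho + rho * absN R rho" for R
	proof -
		have "norm ((R + 1) gchoose (Suc j)) * rho ^ Suc j <= norm (R gchoose (Suc j)) * rho ^ Suc j + rho * (norm (R gchoose j) * rho ^ j)" for j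
		proof -
			have "norm ((R + 1) gchoose (Suc j)) <= norm (R gchoose j) + norm (R gchoose (Suc j))"
				unfolding gbinomial_Suc_Suc by (rule norm_triangle_ineq)
			then have "norm ((R + 1) gchoose (Suc j)) * rho ^ Suc j <= (norm (R gchoose j) + norm (R gchoose (Suc j))) * rho ^ Suc j"
				using assms(1) by (intro mult_right_mono) auto
			then show ?thesis by (simp add: algebra_simps)
		qed
		from suminf_le[OF this sS summable_add[OF sS s2]]
		have "(\<Sum>j. norm ((R + 1) gchoose (Suc j)) * rho ^ Suc j) <= (\<Sum>j. norm (R gchoose (Suc j)) * rho ^ Suc j) + rho * absN R rho"
			unfolding suminf_add[OF sS s2, symmetric] mul .
		then show ?thesis unfolding head[of "R + 1"] head[of R] by (simp add: algebra_simps)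
	qed
	have dn: "absN R rho <= absN (R + 1) rho + rho * absN R rho" for R
	proof -
		have "norm (R gchoose (Suc j)) * rho ^ Suc j <= norm ((R + 1) gchoose (Suc j)) * rho ^ Suc j + rho * (norm (R gchoose j) * rho ^ j)" for j
		proof -
			have "R gchoose (Suc j) = ((R + 1) gchoose (Suc j)) - (R gchoose j)" unfolding gbinomial_Suc_Suc by simp
			then have "norm (R gchoose (Suc j)) <= norm ((R + 1) gchoose (Suc j)) + norm (R gchoose j)"
				by (metis norm_triangle_ineq4)
			then have "norm (R gchoose (Suc j)) * rho ^ Suc j <= (norm ((R + 1) gchoose (Suc j)) + norm (R gchoose j)) * rho ^ Suc j"
				using assms(1) by (intro mult_right_mono) auto
			then show ?thesis by (simp add: algebra_simps)
		qed
		from suminf_le[OF this sS summable_add[OF sS s2]]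
		have "(\<Sum>j. norm (R gchoose (Suc j)) * rho ^ Suc j) <= (\<Sum>j. norm ((R + 1) gchoose (Suc j)) * rho ^ Suc j) + rho * absN R rho"
			unfolding suminf_add[OF sS s2, symmetric] mul .
		then show ?thesis unfolding head[of "R + 1"] head[of R] by (simp add: algebra_simps)
	qed
	have nn: "0 <= absN R rho" for R by (rule absN_nonneg[OF assms])
	have k: "1 / (1 - rho) >= 1" using assms by (simp add: field_simps)
	have "absN (P + 1) rho <= 2 * absN P rho" using up[of P] mult_left_le_one_le[OF nn[of P] assms(1)] assms(2) by simp
	also have "... <= 2 / (1 - rho) * absN P rho" using mult_right_mono[OF k, of "2 * absN P rho"] nn[of P] by simp
	finally show "absN (P + 1) rho <= 2 / (1 - rho) * absN P rho" .
	have "(1 - rho) * absN (P - 1) rho <= absN P rho" using dn[of "P - 1"] by (simp add: algebra_simps)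
	then have "absN (P - 1) rho <= absN P rho / (1 - rho)" using assms by (simp add: field_simps)
	also have "... <= 2 / (1 - rho) * absN P rho" using nn[of P] assms by (intro order_trans[OF _ eq_refl[OF times_divide_eq_left[symmetric]]] divide_right_mono) auto
	finally show "absN (P - 1) rho <= 2 / (1 - rho) * absN P rho" .
qed

lemma absN_growth:
	assumes "0 <= rho" "rho < 1"
	shows "absN (P + of_int j) rho <= (2 / (1 - rho)) ^ nat \<bar>j\<bar> * absN P rho"
proof -
	let ?K = "2 / (1 - rho)"
	have K: "?K >= 0" using assms by simp
	have "absN (P + of_nat k) rho <= ?K ^ k * absN P rho & absN (P - of_nat k) rho <= ?K ^ k * absN P rho" for k
	proof (induct k)
		case (Suc k)
		have "absN (P + of_nat (Suc k)) rho <= ?K * absN (P + of_nat k) rho"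
			using absN_step(1)[OF assms, of "P + of_nat k"] by (simp add: add.assoc add.commute[of 1])
		moreover have "absN (P - of_nat (Suc k)) rho <= ?K * absN (P - of_nat k) rho"
			using absN_step(2)[OF assms, of "P - of_nat k"] by (simp add: algebra_simps)
		moreover have "?K * absN (P + of_nat k) rho <= ?K * (?K ^ k * absN P rho)" "?K * absN (P - of_nat k) rho <= ?K * (?K ^ k * absN P rho)"
			using Suc K by (intro mult_left_mono; simp)+
		ultimately show ?case by (simp add: mult.assoc)
	qed simp
	from this[of "nat \<bar>j\<bar>"] show ?thesis
		by (cases "j >= 0") (auto simp: of_nat_nat)
qed

section \<open>The explicit formula reproduces the orbit map\<close>

text \<open>Minus the coefficients of the chain: \<open>Hop\<close> sends member j to
  -\<open>Pp\<close> times member j - 1 plus -\<open>Qq\<close> times member j + 1. They double as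
  the binomial exponents.\<close>

definition Pp :: "complex => int => int => complex" where "Pp nu n j = (of_int (n + 2 * j) - 1 - nu) / 2"
definition Qq :: "complex => int => int => complex" where "Qq nu n j = (- of_int (n + 2 * j) - 1 - nu) / 2"

lemma Pp_shift: "Pp nu n (j - 1) = Pp nu n j - 1" "Pp nu n (j + 1) = Pp nu n j + 1" "Pp nu n j = Pp nu n 0 + of_int j"
	and Qq_shift: "Qq nu n (j - 1) = Qq nu n j + 1" "Qq nu n (j + 1) = Qq nu n j - 1" "Qq nu n j = Qq nu n 0 + of_int (- j)"
	and Pp_Qq_sum: "Pp nu n j + Qq nu n j = - (1 + nu)"
	by (simp_all add: Pp_def Qq_def field_simps)

text \<open>\<open>Fser\<close> on \<open>dia t\<close>, where a = d = cosh t and b = c = - sinh t.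
  The prefactor a^n (ad)^Q becomes a power of cosh t with exponent n + 2Q = -(1 + nu), the same for
  all j.\<close>

definition Phi :: "complex => int => (int => 'h::complex_hilbert) => int => real => 'h" where
	"Phi nu n w j t = exp (- (1 + nu) * of_real (ln (cosh t))) *%
		 outer_ser (Pp nu n j) (Qq nu n j) w j (- of_real (tanh t)) (- of_real (tanh t))"

text \<open>Pure algebra behind \<open>Phi_deriv\<close>: x stands for - tanh t, 1 - x^2 for the
  derivative of tanh, and the two assumptions are the two ways to split one factor off the double
  series.\<close>

lemma outer_ode_algebra:
	fixes X0 X1 Y0 Y1 Oj :: "'h::complex_hilbert"
	assumes "Oj = X0 + x *% X1" "Oj = Y0 + x *% Y1"
	shows "E *% ((1 - x * x) *% ((- P) *% X1 + (- Q) *% Y1)) + ((- x) * ((P + Q) * E)) *% Oj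
		= (- P) *% (E *% (X1 + x *% X0)) + (- Q) *% (E *% (Y1 + x *% Y0))"
proof (rule cinner_eqI)
	fix z
	have a: "cinner Oj z = cinner X0 z + x * cinner X1 z" unfolding assms(1) by (simp only: cinner_add_left cinner_scaleC_left)
	have b: "cinner Oj z = cinner Y0 z + x * cinner Y1 z" unfolding assms(2) by (simp only: cinner_add_left cinner_scaleC_left)
	show "cinner (E *% ((1 - x * x) *% ((- P) *% X1 + (- Q) *% Y1)) + ((- x) * ((P + Q) * E)) *% Oj) z
		= cinner ((- P) *% (E *% (X1 + x *% X0)) + (- Q) *% (E *% (Y1 + x *% Y0))) z"
		unfolding cinner_add_left cinner_scaleC_left using a b by algebra
qed

lemma tanh_less_1: "\<bar>tanh t\<bar> < (1::real)"
	using tanh_real_bounds[of t] by auto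

text \<open>The derivative lowers one exponent by 1 while the neighbours of j have P - 1, Q + 1 or P
  + 1, Q - 1; Pascal's rule together with the derivative of the power of cosh bridges the
  gap.\<close>

lemma Phi_deriv:
	assumes M: "!!j. norm (w j) <= M"
	shows "(Phi nu n w j has_vector_derivative (- Pp nu n j) *% Phi nu n w (j - 1) t + (- Qq nu n j) *% Phi nu n w (j + 1) t) (at t)"
proof -
	define P Q where "P = Pp nu n j" and "Q = Qq nu n j"
	define T where "T = tanh t"
	define x where "x = - complex_of_real T"
	define c where "c = - (1 + nu)"
	have c: "c = P + Q" unfolding c_def P_def Q_def Pp_Qq_sum ..
	have T1: "\<bar>T\<bar> < 1" unfolding T_def by (rule tanh_less_1)
	then have x1: "norm x < 1" by (simp add: x_def)
	define E where "E s = exp (c * of_real (ln (cosh s)))" for s :: real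
	define R where "R s = outer_ser P Q w j (- of_real (tanh s)) (- of_real (tanh s))" for s :: real
	have "((%s. ln (cosh s)) has_real_derivative T) (at t)"
		unfolding T_def by (auto intro!: derivative_eq_intros simp: tanh_def)
	then have "((%s. complex_of_real (ln (cosh s))) has_vector_derivative of_real T) (at t)"
		by (rule has_vector_derivative_of_real)
	moreover have "((%z. exp (c * z)) has_field_derivative c * E t) (at (of_real (ln (cosh t))))"
		unfolding E_def by (auto intro!: derivative_eq_intros)
	ultimately have dE: "(E has_vector_derivative of_real T * (c * E t)) (at t)"
		using field_vector_diff_chain_at unfolding E_def[abs_def] o_def by fastforce
	have dT: "(tanh has_vector_derivative (1 - T\<^sup>2)) (at t)"
		unfolding has_real_derivative_iff_has_vector_derivative[symmetric] T_def
		by (auto intro!: derivative_eq_intros)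
	have "((%T. outer_ser P Q w j (- of_real T) (- of_real T)) has_vector_derivative
		 (- P) *% outer_ser (P - 1) Q w (j - 1) x x + (- Q) *% outer_ser P (Q - 1) w (j + 1) x x) (at (tanh t))"
		using outer_ser_deriv[OF T1 M] unfolding T_def x_def .
	from vector_diff_chain_at[OF dT this]
	have dR: "(R has_vector_derivative (1 - T\<^sup>2) *\<^sub>R ((- P) *% outer_ser (P - 1) Q w (j - 1) x x + (- Q) *% outer_ser P (Q - 1) w (j + 1) x x)) (at t)"
		unfolding R_def[abs_def] o_def .
	have Rt: "R t = outer_ser P Q w j x x" by (simp add: R_def x_def T_def)
	have s: "R t = outer_ser (P - 1) Q w j x x + x *% outer_ser (P - 1) Q w (j - 1) x x"
		"R t = outer_ser P (Q - 1) w j x x + x *% outer_ser P (Q - 1) w (j + 1) x x"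
		unfolding Rt using outer_ser_step_P[where w = w, OF x1 x1 M, of "P - 1" Q j] outer_ser_step_Q[where w = w, OF x1 x1 M, of P "Q - 1" j] by simp_all
	have s2: "outer_ser (P - 1) (Q + 1) w (j - 1) x x = outer_ser (P - 1) Q w (j - 1) x x + x *% outer_ser (P - 1) Q w j x x"
		"outer_ser (P + 1) (Q - 1) w (j + 1) x x = outer_ser P (Q - 1) w (j + 1) x x + x *% outer_ser P (Q - 1) w j x x"
		using outer_ser_step_Q[where w = w, OF x1 x1 M, of "P - 1" Q "j - 1"] outer_ser_step_P[where w = w, OF x1 x1 M, of P "Q - 1" "j + 1"] by simp_all
	have Et: "((1 - T\<^sup>2) *\<^sub>R y) = (1 - x * x) *% (y::'a)" for y
		unfolding scaleC_of_real[symmetric] x_def by (simp add: power2_eq_square)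
	have xT: "of_real T * (c * E t) = (- x) * ((P + Q) * E t)" by (simp add: x_def c)
	have "((%s. E s *% R s) has_vector_derivative
		 E t *% ((1 - T\<^sup>2) *\<^sub>R ((- P) *% outer_ser (P - 1) Q w (j - 1) x x + (- Q) *% outer_ser P (Q - 1) w (j + 1) x x))
		 + (of_real T * (c * E t)) *% R t) (at t)"
		by (rule bounded_bilinear.has_vector_derivative[OF bounded_bilinear_scaleC dE dR])
	moreover have "Phi nu n w j = (%s. E s *% R s)"
		by (rule ext) (simp only: Phi_def E_def R_def P_def Q_def c_def)
	moreover have "Phi nu n w (j - 1) t = E t *% (outer_ser (P - 1) Q w (j - 1) x x + x *% outer_ser (P - 1) Q w j x x)"
		unfolding s2[symmetric] by (simp only: Phi_def E_def P_def Q_def c_def x_def T_def Pp_shift(1,2) Qq_shift(1,2))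
	moreover have "Phi nu n w (j + 1) t = E t *% (outer_ser P (Q - 1) w (j + 1) x x + x *% outer_ser P (Q - 1) w j x x)"
		unfolding s2[symmetric] by (simp only: Phi_def E_def P_def Q_def c_def x_def T_def Pp_shift(1,2) Qq_shift(1,2))
	ultimately show ?thesis
		unfolding Et xT outer_ode_algebra[OF s] P_def[symmetric] Q_def[symmetric] by (simp only:)
qed

lemma absN_mono: "0 <= r ==> r <= rho ==> rho < 1 ==> absN P r <= absN P rho"
	unfolding absN_def by (rule suminf_le) (auto intro!: mult_left_mono power_mono absN_summable)

lemma outer_ser_bound:
	assumes "norm x <= rho" "norm y <= rho" "rho < 1" "!!j. norm (w j) <= M"
	shows "norm (outer_ser P Q w j x y) <= absN P rho * (absN Q rho * M)"
proof -
	have x1: "norm x < 1" using assms(1,3) by (rule le_less_trans)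
	have r0: "0 <= rho" using norm_ge_zero assms(1) by (rule order_trans)
	have M0: "0 <= M" using norm_ge_zero assms(4) by (rule order_trans)
	have "norm (outer_ser P Q w j x y) <= absN P (norm x) * (absN Q rho * M)"
		unfolding outer_ser_def by (rule ser_summable(2)[OF x1 inner_ser_bound[where w = w, OF assms(2,3,4)]])
	also have "... <= absN P rho * (absN Q rho * M)"
		by (rule mult_right_mono[OF absN_mono]) (use assms M0 r0 absN_nonneg in auto)
	finally show ?thesis .
qed

lemma inner_ser_0: "inner_ser Q w j 0 = w j"
	and outer_ser_0: "outer_ser P Q w j 0 y = inner_ser Q w j y"
proof -
	have "(\<Sum>i. ((R gchoose i) * 0 ^ i) *% u i) = u 0" for R :: complex and u :: "nat => 'a"
		by (subst suminf_finite[where N = "{0}"]) (auto simp: power_0_left)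
	from this[of Q "%k. w (j + int k)"] this[of P "%i. inner_ser Q w (j - int i) y"]
	show "inner_ser Q w j 0 = w j" "outer_ser P Q w j 0 y = inner_ser Q w j y"
		by (simp_all add: inner_ser_def outer_ser_def)
qed

lemma inner_ser_map:
	assumes L: "bounded_linear L" "!!c x. L (c *% x) = c *% L x" and y: "norm y < 1" and M: "!!j. norm (w j) <= M"
	shows "L (inner_ser Q w j y) = inner_ser Q (%j. L (w j)) j y"
proof -
	have "summable (%k. ((Q gchoose k) * y ^ k) *% w (j + int k))" by (rule ser_summable(1)[OF y M])
	from bounded_linear.suminf[OF L(1) this] show ?thesis unfolding inner_ser_def L(2) .
qed

lemma outer_ser_map:
	assumes L: "bounded_linear L" "!!c x. L (c *% x) = c *% L x" and x: "norm x < 1" and y: "norm y < 1" and M: "!!j. norm (w j) <= M"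
	shows "L (outer_ser P Q w j x y) = outer_ser P Q (%j. L (w j)) j x y"
proof -
	have "summable (%k. ((P gchoose k) * x ^ k) *% inner_ser Q w (j - int k) y)"
		by (rule ser_summable(1)[OF x inner_ser_bound[where w = w, OF order_refl y M]])
	from bounded_linear.suminf[OF L(1) this] show ?thesis
		unfolding outer_ser_def L(2) inner_ser_map[OF L y M] .
qed

lemma inner_ser_cis:
	assumes y: "norm y < 1" and M: "!!j. norm (w j) <= M"
	shows "inner_ser Q w j (y * cis (- a)) = cis (a * of_int j) *% inner_ser Q (%j. cis (- a * of_int j) *% w j) j y"
proof -
	have "summable (%k. ((Q gchoose k) * y ^ k) *% (cis (- a * of_int (j + int k)) *% w (j + int k)))"
		by (rule ser_summable(1)[OF y, where M = M]) (simp add: M)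
	from bounded_linear.suminf[OF bounded_linear_scaleC_right this, of "cis (a * of_int j)"]
	have "cis (a * of_int j) *% inner_ser Q (%j. cis (- a * of_int j) *% w j) j y
			= (\<Sum>k. cis (a * of_int j) *% ((Q gchoose k) * y ^ k) *% (cis (- a * of_int (j + int k)) *% w (j + int k)))"
		unfolding inner_ser_def .
	also have "(%k. cis (a * of_int j) *% ((Q gchoose k) * y ^ k) *% (cis (- a * of_int (j + int k)) *% w (j + int k)))
			= (%k. ((Q gchoose k) * (y * cis (- a)) ^ k) *% w (j + int k))"
	proof
		fix k
		have e: "cis (a * of_int j) * cis (- a * of_int (j + int k)) = cis (- a) ^ k"
			unfolding cis_mult Complex.DeMoivre by (simp add: algebra_simps)
		have "cis (a * of_int j) *% ((Q gchoose k) * y ^ k) *% (cis (- a * of_int (j + int k)) *% w (j + int k))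
			= ((Q gchoose k) * y ^ k * (cis (a * of_int j) * cis (- a * of_int (j + int k)))) *% w (j + int k)"
			by (simp only: scaleC_scaleC ac_simps)
		then show "cis (a * of_int j) *% ((Q gchoose k) * y ^ k) *% (cis (- a * of_int (j + int k)) *% w (j + int k))
			= ((Q gchoose k) * (y * cis (- a)) ^ k) *% w (j + int k)"
			unfolding e by (simp only: power_mult_distrib mult.assoc)
	qed
	finally show ?thesis unfolding inner_ser_def by (simp only:)
qed

text \<open>Turning the two variables by opposite angles equals turning each member of the chain
  according to its index, i.e. X is replaced by a unimodular multiple.\<close>

lemma outer_ser_cis:
	assumes x: "norm x < 1" and y: "norm y < 1" and M: "!!j. norm (w j) <= M"
	shows "outer_ser P Q w 0 (x * cis a) (y * cis (- a)) = outer_ser P Q (%j. cis (- a * of_int j) *% w j) 0 x y"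
proof -
	have "((P gchoose i) * (x * cis a) ^ i) *% inner_ser Q w (0 - int i) (y * cis (- a))
			= ((P gchoose i) * x ^ i) *% inner_ser Q (%j. cis (- a * of_int j) *% w j) (0 - int i) y" for i
	proof -
		have "cis a ^ i * cis (a * of_int (0 - int i)) = 1"
			unfolding Complex.DeMoivre cis_mult by (simp add: algebra_simps)
		then have "(P gchoose i) * (x * cis a) ^ i * cis (a * of_int (0 - int i)) = (P gchoose i) * x ^ i"
			by (simp only: power_mult_distrib mult.assoc mult_1_right)
		then show ?thesis unfolding inner_ser_cis[OF y M] scaleC_scaleC by (simp only:)
	qed
	then show ?thesis unfolding outer_ser_def by (simp only:)
qed

lemma add_le_double: "p <= a + J ==> q <= b + J ==> 0 <= a ==> 0 <= b ==> p + q <= 2 * (a + b + J)" for p q a b J :: real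
	by argo

lemma complexify_in_U_crown: "g \<in> SL2R ==> complexify g \<in> U_crown"
proof -
	assume g: "g \<in> SL2R"
	define A B where "A = cayA (complexify g)" and "B = cayB (complexify g)"
	have "A * cnj A - B * cnj B = 1"
		using cay_det[of "complexify g"] complexify_SL2R[OF g] unfolding cay_complexify A_def B_def SL2C_def by simp
	then have "complex_of_real ((norm A)\<^sup>2 - (norm B)\<^sup>2) = 1" by (simp add: mult_cnj_norm)
	then have e: "(norm A)\<^sup>2 - (norm B)\<^sup>2 = 1" using of_real_eq_1_iff by blast
	then have "(norm B)\<^sup>2 < (norm A)\<^sup>2" by simp
	then have 1: "norm B < norm A" using power_less_imp_less_base norm_ge_zero by blast
	have "Re (A * cnj A) = (norm A)\<^sup>2" by (simp add: mult_cnj_norm flip: of_real_power)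
	then have 2: "Re (A * cnj A) > 0" using e zero_le_power2[of "norm B"] by linarith
	show ?thesis using 1 2 by (simp add: U_crown_def cay_complexify A_def B_def)
qed

section \<open>Orbit maps as double binomial series\<close>

context irrep
begin

lemma tower_bounded_ex:
	assumes "v \<in> wt n" "cas nu n v" "Re nu >= 0"
	shows "\<exists>M. \<forall>j. norm (tower nu n v j) <= M"
	by (rule tower_bounded[OF assms]) blast

text \<open>The orbit curves of all chain members and the functions \<open>Phi\<close> obey the same
  system with the same initial values, so \<open>ode_tower_unique\<close> applies to their
  differences.\<close>

lemma dia_tower:
	assumes v: "v \<in> wt n" "v ~= 0" "cas nu n v" and nu: "Re nu >= 0" and nt: "\<not> trivial_rep rp" and b: "b >= 0"
	shows "rp (dia b) v = Phi nu n (tower nu n v) 0 b"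
proof -
	define w where "w = tower nu n v"
	obtain M where "\<forall>j. norm (tower nu n v j) <= M" using tower_bounded_ex[OF v(1,3) nu] ..
	then have M: "norm (w j) <= M" for j by (simp add: w_def)
	have M0: "M >= 0" using norm_ge_zero M by (rule order_trans)
	define rho where "rho = tanh b"
	have rho: "0 <= rho" "rho < 1" using b tanh_less_1[of b] by (auto simp: rho_def)
	define K where "K = 2 / (1 - rho)"
	have K: "K >= 1" using rho by (simp add: K_def)
	define C0 where "C0 = absN (Pp nu n 0) rho * (absN (Qq nu n 0) rho * M)"
	have C0: "C0 >= 0" unfolding C0_def using absN_nonneg[OF rho] M0 by simp
	define Dl where "Dl j t = rp (dia t) (w j) - Phi nu n w j t" for j t
	define Dl' where "Dl' j t = (- Pp nu n j) *% Dl (j - 1) t + (- Qq nu n j) *% Dl (j + 1) t" for j t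
	have wwt: "w j \<in> wt (n + 2 * j)" for j unfolding w_def by (rule tower_wt_cas(1)[OF v(1,3)])
	have growth: "norm (Phi nu n w j t) <= C0 * (K\<^sup>2) ^ nat \<bar>j\<bar>" if "0 <= t" "t <= b" for j t
	proof -
		have T: "norm (- complex_of_real (tanh t)) <= rho" using that unfolding rho_def by simp
		have "norm (outer_ser (Pp nu n j) (Qq nu n j) w j (- of_real (tanh t)) (- of_real (tanh t)))
				<= absN (Pp nu n j) rho * (absN (Qq nu n j) rho * M)"
			by (rule outer_ser_bound[OF T T rho(2) M])
		also have "... <= (K ^ nat \<bar>j\<bar> * absN (Pp nu n 0) rho) * ((K ^ nat \<bar>j\<bar> * absN (Qq nu n 0) rho) * M)"
		proof (intro mult_mono mult_right_mono M0)
			show "absN (Pp nu n j) rho <= K ^ nat \<bar>j\<bar> * absN (Pp nu n 0) rho"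
				using absN_growth[OF rho, of "Pp nu n 0" j] unfolding Pp_shift(3)[of nu n j] K_def .
			show "absN (Qq nu n j) rho <= K ^ nat \<bar>j\<bar> * absN (Qq nu n 0) rho"
				using absN_growth[OF rho, of "Qq nu n 0" "- j"] unfolding Qq_shift(3)[of nu n j] K_def abs_minus_cancel .
		qed (use absN_nonneg[OF rho] M0 K in auto)
		also have "... = C0 * (K\<^sup>2) ^ nat \<bar>j\<bar>"
			unfolding C0_def power2_eq_square power_mult_distrib by (simp only: ac_simps)
		finally have o: "norm (outer_ser (Pp nu n j) (Qq nu n j) w j (- of_real (tanh t)) (- of_real (tanh t))) <= C0 * (K\<^sup>2) ^ nat \<bar>j\<bar>" .
		have "ln (cosh t) >= 0" using cosh_real_ge_1[of t] by simp
		then have "0 <= (1 + Re nu) * ln (cosh t)" using nu by simp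
		then have "norm (exp (- (1 + nu) * complex_of_real (ln (cosh t)))) <= 1"
			unfolding norm_exp_eq_Re by (simp add: algebra_simps)
		from mult_mono[OF this o] show ?thesis unfolding Phi_def norm_scaleC using C0 by simp
	qed
	have "Dl 0 b = 0"
	\<comment> \<open>Only the nonzero members are compared: for these the formula for
	  \<open>Hop\<close> is valid, and the system closes up among them. The rate is K^2 because each of
	  the two binomial majorants can grow by K per index.\<close>
	proof (rule ode_tower_unique[where N = "{j. w j ~= 0}" and Dl' = Dl' and ka = "norm (Pp nu n 0) + norm (Qq nu n 0)" and L = "K\<^sup>2" and C = "M + C0" and b = b])
		fix j t assume j: "j \<in> {j. w j ~= 0}" and t: "0 <= t" "t <= b"
		have "Hop (w j) = (- Pp nu n j) *% w (j - 1) + (- Qq nu n j) *% w (j + 1)"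
		proof -
			have e: "- Qq nu n j = (of_int (n + 2 * j) + 1 + nu) / 2" "Pp nu n j = (of_int (n + 2 * j) - 1 - nu) / 2"
				by (simp_all add: Qq_def Pp_def field_simps)
			show ?thesis using Hop_tower[OF v(1,3), of j] j unfolding w_def e scaleC_minus_left by simp
		qed
		then have h: "rp (dia t) (Hop (w j)) = (- Pp nu n j) *% rp (dia t) (w (j - 1)) + (- Qq nu n j) *% rp (dia t) (w (j + 1))"
			by (simp only: rep_add[OF dia_SL2R] rep_scaleC[OF dia_SL2R])
		have "(Dl j has_vector_derivative rp (dia t) (Hop (w j)) - ((- Pp nu n j) *% Phi nu n w (j - 1) t + (- Qq nu n j) *% Phi nu n w (j + 1) t)) (at t)"
			unfolding Dl_def[abs_def] by (rule has_vector_derivative_diff[OF Hop_deriv[OF wwt] Phi_deriv[OF M]])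
		moreover have "rp (dia t) (Hop (w j)) - ((- Pp nu n j) *% Phi nu n w (j - 1) t + (- Qq nu n j) *% Phi nu n w (j + 1) t) = Dl' j t"
			unfolding h Dl'_def Dl_def scaleC_diff_right by simp
		ultimately show "(Dl j has_vector_derivative Dl' j t) (at t)" by (simp only:)
	next
		fix j t and c :: real
		assume j: "j \<in> {j. w j ~= 0}" and t: "0 <= t" "t <= b" and c: "c >= 0"
			and IH: "!!i. i \<in> {j. w j ~= 0} ==> \<bar>i\<bar> <= \<bar>j\<bar> + 1 ==> norm (Dl i t) <= c"
		have jz: "tower nu n v j ~= 0" using j by (simp add: w_def)
		\<comment> \<open>If the lower neighbour has vanished, the index is outside the system, but then
		  its coefficient is zero by \<open>tower_bottom\<close>.\<close>
		have a: "norm ((- Pp nu n j) *% Dl (j - 1) t) <= norm (Pp nu n j) * c"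
		proof (cases "w (j - 1) = 0")
			case True
			then have "Pp nu n j = 0" using tower_bottom[OF v(1,3) jz _ nu nt] by (simp add: w_def Pp_def)
			then show ?thesis by simp
		next
			case False
			then have "norm (Dl (j - 1) t) <= c" by (intro IH) auto
			then show ?thesis by (simp add: mult_left_mono)
		qed
		have b': "norm ((- Qq nu n j) *% Dl (j + 1) t) <= norm (Qq nu n j) * c"
		proof (cases "w (j + 1) = 0")
			case True
			then have "of_int (n + 2 * j) + 1 + nu = 0" using tower_top[OF v(1,3) jz _ nu nt] by (simp add: w_def)
			moreover have "Qq nu n j = - ((of_int (n + 2 * j) + 1 + nu) / 2)" by (simp add: Qq_def field_simps)
			ultimately have "Qq nu n j = 0" by (simp only: div_0 minus_zero)
			then show ?thesis by simp
		next
			case False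
			then have "norm (Dl (j + 1) t) <= c" by (intro IH) auto
			then show ?thesis by (simp add: mult_left_mono)
		qed
		have "norm (Pp nu n j) <= norm (Pp nu n 0) + of_int \<bar>j\<bar>" "norm (Qq nu n j) <= norm (Qq nu n 0) + of_int \<bar>j\<bar>"
			using norm_triangle_ineq[of "Pp nu n 0" "of_int j"] norm_triangle_ineq[of "Qq nu n 0" "of_int (- j)"]
			unfolding Pp_shift(3)[of nu n j] Qq_shift(3)[of nu n j] by (simp_all add: norm_of_int)
		then have "norm (Pp nu n j) + norm (Qq nu n j) <= 2 * (norm (Pp nu n 0) + norm (Qq nu n 0) + of_int \<bar>j\<bar>)"
			by (rule add_le_double) simp_all
		then have "(norm (Pp nu n j) + norm (Qq nu n j)) * c <= 2 * (norm (Pp nu n 0) + norm (Qq nu n 0) + of_int \<bar>j\<bar>) * c"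
			by (rule mult_right_mono[OF _ c])
		moreover have "norm (Dl' j t) <= norm (Pp nu n j) * c + norm (Qq nu n j) * c"
			unfolding Dl'_def using norm_triangle_ineq a b' by (rule order_trans[OF _ add_mono])
		ultimately show "norm (Dl' j t) <= 2 * (norm (Pp nu n 0) + norm (Qq nu n 0) + of_int \<bar>j\<bar>) * c"
			by (simp add: distrib_right)
	next
		show "1 <= K\<^sup>2" using K by (rule one_le_power)
		then have KL: "1 <= (K\<^sup>2) ^ nat \<bar>j\<bar>" for j by (rule one_le_power)
		fix j t assume "j \<in> {j. w j ~= 0}" and t: "0 <= t" "t <= b"
		have "norm (Dl j t) <= norm (w j) + norm (Phi nu n w j t)"
			unfolding Dl_def using norm_triangle_ineq4[of "rp (dia t) (w j)" "Phi nu n w j t"] by simp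
		also have "... <= M * (K\<^sup>2) ^ nat \<bar>j\<bar> + C0 * (K\<^sup>2) ^ nat \<bar>j\<bar>"
			using M[of j] mult_left_mono[OF KL[of j] M0] growth[OF t, of j] by linarith
		finally show "norm (Dl j t) <= (M + C0) * (K\<^sup>2) ^ nat \<bar>j\<bar>" by (simp add: distrib_right)
	next
		show "Dl j 0 = 0" for j by (simp add: Dl_def Phi_def dia_0 outer_ser_0 inner_ser_0)
	qed (use v b M0 C0 in \<open>auto simp: w_def tower_0\<close>)
	then show ?thesis by (simp add: Dl_def w_def tower_0)
qed

text \<open>By the Cartan decomposition it is enough to follow the two rotations: the left one turns
  b/a and c/d in opposite directions, which is undone by \<open>outer_ser_cis\<close>, and the
  remaining phase sits in a^n.\<close>

lemma Fser_orbit: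
	assumes v: "v \<in> wt n" "v ~= 0" "cas nu n v" and nu: "Re nu >= 0" and nt: "\<not> trivial_rep rp" and g: "g \<in> SL2R"
	shows "Fser n (Pp nu n 0) (Qq nu n 0) (tower nu n v) 0 (complexify g) = rp g v"
proof -
	obtain al t bt where ge: "g = rot al ** dia t ** rot bt" and t: "t >= 0" using KAK[OF g] .
	define w P Q where "w = tower nu n v" and "P = Pp nu n 0" and "Q = Qq nu n 0"
	obtain M where "\<forall>j. norm (tower nu n v j) <= M" using tower_bounded_ex[OF v(1,3) nu] ..
	then have M: "norm (w j) <= M" for j by (simp add: w_def)
	have wwt: "w j \<in> wt (n + 2 * j)" for j unfolding w_def by (rule tower_wt_cas(1)[OF v(1,3)])
	define T where "T = tanh t"
	define x where "x = - complex_of_real T"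
	have x1: "norm x < 1" using tanh_less_1[of t] by (simp add: x_def T_def)
	have ch: "cosh t > 0" by simp
	note A = cay_rot_dia_rot(1)[of al t bt, folded ge] and B = cay_rot_dia_rot(2)[of al t bt, folded ge]
	have "cayA (complexify g) * cayD (complexify g) = of_real ((cosh t)\<^sup>2)"
		unfolding cay_complexify mult_cnj_norm unfolding A by (simp add: norm_mult)
	then have AD: "Ln (cayA (complexify g) * cayD (complexify g)) = of_real (2 * ln (cosh t))"
		using ch by (simp add: Ln_of_real ln_realpow del: of_real_power)
	have xe: "cayB (complexify g) * inverse (cayA (complexify g)) = x * cis (2 * al)"
	proof -
		have "cayA (complexify g) * (x * cis (2 * al)) = - (cis (- (al + bt)) * cis (2 * al)) * of_real (cosh t * tanh t)"
			unfolding A x_def T_def by simp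
		also have "... = cayB (complexify g)" unfolding B cis_mult using ch by (simp add: tanh_def)
		finally show ?thesis using ch unfolding A by (simp add: field_simps)
	qed
	have ye: "cayC (complexify g) * inverse (cayD (complexify g)) = x * cis (- (2 * al))"
	proof -
		have "cnj (cayB (complexify g) * inverse (cayA (complexify g))) = cnj (x * cis (2 * al))" unfolding xe ..
		then show ?thesis by (simp add: cay_complexify x_def cis_cnj)
	qed
	\<comment> \<open>The left rotation, corrected by the phase of v; on the member with index j it
	  acts by \<open>cis (- 2 * al * j)\<close>.\<close>
	define L where "L y = cis (of_int n * al) *% rp (rot al) y" for y
	have L: "bounded_linear L" "L (c *% y) = c *% L y" for c y
		unfolding L_def[abs_def] by (rule bounded_linear_compose[OF bounded_linear_scaleC_right rep_bounded_linear[OF rot_SL2R]],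
			simp add: rep_scaleC scaleC_scaleC mult.commute)
	have Lw: "(%j. cis (- (2 * al) * of_int j) *% w j) = (%j. L (w j))"
	proof
		fix j
		show "cis (- (2 * al) * of_int j) *% w j = L (w j)"
			unfolding L_def wtD[OF wwt] scaleC_scaleC cis_mult by (simp add: algebra_simps)
	qed
	have o: "outer_ser P Q w 0 (x * cis (2 * al)) (x * cis (- (2 * al))) = L (outer_ser P Q w 0 x x)"
		unfolding outer_ser_cis[OF x1 x1 M] Lw outer_ser_map[OF L x1 x1 M] ..
	have powA: "cayA (complexify g) powi n = cis (- of_int n * (al + bt)) * exp (of_int n * of_real (ln (cosh t)))"
	proof -
		have e: "cayA (complexify g) = exp (\<i> * of_real (- (al + bt)) + of_real (ln (cosh t)))"
			unfolding A exp_add cis_conv_exp using ch by (simp add: exp_of_real)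
		have "exp u powi n = exp (of_int n * u)" for u :: complex by (simp add: exp_power_int)
		then show ?thesis unfolding e cis_conv_exp by (simp add: exp_add[symmetric] algebra_simps)
	qed
	have nQ: "of_int n + 2 * Q = - (1 + nu)" by (simp add: Q_def Qq_def field_simps)
	have "cayA (complexify g) powi n * exp (Q * Ln (cayA (complexify g) * cayD (complexify g)))
			= cis (- of_int n * (al + bt)) * (exp (of_int n * of_real (ln (cosh t))) * exp (Q * of_real (2 * ln (cosh t))))"
		unfolding AD powA by simp
	also have "... = cis (- of_int n * (al + bt)) * exp (- (1 + nu) * of_real (ln (cosh t)))"
		unfolding exp_add[symmetric] nQ[symmetric] by (simp add: algebra_simps)
	finally have pre: "cayA (complexify g) powi n * exp (Q * Ln (cayA (complexify g) * cayD (complexify g)))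
		= cis (- of_int n * (al + bt)) * exp (- (1 + nu) * of_real (ln (cosh t)))" .
	have "Fser n P Q w 0 (complexify g) = (cis (- of_int n * (al + bt)) * exp (- (1 + nu) * of_real (ln (cosh t)))) *% L (outer_ser P Q w 0 x x)"
		unfolding Fser_def xe ye o pre ..
	also have "... = cis (- of_int n * (al + bt)) *% L (Phi nu n w 0 t)"
		unfolding Phi_def P_def[symmetric] Q_def[symmetric] L(2) scaleC_scaleC x_def T_def ..
	also have "Phi nu n w 0 t = rp (dia t) v" unfolding w_def by (rule dia_tower[OF v nu nt t, symmetric])
	also have "cis (- of_int n * (al + bt)) *% L (rp (dia t) v) = cis (- of_int n * bt) *% rp (rot al) (rp (dia t) v)"
		unfolding L_def scaleC_scaleC cis_mult by (simp add: algebra_simps)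
	also have "... = rp g v"
		unfolding ge by (simp add: rep_mult SL2R_mult wtD[OF v(1)] rep_scaleC)
	finally show ?thesis unfolding w_def P_def Q_def .
qed

end

section \<open>Geometry of the crown and of the two larger domains\<close>

text \<open>A Hermitian form of signature (1,1) evaluated on the pair (a, b). By
  \<open>moebius_cXY\<close> its sign tells whether the second base point, -i, is moved into the
  lower half plane; \<open>cY\<close> does the same for i and the upper half plane.\<close>

definition cX :: "complex^2^2 => real" where "cX z = (norm (cayA z))\<^sup>2 - (norm (cayB z))\<^sup>2"
definition cY :: "complex^2^2 => real" where "cY z = (norm (cayD z))\<^sup>2 - (norm (cayC z))\<^sup>2"

text \<open>The exponential of cZ with Z spanning p^+: since Z^2 = 0 it is 1 + cZ.\<close>

definition pc :: "complex => complex^2^2" where "pc c = m22 (1 + c) (\<i> * c) (\<i> * c) (1 - c)"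
definition ke :: "complex => complex^2^2" where "ke ta = m22 (cos ta) (- sin ta) (sin ta) (cos ta)"
text \<open>The real matrix with prescribed \<open>cayA\<close> and \<open>cayB\<close>, i.e. the
  inverse Cayley transform.\<close>

definition gr :: "complex => complex => real^2^2" where
	"gr A B = m22 (Re A - Re B) (Im A - Im B) (- Im A - Im B) (Re A + Re B)"
text \<open>Conjugation by diag(1,-1). It swaps a with d and b with c, hence p^+ with p^-.\<close>

definition tw :: "'a^2^2 => 'a::ring_1^2^2" where "tw z = m22 (z$1$1) (- (z$1$2)) (- (z$2$1)) (z$2$2)"

lemma cay_pc: "cayA (pc c) = 1" "cayB (pc c) = 0" "cayC (pc c) = - 2 * c" "cayD (pc c) = 1"
	by (simp_all add: pc_def cay_defs complex_eq_iff)

lemma cay_ke: "cayA (ke ta) = exp (- \<i> * ta)" "cayB (ke ta) = 0" "cayC (ke ta) = 0" "cayD (ke ta) = exp (\<i> * ta)"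
	by (simp_all add: ke_def cay_defs exp_Euler exp_minus_Euler)

lemma cay_gr: "cayA (complexify (gr A B)) = A" "cayB (complexify (gr A B)) = B"
	"cayC (complexify (gr A B)) = cnj B" "cayD (complexify (gr A B)) = cnj A"
	by (simp_all add: gr_def cay_defs complex_eq_iff)

lemma det_gr: "complex_of_real (det (gr A B)) = A * cnj A - B * cnj B"
	by (simp add: gr_def complex_eq_iff algebra_simps)

lemma cay_tw: "cayA (tw z) = cayD z" "cayB (tw z) = cayC z" "cayC (tw z) = cayB z" "cayD (tw z) = cayA z"
	by (simp_all add: tw_def cay_defs algebra_simps)

lemma tw_m22 [simp]: "tw (m22 a b c d) = m22 a (- b) (- c) d" by (simp add: tw_def)
lemma tw_tw [simp]: "tw (tw z) = z" by (cases z rule: m22_cases) simp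
lemma tw_mult: "tw (z ** z') = tw z ** tw (z'::'a::ring_1^2^2)"
	by (cases z rule: m22_cases; cases z' rule: m22_cases) (simp add: add.commute)
lemma tw_complexify: "tw (complexify g) = complexify (tw g)"
	by (cases g rule: m22_cases) simp
lemma tw_SL2R [simp]: "tw g \<in> SL2R \<longleftrightarrow> g \<in> SL2R" by (cases g rule: m22_cases) simp
lemma tw_SL2C [simp]: "tw g \<in> SL2C \<longleftrightarrow> g \<in> SL2C" by (cases g rule: m22_cases) simp
lemma tw_1 [simp]: "tw (mat 1) = mat 1" by (simp add: mat_1_m22)
lemma cX_tw: "cX (tw z) = cY z" "cY (tw z) = cX z" by (simp_all add: cX_def cY_def cay_tw)

lemma SO2C_m22: "m22 a b c d \<in> SO2C \<longleftrightarrow> d = a & c = - b & a * a + b * b = 1"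
proof -
	have t: "transpose (m22 a b c d) = m22 a c b d"
		by (simp add: transpose_def m22_def vec_eq_iff forall_2)
	have e: "m22 a b c d \<in> SO2C \<longleftrightarrow> m22 a c b d ** m22 a b c d = mat 1 & m22 a b c d ** m22 a c b d = mat 1 & a * d - b * c = 1"
		unfolding SO2C_def rotation_matrix_def orthogonal_matrix_def t mem_Collect_eq det_m22 by (simp only: conj_assoc)
	show ?thesis
	proof
		assume "m22 a b c d \<in> SO2C"
		then have h: "a * a + c * c = 1" "a * b + c * d = 0" "a * d - b * c = 1"
			unfolding e mat_1_m22 m22_mult m22_eq_iff by auto
		have d: "d = a" using h by algebra
		have c: "c = - b" using h by algebra
		show "d = a & c = - b & a * a + b * b = 1" using d c h(1) by simp
	next
		assume "d = a & c = - b & a * a + b * b = 1"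
		then show "m22 a b c d \<in> SO2C"
			unfolding e mat_1_m22 m22_mult m22_eq_iff by (auto simp: algebra_simps)
	qed
qed

lemma ke_SO2C [simp]: "ke ta \<in> SO2C"
	unfolding ke_def SO2C_m22 using sin_cos_squared_add[of ta] by (simp add: power2_eq_square add.commute)

lemma complexify_rot: "complexify (rot th) = ke (of_real th)"
	by (simp add: rot_def ke_def cos_of_real sin_of_real)

lemma tw_SO2C [simp]: "tw k \<in> SO2C \<longleftrightarrow> k \<in> SO2C"
	by (cases k rule: m22_cases) (auto simp: SO2C_m22)

lemma SO2C_cay:
	assumes "k \<in> SO2C"
	shows "cayB k = 0" "cayC k = 0" "cayA k * cayD k = 1"
proof -
	obtain a b c d where k: "k = m22 a b c d" by (rule m22_cases)
	have e: "d = a" "c = - b" "a * a + b * b = 1" using assms unfolding k SO2C_m22 by auto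
	show 1: "cayB k = 0" "cayC k = 0" unfolding k cay_defs e by simp_all
	have "det k = 1" unfolding k det_m22 e(1,2) using e(3) by simp
	then show "cayA k * cayD k = 1" using cay_det[of k] 1 by simp
qed

lemma SO2C_SL2C: "k \<in> SO2C ==> k \<in> SL2C"
	by (simp add: SO2C_def SL2C_def rotation_matrix_def)

lemma pc_SL2C [simp]: "pc c \<in> SL2C" by (simp add: pc_def algebra_simps)
lemma pc_0: "pc 0 = mat 1" by (simp add: pc_def mat_1_m22)

text \<open>Left multiplication by a real matrix acts on the pair (a, b) by an element of SU(1,1),
  which preserves the form.\<close>

lemma cX_left:
	assumes g: "g \<in> SL2R"
	shows "cX (complexify g ** z) = cX z" "cY (complexify g ** z) = cY z"
proof -
	define al bt where "al = cayA (complexify g)" and "bt = cayB (complexify g)"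
	have gd: "(Re al)\<^sup>2 + (Im al)\<^sup>2 - ((Re bt)\<^sup>2 + (Im bt)\<^sup>2) = 1"
	proof -
		have "al * cnj al - bt * cnj bt = 1"
			using cay_det[of "complexify g"] complexify_SL2R[OF g] unfolding cay_complexify al_def bt_def SL2C_def by simp
		then have "Re (al * cnj al - bt * cnj bt) = 1" by simp
		then show ?thesis by (simp add: power2_eq_square)
	qed
	have key: "(norm (u * al + v * cnj bt))\<^sup>2 - (norm (u * bt + v * cnj al))\<^sup>2 = (norm u)\<^sup>2 - (norm v)\<^sup>2" for u v
	proof -
		have "(norm (u * al + v * cnj bt))\<^sup>2 - (norm (u * bt + v * cnj al))\<^sup>2
				= ((Re al)\<^sup>2 + (Im al)\<^sup>2 - ((Re bt)\<^sup>2 + (Im bt)\<^sup>2)) * ((norm u)\<^sup>2 - (norm v)\<^sup>2)"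
			unfolding cmod_power2 by (simp add: power2_eq_square algebra_simps)
		then show ?thesis unfolding gd by simp
	qed
	show "cX (complexify g ** z) = cX z"
		using key[of "cayA z" "cayB z"] unfolding cX_def cay_mult cay_complexify al_def bt_def .
	show "cY (complexify g ** z) = cY z"
		using key[of "cayC z" "cayD z"] unfolding cY_def cay_mult cay_complexify al_def bt_def by simp
qed

lemma cX_right:
	assumes k: "k \<in> SO2C"
	shows "cX (z ** k) = (norm (cayA k))\<^sup>2 * cX z" "cY (z ** k) = (norm (cayD k))\<^sup>2 * cY z"
	by (simp_all add: cX_def cY_def cay_mult SO2C_cay[OF k] norm_mult power_mult_distrib right_diff_distrib)

lemma cXY_continuous [continuous_intros]: "continuous_on S cX" "continuous_on S cY"
	unfolding cX_def[abs_def] cY_def[abs_def] by (intro continuous_intros)+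

text \<open>With the image of -i equal to q/p, \<open>cX\<close> is minus the imaginary part of
  \<open>q * cnj p\<close>, so it also has the right sign at infinity. The two images differ because
  their cross term is 2i by the determinant.\<close>

lemma moebius_cXY:
	assumes z: "z \<in> SL2C"
	shows "moebius_P1C z (Fin (-\<i>)) \<in> lower_half_plane \<longleftrightarrow> cX z > 0"
		and "moebius_P1C z (Fin \<i>) \<in> upper_half_plane \<longleftrightarrow> cY z > 0"
		and "moebius_P1C z (Fin \<i>) ~= moebius_P1C z (Fin (-\<i>))"
proof -
	obtain a b c d where ze: "z = m22 a b c d" by (rule m22_cases)
	have det: "a * d - b * c = 1" using z by (simp add: ze)
	define p q p' q' where "p = c * (-\<i>) + d" and "q = a * (-\<i>) + b" and "p' = c * \<i> + d" and "q' = a * \<i> + b"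
	have X: "cX z = - Im (q * cnj p)" and Y: "cY z = Im (q' * cnj p')"
		unfolding cX_def cY_def cmod_power2 ze cay_defs m22_nth p_def q_def p'_def q'_def
		by (simp_all add: power2_eq_square field_simps)
	have m: "moebius_P1C z (Fin (-\<i>)) = (if p = 0 then Infinity else Fin (q / p))"
		"moebius_P1C z (Fin \<i>) = (if p' = 0 then Infinity else Fin (q' / p'))"
		unfolding ze p_def q_def p'_def q'_def by simp_all
	show "moebius_P1C z (Fin (-\<i>)) \<in> lower_half_plane \<longleftrightarrow> cX z > 0"
		unfolding m X lower_half_plane_def by (auto simp: Im_complex_div_lt_0)
	show "moebius_P1C z (Fin \<i>) \<in> upper_half_plane \<longleftrightarrow> cY z > 0"
		unfolding m Y upper_half_plane_def by (auto simp: Im_complex_div_gt_0)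
	have ne: "q' * p - q * p' = 2 * \<i>"
	proof -
		have "q' * p - q * p' = 2 * \<i> * (a * d - b * c)" unfolding p_def q_def p'_def q'_def by (simp add: algebra_simps)
		then show ?thesis unfolding det by simp
	qed
	show "moebius_P1C z (Fin \<i>) ~= moebius_P1C z (Fin (-\<i>))"
	proof
		assume e: "moebius_P1C z (Fin \<i>) = moebius_P1C z (Fin (-\<i>))"
		have "q' * p - q * p' = 0"
		proof (cases "p = 0")
			case True
			then show ?thesis using e unfolding m by (simp split: if_splits)
		next
			case False
			then have "p' ~= 0" "q' / p' = q / p" using e unfolding m by (simp_all split: if_splits)
			then show ?thesis using False by (simp add: field_simps)
		qed
		then show False using ne by simp
	qed
qed

lemma preimage_S_plus: "preimage_SL2C S_plus = {z \<in> SL2C. cX z > 0}"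
	and preimage_S_minus: "preimage_SL2C S_minus = {z \<in> SL2C. cY z > 0}"
	and preimage_crown: "preimage_SL2C crown = {z \<in> SL2C. cX z > 0 & cY z > 0}"
	unfolding preimage_SL2C_def act_P1C2_def base_point_def S_plus_def S_minus_def crown_def X_C_def
	using moebius_cXY by (auto simp del: moebius_P1C.simps)

lemma cX_pos_iff: "cX z > 0 \<longleftrightarrow> norm (cayB z) < norm (cayA z)" "cY z > 0 \<longleftrightarrow> norm (cayC z) < norm (cayD z)"
	unfolding cX_def cY_def by (auto simp: power_strict_mono intro: power_less_imp_less_base)

text \<open>As bc = ad - 1, the two inequalities give |ad - 1| < |ad|: the number ad is closer to 1
  than to 0.\<close>

lemma crown_U_crown:
	assumes "z \<in> SL2C" "cX z > 0" "cY z > 0"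
	shows "z \<in> U_crown"
proof -
	have ad: "cayB z * cayC z = cayA z * cayD z - 1" using cay_det[of z] assms(1) by (simp add: SL2C_def algebra_simps)
	have "norm (cayB z * cayC z) < norm (cayA z * cayD z)"
		unfolding norm_mult using assms(2,3) by (intro mult_strict_mono') (auto simp: cX_pos_iff)
	then have "(norm (cayA z * cayD z - 1))\<^sup>2 < (norm (cayA z * cayD z))\<^sup>2" unfolding ad by (intro power_strict_mono) auto
	then have "0 < Re (cayA z * cayD z)" unfolding cmod_power2 by (simp add: power2_eq_square algebra_simps)
	then show ?thesis using assms(2,3) unfolding U_crown_def cX_pos_iff by simp
qed

text \<open>The Lagrange identity for the Hermitian form, with left side a Gram determinant. It
  shows that the product of \<open>cX\<close> and \<open>cY\<close> is the invariant that measures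
  the distance from the real group.\<close>

lemma cX_cY_identity:
	assumes "z \<in> SL2C"
	shows "(norm (cayC z * cnj (cayA z) - cayD z * cnj (cayB z)))\<^sup>2 = 1 - cX z * cY z"
proof -
	have "(norm (a * d - b * c))\<^sup>2 = ((norm a)\<^sup>2 - (norm b)\<^sup>2) * ((norm d)\<^sup>2 - (norm c)\<^sup>2) + (norm (c * cnj a - d * cnj b))\<^sup>2" for a b c d
		unfolding cmod_power2 by (simp add: power2_eq_square algebra_simps)
	from this[of "cayA z" "cayD z" "cayB z" "cayC z"] show ?thesis
		using assms unfolding cay_det cX_def cY_def SL2C_def by simp
qed

text \<open>The factorisation G exp(p^+) K_C. A purely imaginary angle scales (a, b) to value 1 of
  the form, so that it comes from a real matrix; what is left fixes (a, b) and is
  \<open>pc c\<close>.\<close>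

lemma decompose:
	assumes z: "z \<in> SL2C" and X: "cX z > 0"
	obtains g c ta where "g \<in> SL2R" "z = complexify g ** pc c ** ke ta" "4 * (norm c)\<^sup>2 = 1 - cX z * cY z" "norm (exp (- \<i> * ta)) = sqrt (cX z)"
proof -
	define A B C D where "A = cayA z" and "B = cayB z" and "C = cayC z" and "D = cayD z"
	define t where "t = complex_of_real (sqrt (cX z))"
	\<comment> \<open>Minus half the Hermitian pairing of the rows; \<open>cX_cY_identity\<close> turns
	  its modulus into the stated formula.\<close>
	define c where "c = - (C * cnj A - D * cnj B) / 2"
	define ta where "ta = \<i> * of_real (ln (sqrt (cX z)))"
	have t0: "t ~= 0" using X by (simp add: t_def)
	have kt: "exp (- \<i> * ta) = t" "exp (\<i> * ta) = inverse t"
		using X by (simp_all add: ta_def t_def exp_of_real exp_minus flip: mult.assoc)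
	have tt: "t * t = A * cnj A - B * cnj B"
	proof -
		have "t * t = of_real (cX z)" unfolding t_def of_real_mult[symmetric] using X by simp
		then show ?thesis by (simp add: cX_def mult_cnj_norm A_def B_def)
	qed
	have det: "A * D - B * C = 1" using cay_det[of z] z by (simp add: A_def B_def C_def D_def SL2C_def)
	have ct: "cnj t = t" by (simp add: t_def)
	define g where "g = gr (A / t) (B / t)"
	have "det g = 1"
	proof -
		have "complex_of_real (det g) = (A / t) * cnj (A / t) - (B / t) * cnj (B / t)"
			unfolding g_def by (rule det_gr)
		also have "... = (A * cnj A - B * cnj B) / (t * t)" by (simp add: ct diff_divide_distrib)
		also have "... = 1" using t0 unfolding tt[symmetric] by simp
		finally show ?thesis using of_real_eq_1_iff by blast
	qed
	then have g: "g \<in> SL2R" by (simp add: SL2R_def)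
	have e1: "- 2 * c * A + cnj B = t * t * C"
		unfolding c_def tt using det by (simp add: field_simps) algebra
	have e2: "- 2 * c * B + cnj A = t * t * D"
		unfolding c_def tt using det by (simp add: field_simps) algebra
	have "z = complexify g ** pc c ** ke ta"
	proof (rule cay_inj)
		show "cayA z = cayA (complexify g ** pc c ** ke ta)" "cayB z = cayB (complexify g ** pc c ** ke ta)"
			unfolding cay_mult cay_pc cay_ke g_def cay_gr kt using t0 by (simp_all add: A_def B_def)
		have "cayC (complexify g ** pc c ** ke ta) = (- 2 * c * A + cnj B) / (t * t)"
			unfolding cay_mult cay_pc cay_ke g_def cay_gr kt using t0 by (simp add: ct field_simps)
		then show "cayC z = cayC (complexify g ** pc c ** ke ta)" unfolding e1 using t0 by (simp add: C_def)
		have "cayD (complexify g ** pc c ** ke ta) = (- 2 * c * B + cnj A) / (t * t)"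
			unfolding cay_mult cay_pc cay_ke g_def cay_gr kt using t0 by (simp add: ct field_simps)
		then show "cayD z = cayD (complexify g ** pc c ** ke ta)" unfolding e2 using t0 by (simp add: D_def)
	qed
	moreover have "4 * (norm c)\<^sup>2 = 1 - cX z * cY z"
		unfolding cX_cY_identity[OF z, symmetric] c_def A_def B_def C_def D_def
		by (simp only: norm_divide norm_minus_cancel power_divide) simp
	moreover have "norm (exp (- \<i> * ta)) = sqrt (cX z)" unfolding kt using X by (simp add: t_def)
	ultimately show ?thesis using g that by blast
qed

lemma pc_rot: "complexify (rot al) ** pc c ** complexify (rot (- al)) = pc (c * cis (- (2 * al)))"
proof (rule cay_inj)
	have e: "cis (- al) * cis (- al) = cis (- (2 * al))" by (simp add: cis_mult)
	show "cayC (complexify (rot al) ** pc c ** complexify (rot (- al))) = cayC (pc (c * cis (- (2 * al))))"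
		unfolding cay_mult cay_rot cay_pc e[symmetric] by simp
qed (simp_all add: cay_mult cay_rot cay_pc cis_mult)

lemma cX_pc: "cX (pc c) = 1" "cY (pc c) = 1 - 4 * (norm c)\<^sup>2"
	by (simp_all add: cX_def cY_def cay_pc norm_mult power_mult_distrib)

lemma cX_pos_SL2R: "g \<in> SL2R ==> cX (complexify g) > 0 & cY (complexify g) > 0"
	using complexify_in_U_crown[of g] unfolding cX_pos_iff U_crown_def by simp

lemma cX_triple:
	assumes "g \<in> SL2R" "k \<in> SO2C"
	shows "cX (complexify g ** z ** k) > 0 \<longleftrightarrow> cX z > 0" "cY (complexify g ** z ** k) > 0 \<longleftrightarrow> cY z > 0"
proof -
	have "cayA k ~= 0" "cayD k ~= 0" using SO2C_cay(3)[OF assms(2)] by auto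
	then show "cX (complexify g ** z ** k) > 0 \<longleftrightarrow> cX z > 0" "cY (complexify g ** z ** k) > 0 \<longleftrightarrow> cY z > 0"
		unfolding cX_right[OF assms(2)] cX_left[OF assms(1)] by (simp_all add: zero_less_mult_iff)
qed

lemma continuous_on_matrix_mult [continuous_intros]:
	fixes f g :: "'x::topological_space => complex^2^2"
	assumes "continuous_on S f" "continuous_on S g"
	shows "continuous_on S (%x. f x ** g x)"
	unfolding matrix_matrix_mult_def
	by (intro continuous_on_vec_lambda continuous_intros continuous_on_component assms)

text \<open>Writing g by the Cartan decomposition makes the set a continuous image of a product of
  connected parameter spaces.\<close>

lemma connected_parametrized:
	fixes T :: "complex set"
	assumes T: "connected T"
	shows "connected {complexify g ** pc c ** ke ta | g c ta. g \<in> SL2R & c \<in> T}"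
proof -
	let ?f = "%(al, t, bt, c, ta). ke (of_real al) ** complexify (dia t) ** ke (of_real bt) ** pc c ** ke ta"
	let ?S = "(UNIV::real set) \<times> (UNIV::real set) \<times> (UNIV::real set) \<times> T \<times> (UNIV :: complex set)"
	have "{complexify g ** pc c ** ke ta | g c ta. g \<in> SL2R & c \<in> T} = ?f ` ?S"
	proof (rule set_eqI, rule iffI)
		fix z assume "z \<in> {complexify g ** pc c ** ke ta | g c ta. g \<in> SL2R & c \<in> T}"
		then obtain g c ta where z: "z = complexify g ** pc c ** ke ta" "g \<in> SL2R" "c \<in> T" by blast
		obtain al t bt where "g = rot al ** dia t ** rot bt" using KAK[OF z(2)] by metis
		then have "z = ?f (al, t, bt, c, ta)" unfolding z(1) by (simp add: complexify_mult complexify_rot)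
		then show "z \<in> ?f ` ?S" using z(3) by (intro image_eqI[where x = "(al, t, bt, c, ta)"]) auto
	next
		fix z assume "z \<in> ?f ` ?S"
		then obtain al t bt c ta where z: "z = ?f (al, t, bt, c, ta)" "c \<in> T" by auto
		have "z = complexify (rot al ** dia t ** rot bt) ** pc c ** ke ta" unfolding z(1) by (simp add: complexify_mult complexify_rot)
		moreover have "rot al ** dia t ** rot bt \<in> SL2R" by (intro SL2R_mult) simp_all
		ultimately show "z \<in> {complexify g ** pc c ** ke ta | g c ta. g \<in> SL2R & c \<in> T}" using z(2) by blast
	qed
	moreover have "connected (?f ` ?S)"
	proof (rule connected_continuous_image)
		show "connected ?S" by (intro connected_Times connected_UNIV T)
		show "continuous_on ?S ?f"
			unfolding case_prod_beta ke_def pc_def dia_def map_matrix_m22 by (intro continuous_intros)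
	qed
	ultimately show ?thesis by simp
qed

lemma invariant_domain_cX:
	assumes U: "{z \<in> SL2C. P z} = {complexify g ** pc c ** ke ta | g c ta. g \<in> SL2R & c \<in> T}" and T: "connected T"
		and o: "open {z. P z}" and inv: "!!g z k. g \<in> SL2R ==> k \<in> SO2C ==> P z ==> P (complexify g ** z ** k)"
		and G: "!!g. g \<in> SL2R ==> P (complexify g)"
	shows "invariant_domain {z \<in> SL2C. P z}"
	unfolding invariant_domain_def
proof (intro conjI)
	have e: "{z \<in> SL2C. P z} = SL2C \<inter> {z. P z}" by blast
	show "openin (top_of_set SL2C) {z \<in> SL2C. P z}" unfolding e by (rule openin_open_Int[OF o])
	show "connected {z \<in> SL2C. P z}" unfolding U by (rule connected_parametrized[OF T])
	show "\<forall>g\<in>SL2R. \<forall>x\<in>{z \<in> SL2C. P z}. \<forall>k\<in>SO2C. complexify g ** x ** k \<in> {z \<in> SL2C. P z}"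
		by (auto simp: inv SL2C_mult complexify_SL2R SO2C_SL2C)
	show "complexify ` SL2R \<subseteq> {z \<in> SL2C. P z}" using G by (auto intro: complexify_SL2R)
qed

lemma invariant_domain_S_plus: "invariant_domain {z \<in> SL2C. cX z > 0}"
proof (rule invariant_domain_cX[where T = UNIV])
	show "{z \<in> SL2C. cX z > 0} = {complexify g ** pc c ** ke ta | g c ta. g \<in> SL2R & c \<in> UNIV}"
	proof (intro equalityI subsetI)
		fix z assume "z \<in> {z \<in> SL2C. cX z > 0}"
		then have "z \<in> SL2C" "cX z > 0" by auto
		then obtain g c ta where "g \<in> SL2R" "z = complexify g ** pc c ** ke ta" by (rule decompose)
		then show "z \<in> {complexify g ** pc c ** ke ta | g c ta. g \<in> SL2R & c \<in> UNIV}" by blast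
	next
		fix z assume "z \<in> {complexify g ** pc c ** ke ta | g c ta. g \<in> SL2R & c \<in> UNIV}"
		then obtain g c ta where g: "g \<in> SL2R" and z: "z = complexify g ** pc c ** ke ta" by blast
		show "z \<in> {z \<in> SL2C. cX z > 0}" unfolding z
			using g by (simp add: cX_triple cX_pc SL2C_mult complexify_SL2R SO2C_SL2C)
	qed
	show "open {z. 0 < cX z}" by (intro open_Collect_less continuous_intros)
qed (auto simp: cX_triple cX_pos_SL2R)

lemma invariant_domain_crown: "invariant_domain {z \<in> SL2C. cX z > 0 & cY z > 0}"
proof (rule invariant_domain_cX[where T = "ball 0 (1/2)"])
	have half: "norm c < 1 / 2 \<longleftrightarrow> 0 < 1 - 4 * (norm c)\<^sup>2" for c :: complex
	proof -
		have "norm c < 1 / 2 \<longleftrightarrow> (norm c)\<^sup>2 < (1/2)\<^sup>2" using power_strict_mono power_less_imp_less_base by (metis norm_ge_zero divide_nonneg_nonneg zero_le_one zero_le_numeral pos2)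
		moreover have "(1 / 2 :: real)\<^sup>2 = 1 / 4" by (simp add: power2_eq_square)
		moreover have "x < 1 / 4 \<longleftrightarrow> 0 < 1 - 4 * x" for x :: real by (rule iffI; linarith)
		ultimately show ?thesis by (simp only:)
	qed
	show "{z \<in> SL2C. cX z > 0 & cY z > 0} = {complexify g ** pc c ** ke ta | g c ta. g \<in> SL2R & c \<in> ball 0 (1/2)}"
	proof (intro equalityI subsetI)
		fix z assume "z \<in> {z \<in> SL2C. cX z > 0 & cY z > 0}"
		then have z: "z \<in> SL2C" "cX z > 0" "cY z > 0" by auto
		obtain g c ta where d: "g \<in> SL2R" "z = complexify g ** pc c ** ke ta" by (rule decompose[OF z(1,2)])
		have "cY (pc c) > 0" using z(3) unfolding d(2) cX_triple(2)[OF d(1) ke_SO2C] .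
		then have "c \<in> ball 0 (1/2)" unfolding cX_pc half[symmetric] by simp
		then show "z \<in> {complexify g ** pc c ** ke ta | g c ta. g \<in> SL2R & c \<in> ball 0 (1/2)}" using d by blast
	next
		fix z assume "z \<in> {complexify g ** pc c ** ke ta | g c ta. g \<in> SL2R & c \<in> ball 0 (1/2)}"
		then obtain g c ta where g: "g \<in> SL2R" and z: "z = complexify g ** pc c ** ke ta" and c: "norm c < 1 / 2" by auto
		show "z \<in> {z \<in> SL2C. cX z > 0 & cY z > 0}" unfolding z
			using g c[unfolded half] by (simp add: cX_triple cX_pc SL2C_mult complexify_SL2R SO2C_SL2C)
	qed
	show "open {z. 0 < cX z & 0 < cY z}" by (intro open_Collect_conj open_Collect_less continuous_intros)
qed (auto simp: cX_triple cX_pos_SL2R)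

text \<open>Four elementary matrices reach everything: three do if the lower left entry is nonzero,
  and a fourth one makes it so.\<close>

lemma connected_SL2C: "connected SL2C"
proof -
	let ?f = "%(y, x, w, u). m22 1 0 y 1 ** m22 1 x 0 1 ** m22 1 0 w 1 ** m22 1 u 0 (1::complex)"
	have "SL2C = range ?f"
	proof (intro equalityI subsetI)
		fix z assume z: "z \<in> SL2C"
		obtain a b c d where ze: "z = m22 a b c d" by (rule m22_cases)
		have det: "a * d - b * c = 1" using z by (simp add: ze)
		have *: "m22 a b c d = m22 1 ((a - 1) / c) 0 1 ** m22 1 0 c 1 ** m22 1 ((d - 1) / c) 0 1"
			if "c ~= 0" "a * d - b * c = 1" for a b c d :: complex
		proof -
			have b: "b = (a * d - 1) / c" using that by (simp add: field_simps)
			show ?thesis unfolding b using that(1) by (simp add: field_simps)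
		qed
		show "z \<in> range ?f"
		proof (cases "c = 0")
			case False
			have "z = ?f (0, (a - 1) / c, c, (d - 1) / c)" unfolding ze *[OF False det] by simp
			then show ?thesis by blast
		next
			case True
			\<comment> \<open>Adding the first row to the second puts a, which is nonzero here, in the lower
			  left corner.\<close>
			then have a: "a ~= 0" using det by auto
			have "z = m22 1 0 (- 1) 1 ** m22 a b a (b + d)" unfolding ze using True by simp
			also have "m22 a b a (b + d) = m22 1 ((a - 1) / a) 0 1 ** m22 1 0 a 1 ** m22 1 ((b + d - 1) / a) 0 1"
				by (rule *[OF a]) (use det True in \<open>simp add: algebra_simps\<close>)
			finally have "z = ?f (- 1, (a - 1) / a, a, (b + d - 1) / a)" by (simp only: prod.case matrix_mul_assoc)
			then show ?thesis by blast
		qed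
	next
		fix z assume "z \<in> range ?f"
		then obtain y x w u where z: "z = ?f (y, x, w, u)" by auto
		show "z \<in> SL2C" unfolding z prod.case by (intro SL2C_mult) simp_all
	qed
	moreover have "connected (range ?f)"
		by (rule connected_continuous_image[OF _ connected_UNIV]) (unfold case_prod_beta, intro continuous_intros)
	ultimately show ?thesis by simp
qed

lemma invariant_domain_SL2C: "invariant_domain SL2C"
	unfolding invariant_domain_def
	using connected_SL2C by (auto simp: SL2C_mult complexify_SL2R SO2C_SL2C)

section \<open>Identity theorems and the slices of an invariant domain\<close>

lemma bounded_linear_smult_matrix: "bounded_linear (%c. smult_matrix c Z)"
proof -
	obtain a b c d where Z: "Z = m22 a b c d" by (rule m22_cases)
	have "linear (%c. smult_matrix c Z)"
		unfolding Z by (rule linearI) (simp_all add: smult_m22 add_m22 scaleR_m22 algebra_simps)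
	then show ?thesis by (simp add: linear_conv_bounded_linear)
qed

lemma m22_has_derivative:
	assumes "(a has_field_derivative a') (at c)" "(b has_field_derivative b') (at c)"
		"(e has_field_derivative e') (at c)" "(d has_field_derivative d') (at c)"
	shows "((%x. m22 (a x) (b x) (e x) (d x)) has_derivative (%h. smult_matrix h (m22 a' b' e' d'))) (at (c::complex))"
proof -
	have eq: "(%x. m22 (a x) (b x) (e x) (d x)) = (%x. smult_matrix (a x) (m22 1 0 0 0) + smult_matrix (b x) (m22 0 1 0 0)
			+ smult_matrix (e x) (m22 0 0 1 0) + smult_matrix (d x) (m22 0 0 0 1))"
		by (rule ext) (simp add: smult_m22 add_m22)
	have *: "((%x. smult_matrix (f x) Z) has_derivative (%h. smult_matrix (f' * h) Z)) (at c)"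
		if "(f has_field_derivative f') (at c)" for f f' Z
		by (rule bounded_linear.has_derivative[OF bounded_linear_smult_matrix that[unfolded has_field_derivative_def]])
	have "((%x. m22 (a x) (b x) (e x) (d x)) has_derivative (%h. smult_matrix (a' * h) (m22 1 0 0 0) + smult_matrix (b' * h) (m22 0 1 0 0)
			+ smult_matrix (e' * h) (m22 0 0 1 0) + smult_matrix (d' * h) (m22 0 0 0 1))) (at c)"
		unfolding eq by (intro has_derivative_add * assms)
	then show ?thesis by (simp add: smult_m22 add_m22 mult.commute)
qed

lemma holoE:
	assumes "holomorphic_on_SL2C F D" "z \<in> D"
	obtains U H where "open U" "z \<in> U" "\<forall>x\<in>U. complex_differentiable_at H x" "\<forall>x\<in>U \<inter> D. H x = F x"
	using assms unfolding holomorphic_on_SL2C_def by meson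

lemma holoI:
	assumes "!!z. z \<in> D ==> \<exists>U H. open U & z \<in> U & (\<forall>x\<in>U. complex_differentiable_at H x) & (\<forall>x\<in>U \<inter> D. H x = F x)"
	shows "holomorphic_on_SL2C F D"
	using assms unfolding holomorphic_on_SL2C_def by blast

text \<open>Reduces vector-valued holomorphy on the group to functions of one variable, by
  restriction to curves of determinant one and pairing with a vector.\<close>

lemma holo_curve:
	assumes F: "holomorphic_on_SL2C F D" and S: "open S"
		and h: "a holomorphic_on S" "b holomorphic_on S" "e holomorphic_on S" "d holomorphic_on S"
		and D: "!!c. c \<in> S ==> m22 (a c) (b c) (e c) (d c) \<in> D"
	shows "(%c. cinner (F (m22 (a c) (b c) (e c) (d c))) y) holomorphic_on S"
proof -
	define ga where "ga c = m22 (a c) (b c) (e c) (d c)" for c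
	have cont: "continuous_on S ga"
		unfolding ga_def[abs_def] by (intro continuous_intros holomorphic_on_imp_continuous_on h)
	have "\<exists>f'. ((%c. cinner (F (ga c)) y) has_field_derivative f') (at c)" if c: "c \<in> S" for c
	proof -
		have "ga c \<in> D" using D[OF c] by (simp add: ga_def)
		then obtain U H where U: "open U" "ga c \<in> U" "\<forall>x\<in>U. complex_differentiable_at H x" "\<forall>x\<in>U \<inter> D. H x = F x"
			by (rule holoE[OF F])
		obtain L where L: "(H has_derivative L) (at (ga c))" "\<forall>r Y. L (smult_matrix r Y) = r *% L Y"
			using U(3)[rule_format, OF U(2)] unfolding complex_differentiable_at_def by (elim exE conjE)
		define G where "G = m22 (deriv a c) (deriv b c) (deriv e c) (deriv d c)"
		have G: "(ga has_derivative (%h. smult_matrix h G)) (at c)"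
			unfolding ga_def[abs_def] G_def
			by (rule m22_has_derivative[OF holomorphic_derivI[OF h(1) S c] holomorphic_derivI[OF h(2) S c] holomorphic_derivI[OF h(3) S c] holomorphic_derivI[OF h(4) S c]])
		have "((%x. H (ga x)) has_derivative (%h. L (smult_matrix h G))) (at c)"
			using diff_chain_at[OF G L(1)] by (simp add: o_def)
		then have "((%x. cinner (H (ga x)) y) has_derivative (%h. cinner (L (smult_matrix h G)) y)) (at c)"
			by (rule bounded_linear.has_derivative[OF bounded_linear_cinner_left])
		moreover have "(%h. cinner (L (smult_matrix h G)) y) = (*) (cinner (L G) y)"
			by (rule ext) (simp add: L(2) cinner_scaleC_left mult.commute)
		ultimately have d: "((%x. cinner (H (ga x)) y) has_field_derivative cinner (L G) y) (at c)"
			by (simp add: has_field_derivative_def)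
		have op: "open (S \<inter> ga -` U)" by (rule continuous_open_preimage[OF cont S U(1)])
		have "((%x. cinner (F (ga x)) y) has_field_derivative cinner (L G) y) (at c)"
		proof (rule has_field_derivative_transform_within_open[OF d op])
			show "c \<in> S \<inter> ga -` U" using c U(2) by simp
			show "cinner (H (ga x)) y = cinner (F (ga x)) y" if "x \<in> S \<inter> ga -` U" for x
			proof -
				have "ga x \<in> U \<inter> D" using that D[of x] by (simp add: ga_def)
				then show ?thesis using U(4) by simp
			qed
		qed
		then show ?thesis by blast
	qed
	then show ?thesis unfolding holomorphic_on_open[OF S] ga_def by blast
qed

lemma identity_real:
	fixes x0 dl :: real
	assumes "f holomorphic_on ball (of_real x0) dl" "!!r. \<bar>r - x0\<bar> < dl ==> f (of_real r) = 0"
		and z: "z \<in> ball (of_real x0) dl"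
	shows "f z = 0"
proof (rule analytic_continuation[OF assms(1), where U = "of_real ` {r. \<bar>r - x0\<bar> < dl}" and \<xi> = "of_real x0"])
	have dl: "dl > 0" using le_less_trans[OF zero_le_dist z[unfolded mem_ball]] .
	then show "of_real x0 \<in> ball (complex_of_real x0) dl" by simp
	show "of_real ` {r. \<bar>r - x0\<bar> < dl} \<subseteq> ball (complex_of_real x0) dl"
		by (auto simp: dist_norm norm_minus_commute simp flip: of_real_diff)
	show "complex_of_real x0 islimpt of_real ` {r. \<bar>r - x0\<bar> < dl}"
		unfolding islimpt_approachable
	proof (intro allI impI)
		fix e :: real assume e: "e > 0"
		define r where "r = x0 + min e dl / 2"
		have "\<bar>r - x0\<bar> < dl" "r ~= x0" "\<bar>r - x0\<bar> < e" using e dl by (auto simp: r_def)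
		then show "\<exists>x'\<in>of_real ` {r. \<bar>r - x0\<bar> < dl}. x' ~= complex_of_real x0 & dist x' (of_real x0) < e"
			by (intro bexI[of _ "of_real r"]) (auto simp: dist_norm simp flip: of_real_diff)
	qed
qed (use assms(2) z in auto)

text \<open>SL(2,R) is a real form: in the chart by a, b, c the real points are real boxes, and the
  one-variable identity theorem is applied to one coordinate after the other.\<close>

lemma vanish_near_1:
	assumes D: "openin (top_of_set SL2C) D" "mat 1 \<in> D" and H: "holomorphic_on_SL2C H D"
		and 0: "!!g. g \<in> SL2R ==> complexify g \<in> D ==> H (complexify g) = 0"
	shows "\<exists>dl>0. \<forall>a b c d. m22 a b c d \<in> SL2C --> norm (a - 1) < dl --> norm b < dl --> norm c < dl --> m22 a b c d \<in> D & H (m22 a b c d) = 0"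
proof -
	obtain V where V: "open V" "D = SL2C \<inter> V" using D(1) unfolding openin_open by blast
	\<comment> \<open>The chart of SL(2,C) near the identity, with d solved from the
	  determinant.\<close>
	define cht :: "complex \<times> complex \<times> complex => complex^2^2"
		where "cht p = m22 (fst p) (fst (snd p)) (snd (snd p)) ((1 + fst (snd p) * snd (snd p)) / fst p)" for p
	have o1: "open {p :: complex \<times> complex \<times> complex. fst p ~= 0}" by (intro open_Collect_neq continuous_intros)
	have c1: "continuous_on {p. fst p ~= 0} cht" unfolding cht_def[abs_def] by (intro continuous_intros) auto
	have "open ({p. fst p ~= 0} \<inter> cht -` V)" by (rule continuous_open_preimage[OF c1 o1 V(1)])
	moreover have "(1, 0, 0) \<in> {p. fst p ~= 0} \<inter> cht -` V" using D(2) V(2) by (simp add: cht_def mat_1_m22)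
	ultimately obtain e where e: "e > 0" "ball (1, 0, 0) e \<subseteq> {p. fst p ~= 0} \<inter> cht -` V" unfolding open_contains_ball by meson
	define dl where "dl = e / 3"
	have dl: "dl > 0" using e(1) by (simp add: dl_def)
	have box: "a ~= 0 & m22 a b c ((1 + b * c) / a) \<in> D" if "norm (a - 1) < dl" "norm b < dl" "norm c < dl" for a b c
	proof -
		have "dist (1, 0, 0) (a, b, c) <= norm (1 - a) + norm (- b, - c)" unfolding dist_norm using norm_Pair_le[of "1 - a" "(- b, - c)"] by simp
		also have "... <= norm (a - 1) + (norm b + norm c)" using norm_Pair_le[of "- b" "- c"] by (simp add: norm_minus_commute)
		also have "... < e" using that by (simp add: dl_def)
		finally have "(a, b, c) \<in> {p. fst p ~= 0} \<inter> cht -` V" using e(2) by auto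
		then show ?thesis unfolding V(2) by (auto simp: cht_def)
	qed
	define f where "f a b c y = cinner (H (m22 a b c ((1 + b * c) / a))) y" for a b c y
	have holA: "(%a. f a b c y) holomorphic_on ball (of_real 1) dl" if "norm b < dl" "norm c < dl" for b c y
		unfolding f_def
	proof (rule holo_curve[OF H open_ball])
		fix a assume "a \<in> ball (complex_of_real 1) dl"
		then have "norm (a - 1) < dl" by (simp add: dist_norm norm_minus_commute)
		then show "m22 a b c ((1 + b * c) / a) \<in> D" using box that by blast
	next
		have "a ~= 0" if "a \<in> ball (complex_of_real 1) dl" for a
			using box[of a 0 0] that dl by (simp add: dist_norm norm_minus_commute)
		then show "(%a. (1 + b * c) / a) holomorphic_on ball (complex_of_real 1) dl" by (intro holomorphic_intros) auto
	qed (intro holomorphic_intros)+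
	have holB: "(%b. f a b c y) holomorphic_on ball (of_real 0) dl" if "norm (a - 1) < dl" "norm c < dl" for a c y
		unfolding f_def
	proof (rule holo_curve[OF H open_ball])
		fix b assume "b \<in> ball (complex_of_real 0) dl"
		then have "norm b < dl" by simp
		then show "m22 a b c ((1 + b * c) / a) \<in> D" using box that by blast
	next
		have "a ~= 0" using box[of a 0 0] that dl by simp
		then show "(%b. (1 + b * c) / a) holomorphic_on ball (complex_of_real 0) dl" by (intro holomorphic_intros) auto
	qed (intro holomorphic_intros)+
	have holC: "(%c. f a b c y) holomorphic_on ball (of_real 0) dl" if "norm (a - 1) < dl" "norm b < dl" for a b y
		unfolding f_def
	proof (rule holo_curve[OF H open_ball])
		fix c assume "c \<in> ball (complex_of_real 0) dl"
		then have "norm c < dl" by simp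
		then show "m22 a b c ((1 + b * c) / a) \<in> D" using box that by blast
	next
		have "a ~= 0" using box[of a 0 0] that dl by simp
		then show "(%c. (1 + b * c) / a) holomorphic_on ball (complex_of_real 0) dl" by (intro holomorphic_intros) auto
	qed (intro holomorphic_intros)+
	have b0: "norm x < dl ==> x \<in> ball (complex_of_real 0) dl" "norm (x - 1) < dl ==> x \<in> ball (complex_of_real 1) dl" for x
		by (simp_all add: dist_norm norm_minus_commute)
	have s0: "f (of_real a) (of_real b) (of_real c) y = 0" if "\<bar>a - 1\<bar> < dl" "\<bar>b\<bar> < dl" "\<bar>c\<bar> < dl" for a b c y
	proof -
		have "norm (complex_of_real (a - 1)) < dl" unfolding norm_of_real using that(1) .
		then have n: "norm (complex_of_real a - 1) < dl" by (simp only: of_real_diff of_real_1)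
		have n2: "norm (complex_of_real b) < dl" "norm (complex_of_real c) < dl" unfolding norm_of_real using that(2,3) .
		note b = box[OF n n2, THEN conjunct1] box[OF n n2, THEN conjunct2]
		have eq: "complexify (m22 a b c ((1 + b * c) / a)) = m22 (of_real a) (of_real b) (of_real c) ((1 + of_real b * of_real c) / complex_of_real a)"
			unfolding map_matrix_m22 m22_eq_iff of_real_divide of_real_add of_real_mult of_real_1 by (intro conjI refl)
		have "a ~= 0" using b(1) unfolding of_real_eq_0_iff .
		then have "m22 a b c ((1 + b * c) / a) \<in> SL2R" unfolding m22_in_SL2R by simp
		then have "H (complexify (m22 a b c ((1 + b * c) / a))) = 0" by (rule 0) (simp only: eq b(2))
		then show ?thesis unfolding eq f_def by (simp only: cinner_zero_left)
	qed
	have s1: "f a (of_real b) (of_real c) y = 0" if "norm (a - 1) < dl" "\<bar>b\<bar> < dl" "\<bar>c\<bar> < dl" for a b c y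
	proof (rule identity_real[where f = "%a. f a (of_real b) (of_real c) y", OF holA _ b0(2)[OF that(1)]])
		show "f (of_real r) (of_real b) (of_real c) y = 0" if "\<bar>r - 1\<bar> < dl" for r
			by (rule s0[OF that]) fact+
	qed (use that in simp_all)
	have s2: "f a b (of_real c) y = 0" if "norm (a - 1) < dl" "norm b < dl" "\<bar>c\<bar> < dl" for a b c y
	proof (rule identity_real[where f = "%b. f a b (of_real c) y", OF holB _ b0(1)[OF that(2)]])
		show "f a (of_real r) (of_real c) y = 0" if "\<bar>r - 0\<bar> < dl" for r
			by (rule s1) (use that \<open>norm (a - 1) < dl\<close> \<open>\<bar>c\<bar> < dl\<close> in simp_all)
	qed (use that in simp_all)
	have s3: "f a b c y = 0" if "norm (a - 1) < dl" "norm b < dl" "norm c < dl" for a b c y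
	proof (rule identity_real[where f = "%c. f a b c y", OF holC _ b0(1)[OF that(3)]])
		show "f a b (of_real r) y = 0" if "\<bar>r - 0\<bar> < dl" for r
			by (rule s2) (use that \<open>norm (a - 1) < dl\<close> \<open>norm b < dl\<close> in simp_all)
	qed (use that in simp_all)
	have "m22 a b c d \<in> D & H (m22 a b c d) = 0"
		if z: "m22 a b c d \<in> SL2C" and n: "norm (a - 1) < dl" "norm b < dl" "norm c < dl" for a b c d
	proof -
		have bx: "a ~= 0" "m22 a b c ((1 + b * c) / a) \<in> D" using box[OF n] by auto
		have d: "d = (1 + b * c) / a" using z bx(1) by (simp add: field_simps)
		have "H (m22 a b c ((1 + b * c) / a)) = 0" by (rule cinner_eq_zeroI) (rule s3[OF n, unfolded f_def])
		then show ?thesis unfolding d using bx(2) by simp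
	qed
	then show ?thesis using dl by blast
qed

text \<open>The set D may be complicated away from the identity, so the vanishing is continued only
  along a disc of \<open>pc c\<close> known to lie inside.\<close>

lemma vanish_line:
	assumes D: "openin (top_of_set SL2C) D" "mat 1 \<in> D" and H: "holomorphic_on_SL2C H D"
		and 0: "!!g. g \<in> SL2R ==> complexify g \<in> D ==> H (complexify g) = 0"
		and rho: "!!c. norm c < rho ==> pc c \<in> D" and c: "norm c < rho"
	shows "H (pc c) = 0"
proof (rule cinner_eq_zeroI)
	fix y
	have rho0: "rho > 0" using c norm_ge_zero le_less_trans by blast
	obtain dl where dl: "dl > 0" "\<forall>a b c d. m22 a b c d \<in> SL2C --> norm (a - 1) < dl --> norm b < dl --> norm c < dl --> m22 a b c d \<in> D & H (m22 a b c d) = 0"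
		using vanish_near_1[OF D H 0] by blast
	have z: "H (pc c) = 0" if "norm c < dl" for c
		unfolding pc_def using dl(2)[rule_format, OF pc_SL2C[of c, unfolded pc_def]] that by (simp add: norm_mult)
	have "(%c. cinner (H (pc c)) y) holomorphic_on ball 0 rho"
		unfolding pc_def by (rule holo_curve[OF H]) (use rho in \<open>auto intro!: holomorphic_intros simp: pc_def\<close>)
	then show "cinner (H (pc c)) y = 0"
		by (rule analytic_continuation[where U = "ball 0 (min dl rho)" and \<xi> = 0])
			(use dl(1) rho0 c z in \<open>auto simp: interior_limit_point\<close>)
qed

lemma complex_differentiable_diff:
	assumes "complex_differentiable_at H x" "complex_differentiable_at K x"
	shows "complex_differentiable_at (%z. H z - K z) x"
proof -
	obtain L L' where "(H has_derivative L) (at x)" "\<forall>c Y. L (smult_matrix c Y) = c *% L Y"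
		"(K has_derivative L') (at x)" "\<forall>c Y. L' (smult_matrix c Y) = c *% L' Y"
		using assms unfolding complex_differentiable_at_def by (elim exE conjE)
	then show ?thesis unfolding complex_differentiable_at_def
		by (intro exI[of _ "%Y. L Y - L' Y"]) (simp add: has_derivative_diff scaleC_diff_right)
qed

lemma complex_differentiable_map:
	assumes "complex_differentiable_at H x" "bounded_linear A" "!!c y. A (c *% y) = c *% A y"
	shows "complex_differentiable_at (%z. A (H z)) x"
proof -
	obtain L where "(H has_derivative L) (at x)" "\<forall>c Y. L (smult_matrix c Y) = c *% L Y"
		using assms unfolding complex_differentiable_at_def by (elim exE conjE)
	then show ?thesis unfolding complex_differentiable_at_def
		by (intro exI[of _ "%Y. A (L Y)"]) (simp add: bounded_linear.has_derivative[OF assms(2)] assms(3))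
qed

lemma complex_differentiable_comp:
	assumes "complex_differentiable_at H (T x)" and T: "bounded_linear T" "!!c Y. T (smult_matrix c Y) = smult_matrix c (T Y)"
	shows "complex_differentiable_at (%z. H (T z)) x"
proof -
	obtain L where L: "(H has_derivative L) (at (T x))" "\<forall>c Y. L (smult_matrix c Y) = c *% L Y"
		using assms(1) unfolding complex_differentiable_at_def by (elim exE conjE)
	have "(T has_derivative T) (at x)" by (rule bounded_linear_imp_has_derivative[OF T(1)])
	from diff_chain_at[OF this L(1)] have "((%z. H (T z)) has_derivative (%Y. L (T Y))) (at x)" by (simp add: o_def)
	then show ?thesis unfolding complex_differentiable_at_def using L(2) T(2) by (intro exI[of _ "%Y. L (T Y)"]) simp
qed

lemma holo_open: "open U ==> D \<subseteq> U ==> (!!x. x \<in> U ==> complex_differentiable_at F x) ==> holomorphic_on_SL2C F D"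
	by (rule holoI) (intro exI[of _ U] exI[of _ F], auto)

lemma holo_subset:
	assumes "holomorphic_on_SL2C F D" "D' \<subseteq> D"
	shows "holomorphic_on_SL2C F D'"
proof (rule holoI)
	fix z assume "z \<in> D'"
	then have z: "z \<in> D" using assms(2) by (rule subsetD[rotated])
	obtain U H where U: "open U" "z \<in> U" "\<forall>x\<in>U. complex_differentiable_at H x" "\<forall>x\<in>U \<inter> D. H x = F x" by (rule holoE[OF assms(1) z])
	have "\<forall>x\<in>U \<inter> D'. H x = F x" using U(4) assms(2) by auto
	then show "\<exists>U H. open U & z \<in> U & (\<forall>x\<in>U. complex_differentiable_at H x) & (\<forall>x\<in>U \<inter> D'. H x = F x)"
		using U(1-3) by (intro exI[of _ U] exI[of _ H] conjI)
qed

lemma holo_diff: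
	assumes "holomorphic_on_SL2C F D" "holomorphic_on_SL2C K D"
	shows "holomorphic_on_SL2C (%z. F z - K z) D"
proof (rule holoI)
	fix z assume z: "z \<in> D"
	obtain U H where U: "open U" "z \<in> U" "\<forall>x\<in>U. complex_differentiable_at H x" "\<forall>x\<in>U \<inter> D. H x = F x" by (rule holoE[OF assms(1) z])
	obtain U' H' where U': "open U'" "z \<in> U'" "\<forall>x\<in>U'. complex_differentiable_at H' x" "\<forall>x\<in>U' \<inter> D. H' x = K x" by (rule holoE[OF assms(2) z])
	show "\<exists>U H. open U & z \<in> U & (\<forall>x\<in>U. complex_differentiable_at H x) & (\<forall>x\<in>U \<inter> D. H x = F x - K x)"
		using U U' by (intro exI[of _ "U \<inter> U'"] exI[of _ "%x. H x - H' x"]) (simp add: open_Int complex_differentiable_diff)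
qed

lemma holo_map:
	assumes "holomorphic_on_SL2C F D" "bounded_linear A" "!!c y. A (c *% y) = c *% A y"
	shows "holomorphic_on_SL2C (%z. A (F z)) D"
proof (rule holoI)
	fix z assume z: "z \<in> D"
	obtain U H where U: "open U" "z \<in> U" "\<forall>x\<in>U. complex_differentiable_at H x" "\<forall>x\<in>U \<inter> D. H x = F x" by (rule holoE[OF assms(1) z])
	show "\<exists>U H. open U & z \<in> U & (\<forall>x\<in>U. complex_differentiable_at H x) & (\<forall>x\<in>U \<inter> D. H x = A (F x))"
		using U by (intro exI[of _ U] exI[of _ "%x. A (H x)"]) (simp add: complex_differentiable_map[OF _ assms(2,3)])
qed

lemma holo_comp:
	assumes F: "holomorphic_on_SL2C F D" and T: "bounded_linear T" "!!c Y. T (smult_matrix c Y) = smult_matrix c (T Y)"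
		and D': "!!x. x \<in> D' ==> T x \<in> D"
	shows "holomorphic_on_SL2C (%z. F (T z)) D'"
proof (rule holoI)
	fix z assume "z \<in> D'"
	from D'[OF this] obtain U H where U: "open U" "T z \<in> U" "\<forall>x\<in>U. complex_differentiable_at H x" "\<forall>x\<in>U \<inter> D. H x = F x" by (rule holoE[OF F])
	have "open (T -` U)" by (rule open_vimage[OF U(1) bounded_linear.continuous_on[OF T(1) continuous_on_id]])
	then show "\<exists>U H. open U & z \<in> U & (\<forall>x\<in>U. complex_differentiable_at H x) & (\<forall>x\<in>U \<inter> D'. H x = F (T x))"
		using U D' by (intro exI[of _ "T -` U"] exI[of _ "%x. H (T x)"]) (simp add: complex_differentiable_comp[OF _ T])
qed

lemma bounded_linear_two_sided: "bounded_linear (%z::complex^2^2. g ** z ** k)"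
	and smult_two_sided: "g ** smult_matrix c z ** k = smult_matrix c (g ** z ** k)"
proof -
	obtain a b c' d where g: "g = m22 a b c' d" by (rule m22_cases)
	obtain a' b' c'' d' where k: "k = m22 a' b' c'' d'" by (rule m22_cases)
	have s: "g ** smult_matrix c z ** k = smult_matrix c (g ** z ** k)" for c z
		unfolding g k by (cases z rule: m22_cases) (simp add: smult_m22 algebra_simps)
	then show "g ** smult_matrix c z ** k = smult_matrix c (g ** z ** k)" .
	have "linear (%z::complex^2^2. g ** z ** k)"
	proof (rule linearI)
		show "g ** (x + y) ** k = g ** x ** k + g ** y ** k" for x y :: "complex^2^2"
			unfolding g k by (cases x rule: m22_cases; cases y rule: m22_cases) (simp add: add_m22 algebra_simps)
		show "g ** (r *\<^sub>R x) ** k = r *\<^sub>R (g ** x ** k)" for r x unfolding scaleR_smult s ..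
	qed
	then show "bounded_linear (%z::complex^2^2. g ** z ** k)" by (simp add: linear_conv_bounded_linear)
qed

lemma bounded_linear_tw: "bounded_linear (tw :: complex^2^2 => complex^2^2)"
	and smult_tw: "tw (smult_matrix c z) = smult_matrix c (tw z)"
proof -
	have s: "tw (smult_matrix c z) = smult_matrix c (tw z)" for c z
		by (cases z rule: m22_cases) (simp add: smult_m22)
	then show "tw (smult_matrix c z) = smult_matrix c (tw z)" .
	have "linear (tw :: complex^2^2 => complex^2^2)"
	proof (rule linearI)
		show "tw (x + y) = tw x + tw y" for x y :: "complex^2^2"
			by (cases x rule: m22_cases; cases y rule: m22_cases) (simp add: add_m22)
		show "tw (r *\<^sub>R x) = r *\<^sub>R tw x" for r and x :: "complex^2^2" unfolding scaleR_smult s ..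
	qed
	then show "bounded_linear (tw :: complex^2^2 => complex^2^2)" by (simp add: linear_conv_bounded_linear)
qed

lemma invariant_domainD:
	assumes "invariant_domain D"
	shows "openin (top_of_set SL2C) D" "connected D" "!!g x k. g \<in> SL2R ==> x \<in> D ==> k \<in> SO2C ==> complexify g ** x ** k \<in> D"
		"!!g. g \<in> SL2R ==> complexify g \<in> D" "mat 1 \<in> D" "D \<subseteq> SL2C"
proof -
	show 1: "!!g. g \<in> SL2R ==> complexify g \<in> D" using assms unfolding invariant_domain_def by blast
	show "mat 1 \<in> D" using 1[OF mat_1_SL2R] by (simp add: mat_1_m22)
	show "openin (top_of_set SL2C) D" using assms by (simp add: invariant_domain_def)
	then show "D \<subseteq> SL2C" using openin_imp_subset by blast
qed (use assms in \<open>auto simp: invariant_domain_def\<close>)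

lemma invariant_cancel:
	assumes D: "invariant_domain D" and g: "g \<in> SL2R" and z: "complexify g ** x ** ke ta \<in> D"
	shows "x \<in> D"
proof -
	have k: "ke ta ** ke (- ta) = mat 1"
		unfolding ke_def mat_1_m22 using sin_cos_squared_add[of ta] by (simp add: power2_eq_square algebra_simps)
	have a: "complexify (adj22 g) ** complexify g = mat 1"
		unfolding complexify_mult[symmetric] using adj22_SL2R[OF g] by (simp add: mat_1_m22)
	have "complexify (adj22 g) ** (complexify g ** x ** ke ta) ** ke (- ta) = (complexify (adj22 g) ** complexify g) ** x ** (ke ta ** ke (- ta))"
		by (simp only: matrix_mul_assoc)
	also have "... = x" unfolding a k by simp
	finally show ?thesis using invariant_domainD(3)[OF D _ z ke_SO2C, of "adj22 g" "- ta"] adj22_SL2R[OF g] by simp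
qed

lemma invariant_pc:
	assumes D: "invariant_domain D" and c: "pc c \<in> D" and n: "norm c' = norm c"
	shows "pc c' \<in> D"
proof (cases "c = 0")
	case True
	then show ?thesis using c n by simp
next
	case False
	define u where "u = c' / c"
	have "norm u = 1" using False n by (simp add: u_def norm_divide)
	then have "cis (Arg u) = u" using cis_Arg[of u] by (force simp: sgn_div_norm)
	then have "c' = c * cis (- (2 * (- Arg u / 2)))" using False by (simp add: u_def)
	then have "pc c' = complexify (rot (- Arg u / 2)) ** pc c ** complexify (rot (- (- Arg u / 2)))" unfolding pc_rot by simp
	moreover have "complexify (rot (- Arg u / 2)) ** pc c ** complexify (rot (- (- Arg u / 2))) \<in> D"
		by (rule invariant_domainD(3)[OF D rot_SL2R c]) (simp only: complexify_rot ke_SO2C)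
	ultimately show ?thesis by (simp only:)
qed

text \<open>By two-sided K-invariance \<open>pc c\<close> belongs to D or not according to |c|
  alone, so the radius of a full disc is the natural datum.\<close>

definition disc_in :: "(complex^2^2) set => real => bool" where
	"disc_in D r \<longleftrightarrow> (\<forall>c. norm c < r --> pc c \<in> D)"

text \<open>One point on the bounding circle brings the whole circle by rotation, and openness at a
  single real point then gives a full annulus.\<close>

lemma disc_extend:
	assumes D: "invariant_domain D" and r: "disc_in D r" and c0: "pc c0 \<in> D" "norm c0 = r"
	shows "\<exists>r'>r. disc_in D r'"
proof -
	obtain V where V: "open V" "D = SL2C \<inter> V" using invariant_domainD(1)[OF D] unfolding openin_open by blast
	have "continuous_on UNIV (%s::real. pc (of_real s))" unfolding pc_def by (intro continuous_intros)
	then have "open ((%s::real. pc (of_real s)) -` V)" by (rule open_vimage[OF V(1)])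
	moreover have "pc (of_real r) \<in> D" by (rule invariant_pc[OF D c0(1)]) (use c0(2) in auto)
	ultimately obtain e where e: "e > 0" "ball r e \<subseteq> (%s::real. pc (of_real s)) -` V" using V(2) unfolding open_contains_ball by (metis IntE vimageI)
	have "pc c \<in> D" if "norm c < r + e" for c
	proof (cases "norm c < r")
		case True
		then show ?thesis using r by (simp add: disc_in_def)
	next
		case False
		then have "norm c \<in> ball r e" using that by (simp add: dist_real_def)
		then have "pc (of_real (norm c)) \<in> D" using e(2) V(2) by auto
		then show ?thesis by (rule invariant_pc[OF D]) simp
	qed
	then show ?thesis using e(1) by (intro exI[of _ "r + e"]) (simp add: disc_in_def)
qed

text \<open>A point of D outside P is of little use by itself, as its slice of D might consist of
  rings not joined to the identity. The point found here is a limit of points whose whole disc lies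
  in D, so the identity theorem reaches its neighbourhood.\<close>

lemma boundary_point:
	assumes D: "invariant_domain D" and P: "open P" "mat 1 \<in> P" "!!z. z \<in> P ==> cX z > 0" and n: "\<not> D \<subseteq> P"
	obtains z where "z \<in> D" "z \<notin> P" "z \<in> closure (D \<inter> P \<inter> {z. \<exists>r'>0. disc_in D r' & 1 - cX z * cY z < 4 * r'\<^sup>2})"
		"\<forall>c. 4 * (norm c)\<^sup>2 < 1 - cX z * cY z --> pc c \<in> D"
proof -
	define R where "R = {z. \<exists>r'>0. disc_in D r' & 1 - cX z * cY z < 4 * r'\<^sup>2}"
	define E where "E = D \<inter> P \<inter> R"
	have "R = (\<Union>r'\<in>{r'. r' > 0 & disc_in D r'}. {z. 1 - cX z * cY z < 4 * r'\<^sup>2})" by (auto simp: R_def)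
	then have oR: "open R" by (simp only:) (intro open_UN ballI open_Collect_less continuous_intros)
	have oE: "openin (top_of_set D) E"
		unfolding E_def Int_assoc by (rule openin_open_Int) (intro open_Int P oR)
	have X1: "cX (mat 1) = 1" "cY (mat 1) = 1" using cX_pc[of 0] by (simp_all add: pc_0)
	have "\<exists>r'>0. disc_in D r'" by (rule disc_extend[OF D, of 0 0]) (use invariant_domainD(5)[OF D] in \<open>auto simp: disc_in_def pc_0\<close>)
	then have "mat 1 \<in> R" by (auto simp: R_def X1)
	then have E1: "mat 1 \<in> E" using P(2) invariant_domainD(5)[OF D] by (simp add: E_def)
	have "\<not> closedin (top_of_set D) E"
	proof
		assume "closedin (top_of_set D) E"
		then have "E = {} \<or> E = D" using invariant_domainD(2)[OF D] oE unfolding connected_clopen by blast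
		then show False using E1 n by (auto simp: E_def)
	qed
	\<comment> \<open>E is open in the connected set D, contains the identity and is not all of D; so
	  it is not closed in D, and z is a limit point that escapes it.\<close>
	then have "E ~= D \<inter> closure E" using closedin_closed_Int[OF closed_closure, of D E] by metis
	then obtain z where z: "z \<in> D" "z \<in> closure E" "z \<notin> E" using closure_subset[of E] by (auto simp: E_def)
	have st: "pc c \<in> D" if c: "4 * (norm c)\<^sup>2 < 1 - cX z * cY z" for c
	proof -
		have "open {z. 4 * (norm c)\<^sup>2 < 1 - cX z * cY z}" by (intro open_Collect_less continuous_intros)
		then have "{z. 4 * (norm c)\<^sup>2 < 1 - cX z * cY z} \<inter> E ~= {}"
			using z(2) c open_Int_closure_eq_empty[of "{z. 4 * (norm c)\<^sup>2 < 1 - cX z * cY z}" E] by blast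
		then obtain z' where z': "4 * (norm c)\<^sup>2 < 1 - cX z' * cY z'" "z' \<in> E" by auto
		then obtain r' where r': "r' > 0" "disc_in D r'" "1 - cX z' * cY z' < 4 * r'\<^sup>2" by (auto simp: E_def R_def)
		have "(norm c)\<^sup>2 < r'\<^sup>2" using z'(1) r'(3) by simp
		then have "norm c < r'" by (rule power_less_imp_less_base) (use r'(1) in simp)
		then show ?thesis using r'(2) by (simp add: disc_in_def)
	qed
	\<comment> \<open>Inside P the point could be decomposed; its circle bounds a disc in D, which
	  extends a little further, and z would belong to E.\<close>
	have "z \<notin> P"
	proof
		assume zP: "z \<in> P"
		have zS: "z \<in> SL2C" using z(1) invariant_domainD(6)[OF D] by blast
		obtain g c ta where d: "g \<in> SL2R" "z = complexify g ** pc c ** ke ta" "4 * (norm c)\<^sup>2 = 1 - cX z * cY z"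
			by (rule decompose[OF zS P(3)[OF zP]])
		have "pc c \<in> D" by (rule invariant_cancel[OF D d(1)]) (use z(1) d(2) in simp)
		moreover have "disc_in D (norm c)"
			unfolding disc_in_def
		proof (intro allI impI)
			fix c' :: complex assume "norm c' < norm c"
			then have "(norm c')\<^sup>2 < (norm c)\<^sup>2" by (intro power_strict_mono) auto
			then show "pc c' \<in> D" by (intro st) (simp add: d(3)[symmetric])
		qed
		ultimately obtain r' where r': "r' > norm c" "disc_in D r'" using disc_extend[OF D] by blast
		then have "(norm c)\<^sup>2 < r'\<^sup>2" by (intro power_strict_mono) auto
		then have "1 - cX z * cY z < 4 * r'\<^sup>2" unfolding d(3)[symmetric] by simp
		moreover have "r' > 0" using r'(1) norm_ge_zero le_less_trans by blast
		ultimately have "z \<in> R" using r'(2) by (auto simp: R_def)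
		then show False using z(1,3) zP by (simp add: E_def)
	qed
	then show ?thesis using that[of z] z(1,2) st unfolding E_def R_def by blast
qed

section \<open>Maximality for a single weight vector\<close>

context irrep
begin

text \<open>Near the identity D meets the crown, where \<open>Fser\<close> is a second extension; on
  \<open>pc c\<close> one has b = 0 and a = d = 1, so only the inner series in -2c survives.\<close>

lemma ext_local:
	assumes v: "v \<in> wt n" "v ~= 0" "cas nu n v" and nu: "Re nu >= 0" and nt: "\<not> trivial_rep rp"
		and D: "openin (top_of_set SL2C) D" "mat 1 \<in> D"
		and F: "holomorphic_on_SL2C F D" "!!g. g \<in> SL2R ==> F (complexify g) = rp g v"
	shows "\<exists>dl>0. \<forall>c. norm c < dl --> F (pc c) = inner_ser (Qq nu n 0) (tower nu n v) 0 (- 2 * c)"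
proof -
	define K where "K = Fser n (Pp nu n 0) (Qq nu n 0) (tower nu n v) 0"
	obtain M where M: "\<forall>j. norm (tower nu n v j) <= M" using tower_bounded_ex[OF v(1,3) nu] ..
	have K1: "complex_differentiable_at K x" if "x \<in> U_crown" for x
		unfolding K_def by (rule Fser_complex_differentiable[OF that M[rule_format]])
	have H: "holomorphic_on_SL2C (%z. F z - K z) (D \<inter> U_crown)"
		by (rule holo_diff[OF holo_subset[OF F(1)] holo_open[OF open_U_crown _ K1]]) auto
	have o: "openin (top_of_set SL2C) (D \<inter> U_crown)" by (rule openin_Int_open[OF D(1) open_U_crown])
	have "mat 1 \<in> U_crown" using complexify_in_U_crown[OF mat_1_SL2R] by (simp add: mat_1_m22)
	then have 1: "mat 1 \<in> D \<inter> U_crown" using D(2) by simp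
	have 0: "F (complexify g) - K (complexify g) = 0" if "g \<in> SL2R" for g
		unfolding K_def F(2)[OF that] Fser_orbit[OF v nu nt that] by simp
	obtain dl where dl: "dl > 0" "\<forall>a b c d. m22 a b c d \<in> SL2C --> norm (a - 1) < dl --> norm b < dl --> norm c < dl -->
			m22 a b c d \<in> D \<inter> U_crown & F (m22 a b c d) - K (m22 a b c d) = 0"
		using vanish_near_1[OF o 1 H 0] by blast
	have "F (pc c) = inner_ser (Qq nu n 0) (tower nu n v) 0 (- 2 * c)" if "norm c < dl" for c
	proof -
		have "F (pc c) = K (pc c)"
			unfolding pc_def using dl(2)[rule_format, OF pc_SL2C[of c, unfolded pc_def]] that by (simp add: norm_mult)
		also have "... = inner_ser (Qq nu n 0) (tower nu n v) 0 (- 2 * c)"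
			unfolding K_def Fser_def cay_pc by (simp add: outer_ser_0)
		finally show ?thesis .
	qed
	then show ?thesis using dl(1) by blast
qed

lemma cinner_inner_ser:
	assumes w: "!!j. w j \<in> wt (n + 2 * j)" and M: "!!j. norm (w j) <= M" and y: "norm y < 1"
	shows "cinner (inner_ser Q w 0 y) (w (int k)) = (Q gchoose k) * y ^ k * of_real ((norm (w (int k)))\<^sup>2)"
proof -
	have s: "summable (%i. ((Q gchoose i) * y ^ i) *% w (0 + int i))" by (rule ser_summable(1)[OF y M])
	have "cinner (inner_ser Q w 0 y) (w (int k)) = (\<Sum>i. cinner (((Q gchoose i) * y ^ i) *% w (0 + int i)) (w (int k)))"
		unfolding inner_ser_def by (rule bounded_linear.suminf[OF bounded_linear_cinner_left s])
	also have "... = (\<Sum>i\<in>{k}. cinner (((Q gchoose i) * y ^ i) *% w (0 + int i)) (w (int k)))"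
	proof (rule suminf_finite)
		fix i assume "i \<notin> {k}"
		then have "cinner (w (int i)) (w (int k)) = 0" by (intro wt_orthogonal[OF w w]) simp
		then show "cinner (((Q gchoose i) * y ^ i) *% w (0 + int i)) (w (int k)) = 0" by (simp add: cinner_scaleC_left)
	qed simp
	also have "... = (Q gchoose k) * y ^ k * of_real ((norm (w (int k)))\<^sup>2)" by (simp add: cinner_scaleC_left cinner_norm)
	finally show ?thesis .
qed

text \<open>Pairing with the k-th chain member isolates one monomial, and this identity continues
  over the whole disc, even where the series itself would diverge. Cauchy-Schwarz then bounds each
  term by the norm of the extension.\<close>

lemma ext_series:
	assumes v: "v \<in> wt n" "v ~= 0" "cas nu n v" and nu: "Re nu >= 0" and nt: "\<not> trivial_rep rp"
		and D: "invariant_domain D" and F: "holomorphic_on_SL2C F D" "!!g. g \<in> SL2R ==> F (complexify g) = rp g v"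
		and rho: "disc_in D rho" and c: "norm c < rho"
	shows "norm (Qq nu n 0 gchoose k) * (2 * norm c) ^ k * norm (tower nu n v (int k)) <= norm (F (pc c))"
proof -
	define w Q where "w = tower nu n v" and "Q = Qq nu n 0"
	have rho0: "rho > 0" using c norm_ge_zero le_less_trans by blast
	obtain M where M: "\<forall>j. norm (w j) <= M" using tower_bounded_ex[OF v(1,3) nu] unfolding w_def ..
	have ww: "w j \<in> wt (n + 2 * j)" for j unfolding w_def by (rule tower_wt_cas(1)[OF v(1,3)])
	obtain dl where dl: "dl > 0" "\<forall>c. norm c < dl --> F (pc c) = inner_ser Q w 0 (- 2 * c)"
		using ext_local[OF v nu nt invariant_domainD(1,5)[OF D] F] unfolding w_def Q_def by blast
	define f where "f c = cinner (F (pc c)) (w (int k)) - (Q gchoose k) * (- 2 * c) ^ k * of_real ((norm (w (int k)))\<^sup>2)" for c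
	have f0: "f c = 0" if "norm c < min dl (1/2)" for c
	proof -
		have y: "norm (- 2 * c) < 1" using that by (simp add: norm_mult)
		have "F (pc c) = inner_ser Q w 0 (- 2 * c)" using dl(2) that by simp
		then show ?thesis unfolding f_def using cinner_inner_ser[where w = w and n = n, OF ww M[rule_format] y, of Q k] by simp
	qed
	have "(%c. cinner (F (pc c)) (w (int k))) holomorphic_on ball 0 rho"
		unfolding pc_def by (rule holo_curve[OF F(1)]) (use rho in \<open>auto intro!: holomorphic_intros simp: pc_def disc_in_def\<close>)
	then have "f holomorphic_on ball 0 rho" unfolding f_def[abs_def] by (intro holomorphic_intros)
	then have "f c = 0"
		by (rule analytic_continuation[where U = "ball 0 (min rho (min dl (1/2)))" and \<xi> = 0])
			(use dl(1) rho0 c f0 in \<open>auto simp: interior_limit_point\<close>)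
	then have "cinner (F (pc c)) (w (int k)) = (Q gchoose k) * (- 2 * c) ^ k * of_real ((norm (w (int k)))\<^sup>2)" by (simp add: f_def)
	then have "norm (cinner (F (pc c)) (w (int k))) = norm (Q gchoose k) * (2 * norm c) ^ k * (norm (w (int k)))\<^sup>2"
		by (simp add: norm_mult norm_power)
	then have le: "(norm (Q gchoose k) * (2 * norm c) ^ k * norm (w (int k))) * norm (w (int k)) <= norm (F (pc c)) * norm (w (int k))"
		using cinner_Cauchy_Schwarz[of "F (pc c)" "w (int k)"] by (simp add: power2_eq_square mult.assoc)
	show ?thesis
	proof (cases "w (int k) = 0")
		case True
		then show ?thesis by (simp add: w_def)
	next
		case False
		then show ?thesis using le unfolding w_def Q_def by (simp add: mult_le_cancel_right)
	qed
qed

text \<open>For real angles this is an identity of two extensions, continued along the disc by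
  \<open>vanish_line\<close>; the complex angle then follows from the identity theorem in the angle
  alone.\<close>

lemma ext_equivariant:
	assumes v: "v \<in> wt n" and D: "invariant_domain D"
		and F: "holomorphic_on_SL2C F D" "!!g. g \<in> SL2R ==> F (complexify g) = rp g v"
		and rho: "disc_in D rho" and c: "norm c < rho" and g: "g \<in> SL2R"
	shows "F (complexify g ** pc c ** ke ta) = exp (- \<i> * of_int n * ta) *% rp g (F (pc c))"
proof -
	note Dd = invariant_domainD[OF D]
	have real: "F (complexify g ** pc c ** ke (of_real th)) = exp (- \<i> * of_int n * of_real th) *% rp g (F (pc c))" for th
	proof -
		define e where "e = exp (- \<i> * of_int n * complex_of_real th)"
		have e: "e = cis (- of_int n * th)" unfolding e_def cis_conv_exp by (simp add: mult.assoc)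
		have h1: "holomorphic_on_SL2C (%z. F (complexify g ** z ** ke (of_real th))) D"
			by (rule holo_comp[OF F(1) bounded_linear_two_sided smult_two_sided]) (rule Dd(3)[OF g _ ke_SO2C])
		have h2: "holomorphic_on_SL2C (%z. e *% rp g (F z)) D"
			by (rule holo_map[OF F(1) bounded_linear_compose[OF bounded_linear_scaleC_right rep_bounded_linear[OF g]]])
				(simp add: rep_scaleC[OF g] scaleC_scaleC mult.commute)
		have "F (complexify g ** pc c ** ke (of_real th)) - e *% rp g (F (pc c)) = 0"
		proof (rule vanish_line[OF Dd(1,5) holo_diff[OF h1 h2], where rho = rho])
			fix h assume h: "h \<in> SL2R"
			have gh: "g ** h ** rot th \<in> SL2R" using g h by (intro SL2R_mult) simp_all
			have "complexify g ** complexify h ** ke (of_real th) = complexify (g ** h ** rot th)"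
				by (simp only: complexify_mult complexify_rot)
			then have "F (complexify g ** complexify h ** ke (of_real th)) = rp (g ** h ** rot th) v" using F(2)[OF gh] by simp
			also have "... = e *% rp g (rp h v)"
				using g h by (simp add: rep_mult SL2R_mult wtD[OF v] rep_scaleC e)
			finally show "F (complexify g ** complexify h ** ke (of_real th)) - e *% rp g (F (complexify h)) = 0" using F(2)[OF h] by simp
		qed (use rho c in \<open>auto simp: disc_in_def\<close>)
		then show ?thesis unfolding e_def by simp
	qed
	show ?thesis
	proof (rule cinner_eqI)
		fix y
		obtain p q r s where m: "complexify g ** pc c = m22 p q r s" by (rule m22_cases)
		have pD: "pc c \<in> D" using rho c by (simp add: disc_in_def)
		have kD: "complexify g ** pc c ** ke ta \<in> D" for ta by (rule Dd(3)[OF g pD ke_SO2C])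
		have k: "complexify g ** pc c ** ke ta = m22 (p * cos ta + q * sin ta) (p * - sin ta + q * cos ta) (r * cos ta + s * sin ta) (r * - sin ta + s * cos ta)" for ta
			unfolding m ke_def m22_mult ..
		define f where "f ta = cinner (F (complexify g ** pc c ** ke ta)) y - exp (- \<i> * of_int n * ta) * cinner (rp g (F (pc c))) y" for ta
		have "(%ta. cinner (F (complexify g ** pc c ** ke ta)) y) holomorphic_on ball (of_real 0) (norm ta + 1)"
			unfolding k by (rule holo_curve[OF F(1)]) (use kD[unfolded k] in \<open>auto intro!: holomorphic_intros\<close>)
		then have "f holomorphic_on ball (of_real 0) (norm ta + 1)" unfolding f_def[abs_def] by (intro holomorphic_intros)
		then have "f ta = 0"
			by (rule identity_real) (auto simp: f_def real cinner_scaleC_left)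
		then show "cinner (F (complexify g ** pc c ** ke ta)) y = cinner (exp (- \<i> * of_int n * ta) *% rp g (F (pc c))) y"
			by (simp add: f_def cinner_scaleC_left)
	qed
qed

text \<open>Write x near the boundary as g exp(cZ) k. The factor k multiplies the norm by the n-th
  power of \<open>sqrt (cX x)\<close>, which blows up for n < 0, while the norm at
  \<open>pc c\<close> is at least that of v by the term k = 0 of \<open>ext_series\<close>.\<close>

lemma S_plus_maximal:
	assumes v: "v \<in> wt n" "v ~= 0" and n: "n < 0" and nt: "\<not> trivial_rep rp"
		and D: "invariant_domain D" and F: "holomorphic_on_SL2C F D" "!!g. g \<in> SL2R ==> F (complexify g) = rp g v"
	shows "D \<subseteq> {z. cX z > 0}"
proof (rule ccontr)
	assume nD: "\<not> D \<subseteq> {z. cX z > 0}"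
	obtain nu where nu: "Re nu >= 0" "cas nu n v" by (rule cas_exists[OF v(2)])
	define E where "E = D \<inter> {z. cX z > 0} \<inter> {z. \<exists>r'>0. disc_in D r' & 1 - cX z * cY z < 4 * r'\<^sup>2}"
	have oP: "open {z. cX z > 0}" by (intro open_Collect_less continuous_intros)
	have 1: "mat 1 \<in> {z. cX z > 0}" using cX_pc(1)[of 0] by (simp add: pc_0)
	obtain z where z: "z \<in> D" "z \<notin> {z. cX z > 0}" "z \<in> closure E"
		unfolding E_def by (rule boundary_point[OF D oP 1 _ nD]) auto
	obtain U H where U: "open U" "z \<in> U" "\<forall>x\<in>U. complex_differentiable_at H x" "\<forall>x\<in>U \<inter> D. H x = F x" by (rule holoE[OF F(1) z(1)])
	obtain L where "(H has_derivative L) (at z)" using U(3)[rule_format, OF U(2)] unfolding complex_differentiable_at_def by (elim exE conjE)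
	then have "isCont H z" by (rule has_derivative_continuous)
	then obtain d where d: "d > 0" "\<forall>x. dist x z < d --> dist (H x) (H z) < 1" unfolding continuous_at_eps_delta using zero_less_one by blast
	define B where "B = norm (H z) + 1"
	have B: "B > 0" unfolding B_def by (simp add: add_nonneg_pos)
	\<comment> \<open>B bounds the extension near z, and \<open>sqrt (cX x) < et\<close> pushes norm v
	  divided by that root above B. The bound 1 allows the power |n| to be weakened to 1.\<close>
	define et where "et = min 1 (norm v / B)"
	have et: "et > 0" "et <= 1" "et <= norm v / B" using B v(2) by (auto simp: et_def)
	define W where "W = {x. cX x < et\<^sup>2} \<inter> ball z d \<inter> U"
	have "open W" unfolding W_def by (intro open_Int open_ball U(1) open_Collect_less continuous_intros)
	moreover have "cX z < et\<^sup>2" by (rule le_less_trans[OF _ zero_less_power[OF et(1)]]) (use z(2) in simp)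
	then have "z \<in> W" using U(2) d(1) by (simp add: W_def)
	ultimately have "W \<inter> E ~= {}" using z(3) open_Int_closure_eq_empty[of W E] by blast
	then obtain x where x: "x \<in> W" "x \<in> E" by blast
	then obtain r' where r': "r' > 0" "disc_in D r'" "1 - cX x * cY x < 4 * r'\<^sup>2" by (auto simp: E_def)
	have xD: "x \<in> D" "cX x > 0" using x(2) by (auto simp: E_def)
	have xS: "x \<in> SL2C" using xD(1) invariant_domainD(6)[OF D] by blast
	obtain g c ta where dc: "g \<in> SL2R" "x = complexify g ** pc c ** ke ta" "4 * (norm c)\<^sup>2 = 1 - cX x * cY x" "norm (exp (- \<i> * ta)) = sqrt (cX x)"
		by (rule decompose[OF xS xD(2)])
	have "(norm c)\<^sup>2 < r'\<^sup>2" using r'(3) dc(3) by simp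
	then have c: "norm c < r'" by (rule power_less_imp_less_base) (use r'(1) in simp)
	define t where "t = sqrt (cX x)"
	have t: "t > 0" "t < et"
		using xD(2) x(1) et(1) real_sqrt_less_mono[of "cX x" "et\<^sup>2"] by (auto simp: t_def W_def)
	have "norm v <= norm (F (pc c))"
		using ext_series[OF v nu(2,1) nt D F r'(2) c, of 0] by (simp add: tower_0)
	moreover have "norm (F x) = norm (exp (- \<i> * of_int n * ta)) * norm (F (pc c))"
	proof -
		have "F x = exp (- \<i> * of_int n * ta) *% rp g (F (pc c))"
			unfolding dc(2) by (rule ext_equivariant[OF v(1) D F r'(2) c dc(1)])
		then show ?thesis using dc(1) by (simp only: norm_scaleC rep_norm)
	qed
	moreover have "norm (exp (- \<i> * of_int n * ta)) >= inverse t"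
	proof -
		define k where "k = nat (- n)"
		have k: "k >= 1" "of_int n = - (of_nat k :: complex)" using n by (auto simp: k_def of_nat_nat)
		have "exp (- \<i> * of_int n * ta) = inverse (exp (- \<i> * ta)) ^ k"
			unfolding k(2) exp_minus[symmetric] exp_of_nat_mult[symmetric] by (simp add: algebra_simps)
		then have "norm (exp (- \<i> * of_int n * ta)) = inverse t ^ k"
			using dc(4) by (simp add: norm_power norm_inverse t_def)
		moreover have "inverse t ^ 1 <= inverse t ^ k"
			by (rule power_increasing[OF k(1)]) (use t et(2) in \<open>simp add: one_le_inverse_iff\<close>)
		ultimately show ?thesis by simp
	qed
	ultimately have "inverse t * norm v <= norm (F x)" by (simp add: mult_mono)
	moreover have "B < inverse t * norm v"
	proof -
		have "t < norm v / B" using t(2) et(3) by simp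
		then have "B * t < norm v" using B by (simp add: pos_less_divide_eq mult.commute)
		then show ?thesis using t(1) by (simp add: field_simps)
	qed
	moreover have "norm (F x) <= B"
	proof -
		have "H x = F x" using U(4) x(1) xD(1) by (auto simp: W_def)
		moreover have "dist (H x) (H z) < 1" using d(2) x(1) by (auto simp: W_def dist_commute)
		ultimately show ?thesis using norm_triangle_ineq2[of "F x" "H z"] unfolding B_def dist_norm by simp
	qed
	ultimately show False by simp
qed

text \<open>Were no vector killed by raising, all terms in \<open>ext_series\<close> would be
  nonzero, with quotients of successive ones tending to twice the radius. A radius above 1/2 makes
  them unbounded, against the bound at one fixed point.\<close>

lemma crown_edge_highest:
	assumes v: "v \<in> wt n" "v ~= 0" and nt: "\<not> trivial_rep rp"
		and D: "invariant_domain D" and F: "holomorphic_on_SL2C F D" "!!g. g \<in> SL2R ==> F (complexify g) = rp g v"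
		and half: "disc_in D (1/2)" and c0: "pc c0 \<in> D" "norm c0 = 1/2"
	shows "\<exists>m x. x \<in> wt m & x ~= 0 & up m x = 0"
proof (rule ccontr)
	assume "\<not> (\<exists>m x. x \<in> wt m & x ~= 0 & up m x = 0)"
	then have no: "up m x ~= 0" if "x \<in> wt m" "x ~= 0" for m x using that by blast
	obtain nu where nu: "Re nu >= 0" "cas nu n v" by (rule cas_exists[OF v(2)])
	obtain r where r: "r > 1/2" "disc_in D r" using disc_extend[OF D half c0] by blast
	\<comment> \<open>Strictly between 1/2 and r, so that \<open>pc rho\<close> is still inside the
	  larger disc.\<close>
	define rho where "rho = (r + 1/2) / 2"
	have rho: "rho > 1/2" "rho < r" using r(1) by (auto simp: rho_def)
	define w where "w k = tower nu n v (int k)" for k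
	have wtup: "w k = tup nu n v k" for k by (simp add: w_def tower_def)
	have ww: "w k \<in> wt (n + 2 * int k)" for k unfolding w_def by (rule tower_wt_cas(1)[OF v(1) nu(2)])
	define z where "z k = of_int (n + 2 * int k) + 1 + nu" for k
	have step: "z k ~= 0 & w (Suc k) ~= 0" if "w k ~= 0" for k
		using no[OF ww that] unfolding wtup up_tup[OF v(1) nu(2)] z_def by auto
	have wn: "w k ~= 0" for k
	proof (induct k)
		case 0
		then show ?case using v(2) by (simp add: w_def tower_0)
	qed (use step in blast)
	have zn: "z k ~= 0" for k using step[OF wn] by blast
	define Q where "Q = Qq nu n 0"
	have Qk: "Q - of_nat k = - (z k / 2)" for k by (simp add: Q_def Qq_def z_def field_simps)
	have gS: "of_nat (Suc k) * (Q gchoose Suc k) = - (z k / 2) * (Q gchoose k)" for k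
		unfolding Qk[symmetric] using gbinomial_mult_1[of Q k] by (simp add: algebra_simps)
	have gn: "Q gchoose k ~= 0" for k
	proof (induct k)
		case (Suc k)
		then have "of_nat (Suc k) * (Q gchoose Suc k) ~= 0" unfolding gS using zn by simp
		then show ?case by auto
	qed simp
	define d where "d k = norm (Q gchoose k) * (2 * rho) ^ k * norm (w k)" for k
	have dpos: "d k > 0" for k using gn wn rho(1) by (simp add: d_def)
	have dK: "d k <= norm (F (pc (of_real rho)))" for k
		using ext_series[OF v nu(2,1) nt D F r(2), of "of_real rho" k] rho by (simp add: d_def Q_def w_def)
	have rec: "(real (Suc k))\<^sup>2 * (d (Suc k))\<^sup>2 = rho\<^sup>2 * (norm (z k) * norm (of_int (n + 2 * int k) + 1 - nu)) * (d k)\<^sup>2" for k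
	proof -
		have a: "real (Suc k) * norm (Q gchoose Suc k) = norm (z k) / 2 * norm (Q gchoose k)"
			using arg_cong[OF gS[of k], of norm] by (simp only: norm_mult norm_of_nat norm_minus_cancel norm_divide norm_numeral)
		have b: "norm (z k) * (norm (w (Suc k)))\<^sup>2 = norm (of_int (n + 2 * int k) + 1 - nu) * (norm (w k))\<^sup>2"
			unfolding wtup z_def by (rule norm_tup_Suc[OF v(1) nu(2)]) (use zn[of k] in \<open>simp add: z_def\<close>)
		have "(real (Suc k))\<^sup>2 * (d (Suc k))\<^sup>2 = (real (Suc k) * norm (Q gchoose Suc k))\<^sup>2 * ((2 * rho) ^ Suc k)\<^sup>2 * (norm (w (Suc k)))\<^sup>2"
			unfolding d_def by (simp only: power_mult_distrib ac_simps)
		also have "... = (norm (z k) / 2)\<^sup>2 * (norm (Q gchoose k))\<^sup>2 * ((2 * rho)\<^sup>2 * ((2 * rho) ^ k)\<^sup>2) * (norm (w (Suc k)))\<^sup>2"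
			unfolding a power_mult_distrib power_Suc ..
		also have "... = rho\<^sup>2 * norm (z k) * (norm (Q gchoose k))\<^sup>2 * ((2 * rho) ^ k)\<^sup>2 * (norm (z k) * (norm (w (Suc k)))\<^sup>2)"
			by (simp add: power2_eq_square)
		also have "... = rho\<^sup>2 * (norm (z k) * norm (of_int (n + 2 * int k) + 1 - nu)) * (d k)\<^sup>2"
			unfolding b d_def by (simp only: power_mult_distrib ac_simps)
		finally show ?thesis .
	qed
	define C where "C = \<bar>real_of_int n\<bar> + 1 + norm nu"
	\<comment> \<open>The midpoint of 1 and 2 rho. C collects the bounded parts of the two linear
	  factors, and beyond K0 each of them is so close to 2k that the terms grow at least by the factor
	  s.\<close>
	define s where "s = (1 + 2 * rho) / 2"
	have s: "s > 1" "2 * rho - s > 0" using rho(1) by (auto simp: s_def)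
	obtain K0 :: nat where K0: "real K0 >= (s + rho * C) / (2 * rho - s)" using real_arch_simple by blast
	have grow: "s\<^sup>2 * (d k)\<^sup>2 <= (d (Suc k))\<^sup>2" if k: "k >= K0" for k
	proof -
		have "real k >= (s + rho * C) / (2 * rho - s)" using K0 k by simp
		then have "s + rho * C <= real k * (2 * rho - s)" using s(2) by (simp add: pos_divide_le_eq)
		then have q: "s * real (Suc k) <= rho * (2 * real k - C)" by (simp add: algebra_simps)
		have low: "2 * real k - C <= norm (of_int (n + 2 * int k) + 1 + \<mu>)" if "norm \<mu> = norm nu" for \<mu> :: complex
		proof -
			have "2 * real k = norm (of_nat (2 * k) :: complex)" by (simp add: norm_mult)
			also have "(of_nat (2 * k) :: complex) = (of_int (n + 2 * int k) + 1 + \<mu>) - of_int n - 1 - \<mu>" by simp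
			also have "norm ... <= norm (of_int (n + 2 * int k) + 1 + \<mu>) + norm (of_int n :: complex) + 1 + norm \<mu>"
				by (intro order_trans[OF norm_triangle_ineq4] add_mono) auto
			finally show ?thesis using that by (simp add: C_def)
		qed
		have l1: "2 * real k - C <= norm (z k)" unfolding z_def by (rule low) simp
		have l2: "2 * real k - C <= norm (of_int (n + 2 * int k) + 1 - nu)" using low[of "- nu"] by simp
		have s0: "0 <= s * real (Suc k)" using s(1) by simp
		have a1: "s * real (Suc k) <= rho * norm (z k)" by (rule order_trans[OF q mult_left_mono[OF l1]]) (use rho(1) in simp)
		have a2: "s * real (Suc k) <= rho * norm (of_int (n + 2 * int k) + 1 - nu)" by (rule order_trans[OF q mult_left_mono[OF l2]]) (use rho(1) in simp)
		have "(s * real (Suc k)) * (s * real (Suc k)) <= (rho * norm (z k)) * (rho * norm (of_int (n + 2 * int k) + 1 - nu))"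
			by (rule mult_mono[OF a1 a2]) (use s0 rho(1) in auto)
		then have "((s * real (Suc k)) * (s * real (Suc k))) * (d k)\<^sup>2 <= ((rho * norm (z k)) * (rho * norm (of_int (n + 2 * int k) + 1 - nu))) * (d k)\<^sup>2"
			by (rule mult_right_mono) simp
		also have "... = (real (Suc k))\<^sup>2 * (d (Suc k))\<^sup>2" unfolding rec power2_eq_square[of rho] by (simp only: ac_simps)
		finally have "(real (Suc k))\<^sup>2 * (s\<^sup>2 * (d k)\<^sup>2) <= (real (Suc k))\<^sup>2 * (d (Suc k))\<^sup>2"
			unfolding power2_eq_square[of s] power2_eq_square[of "real (Suc k)"] by (simp only: ac_simps)
		then show ?thesis by (rule mult_left_le_imp_le) simp
	qed
	have gi: "(s\<^sup>2) ^ i * (d K0)\<^sup>2 <= (d (K0 + i))\<^sup>2" for i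
	proof (induct i)
		case (Suc i)
		have "(s\<^sup>2) ^ Suc i * (d K0)\<^sup>2 = s\<^sup>2 * ((s\<^sup>2) ^ i * (d K0)\<^sup>2)" by simp
		also have "... <= s\<^sup>2 * (d (K0 + i))\<^sup>2" by (rule mult_left_mono[OF Suc]) simp
		also have "... <= (d (K0 + Suc i))\<^sup>2" using grow[of "K0 + i"] by simp
		finally show ?case .
	qed simp
	define N where "N = norm (F (pc (of_real rho)))"
	have "1 < s\<^sup>2" using s(1) by (simp add: one_less_power)
	then obtain i where i: "N\<^sup>2 / (d K0)\<^sup>2 < (s\<^sup>2) ^ i" using real_arch_pow by blast
	have "N\<^sup>2 < (s\<^sup>2) ^ i * (d K0)\<^sup>2" using i dpos[of K0] by (simp add: pos_divide_less_eq)
	also have "... <= (d (K0 + i))\<^sup>2" by (rule gi)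
	also have "... <= N\<^sup>2" unfolding N_def by (rule power_mono[OF dK]) (use dpos less_imp_le in blast)
	finally show False by simp
qed

end

section \<open>From weight vectors to K-finite vectors\<close>

lemma complex_differentiable_add:
	assumes "complex_differentiable_at H x" "complex_differentiable_at K x"
	shows "complex_differentiable_at (%z. H z + K z) x"
proof -
	have "complex_differentiable_at (%z. - K z) x"
		by (rule complex_differentiable_map[OF assms(2) bounded_linear_minus[OF bounded_linear_ident]]) simp
	from complex_differentiable_diff[OF assms(1) this] show ?thesis by simp
qed

lemma complex_differentiable_const: "complex_differentiable_at (%z. c) x"
	unfolding complex_differentiable_at_def by (intro exI[of _ "%_. 0"]) simp

context unirep
begin

lemma proj_sum: "proj k (\<Sum>m\<in>S. f m) = (\<Sum>m\<in>S. proj k (f m))"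
	by (rule Real_Vector_Spaces.linear_sum[OF bounded_linear.linear[OF bounded_linear_proj]])

lemma rep_sum: "g \<in> SL2R ==> rp g (\<Sum>m\<in>S. f m) = (\<Sum>m\<in>S. rp g (f m))"
	by (rule Real_Vector_Spaces.linear_sum[OF bounded_linear.linear[OF rep_bounded_linear]])

text \<open>The angle 1/(m - n) makes the two eigenvalues differ by the factor \<open>cis 1\<close>,
  which is not 1 because sin 1 > 0.\<close>

lemma cis_separates:
	assumes "n ~= (m::int)"
	shows "\<exists>th. cis (- of_int n * th) ~= cis (- of_int m * th)"
proof -
	define th where "th = 1 / (of_int m - of_int n :: real)"
	have d0: "(of_int m - of_int n :: real) ~= 0" using assms by simp
	have "- of_int n * th + of_int m * th = (of_int m - of_int n) * th" by (simp add: algebra_simps)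
	also have "... = 1" unfolding th_def using d0 by simp
	finally have one: "- of_int n * th + of_int m * th = 1" .
	have "cis (- of_int n * th) ~= cis (- of_int m * th)"
	proof
		assume e: "cis (- of_int n * th) = cis (- of_int m * th)"
		have "cis 1 = cis (- of_int n * th) * cis (of_int m * th)" unfolding cis_mult one ..
		also have "... = 1" unfolding e cis_mult by simp
		finally have "sin 1 = (0::real)" by (simp add: complex_eq_iff)
		then show False using sin_gt_zero[of 1] pi_gt3 by simp
	qed
	then show ?thesis by blast
qed

text \<open>A predicate stable under \<open>y \<mapsto> rp(rot th) y - c y\<close> and under scaling passes from a finite sum of
	weight vectors to each summand: choosing \<open>c\<close> as an eigenvalue of \<open>rp(rot th)\<close> removes one summand at a time.\<close>

lemma extract_weight:
	assumes "finite S" "n \<notin> S"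
		and P1: "!!y th c. P y ==> P (rp (rot th) y - c *% y)" and P2: "!!y c. P y ==> P (c *% y)"
		and "!!m. x m \<in> wt m" "P (x n + (\<Sum>m\<in>S. x m))"
	shows "P (x n)"
	using assms(1,2,5,6)
proof (induct S arbitrary: x rule: finite_induct)
	case (insert m S)
	have nm: "n ~= m" and nS: "n \<notin> S" using insert.prems(1) by auto
	obtain th where th: "cis (- of_int n * th) ~= cis (- of_int m * th)" using cis_separates[OF nm] ..
	define k where "k i = cis (- of_int i * th) - cis (- of_int m * th)" for i :: int
	have kx: "rp (rot th) (x i) - cis (- of_int m * th) *% x i = k i *% x i" for i
		unfolding wtD[OF insert.prems(2)] k_def complex_vector.scale_left_diff_distrib ..
	have km: "k m = 0" by (simp add: k_def)
	have "rp (rot th) (x n + (\<Sum>i\<in>insert m S. x i)) - cis (- of_int m * th) *% (x n + (\<Sum>i\<in>insert m S. x i))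
			= (rp (rot th) (x n) - cis (- of_int m * th) *% x n) + (\<Sum>i\<in>insert m S. rp (rot th) (x i) - cis (- of_int m * th) *% x i)"
		unfolding rep_add[OF rot_SL2R] rep_sum[OF rot_SL2R] scaleC_add_right complex_vector.scale_sum_right sum_subtractf by (simp only: add_diff_add)
	also have "... = k n *% x n + (\<Sum>i\<in>S. k i *% x i)"
		unfolding kx using insert.hyps by (simp add: km)
	finally have "P (k n *% x n + (\<Sum>i\<in>S. k i *% x i))"
		using P1[OF insert.prems(3), of th "cis (- of_int m * th)"] by (simp only:)
	then have "P (k n *% x n)" by (rule insert.hyps(3)[OF nS wt_scaleC[OF insert.prems(2)]])
	from P2[OF this, of "inverse (k n)"] show ?case
		using th by (simp add: scaleC_scaleC k_def)
qed simp

lemma independent_weights: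
	assumes "finite T" "!!n. n \<in> T ==> x n \<in> wt n & x n ~= 0"
	shows "complex_vector.independent (x ` T)" "card (x ` T) = card T"
proof -
	have orth: "cinner y y' = 0" if "y \<in> x ` T" "y' \<in> x ` T" "y ~= y'" for y y'
		using that assms(2) wt_orthogonal by (auto; metis)
	show "card (x ` T) = card T"
	proof (rule card_image, rule inj_onI)
		fix n m assume nm: "n \<in> T" "m \<in> T" "x n = x m"
		show "n = m"
		proof (rule ccontr)
			assume "n ~= m"
			then have "cinner (x n) (x m) = 0" using nm(1,2) assms(2) by (intro wt_orthogonal) auto
			then have "of_real ((norm (x n))\<^sup>2) = (0::complex)" unfolding nm(3)[symmetric] cinner_norm .
			then show False using assms(2)[OF nm(1)] by simp
		qed
	qed
	show "complex_vector.independent (x ` T)"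
	proof
		assume "complex_vector.dependent (x ` T)"
		then obtain u where u: "\<exists>y\<in>x ` T. u y ~= 0" "(\<Sum>y\<in>x ` T. u y *% y) = 0"
			using complex_vector.dependent_finite[of "x ` T"] assms(1) by auto
		then obtain y where y: "y \<in> x ` T" "u y ~= 0" by blast
		have "0 = cinner (\<Sum>y\<in>x ` T. u y *% y) y" unfolding u(2) by simp
		also have "... = (\<Sum>y'\<in>x ` T. u y' * cinner y' y)" by (simp add: cinner_sum_left cinner_scaleC_left)
		also have "... = (\<Sum>y'\<in>{y}. u y' * cinner y' y)"
			by (rule sum.mono_neutral_right) (use assms(1) y(1) orth in auto)
		also have "... = u y * of_real ((norm y)\<^sup>2)" by (simp add: cinner_norm)
		finally show False using y assms(2) by auto
	qed
qed

text \<open>Infinitely many components would include more than \<open>card B\<close> of them;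
  projected onto those weights, they would be independent vectors in the span of
  \<open>card B\<close> ones.\<close>

lemma K_finite_weights:
	assumes v: "v \<in> K_finite rp"
	shows "finite {n. proj n v ~= 0}"
proof (rule ccontr)
	assume inf: "infinite {n. proj n v ~= 0}"
	obtain B where B: "finite B" "(%k. rp k v) ` SO2R \<subseteq> complex_vector.span B" using v unfolding K_finite_def by blast
	obtain T where T: "finite T" "card T = Suc (card B)" "T \<subseteq> {n. proj n v ~= 0}" using infinite_arbitrarily_large[OF inf] by blast
	define PT where "PT u = (\<Sum>n\<in>T. proj n u)" for u
	have PT_add: "PT (c *% u + u') = c *% PT u + PT u'" for c u u'
		by (simp add: PT_def proj_add proj_scaleC sum.distrib complex_vector.scale_sum_right)
	have PT_diff: "PT (u - c *% u') = PT u - c *% PT u'" for c u u'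
		by (simp add: PT_def proj_diff proj_scaleC sum_subtractf complex_vector.scale_sum_right)
	have PT_rot: "PT (rp (rot th) u) = rp (rot th) (PT u)" for th u
	proof -
		have "proj n (rp (rot th) u) = rp (rot th) (proj n u)" for n
		proof (rule cinner_eqI)
			fix z
			have "cinner (proj n (rp (rot th) u)) z = cinner u (rp (rot (- th)) (proj n z))"
				by (simp add: cinner_proj_proj rep_adjoint rot_adj)
			also have "... = cnj (cis (- of_int n * (- th))) * cinner (proj n u) z"
				unfolding wtD[OF proj_in_wt] cinner_scaleC_right cinner_proj_proj ..
			also have "... = cinner (rp (rot th) (proj n u)) z"
				unfolding wtD[OF proj_in_wt] cinner_scaleC_left by (simp add: cis_cnj)
			finally show "cinner (proj n (rp (rot th) u)) z = cinner (rp (rot th) (proj n u)) z" .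
		qed
		then show ?thesis unfolding PT_def rep_sum[OF rot_SL2R] by simp
	qed
	\<comment> \<open>Vectors whose whole K-orbit lies in the span. Its image under \<open>PT\<close>
	  is stable under the operations of \<open>extract_weight\<close>, which therefore places every
	  single component in it.\<close>
	define W where "W = {u. \<forall>th. rp (rot th) u \<in> complex_vector.span B}"
	have W1: "rp (rot th) u - c *% u \<in> W" if "u \<in> W" for th u c
	proof -
		have "rp (rot \<phi>) (rp (rot th) u - c *% u) = rp (rot (\<phi> + th)) u - c *% rp (rot \<phi>) u" for \<phi>
			by (simp add: rep_diff rep_scaleC rep_mult[symmetric] rot_mult)
		then show ?thesis using that unfolding W_def by (simp add: complex_vector.span_diff complex_vector.span_scale)
	qed
	have W2: "c *% u \<in> W" if "u \<in> W" for u c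
		using that by (simp add: W_def rep_scaleC complex_vector.span_scale)
	have vW: "v \<in> W" using B(2) by (auto simp: W_def SO2R_eq)
	have inPT: "proj n v \<in> PT ` W" if n: "n \<in> T" for n
	proof (rule extract_weight[where S = "T - {n}" and x = "%m. proj m v" and P = "%y. y \<in> PT ` W"])
		fix y th c assume "y \<in> PT ` W"
		then obtain u where u: "u \<in> W" "y = PT u" by blast
		have "rp (rot th) y - c *% y = PT (rp (rot th) u - c *% u)" unfolding u(2) PT_diff PT_rot ..
		then show "rp (rot th) y - c *% y \<in> PT ` W" using W1[OF u(1)] by blast
	next
		fix y c assume "y \<in> PT ` W"
		then obtain u where u: "u \<in> W" "y = PT u" by blast
		have "c *% y = PT (c *% u)" using PT_add[of c u 0] unfolding u(2) by (simp add: PT_def)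
		then show "c *% y \<in> PT ` W" using W2[OF u(1)] by blast
	next
		have "proj n v + (\<Sum>m\<in>T - {n}. proj m v) = PT v" unfolding PT_def using sum.remove[OF T(1) n, of "%m. proj m v"] by simp
		then show "proj n v + (\<Sum>m\<in>T - {n}. proj m v) \<in> PT ` W" using vW by (simp only: imageI)
	qed (use T(1) proj_in_wt in auto)
	have PTspan: "PT u \<in> complex_vector.span (PT ` B)" if "u \<in> W" for u
	proof -
		have "rp (rot 0) u \<in> complex_vector.span B" using that unfolding W_def by blast
		then have "u \<in> complex_vector.span B" by (simp add: rot_0)
		then show ?thesis
		proof (induct rule: complex_vector.span_induct_alt)
			case base
			show ?case by (simp add: PT_def complex_vector.span_zero)
		next
			case (step c x y)
			then have "PT x \<in> complex_vector.span (PT ` B)" by (intro complex_vector.span_base imageI)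
			then show ?case unfolding PT_add by (intro complex_vector.span_add complex_vector.span_scale step)
		qed
	qed
	have sub: "(%n. proj n v) ` T \<subseteq> complex_vector.span (PT ` B)"
	proof (rule image_subsetI)
		fix n assume "n \<in> T"
		then obtain u where "proj n v = PT u" "u \<in> W" by (rule imageE[OF inPT])
		then show "proj n v \<in> complex_vector.span (PT ` B)" using PTspan by simp
	qed
	have wtT: "proj n v \<in> wt n & proj n v ~= 0" if "n \<in> T" for n using T(3) that proj_in_wt[of n v] by auto
	note ind = independent_weights[where x = "%n. proj n v", OF T(1) wtT]
	have "card ((%n. proj n v) ` T) <= card (PT ` B)"
		using complex_vector.independent_span_bound[OF finite_imageI[OF B(1)] ind(1) sub] by blast
	also have "... <= card B" by (rule card_image_le[OF B(1)])
	finally show False using ind(2) T(2) by simp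
qed

lemma K_finite_decomp:
	assumes "v \<in> K_finite rp"
	shows "\<exists>S. finite S & v = (\<Sum>n\<in>S. proj n v)"
proof (intro exI conjI)
	let ?S = "{n. proj n v ~= 0}"
	show f: "finite ?S" by (rule K_finite_weights[OF assms])
	have "v - (\<Sum>n\<in>?S. proj n v) = 0"
	proof (rule eq_zero_if_proj_zero)
		fix k
		have "proj k (\<Sum>n\<in>?S. proj n v) = (\<Sum>n\<in>?S. if n = k then proj k v else 0)"
			unfolding proj_sum by (rule sum.cong) (auto simp: proj_wt[OF proj_in_wt] proj_wt_other[OF proj_in_wt])
		also have "... = proj k v" using f by (simp add: sum.delta)
		finally show "proj k (v - (\<Sum>n\<in>?S. proj n v)) = 0" by (simp add: proj_diff)
	qed
	then show "v = (\<Sum>n\<in>?S. proj n v)" by simp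
qed

lemma wt_K_finite: "x \<in> wt n ==> x \<in> K_finite rp"
	unfolding K_finite_def SO2R_eq
	by (auto intro!: exI[of _ "{x}"] simp: wtD complex_vector.span_scale complex_vector.span_base)

text \<open>Extendability to D survives right translation by a rotation because D is K-invariant, so
  \<open>extract_weight\<close> applies to it as a predicate of the vector.\<close>

lemma extends_weight:
	assumes S: "finite S" "v = (\<Sum>n\<in>S. proj n v)" and n: "n \<in> S" and D: "invariant_domain D"
		and e: "extends_holomorphically (orbit_map rp v) D"
	shows "extends_holomorphically (orbit_map rp (proj n v)) D"
proof (rule extract_weight[where S = "S - {n}" and x = "%m. proj m v" and P = "%y. extends_holomorphically (orbit_map rp y) D"])
	show "extends_holomorphically (orbit_map rp (proj n v + (\<Sum>m\<in>S - {n}. proj m v))) D"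
		using e sum.remove[OF S(1) n, of "%m. proj m v"] S(2) by simp
next
	fix y c assume "extends_holomorphically (orbit_map rp y) D"
	then obtain F where F: "holomorphic_on_SL2C F D" "\<forall>g\<in>SL2R. F (complexify g) = rp g y"
		unfolding extends_holomorphically_def orbit_map_def by blast
	have "holomorphic_on_SL2C (%z. c *% F z) D"
		by (rule holo_map[OF F(1) bounded_linear_scaleC_right]) (simp add: scaleC_scaleC mult.commute)
	then show "extends_holomorphically (orbit_map rp (c *% y)) D"
		unfolding extends_holomorphically_def orbit_map_def using F(2) by (intro exI[of _ "%z. c *% F z"]) (simp add: rep_scaleC)
next
	fix y th c assume "extends_holomorphically (orbit_map rp y) D"
	then obtain F where F: "holomorphic_on_SL2C F D" "\<forall>g\<in>SL2R. F (complexify g) = rp g y"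
		unfolding extends_holomorphically_def orbit_map_def by blast
	have h1: "holomorphic_on_SL2C (%z. c *% F z) D"
		by (rule holo_map[OF F(1) bounded_linear_scaleC_right]) (simp add: scaleC_scaleC mult.commute)
	have h2: "holomorphic_on_SL2C (%z. F (complexify (mat 1) ** z ** ke (of_real th))) D"
		by (rule holo_comp[OF F(1) bounded_linear_two_sided smult_two_sided]) (rule invariant_domainD(3)[OF D mat_1_SL2R _ ke_SO2C])
	have "F (complexify (mat 1) ** complexify g ** ke (of_real th)) - c *% F (complexify g) = rp g (rp (rot th) y - c *% y)" if g: "g \<in> SL2R" for g
	proof -
		have "complexify (mat 1) ** complexify g ** ke (of_real th) = complexify (g ** rot th)"
			unfolding complexify_rot[symmetric] complexify_mult[symmetric] by simp
		moreover have "g ** rot th \<in> SL2R" using g by (intro SL2R_mult) simp_all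
		ultimately show ?thesis using F(2) g by (simp add: rep_mult rep_diff rep_scaleC)
	qed
	then show "extends_holomorphically (orbit_map rp (rp (rot th) y - c *% y)) D"
		unfolding extends_holomorphically_def orbit_map_def using holo_diff[OF h2 h1]
		by (intro exI[of _ "%z. F (complexify (mat 1) ** z ** ke (of_real th)) - c *% F z"] conjI) auto
qed (use S(1) proj_in_wt in auto)

lemma extension_sum:
	assumes "finite S" "!!m. m \<in> S ==> \<exists>F. (\<forall>x\<in>U. complex_differentiable_at F x) & (\<forall>g\<in>SL2R. F (complexify g) = rp g (x m))"
	shows "\<exists>F. (\<forall>x\<in>U. complex_differentiable_at F x) & (\<forall>g\<in>SL2R. F (complexify g) = rp g (\<Sum>m\<in>S. x m))"
	using assms
proof (induct S rule: finite_induct)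
	case empty
	show ?case by (intro exI[of _ "%_. 0"]) (simp add: complex_differentiable_const)
next
	case (insert m S)
	obtain F where F: "\<forall>x\<in>U. complex_differentiable_at F x" "\<forall>g\<in>SL2R. F (complexify g) = rp g (x m)" using insert.prems[of m] by auto
	obtain K where K: "\<forall>x\<in>U. complex_differentiable_at K x" "\<forall>g\<in>SL2R. K (complexify g) = rp g (\<Sum>m\<in>S. x m)" using insert.hyps(3) insert.prems by auto
	show ?case using F K insert.hyps(1,2)
		by (intro exI[of _ "%z. F z + K z"]) (simp add: complex_differentiable_add rep_add)
qed

end

section \<open>The twist by diag(1,-1) and the Lie algebra action\<close>

lemma tw_rot: "tw (rot th) = rot (- th)" and tw_dia: "tw (dia t) = dia t"
	by (simp_all add: rot_def dia_def)

lemma continuous_tw: "continuous_on S (tw :: real^2^2 => real^2^2)"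
	unfolding tw_def by (intro continuous_intros)

lemma tw_image_iff: "z \<in> tw ` D \<longleftrightarrow> tw z \<in> D" for z :: "'a::ring_1^2^2"
	by (metis imageE imageI tw_tw)

lemma invariant_domain_tw:
	assumes D: "invariant_domain D"
	shows "invariant_domain (tw ` D)"
	unfolding invariant_domain_def
proof (intro conjI ballI)
	note Dd = invariant_domainD[OF D]
	have c: "continuous_on UNIV (tw :: complex^2^2 => complex^2^2)" by (rule linear_continuous_on[OF bounded_linear_tw])
	obtain V where V: "open V" "D = SL2C \<inter> V" using Dd(1) unfolding openin_open by blast
	have "tw ` D = SL2C \<inter> tw -` V" unfolding V(2) by (auto simp: tw_image_iff)
	moreover have "open (tw -` V)" by (rule open_vimage[OF V(1) c])
	ultimately show "openin (top_of_set SL2C) (tw ` D)" by (simp add: openin_open_Int)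
	show "connected (tw ` D)" by (rule connected_continuous_image[OF continuous_on_subset[OF c] Dd(2)]) simp
	show "complexify ` SL2R \<subseteq> tw ` D"
		using Dd(4) by (auto simp: tw_image_iff tw_complexify)
	fix g x and k :: "complex^2^2" assume g: "g \<in> SL2R" and x: "x \<in> tw ` D" and k: "k \<in> SO2C"
	have "complexify (tw g) ** tw x ** tw k \<in> D" by (rule Dd(3)) (use g x k in \<open>simp_all add: tw_image_iff\<close>)
	then show "complexify g ** x ** k \<in> tw ` D" by (simp add: tw_image_iff tw_mult tw_complexify)
qed

lemma extends_tw:
	assumes "extends_holomorphically (orbit_map rp v) D"
	shows "extends_holomorphically (orbit_map (%g. rp (tw g)) v) (tw ` D)"
proof -
	obtain F where F: "holomorphic_on_SL2C F D" "\<forall>g\<in>SL2R. F (complexify g) = rp g v"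
		using assms unfolding extends_holomorphically_def orbit_map_def by blast
	have "holomorphic_on_SL2C (%z. F (tw z)) (tw ` D)"
		by (rule holo_comp[OF F(1) bounded_linear_tw smult_tw]) (simp add: tw_image_iff)
	moreover have "\<forall>g\<in>SL2R. F (tw (complexify g)) = rp (tw g) v" using F(2) by (simp add: tw_complexify)
	ultimately show ?thesis unfolding extends_holomorphically_def orbit_map_def by blast
qed

lemma irreducible_tw:
	assumes "irreducible_unitary_rep rp"
	shows "irreducible_unitary_rep (%g. rp (tw g))"
proof -
	have u: "unitary_rep rp" and n: "\<exists>v::'a. v ~= 0"
		and i: "\<forall>W. complex_vector.subspace W & closed W & (\<forall>g\<in>SL2R. rp g ` W \<subseteq> W) --> W = {0} \<or> W = UNIV"
		using assms unfolding irreducible_unitary_rep_def by blast+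
	have "continuous_on SL2R (%g. rp (tw g) v)" for v
		by (rule continuous_on_compose2[OF _ continuous_tw]) (use u in \<open>auto simp: unitary_rep_def\<close>)
	then have "unitary_rep (%g. rp (tw g))" using u unfolding unitary_rep_def by (simp add: tw_mult)
	moreover have "W = {0} \<or> W = UNIV" if W: "complex_vector.subspace W" "closed W" "\<forall>g\<in>SL2R. rp (tw g) ` W \<subseteq> W" for W
	proof -
		have "\<forall>g\<in>SL2R. rp g ` W \<subseteq> W"
		proof
			fix g :: "real^2^2" assume "g \<in> SL2R"
			then show "rp g ` W \<subseteq> W" using W(3)[rule_format, of "tw g"] by simp
		qed
		then show ?thesis using i W(1,2) by blast
	qed
	ultimately show ?thesis unfolding irreducible_unitary_rep_def using n by blast
qed

lemma trivial_tw: "trivial_rep (%g. rp (tw g)) \<longleftrightarrow> trivial_rep rp"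
proof -
	have "trivial_rep rp" if "trivial_rep (%g. rp (tw g))"
		unfolding trivial_rep_def
	proof (intro ballI allI)
		fix g :: "real^2^2" and v assume "g \<in> SL2R"
		then show "rp g v = v" using that[unfolded trivial_rep_def, rule_format, of "tw g"] by simp
	qed
	then show ?thesis unfolding trivial_rep_def by auto
qed

lemma power_sym:
	fixes C N s :: real
	assumes "C * C + N * N = 1"
	shows "(((**) (s *\<^sub>R m22 C N N (- C))) ^^ n) (mat 1) = s ^ n *\<^sub>R (if even n then mat 1 else m22 C N N (- C))"
proof (induct n)
	case (Suc n)
	have "(((**) (s *\<^sub>R m22 C N N (- C))) ^^ Suc n) (mat 1) = (s *\<^sub>R m22 C N N (- C)) ** (s ^ n *\<^sub>R (if even n then mat 1 else m22 C N N (- C)))"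
		unfolding Suc[symmetric] by simp
	also have "... = s ^ Suc n *\<^sub>R (if even (Suc n) then mat 1 else m22 C N N (- C))"
	proof (cases "even n")
		case False
		have "s * C * (s ^ n * C) + s * N * (s ^ n * N) = s * s ^ n * (C * C + N * N)" by (simp add: algebra_simps)
		then show ?thesis using False assms by (simp add: mat_1_m22 scaleR_m22 algebra_simps)
	qed (simp add: mat_1_m22 scaleR_m22 algebra_simps)
	finally show ?case .
qed simp

text \<open>A trace-free symmetric matrix with determinant -1 has square 1, so its exponential is
  cosh s plus sinh s times the matrix.\<close>

lemma matrix_exp_sym:
	fixes C N s :: real
	assumes "C * C + N * N = 1"
	shows "matrix_exp (s *\<^sub>R m22 C N N (- C)) = m22 (cosh s + sinh s * C) (sinh s * N) (sinh s * N) (cosh s - sinh s * C)"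
proof -
	\<comment> \<open>The spectral projections for the eigenvalues 1 and -1; they reduce the matrix
	  series to two scalar exponentials.\<close>
	let ?a = "m22 ((1 + C) / 2) (N / 2) (N / 2) ((1 - C) / 2)" and ?b = "m22 ((1 - C) / 2) (- N / 2) (- N / 2) ((1 + C) / 2)"
	have "(%n. (s ^ n /\<^sub>R fact n) *\<^sub>R ?a + ((- s) ^ n /\<^sub>R fact n) *\<^sub>R ?b) sums (exp s *\<^sub>R ?a + exp (- s) *\<^sub>R ?b)"
		by (intro sums_add sums_scaleR_left exp_converges)
	moreover have "(%n. (s ^ n /\<^sub>R fact n) *\<^sub>R ?a + ((- s) ^ n /\<^sub>R fact n) *\<^sub>R ?b)
			= (%n. (1 / fact n) *\<^sub>R (((**) (s *\<^sub>R m22 C N N (- C))) ^^ n) (mat 1))"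
	proof
		fix n
		show "(s ^ n /\<^sub>R fact n) *\<^sub>R ?a + ((- s) ^ n /\<^sub>R fact n) *\<^sub>R ?b = (1 / fact n) *\<^sub>R (((**) (s *\<^sub>R m22 C N N (- C))) ^^ n) (mat 1)"
			unfolding power_sym[OF assms] by (cases "even n") (simp_all add: mat_1_m22 scaleR_m22 add_m22 field_simps)
	qed
	ultimately have "matrix_exp (s *\<^sub>R m22 C N N (- C)) = exp s *\<^sub>R ?a + exp (- s) *\<^sub>R ?b"
		unfolding matrix_exp_def by (simp add: sums_iff)
	then show ?thesis by (simp add: scaleR_m22 add_m22 cosh_field_def sinh_field_def field_simps)
qed

lemma cdia_entries:
	fixes a b c s :: real
	assumes h: "c * c + s * s = 1"
	shows "(c * (2 * a) + - s * 0) * c + (c * 0 + - s * (2 * b)) * - s = a + b + (a - b) * (c * c - s * s)"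
		and "(c * (2 * a) + - s * 0) * - (- s) + (c * 0 + - s * (2 * b)) * c = (a - b) * (2 * s * c)"
		and "(s * (2 * a) + c * 0) * c + (s * 0 + c * (2 * b)) * - s = (a - b) * (2 * s * c)"
		and "(s * (2 * a) + c * 0) * - (- s) + (s * 0 + c * (2 * b)) * c = a + b - (a - b) * (c * c - s * s)"
proof -
	have "(c * (2 * a) + - s * 0) * c + (c * 0 + - s * (2 * b)) * - s = (a + b) * (c * c + s * s) + (a - b) * (c * c - s * s)"
		by (simp add: algebra_simps)
	then show "(c * (2 * a) + - s * 0) * c + (c * 0 + - s * (2 * b)) * - s = a + b + (a - b) * (c * c - s * s)" unfolding h mult_1_right .
	have "(s * (2 * a) + c * 0) * - (- s) + (s * 0 + c * (2 * b)) * c = (a + b) * (c * c + s * s) - (a - b) * (c * c - s * s)"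
		by (simp add: algebra_simps)
	then show "(s * (2 * a) + c * 0) * - (- s) + (s * 0 + c * (2 * b)) * c = a + b - (a - b) * (c * c - s * s)" unfolding h mult_1_right .
qed (simp_all add: algebra_simps)

context irrep
begin

lemma cdia_m22: "cdia th t = m22 (cosh t + sinh t * cos (2 * th)) (sinh t * sin (2 * th)) (sinh t * sin (2 * th)) (cosh t - sinh t * cos (2 * th))"
proof -
	have c2: "cos (2 * th) = cos th * cos th - sin th * sin th" "sin (2 * th) = 2 * sin th * cos th"
		by (simp_all add: cos_double sin_double power2_eq_square)
	have h: "cos th * cos th + sin th * sin th = 1" using sin_cos_squared_add[of th] by (simp add: power2_eq_square add.commute)
	define a b where "a = exp t / 2" and "b = exp (- t) / 2"
	have ab: "exp t = 2 * a" "exp (- t) = 2 * b" and ch: "cosh t = a + b" "sinh t = a - b"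
		by (simp_all add: a_def b_def cosh_field_def sinh_field_def add_divide_distrib diff_divide_distrib)
	show ?thesis
		unfolding cdia_def rot_def dia_def m22_mult m22_eq_iff c2 ch ab cos_minus sin_minus
		by (intro conjI; rule cdia_entries[OF h])
qed

text \<open>In polar form p + iq = r cis phi, the generator is r times the diagonal one turned by
  the angle phi, so its exponential curve is a \<open>cdia\<close> curve and its derivative is known
  from \<open>rot_Hop\<close>.\<close>

lemma deriv_rep_sym:
	assumes S: "finite S" and x: "!!m. m \<in> S ==> x m \<in> wt m"
	shows "deriv_rep rp (m22 p q q (- p)) (\<Sum>m\<in>S. x m) = (\<Sum>m\<in>S. cnj (Complex p q) *% up m (x m) + Complex p q *% dn m (x m))"
proof -
	define r \<phi> where "r = norm (Complex p q)" and "\<phi> = Arg (Complex p q)"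
	have e: "Complex p q = of_real r * cis \<phi>" using rcis_cmod_Arg[of "Complex p q"] by (simp add: rcis_def r_def \<phi>_def)
	have pq: "p = r * cos \<phi>" "q = r * sin \<phi>" using e by (simp_all add: complex_eq_iff)
	have m: "matrix_exp (t *\<^sub>R m22 p q q (- p)) = cdia (\<phi> / 2) (t * r)" for t
	proof -
		have "t *\<^sub>R m22 p q q (- p) = (t * r) *\<^sub>R m22 (cos \<phi>) (sin \<phi>) (sin \<phi>) (- cos \<phi>)"
			unfolding scaleR_m22 pq by (simp add: mult.assoc)
		then show ?thesis
			using matrix_exp_sym[of "cos \<phi>" "sin \<phi>" "t * r"] sin_cos_squared_add[of \<phi>] unfolding cdia_m22 by (simp add: power2_eq_square add.commute)
	qed
	have d: "((%t. rp (cdia (\<phi> / 2) (t * r)) (x m)) has_vector_derivative (cnj (Complex p q) *% up m (x m) + Complex p q *% dn m (x m))) (at 0)" if "m \<in> S" for m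
	proof -
		have d1: "((%t. t * r) has_vector_derivative r) (at 0)"
			unfolding has_real_derivative_iff_has_vector_derivative[symmetric] by (auto intro!: derivative_eq_intros)
		have d2: "((%t. rp (cdia (\<phi> / 2) t) (x m)) has_vector_derivative (cis (- \<phi>) *% up m (x m) + cis \<phi> *% dn m (x m))) (at (0 * r))"
			using cdia_deriv[OF x[OF that], of "\<phi> / 2"] unfolding rot_Hop[OF x[OF that]] by simp
		have "r *\<^sub>R (cis (- \<phi>) *% up m (x m) + cis \<phi> *% dn m (x m)) = cnj (Complex p q) *% up m (x m) + Complex p q *% dn m (x m)"
			unfolding e scaleC_of_real[symmetric] by (simp add: scaleC_add_right scaleC_scaleC cis_cnj)
		then show ?thesis using vector_diff_chain_at[OF d1 d2] by (simp add: o_def)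
	qed
	have "((%t. rp (matrix_exp (t *\<^sub>R m22 p q q (- p))) (\<Sum>m\<in>S. x m)) has_vector_derivative
			(\<Sum>m\<in>S. cnj (Complex p q) *% up m (x m) + Complex p q *% dn m (x m))) (at 0)"
		unfolding m rep_sum[OF cdia_SL2R] by (rule has_vector_derivative_sum) (rule d)
	then show ?thesis unfolding deriv_rep_def by (rule vector_derivative_at)
qed

text \<open>The real and the imaginary part of a multiple of Z contribute equally to raising and
  oppositely to lowering; for the conjugate matrix the roles are exchanged.\<close>

lemma deriv_rep_C_plus:
	assumes S: "finite S" and x: "!!m. m \<in> S ==> x m \<in> wt m"
	shows "deriv_rep_C rp (smult_matrix c (vector [vector [1, \<i>], vector [\<i>, -1]])) (\<Sum>m\<in>S. x m) = (2 * c) *% (\<Sum>m\<in>S. up m (x m))"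
		and "deriv_rep_C rp (smult_matrix c (vector [vector [1, -\<i>], vector [-\<i>, -1]])) (\<Sum>m\<in>S. x m) = (2 * c) *% (\<Sum>m\<in>S. dn m (x m))"
proof -
	have 1: "map_matrix Re (smult_matrix c (m22 1 \<i> \<i> (-1))) = m22 (Re c) (- Im c) (- Im c) (- Re c)"
		"map_matrix Im (smult_matrix c (m22 1 \<i> \<i> (-1))) = m22 (Im c) (Re c) (Re c) (- Im c)"
		"map_matrix Re (smult_matrix c (m22 1 (-\<i>) (-\<i>) (-1))) = m22 (Re c) (Im c) (Im c) (- Re c)"
		"map_matrix Im (smult_matrix c (m22 1 (-\<i>) (-\<i>) (-1))) = m22 (Im c) (- Re c) (- Re c) (- Im c)"
		by (simp_all add: smult_m22)
	have c: "Complex (Re c) (- Im c) = cnj c" "Complex (Im c) (Re c) = \<i> * cnj c" "Complex (Re c) (Im c) = c" "Complex (Im c) (- Re c) = - \<i> * c"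
		by (simp_all add: complex_eq_iff)
	have a: "(cnj e *% u + e *% d) + \<i> *% (cnj e' *% u + e' *% d) = (cnj e + \<i> * cnj e') *% u + (e + \<i> * e') *% d" for e e' and u d :: 'h
		by (simp add: scaleC_add_right scaleC_add_left scaleC_scaleC)
	have ds: "deriv_rep rp (m22 p q q (- p)) (\<Sum>m\<in>S. x m) = (\<Sum>m\<in>S. cnj (Complex p q) *% up m (x m) + Complex p q *% dn m (x m))" for p q
		by (rule deriv_rep_sym[OF S]) (rule x)
	have ds': "deriv_rep rp (m22 p (- q) (- q) (- p)) (\<Sum>m\<in>S. x m) = (\<Sum>m\<in>S. cnj (Complex p (- q)) *% up m (x m) + Complex p (- q) *% dn m (x m))" for p q
		by (rule ds)
	show "deriv_rep_C rp (smult_matrix c (vector [vector [1, \<i>], vector [\<i>, -1]])) (\<Sum>m\<in>S. x m) = (2 * c) *% (\<Sum>m\<in>S. up m (x m))"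
		unfolding deriv_rep_C_def m22_def[symmetric] 1 ds ds' c complex_vector.scale_sum_right sum.distrib[symmetric]
		by (rule sum.cong[OF refl]) (simp only: a, simp)
	show "deriv_rep_C rp (smult_matrix c (vector [vector [1, -\<i>], vector [-\<i>, -1]])) (\<Sum>m\<in>S. x m) = (2 * c) *% (\<Sum>m\<in>S. dn m (x m))"
		unfolding deriv_rep_C_def m22_def[symmetric] 1 ds ds' c complex_vector.scale_sum_right sum.distrib[symmetric]
		by (rule sum.cong[OF refl]) (simp only: a, simp)
qed

lemma sum_distinct_weights_zero:
	assumes S: "finite S" and y: "!!m. m \<in> S ==> y m \<in> wt (m + k)" and z: "(\<Sum>m\<in>S. y m) = 0" and m: "m \<in> S"
	shows "y m = 0"
proof -
	have "0 = proj (m + k) (\<Sum>i\<in>S. y i)" unfolding z by simp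
	also have "... = (\<Sum>i\<in>S. if i = m then y m else 0)"
		unfolding proj_sum
	proof (rule sum.cong[OF refl])
		fix i assume i: "i \<in> S"
		show "proj (m + k) (y i) = (if i = m then y m else 0)"
		proof (cases "i = m")
			case True
			then show ?thesis using proj_wt[OF y[OF m]] by simp
		next
			case False
			then show ?thesis using proj_wt_other[OF y[OF i], of "m + k"] by simp
		qed
	qed
	also have "... = y m" using S m by (simp add: sum.delta)
	finally show ?thesis by simp
qed

text \<open>Raising sends distinct weights to distinct weights, so a K-finite vector is annihilated
  only if each component is, and one nonzero component is enough.\<close>

lemma highest_weight_iff: "highest_weight_rep rp \<longleftrightarrow> (\<exists>n x. x \<in> wt n & x ~= 0 & up n x = 0)"
	and lowest_weight_iff: "lowest_weight_rep rp \<longleftrightarrow> (\<exists>n x. x \<in> wt n & x ~= 0 & dn n x = 0)"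
proof -
	have nz: "\<exists>m\<in>S. proj m w ~= 0" if "w ~= 0" "w = (\<Sum>n\<in>S. proj n w)" for w S
	proof (rule ccontr)
		assume "\<not> (\<exists>m\<in>S. proj m w ~= 0)"
		then have "(\<Sum>n\<in>S. proj n w) = 0" by (simp add: sum.neutral)
		then show False using that by simp
	qed
	have pw: "proj m w \<in> wt m" for m w by (rule proj_in_wt)
	have one: "(\<Sum>m\<in>{n}. x) = x" for n :: int and x :: 'h by simp
	show "highest_weight_rep rp \<longleftrightarrow> (\<exists>n x. x \<in> wt n & x ~= 0 & up n x = 0)"
	proof
		assume "highest_weight_rep rp"
		then obtain w where w: "w \<in> K_finite rp" "w ~= 0" "\<forall>Z\<in>p_plus. deriv_rep_C rp Z w = 0" unfolding highest_weight_rep_def by blast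
		obtain S where S: "finite S" "w = (\<Sum>n\<in>S. proj n w)" using K_finite_decomp[OF w(1)] by blast
		obtain m where m: "m \<in> S" "proj m w ~= 0" using nz[OF w(2) S(2)] by blast
		have "deriv_rep_C rp (smult_matrix 1 (vector [vector [1, \<i>], vector [\<i>, -1]])) w = 0" using w(3) unfolding p_plus_def by blast
		then have "deriv_rep_C rp (smult_matrix 1 (vector [vector [1, \<i>], vector [\<i>, -1]])) (\<Sum>n\<in>S. proj n w) = 0" unfolding S(2)[symmetric] .
		then have "(\<Sum>n\<in>S. up n (proj n w)) = 0" unfolding deriv_rep_C_plus(1)[OF S(1) pw] by simp
		then have "up m (proj m w) = 0" by (rule sum_distinct_weights_zero[OF S(1) up_wt _ m(1)])
		then show "\<exists>n x. x \<in> wt n & x ~= 0 & up n x = 0" using m(2) proj_in_wt by blast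
	next
		assume "\<exists>n x. x \<in> wt n & x ~= 0 & up n x = 0"
		then obtain n x where x: "x \<in> wt n" "x ~= 0" "up n x = 0" by blast
		have "deriv_rep_C rp Z x = 0" if "Z \<in> p_plus" for Z
			using that deriv_rep_C_plus(1)[of "{n}" "%_. x"] x(1,3) unfolding p_plus_def by auto
		then show "highest_weight_rep rp" unfolding highest_weight_rep_def using x wt_K_finite by blast
	qed
	show "lowest_weight_rep rp \<longleftrightarrow> (\<exists>n x. x \<in> wt n & x ~= 0 & dn n x = 0)"
	proof
		assume "lowest_weight_rep rp"
		then obtain w where w: "w \<in> K_finite rp" "w ~= 0" "\<forall>Z\<in>p_minus. deriv_rep_C rp Z w = 0" unfolding lowest_weight_rep_def by blast
		obtain S where S: "finite S" "w = (\<Sum>n\<in>S. proj n w)" using K_finite_decomp[OF w(1)] by blast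
		obtain m where m: "m \<in> S" "proj m w ~= 0" using nz[OF w(2) S(2)] by blast
		have "deriv_rep_C rp (smult_matrix 1 (vector [vector [1, -\<i>], vector [-\<i>, -1]])) w = 0" using w(3) unfolding p_minus_def by blast
		then have "deriv_rep_C rp (smult_matrix 1 (vector [vector [1, -\<i>], vector [-\<i>, -1]])) (\<Sum>n\<in>S. proj n w) = 0" unfolding S(2)[symmetric] .
		then have "(\<Sum>n\<in>S. dn n (proj n w)) = 0" unfolding deriv_rep_C_plus(2)[OF S(1) pw] by simp
		moreover have "dn n (proj n w) \<in> wt (n + (- 2))" for n using dn_wt[of n "proj n w"] by simp
		ultimately have "dn m (proj m w) = 0"
			using sum_distinct_weights_zero[where k = "- 2" and y = "%n. dn n (proj n w)", OF S(1) _ _ m(1)] by simp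
		then show "\<exists>n x. x \<in> wt n & x ~= 0 & dn n x = 0" using m(2) proj_in_wt by blast
	next
		assume "\<exists>n x. x \<in> wt n & x ~= 0 & dn n x = 0"
		then obtain n x where x: "x \<in> wt n" "x ~= 0" "dn n x = 0" by blast
		have "deriv_rep_C rp Z x = 0" if "Z \<in> p_minus" for Z
			using that deriv_rep_C_plus(2)[of "{n}" "%_. x"] x(1,3) unfolding p_minus_def by auto
		then show "lowest_weight_rep rp" unfolding lowest_weight_rep_def using x wt_K_finite by blast
	qed
qed

text \<open>The chain below the top vector exhausts all weights, since its series spans the orbit of
  that vector. Hence every weight is negative, and \<open>Qq\<close> at a weight counts the steps up
  to the top: a natural number, for which the inner series is a polynomial.\<close>

lemma highest_all_weights:
	assumes x: "x \<in> wt N" "x ~= 0" "up N x = 0" and nt: "\<not> trivial_rep rp" and v: "v \<in> wt n" "v ~= 0"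
	shows "n < 0 & (\<exists>nu q. Re nu >= 0 & cas nu n v & Qq nu n 0 = of_nat q)"
proof -
	obtain nu where nu: "Re nu >= 0" "cas nu N x" by (rule cas_exists[OF x(2)])
	have top: "of_int N + 1 + nu = 0" by (rule top_weight[OF x(1,2) nu(2) x(3) nu(1) nt])
	define w where "w = tower nu N x"
	obtain M where M: "\<forall>j. norm (w j) <= M" using tower_bounded_ex[OF x(1) nu(2,1)] unfolding w_def ..
	have "\<exists>g\<in>SL2R. cinner (rp g x) v ~= 0"
	proof (rule ccontr)
		assume "\<not> (\<exists>g\<in>SL2R. cinner (rp g x) v ~= 0)"
		then have 0: "\<forall>g\<in>SL2R. cinner (rp g x) v = 0" by blast
		define W where "W = {y. \<forall>g\<in>SL2R. cinner (rp g y) v = 0}"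
		have "v \<in> W"
		proof (rule invariant_subspace[where x = x])
			show "complex_vector.subspace W"
				unfolding complex_vector.subspace_def W_def by (simp add: rep_add rep_scaleC cinner_add_left cinner_scaleC_left)
			have "W = (\<Inter>g\<in>SL2R. {y. cinner (rp g y) v = 0})" by (auto simp: W_def)
			moreover have "closed {y. cinner (rp g y) v = 0}" if "g \<in> SL2R" for g
				by (intro closed_Collect_eq continuous_intros bounded_linear.continuous_on[OF rep_bounded_linear[OF that]])
			ultimately show "closed W" by (simp add: closed_INT)
			show "rp g y \<in> W" if "g \<in> SL2R" "y \<in> W" for g y
				using that by (auto simp: W_def rep_mult[symmetric] SL2R_mult)
			show "x \<in> W" using 0 by (simp add: W_def)
		qed (rule x(2))
		then have "\<forall>g\<in>SL2R. cinner (rp g v) v = 0" unfolding W_def mem_Collect_eq .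
		from bspec[OF this mat_1_SL2R] have "cinner (rp (mat 1) v) v = 0" .
		then have "of_real ((norm v)\<^sup>2) = (0::complex)" by (simp add: cinner_norm)
		then show False using v(2) by simp
	qed
	then obtain g where g: "g \<in> SL2R" "cinner (rp g x) v ~= 0" by blast
	\<comment> \<open>Otherwise pairing the series of \<open>Fser_orbit\<close> with v termwise would
	  make the coefficient at g vanish.\<close>
	have "\<exists>j. cinner (w j) v ~= 0"
	proof (rule ccontr)
		assume "\<not> (\<exists>j. cinner (w j) v ~= 0)"
		then have z: "(%j. cinner (w j) v) = (%j. 0)" by auto
		define \<xi> et where "\<xi> = cayB (complexify g) * inverse (cayA (complexify g))" and "et = cayC (complexify g) * inverse (cayD (complexify g))"
		have U: "complexify g \<in> U_crown" by (rule complexify_in_U_crown[OF g(1)])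
		have n1: "norm \<xi> < 1" "norm et < 1" unfolding \<xi>_def et_def using U by (auto simp: U_crown_def intro!: norm_mult_inverse_less_1)
		have "cinner (outer_ser (Pp nu N 0) (Qq nu N 0) w 0 \<xi> et) v = outer_ser (Pp nu N 0) (Qq nu N 0) (%j. cinner (w j) v) 0 \<xi> et"
			by (rule outer_ser_map[where L = "%y. cinner y v", OF bounded_linear_cinner_left _ n1 M[rule_format]]) (simp add: cinner_scaleC_left scaleC_complex_def)
		also have "... = 0" unfolding z outer_ser_def inner_ser_def by simp
		finally have "cinner (Fser N (Pp nu N 0) (Qq nu N 0) w 0 (complexify g)) v = 0"
			unfolding Fser_def \<xi>_def[symmetric] et_def[symmetric] by (simp add: cinner_scaleC_left)
		then show False using g(2) unfolding w_def Fser_orbit[OF x(1,2) nu(2,1) nt g(1)] by simp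
	qed
	then obtain j where j: "cinner (w j) v ~= 0" by blast
	have wj: "w j \<in> wt (N + 2 * j)" "cas nu (N + 2 * j) (w j)" "w j ~= 0"
		unfolding w_def by (rule tower_wt_cas[OF x(1) nu(2)])+ (use j in \<open>auto simp: w_def\<close>)
	have n: "n = N + 2 * j" using wt_orthogonal[OF wj(1) v(1)] j by metis
	have "v = (cinner v (w j) / of_real ((norm (w j))\<^sup>2)) *% w j" by (rule wt_one_dim) (use wj v(1) n in auto)
	then have cas: "cas nu n v" using cas_scaleC[OF wj(1,2)] unfolding n by metis
	have tz: "tup nu N x (Suc k) = 0" for k
	proof (induct k)
		case 0
		show ?case using x(3) by (simp add: tup_Suc tup_0)
	next
		case (Suc k)
		show ?case unfolding tup_Suc[of nu N x "Suc k"] Suc by simp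
	qed
	have "j <= 0"
	proof (rule ccontr)
		assume "\<not> j <= 0"
		then have "w j = tup nu N x (Suc (nat j - 1))" by (simp add: w_def tower_def)
		then show False using wj(3) tz by simp
	qed
	moreover have "N < 0" by (rule up_zero_neg[OF x nt])
	ultimately have "n < 0" using n by simp
	\<comment> \<open>The top condition gives nu = -N - 1, and with n = N + 2j the half-integral terms
	  cancel and leave -j.\<close>
	moreover have "Qq nu n 0 = of_nat (nat (- j))"
	proof -
		have "nu = - of_int N - 1" using top by (simp add: eq_neg_iff_add_eq_0 algebra_simps)
		then have "Qq nu n 0 = of_int (- j)" unfolding n Qq_def by (simp add: field_simps)
		then show ?thesis using \<open>j <= 0\<close> by (simp add: of_nat_nat)
	qed
	ultimately show ?thesis using nu(1) cas by blast
qed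

end

section \<open>The four cases of the classification\<close>

context irrep
begin

text \<open>Extensions are added over the finitely many weights on one common open set U, so no
  gluing is involved.\<close>

lemma extension_exists:
	assumes S: "finite S" "v = (\<Sum>n\<in>S. proj n v)"
		and ex: "!!n y. y \<in> wt n ==> y ~= 0 ==> \<exists>F. (\<forall>x\<in>U. complex_differentiable_at F x) & (\<forall>g\<in>SL2R. F (complexify g) = rp g y)"
		and U: "open U" "D \<subseteq> U"
	shows "extends_holomorphically (orbit_map rp v) D"
proof -
	have "\<exists>F. (\<forall>x\<in>U. complex_differentiable_at F x) & (\<forall>g\<in>SL2R. F (complexify g) = rp g (proj n v))" for n
	proof (cases "proj n v = 0")
		case True
		then show ?thesis by (intro exI[of _ "%_. 0"]) (simp add: complex_differentiable_const)
	next
		case False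
		then show ?thesis by (rule ex[OF proj_in_wt])
	qed
	from extension_sum[where x = "%n. proj n v", OF S(1) this]
	obtain F where F: "\<forall>x\<in>U. complex_differentiable_at F x" "\<forall>g\<in>SL2R. F (complexify g) = rp g v"
		unfolding S(2)[symmetric] by blast
	then show ?thesis unfolding extends_holomorphically_def orbit_map_def using holo_open[OF U] by blast
qed

lemma weight_extension:
	assumes v: "v \<in> K_finite rp" "v ~= 0" and D: "invariant_domain D" and e: "extends_holomorphically (orbit_map rp v) D"
	obtains n y F where "y \<in> wt n" "y ~= 0" "holomorphic_on_SL2C F D" "\<forall>g\<in>SL2R. F (complexify g) = rp g y"
proof -
	obtain S where S: "finite S" "v = (\<Sum>n\<in>S. proj n v)" using K_finite_decomp[OF v(1)] by blast
	have "\<exists>n\<in>S. proj n v ~= 0"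
	proof (rule ccontr)
		assume "\<not> (\<exists>n\<in>S. proj n v ~= 0)"
		then have "(\<Sum>n\<in>S. proj n v) = 0" by (simp add: sum.neutral)
		then show False using S(2) v(2) by simp
	qed
	then obtain n where n: "n \<in> S" "proj n v ~= 0" by blast
	obtain F where "holomorphic_on_SL2C F D" "\<forall>g\<in>SL2R. F (complexify g) = rp g (proj n v)"
		using extends_weight[OF S n(1) D e] unfolding extends_holomorphically_def orbit_map_def by blast
	then show ?thesis using that[OF proj_in_wt n(2)] by blast
qed

lemma trivial_domain:
	assumes "trivial_rep rp"
	shows "is_domain_of_holomorphy (orbit_map rp v) SL2C"
proof -
	have "holomorphic_on_SL2C (%_. v) SL2C" by (rule holo_open[OF open_UNIV]) (auto simp: complex_differentiable_const)
	then have "extends_holomorphically (orbit_map rp v) SL2C"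
		unfolding extends_holomorphically_def orbit_map_def using assms unfolding trivial_rep_def by (intro exI[of _ "%_. v"]) simp
	then show ?thesis unfolding is_domain_of_holomorphy_def using invariant_domain_SL2C invariant_domainD(6) by blast
qed

text \<open>Existence is \<open>Fpol\<close>, holomorphic on all of \<open>U_plus\<close> because
  the exponent is natural for every weight; maximality needs only one nonzero component, and its
  weight is negative.\<close>

lemma highest_domain:
	assumes nt: "\<not> trivial_rep rp" and hw: "highest_weight_rep rp" and v: "v \<in> K_finite rp" "v ~= 0"
	shows "is_domain_of_holomorphy (orbit_map rp v) (preimage_SL2C S_plus)"
proof -
	obtain N x where x: "x \<in> wt N" "x ~= 0" "up N x = 0" using hw unfolding highest_weight_iff by blast
	obtain S where S: "finite S" "v = (\<Sum>n\<in>S. proj n v)" using K_finite_decomp[OF v(1)] by blast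
	have "extends_holomorphically (orbit_map rp v) {z \<in> SL2C. cX z > 0}"
	proof (rule extension_exists[OF S _ open_U_plus])
		fix n y assume y: "y \<in> wt n" "y ~= 0"
		obtain nu q where nu: "Re nu >= 0" "cas nu n y" "Qq nu n 0 = of_nat q" using highest_all_weights[OF x nt y] by blast
		obtain M where M: "\<forall>j. norm (tower nu n y j) <= M" using tower_bounded_ex[OF y(1) nu(2,1)] ..
		let ?F = "Fpol n q (Pp nu n 0) (tower nu n y) 0"
		have "\<forall>x\<in>U_plus. complex_differentiable_at ?F x"
			by (intro ballI Fpol_complex_differentiable[OF _ M[rule_format]])
		moreover have "?F (complexify g) = rp g y" if "g \<in> SL2R" for g
			using Fpol_eq_Fser[where w = "tower nu n y", OF complexify_in_U_crown[OF that] M[rule_format], of n q "Pp nu n 0" 0]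
				Fser_orbit[OF y nu(2,1) nt that] unfolding nu(3) by simp
		ultimately show "\<exists>F. (\<forall>x\<in>U_plus. complex_differentiable_at F x) & (\<forall>g\<in>SL2R. F (complexify g) = rp g y)" by blast
	qed (auto simp: U_plus_def cX_pos_iff)
	moreover have "D \<subseteq> {z \<in> SL2C. cX z > 0}" if D: "invariant_domain D" "extends_holomorphically (orbit_map rp v) D" for D
	proof -
		obtain n y F where y: "y \<in> wt n" "y ~= 0" "holomorphic_on_SL2C F D" "\<forall>g\<in>SL2R. F (complexify g) = rp g y"
			by (rule weight_extension[OF v D])
		have "n < 0" using highest_all_weights[OF x nt y(1,2)] by blast
		then have "D \<subseteq> {z. cX z > 0}" by (rule S_plus_maximal[OF y(1,2) _ nt D(1) y(3) y(4)[rule_format]])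
		then show ?thesis using invariant_domainD(6)[OF D(1)] by blast
	qed
	ultimately show ?thesis
		unfolding is_domain_of_holomorphy_def preimage_S_plus using invariant_domain_S_plus by blast
qed

text \<open>The contrapositive of \<open>crown_edge_highest\<close> for K-finite vectors, in the
  form that serves both the representation and its twist.\<close>

lemma crown_maximal_aux:
	assumes nt: "\<not> trivial_rep rp" and hw: "\<not> highest_weight_rep rp" and v: "v \<in> K_finite rp" "v ~= 0"
		and D: "invariant_domain D" "extends_holomorphically (orbit_map rp v) D"
		and half: "disc_in D (1/2)"
	shows "pc c \<in> D ==> norm c ~= 1/2"
proof
	assume c: "pc c \<in> D" "norm c = 1/2"
	obtain n y F where y: "y \<in> wt n" "y ~= 0" "holomorphic_on_SL2C F D" "\<forall>g\<in>SL2R. F (complexify g) = rp g y"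
		by (rule weight_extension[OF v D])
	have "\<exists>m x. x \<in> wt m & x ~= 0 & up m x = 0"
		by (rule crown_edge_highest[OF y(1,2) nt D(1) y(3) y(4)[rule_format] half c])
	then show False using hw unfolding highest_weight_iff by blast
qed

text \<open>The twist inverts rotations and fixes the diagonal group. So weight n becomes -n,
  \<open>Hop\<close> is unchanged, and raising turns into lowering.\<close>

lemma lowest_tw: "highest_weight_rep (%g. rp (tw g)) \<longleftrightarrow> lowest_weight_rep rp"
	and K_finite_tw: "K_finite (%g. rp (tw g)) = K_finite rp"
proof -
	interpret T: irrep "%g. rp (tw g)" by (rule irrep.intro[OF irreducible_tw[OF irreducible]])
	have wt: "T.wt n = wt (- n)" for n
	proof (intro equalityI subsetI)
		fix x assume x: "x \<in> T.wt n"
		show "x \<in> wt (- n)" unfolding wt_def mem_Collect_eq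
		proof
			fix th
			show "rp (rot th) x = cis (- of_int (- n) * th) *% x" using T.wtD[OF x, of "- th"] by (simp add: tw_rot)
		qed
	next
		fix x assume x: "x \<in> wt (- n)"
		show "x \<in> T.wt n" unfolding T.wt_def mem_Collect_eq
		proof
			fix th
			show "rp (tw (rot th)) x = cis (- of_int n * th) *% x" using wtD[OF x, of "- th"] by (simp add: tw_rot)
		qed
	qed
	have Hop: "T.Hop x = Hop x" for x unfolding T.Hop_def Hop_def tw_dia ..
	have up: "T.up n x = dn (- n) x" if x: "x \<in> wt (- n)" for n x
	proof -
		have d: "dn (- n) x \<in> T.wt (n + 2)" using dn_wt[of "- n" x] unfolding wt by simp
		have u: "up (- n) x \<in> T.wt (n - 2)" using up_wt[of "- n" x] unfolding wt by simp
		show ?thesis unfolding T.up_def Hop Hop_decomp[OF x] T.proj_add T.proj_wt[OF d]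
			using T.proj_wt_other[OF u, of "n + 2"] by simp
	qed
	have "(\<exists>n x. x \<in> T.wt n & x ~= 0 & T.up n x = 0) \<longleftrightarrow> (\<exists>n x. x \<in> wt n & x ~= 0 & dn n x = 0)"
	proof
		assume "\<exists>n x. x \<in> T.wt n & x ~= 0 & T.up n x = 0"
		then obtain n x where "x \<in> wt (- n)" "x ~= 0" "T.up n x = 0" unfolding wt by blast
		then show "\<exists>n x. x \<in> wt n & x ~= 0 & dn n x = 0" using up by metis
	next
		assume "\<exists>n x. x \<in> wt n & x ~= 0 & dn n x = 0"
		then obtain n x where x: "x \<in> wt n" "x ~= 0" "dn n x = 0" by blast
		then have "x \<in> T.wt (- n)" "T.up (- n) x = 0" using up[of x "- n"] unfolding wt by simp_all
		then show "\<exists>n x. x \<in> T.wt n & x ~= 0 & T.up n x = 0" using x(2) by blast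
	qed
	then show "highest_weight_rep (%g. rp (tw g)) \<longleftrightarrow> lowest_weight_rep rp"
		unfolding T.highest_weight_iff lowest_weight_iff .
	have "(%k. rp (tw k) v) ` SO2R = (%k. rp k v) ` SO2R" for v
		unfolding SO2R_eq image_image tw_rot
	proof (intro equalityI subsetI)
		fix y assume "y \<in> range (%th. rp (rot th) v)"
		then obtain th where "y = rp (rot (- (- th))) v" by auto
		then show "y \<in> range (%th. rp (rot (- th)) v)" by blast
	qed auto
	then show "K_finite (%g. rp (tw g)) = K_finite rp" unfolding K_finite_def by simp
qed

text \<open>The highest weight case for the twisted representation, carried back by
  \<open>tw\<close>, which exchanges \<open>cX\<close> and \<open>cY\<close> and thereby the two
  domains.\<close>

lemma lowest_domain:
	assumes nt: "\<not> trivial_rep rp" and lw: "lowest_weight_rep rp" and v: "v \<in> K_finite rp" "v ~= 0"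
	shows "is_domain_of_holomorphy (orbit_map rp v) (preimage_SL2C S_minus)"
proof -
	interpret T: irrep "%g. rp (tw g)" by (rule irrep.intro[OF irreducible_tw[OF irreducible]])
	have "is_domain_of_holomorphy (orbit_map (%g. rp (tw g)) v) (preimage_SL2C S_plus)"
		by (rule T.highest_domain) (use nt lw v in \<open>simp_all add: trivial_tw lowest_tw K_finite_tw\<close>)
	then have p: "invariant_domain (preimage_SL2C S_plus)"
			"extends_holomorphically (orbit_map (%g. rp (tw g)) v) (preimage_SL2C S_plus)"
		and mx: "!!D. invariant_domain D ==> extends_holomorphically (orbit_map (%g. rp (tw g)) v) D ==> D \<subseteq> preimage_SL2C S_plus"
		unfolding is_domain_of_holomorphy_def by blast+
	have i: "tw ` preimage_SL2C S_plus = preimage_SL2C S_minus"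
		unfolding preimage_S_plus preimage_S_minus by (auto simp: tw_image_iff cX_tw)
	have "D \<subseteq> preimage_SL2C S_minus" if "invariant_domain D" "extends_holomorphically (orbit_map rp v) D" for D
	proof
		fix z assume "z \<in> D"
		then have "tw z \<in> preimage_SL2C S_plus"
			using mx[OF invariant_domain_tw[OF that(1)] extends_tw[OF that(2)]] by blast
		then show "z \<in> preimage_SL2C S_minus" unfolding i[symmetric] by (simp add: tw_image_iff)
	qed
	moreover have "extends_holomorphically (orbit_map rp v) (preimage_SL2C S_minus)"
		using extends_tw[OF p(2)] unfolding i by simp
	ultimately show ?thesis
		unfolding is_domain_of_holomorphy_def using invariant_domain_tw[OF p(1)] unfolding i by blast
qed

text \<open>Where both forms vanish no decomposition is available. A small factor from exp(p^-) on
  the right fixes c and d, hence keeps \<open>cY\<close> at 0, and moves \<open>cX\<close> to the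
  positive side.\<close>

lemma perturb_corner:
	assumes z: "z \<in> SL2C" "cX z = 0" "cY z = 0" and W: "open W" "z \<in> W"
	obtains z' where "z' \<in> SL2C" "z' \<in> W" "cX z' > 0" "cY z' = 0"
proof -
	define A B C D where "A = cayA z" and "B = cayB z" and "C = cayC z" and "D = cayD z"
	define k where "k = C * cnj A - D * cnj B"
	have "(norm k)\<^sup>2 = 1" using cX_cY_identity[OF z(1)] z(2,3) by (simp add: k_def A_def B_def C_def D_def)
	then have k0: "k ~= 0" by auto
	have mt: "cayA (z ** tw (pc c)) = A - 2 * c * C" "cayB (z ** tw (pc c)) = B - 2 * c * D"
		"cayC (z ** tw (pc c)) = C" "cayD (z ** tw (pc c)) = D" for c
		unfolding cay_mult cay_tw cay_pc by (simp_all add: A_def B_def C_def D_def)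
	have Y: "cY (z ** tw (pc c)) = 0" for c using z(3) unfolding cY_def mt by (simp add: C_def D_def)
	\<comment> \<open>The quadratic term disappears because |C| = |D|. The linear one is -4 Re(ck), and
	  k is nonzero by \<open>cX_cY_identity\<close>, so c is taken in the direction of
	  \<open>- cnj k\<close>.\<close>
	have X: "cX (z ** tw (pc (of_real s * (- cnj k)))) = 4 * s * (norm k)\<^sup>2" for s
	proof -
		have AB: "(norm A)\<^sup>2 = (norm B)\<^sup>2" and CD: "(norm D)\<^sup>2 = (norm C)\<^sup>2" using z(2,3) by (simp_all add: cX_def cY_def A_def B_def C_def D_def)
		have "(norm (A - 2 * c * C))\<^sup>2 - (norm (B - 2 * c * D))\<^sup>2
				= (norm A)\<^sup>2 - (norm B)\<^sup>2 + 4 * (norm c)\<^sup>2 * ((norm C)\<^sup>2 - (norm D)\<^sup>2) - 4 * Re (c * k)" for c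
			unfolding cmod_power2 k_def by (simp add: power2_eq_square algebra_simps)
		then have "cX (z ** tw (pc c)) = - 4 * Re (c * k)" for c unfolding cX_def mt AB CD by simp
		moreover have "Re ((of_real s * (- cnj k)) * k) = - s * (norm k)\<^sup>2"
			unfolding cmod_power2 by (simp add: power2_eq_square algebra_simps)
		ultimately show ?thesis by simp
	qed
	have "continuous_on UNIV (%s::real. z ** tw (pc (of_real s * (- cnj k))))"
		unfolding pc_def tw_m22 by (intro continuous_intros)
	then have "open ((%s::real. z ** tw (pc (of_real s * (- cnj k)))) -` W)" by (rule open_vimage[OF W(1)])
	moreover have "0 \<in> (%s::real. z ** tw (pc (of_real s * (- cnj k)))) -` W" using W(2) by (simp add: pc_0)
	ultimately obtain e where e: "e > 0" "ball 0 e \<subseteq> (%s::real. z ** tw (pc (of_real s * (- cnj k)))) -` W" unfolding open_contains_ball by meson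
	have "e / 2 \<in> ball 0 e" using e(1) by simp
	then have "z ** tw (pc (of_real (e / 2) * (- cnj k))) \<in> W" using e(2) by blast
	moreover have "z ** tw (pc (of_real (e / 2) * (- cnj k))) \<in> SL2C" using z(1) by (intro SL2C_mult) simp_all
	ultimately show ?thesis using that X[of "e / 2"] Y k0 e(1) by simp
qed

text \<open>At an escaping boundary point one of the forms is zero. If only \<open>cY\<close>
  vanishes, the point lies over the circle |c| = 1/2 and highest weights are forced; if only
  \<open>cX\<close> does, the twist gives lowest weights; a corner is first moved to an
  edge.\<close>

lemma crown_domain:
	assumes nt: "\<not> trivial_rep rp" and hw: "\<not> highest_weight_rep rp" and lw: "\<not> lowest_weight_rep rp"
		and v: "v \<in> K_finite rp" "v ~= 0"
	shows "is_domain_of_holomorphy (orbit_map rp v) (preimage_SL2C crown)"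
proof -
	interpret T: irrep "%g. rp (tw g)" by (rule irrep.intro[OF irreducible_tw[OF irreducible]])
	obtain S where S: "finite S" "v = (\<Sum>n\<in>S. proj n v)" using K_finite_decomp[OF v(1)] by blast
	have "extends_holomorphically (orbit_map rp v) {z \<in> SL2C. cX z > 0 & cY z > 0}"
	proof (rule extension_exists[OF S _ open_U_crown])
		fix n y assume y: "y \<in> wt n" "y ~= 0"
		obtain nu where nu: "Re nu >= 0" "cas nu n y" by (rule cas_exists[OF y(2)])
		obtain M where M: "\<forall>j. norm (tower nu n y j) <= M" using tower_bounded_ex[OF y(1) nu(2,1)] ..
		let ?F = "Fser n (Pp nu n 0) (Qq nu n 0) (tower nu n y) 0"
		have "\<forall>x\<in>U_crown. complex_differentiable_at ?F x"
			by (intro ballI Fser_complex_differentiable[OF _ M[rule_format]])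
		moreover have "\<forall>g\<in>SL2R. ?F (complexify g) = rp g y" using Fser_orbit[OF y nu(2,1) nt] by blast
		ultimately show "\<exists>F. (\<forall>x\<in>U_crown. complex_differentiable_at F x) & (\<forall>g\<in>SL2R. F (complexify g) = rp g y)" by blast
	qed (auto intro: crown_U_crown)
	moreover have "D \<subseteq> {z \<in> SL2C. cX z > 0 & cY z > 0}" if D: "invariant_domain D" "extends_holomorphically (orbit_map rp v) D" for D
	proof (rule ccontr)
		note Dd = invariant_domainD[OF D(1)]
		define P where "P = {z. cX z > 0 & cY z > 0}"
		assume "\<not> D \<subseteq> {z \<in> SL2C. cX z > 0 & cY z > 0}"
		then have nP: "\<not> D \<subseteq> P" using Dd(6) by (auto simp: P_def)
		have oP: "open P" unfolding P_def by (intro open_Collect_conj open_Collect_less continuous_intros)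
		have 1: "mat 1 \<in> P" using cX_pc[of 0] by (simp add: pc_0 P_def)
		obtain z where z: "z \<in> D" "z \<notin> P" "z \<in> closure (D \<inter> P \<inter> {z. \<exists>r'>0. disc_in D r' & 1 - cX z * cY z < 4 * r'\<^sup>2})"
			"\<forall>c. 4 * (norm c)\<^sup>2 < 1 - cX z * cY z --> pc c \<in> D"
			by (rule boundary_point[OF D(1) oP 1 _ nP]) (auto simp: P_def)
		have zS: "z \<in> SL2C" using z(1) Dd(6) by blast
		have "closed {z. cX z >= 0 & cY z >= 0}" by (intro closed_Collect_conj closed_Collect_le continuous_intros)
		moreover have "D \<inter> P \<inter> {z. \<exists>r'>0. disc_in D r' & 1 - cX z * cY z < 4 * r'\<^sup>2} \<subseteq> {z. cX z >= 0 & cY z >= 0}" by (auto simp: P_def)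
		ultimately have ge: "cX z >= 0" "cY z >= 0" using z(3) closure_minimal by blast+
		have XY: "cX z * cY z = 0" using z(2) ge unfolding P_def by force
		\<comment> \<open>Since the product of the two forms is 0, the discs provided by
		  \<open>boundary_point\<close> have every radius with 4|c|^2 < 1.\<close>
		have half: "disc_in D (1/2)"
			unfolding disc_in_def
		proof (intro allI impI)
			fix c :: complex assume "norm c < 1/2"
			then have "(norm c)\<^sup>2 < (1/2)\<^sup>2" by (intro power_strict_mono) auto
			then show "pc c \<in> D" using z(4) unfolding XY by (simp add: power_divide)
		qed
		have edge: False if x: "x \<in> D" "cX x > 0" "cY x = 0" for x
		proof -
			have xS: "x \<in> SL2C" using x(1) Dd(6) by blast
			obtain g c ta where d: "g \<in> SL2R" "x = complexify g ** pc c ** ke ta" "4 * (norm c)\<^sup>2 = 1 - cX x * cY x" by (rule decompose[OF xS x(2)])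
			have "pc c \<in> D" by (rule invariant_cancel[OF D(1) d(1)]) (use x(1) d(2) in simp)
			moreover have "(norm c)\<^sup>2 = (1/2)\<^sup>2" using d(3) x(3) by (simp add: power_divide)
			then have "norm c = 1/2" by (rule power2_eq_imp_eq) simp_all
			ultimately show False using crown_maximal_aux[OF nt hw v D half] by blast
		qed
		consider "cX z > 0" "cY z = 0" | "cX z = 0" "cY z > 0" | "cX z = 0" "cY z = 0" using ge XY by force
		then show False
		proof cases
			case 1
			then show False using edge[OF z(1)] by blast
		next
			case 2
			have D': "invariant_domain (tw ` D)" "extends_holomorphically (orbit_map (%g. rp (tw g)) v) (tw ` D)"
				by (rule invariant_domain_tw[OF D(1)], rule extends_tw[OF D(2)])
			have tS: "tw z \<in> SL2C" "cX (tw z) > 0" using zS 2 by (simp_all add: cX_tw)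
			obtain g c ta where d: "g \<in> SL2R" "tw z = complexify g ** pc c ** ke ta" "4 * (norm c)\<^sup>2 = 1 - cX (tw z) * cY (tw z)" by (rule decompose[OF tS])
			have "complexify g ** pc c ** ke ta \<in> tw ` D" unfolding d(2)[symmetric] by (rule imageI[OF z(1)])
			then have "pc c \<in> tw ` D" by (rule invariant_cancel[OF D'(1) d(1)])
			moreover have "(norm c)\<^sup>2 = (1/2)\<^sup>2" using d(3) 2 by (simp add: cX_tw power_divide)
			then have "norm c = 1/2" by (rule power2_eq_imp_eq) simp_all
			\<comment> \<open>The slice of the twisted domain runs along p^- in D. Decomposing
			  \<open>tw (pc c)\<close> along p^+ gives a parameter of the same modulus, as both come from the
			  product of \<open>cX\<close> and \<open>cY\<close>.\<close>
			moreover have "disc_in (tw ` D) (1/2)"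
				unfolding disc_in_def
			proof (intro allI impI)
				fix c :: complex assume c: "norm c < 1/2"
				then have "(norm c)\<^sup>2 < (1/2)\<^sup>2" by (intro power_strict_mono) auto
				then have p: "cX (tw (pc c)) > 0" "tw (pc c) \<in> SL2C" by (simp_all add: cX_tw cX_pc power_divide)
				obtain g c' ta where d: "g \<in> SL2R" "tw (pc c) = complexify g ** pc c' ** ke ta" "4 * (norm c')\<^sup>2 = 1 - cX (tw (pc c)) * cY (tw (pc c))"
					by (rule decompose[OF p(2,1)])
				have "(norm c')\<^sup>2 = (norm c)\<^sup>2" using d(3) by (simp add: cX_tw cX_pc)
				then have "norm c' = norm c" by (rule power2_eq_imp_eq) simp_all
				then have "pc c' \<in> D" using half c by (simp add: disc_in_def)
				then have "tw (pc c) \<in> D" unfolding d(2) by (rule Dd(3)[OF d(1) _ ke_SO2C])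
				then show "pc c \<in> tw ` D" by (simp add: tw_image_iff)
			qed
			moreover have "\<not> trivial_rep (%g. rp (tw g))" "\<not> highest_weight_rep (%g. rp (tw g))" "v \<in> K_finite (%g. rp (tw g))"
				using nt lw v by (simp_all add: trivial_tw lowest_tw K_finite_tw)
			ultimately show False using T.crown_maximal_aux[OF _ _ _ v(2) D'] by blast
		next
			case 3
			obtain V where V: "open V" "D = SL2C \<inter> V" using Dd(1) unfolding openin_open by blast
			have "z \<in> V" using z(1) V(2) by blast
			then obtain z' where "z' \<in> SL2C" "z' \<in> V" "cX z' > 0" "cY z' = 0" by (rule perturb_corner[OF zS 3 V(1)])
			then show False using edge[of z'] V(2) by blast
		qed
	qed
	ultimately show ?thesis
		unfolding is_domain_of_holomorphy_def preimage_crown using invariant_domain_crown by blast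
qed

end

theorem theorem4p7:
  fixes \<pi> :: "real^2^2 \<Rightarrow> 'h \<Rightarrow> 'h::complex_hilbert" and v :: 'h
  assumes "irreducible_unitary_rep \<pi>"
    and "v \<in> K_finite \<pi>" and "v \<noteq> 0"
  shows "(trivial_rep \<pi> \<longrightarrow> is_domain_of_holomorphy (orbit_map \<pi> v) SL2C) \<and>
    (\<not> trivial_rep \<pi> \<and> highest_weight_rep \<pi> \<longrightarrow>
       is_domain_of_holomorphy (orbit_map \<pi> v) (preimage_SL2C S_plus)) \<and>
    (\<not> trivial_rep \<pi> \<and> lowest_weight_rep \<pi> \<longrightarrow>
       is_domain_of_holomorphy (orbit_map \<pi> v) (preimage_SL2C S_minus)) \<and>
    (\<not> trivial_rep \<pi> \<and> \<not> highest_weight_rep \<pi> \<and> \<not> lowest_weight_rep \<pi> \<longrightarrow>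
       is_domain_of_holomorphy (orbit_map \<pi> v) (preimage_SL2C crown))"
proof -
	interpret irrep \<pi> by (rule irrep.intro[OF assms(1)])
	show ?thesis
		using trivial_domain highest_domain[OF _ _ assms(2,3)] lowest_domain[OF _ _ assms(2,3)] crown_domain[OF _ _ _ assms(2,3)] by blast
qed

end
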